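(* Let $N\ge 1$, let $\Omega\subset\mathbb{R}^N$ be a bounded domain with smooth boundary, let $\mu\in\mathbb{R}$ and $2<p\le q\le 2^*$, where $2^*=\frac{2N}{(N-2)^+}$ (so $2^*=+\infty$ if $N\le 2$, in which case $q$ is any finite exponent). Then there exists $\rho_0=\rho_0(N,p,q,\Omega,\mu)>0$ such that for every $\rho\in(0,\rho_0)$ the problem $$-\Delta u+\omega u=\mu u^{p-1}+u^{q-1},\quad u>0 \text{ in }\Omega,\qquad u=0\text{ on }\partial\Omega,\qquad \int_\Omega u^2\,\mathrm{d}x=\rho,$$ has a solution $(\omega,u)\in\mathbb{R}\times S_\rho$ such that $u$ is a local minimizer of $I$ restricted to $S_\rho$.
   Context: $S_\rho=\{u\in H^1_0(\Omega):\|u\|_{L^2(\Omega)}^2=\rho\}$ and $I(u)=\frac12\int_\Omega|\nabla u|^2\,\mathrm{d}x-\frac{\mu}{p}\int_\Omega|u|^p\,\mathrm{d}x-\frac1q\int_\Omega|u|^q\,\mathrm{d}x$ for $u\in H^1_0(\Omega)$. The real number $\omega$ is unknown (a Lagrange multiplier), and a solution is a pair $(\omega,u)$ satisfying the equation weakly. *)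

theory Defs
  imports "HOL-Analysis.Analysis"
begin

definition pdx :: "(real^'n \<Rightarrow> real) \<Rightarrow> 'n \<Rightarrow> real^'n \<Rightarrow> real" where
  "pdx f i x = frechet_derivative f (at x) (axis i 1)"

definition cgrad :: "(real^'n \<Rightarrow> real) \<Rightarrow> real^'n \<Rightarrow> real^'n" where
  "cgrad f x = (\<chi> i. pdx f i x)"

fun Ck_on :: "nat \<Rightarrow> (real^'n) set \<Rightarrow> (real^'n \<Rightarrow> real) \<Rightarrow> bool" where
  "Ck_on 0 U f = continuous_on U f"
| "Ck_on (Suc k) U f = (f differentiable_on U \<and> (\<forall>i. Ck_on k U (pdx f i)))"

definition Cinf_on :: "(real^'n) set \<Rightarrow> (real^'n \<Rightarrow> real) \<Rightarrow> bool" where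
  "Cinf_on U f = (\<forall>k. Ck_on k U f)"

definition smooth_bounded_domain :: "(real^'n) set \<Rightarrow> bool" where
  "smooth_bounded_domain \<Omega> \<longleftrightarrow> open \<Omega> \<and> connected \<Omega> \<and> bounded \<Omega> \<and> \<Omega> \<noteq> {} \<and>
     (\<forall>z\<in>frontier \<Omega>. \<exists>U \<psi>. open U \<and> z \<in> U \<and> Cinf_on U \<psi> \<and>
        (\<forall>x\<in>U. cgrad \<psi> x \<noteq> 0) \<and> \<Omega> \<inter> U = {x\<in>U. \<psi> x < 0})"

definition test_fun :: "(real^'n) set \<Rightarrow> (real^'n \<Rightarrow> real) \<Rightarrow> bool" where
  "test_fun \<Omega> \<phi> \<longleftrightarrow> Cinf_on UNIV \<phi> \<and> compact (closure {x. \<phi> x \<noteq> 0}) \<and>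
     closure {x. \<phi> x \<noteq> 0} \<subseteq> \<Omega>"

definition L2_on :: "(real^'n) set \<Rightarrow> (real^'n \<Rightarrow> real) \<Rightarrow> bool" where
  "L2_on \<Omega> u \<longleftrightarrow> set_borel_measurable lebesgue \<Omega> u \<and> set_integrable lebesgue \<Omega> (\<lambda>x. (u x)\<^sup>2)"

definition L2v_on :: "(real^'n) set \<Rightarrow> (real^'n \<Rightarrow> real^'n) \<Rightarrow> bool" where
  "L2v_on \<Omega> g \<longleftrightarrow> set_borel_measurable lebesgue \<Omega> g \<and> set_integrable lebesgue \<Omega> (\<lambda>x. (norm (g x))\<^sup>2)"

definition weak_gradient :: "(real^'n) set \<Rightarrow> (real^'n \<Rightarrow> real) \<Rightarrow> (real^'n \<Rightarrow> real^'n) \<Rightarrow> bool" where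
  "weak_gradient \<Omega> u g \<longleftrightarrow> (\<forall>\<phi> i. test_fun \<Omega> \<phi> \<longrightarrow>
      set_integrable lebesgue \<Omega> (\<lambda>x. u x * pdx \<phi> i x) \<and>
      set_integrable lebesgue \<Omega> (\<lambda>x. g x $ i * \<phi> x) \<and>
      (LINT x:\<Omega>|lebesgue. u x * pdx \<phi> i x) = - (LINT x:\<Omega>|lebesgue. g x $ i * \<phi> x))"

definition H1_grad :: "(real^'n) set \<Rightarrow> (real^'n \<Rightarrow> real) \<Rightarrow> (real^'n \<Rightarrow> real^'n) \<Rightarrow> bool" where
  "H1_grad \<Omega> u g \<longleftrightarrow> L2_on \<Omega> u \<and> L2v_on \<Omega> g \<and> weak_gradient \<Omega> u g"

definition wgrad :: "(real^'n) set \<Rightarrow> (real^'n \<Rightarrow> real) \<Rightarrow> real^'n \<Rightarrow> real^'n" where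
  "wgrad \<Omega> u = (SOME g. H1_grad \<Omega> u g)"

definition H1_dist2 :: "(real^'n) set \<Rightarrow> (real^'n \<Rightarrow> real) \<Rightarrow> (real^'n \<Rightarrow> real^'n)
     \<Rightarrow> (real^'n \<Rightarrow> real) \<Rightarrow> (real^'n \<Rightarrow> real^'n) \<Rightarrow> real" where
  "H1_dist2 \<Omega> u g v h = (LINT x:\<Omega>|lebesgue. (u x - v x)\<^sup>2 + (norm (g x - h x))\<^sup>2)"

definition H10 :: "(real^'n) set \<Rightarrow> (real^'n \<Rightarrow> real) \<Rightarrow> bool" where
  "H10 \<Omega> u \<longleftrightarrow> (\<exists>g. H1_grad \<Omega> u g \<and>
     (\<exists>\<phi>s. (\<forall>k. test_fun \<Omega> (\<phi>s k)) \<and>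
        (\<lambda>k. H1_dist2 \<Omega> (\<phi>s k) (cgrad (\<phi>s k)) u g) \<longlonglongrightarrow> 0))"

definition S_rho :: "(real^'n) set \<Rightarrow> real \<Rightarrow> (real^'n \<Rightarrow> real) set" where
  "S_rho \<Omega> \<rho> = {u. H10 \<Omega> u \<and> (LINT x:\<Omega>|lebesgue. (u x)\<^sup>2) = \<rho>}"

definition energy :: "(real^'n) set \<Rightarrow> real \<Rightarrow> real \<Rightarrow> real \<Rightarrow> (real^'n \<Rightarrow> real) \<Rightarrow> real" where
  "energy \<Omega> \<mu> p q u =
     1/2 * (LINT x:\<Omega>|lebesgue. (norm (wgrad \<Omega> u x))\<^sup>2)
     - \<mu> / p * (LINT x:\<Omega>|lebesgue. \<bar>u x\<bar> powr p)
     - 1 / q * (LINT x:\<Omega>|lebesgue. \<bar>u x\<bar> powr q)"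

definition local_min_on_S :: "(real^'n) set \<Rightarrow> real \<Rightarrow> real \<Rightarrow> real \<Rightarrow> real \<Rightarrow> (real^'n \<Rightarrow> real) \<Rightarrow> bool" where
  "local_min_on_S \<Omega> \<mu> p q \<rho> u \<longleftrightarrow> u \<in> S_rho \<Omega> \<rho> \<and>
     (\<exists>r>0. \<forall>v\<in>S_rho \<Omega> \<rho>. H1_dist2 \<Omega> v (wgrad \<Omega> v) u (wgrad \<Omega> u) < r \<longrightarrow>
        energy \<Omega> \<mu> p q u \<le> energy \<Omega> \<mu> p q v)"

text \<open>Weak formulation of \<open>-\<Delta>u + \<omega>u = \<mu>u\<^sup>p\<^sup>-\<^sup>1 + u\<^sup>q\<^sup>-\<^sup>1\<close> in \<open>\<Omega>\<close> (Dirichlet condition via \<open>u \<in> H\<^sup>1\<^sub>0\<close>).\<close>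
definition weak_solution :: "(real^'n) set \<Rightarrow> real \<Rightarrow> real \<Rightarrow> real \<Rightarrow> real \<Rightarrow> (real^'n \<Rightarrow> real) \<Rightarrow> bool" where
  "weak_solution \<Omega> \<mu> p q \<omega> u \<longleftrightarrow> H10 \<Omega> u \<and> (\<forall>\<phi>. test_fun \<Omega> \<phi> \<longrightarrow>
     (LINT x:\<Omega>|lebesgue. wgrad \<Omega> u x \<bullet> cgrad \<phi> x) + \<omega> * (LINT x:\<Omega>|lebesgue. u x * \<phi> x)
       = \<mu> * (LINT x:\<Omega>|lebesgue. u x powr (p - 1) * \<phi> x)
         + (LINT x:\<Omega>|lebesgue. u x powr (q - 1) * \<phi> x))"

text \<open>Critical Sobolev exponent condition \<open>q \<le> 2\<^sup>*\<close> (\<open>2\<^sup>* = +\<infinity>\<close> if \<open>N \<le> 2\<close>).\<close>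
definition below_crit :: "nat \<Rightarrow> real \<Rightarrow> bool" where
  "below_crit N q \<longleftrightarrow> (N \<ge> 3 \<longrightarrow> q \<le> 2 * real N / (real N - 2))"

end

(* For small \<rho> let T = 2 A \<rho>, where A is the Dirichlet energy of a normalized nonnegative test
   function \<phi>. On the ball |grad v|^2 \<le> T the Sobolev inequality makes the two power terms a small
   multiple of the Dirichlet energy, even at the critical exponent; hence there the energy is uniformly
   convex, and near the boundary of the ball it exceeds its value at sqrt \<rho> \<phi>. A minimizing sequence
   on the sphere of mass \<rho> therefore stays well inside the ball. Rellich's theorem makes it Cauchy in
   the mean square, and comparing the energies of two members with that of their midpoint, rescaled to
   the sphere, makes it Cauchy in H^1. So no compactness is lost for q = 2*.

   Replacing test functions \<psi> by sqrt (\<psi>^2 + \<delta>^2) - \<delta>, the minimizing sequence can be taken among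
   nonnegative test functions w_k, which gives u \<ge> 0. Testing the equation with \<eta>^2 / (w_k + \<epsilon>) bounds
   the gradient of ln (w_k + \<epsilon>) locally in the mean square, independently of \<epsilon>; a nonnegative
   function for which this holds is positive almost everywhere or zero almost everywhere.

   Poincare's inequality, Rellich's theorem and the Sobolev inequality all come from one estimate for
   the double integral of |g x - g y|^2 over the pairs of points in a common cell of a dyadic grid. *)
theory Submission
  imports Defs "HOL-Complex_Analysis.Great_Picard"
begin

section \<open>Smooth functions and cutoffs\<close>

text \<open>At the critical exponent a weak limit may lose part of the \<open>q\<close>-th power
  integral, so weak limits are avoided: convexity produces strong ones. The factor 2 in
  \<open>T\<close> puts the start function at gradient mass T/2, with energy near T/4, while
  gradient mass near T costs about T/2; on the ball the power terms never exceed T/32, and this gap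
  keeps minimizing sequences inside. Minimization runs over nonnegative test functions, where
  gradients are classical and truncation is elementary calculus. The competitors of the theorem are
  arbitrary and may change sign; they are reached by approximation from that class. The approximants
  are kept after the limit, because \<open>u\<close> need not be smooth and only they give smooth
  test functions with \<open>w k + \<epsilon>\<close> in the denominator. The statement picks a weak
  gradient by choice, so the proof carries pairs \<open>(v, h)\<close> in the closure of the graph
  of the classical gradient and returns through uniqueness almost everywhere. Functions are not
  identified almost everywhere there, so positivity at every point takes a final change on a null
  set.\<close>

lemma GDERIV_imp_cgrad:
  fixes f :: "real^'n \<Rightarrow> real"
  assumes "GDERIV f x :> D"
  shows "cgrad f x = D"
proof -
  have "(f has_derivative (\<lambda>h. h \<bullet> D)) (at x)"
    using assms by (simp add: gderiv_def)
  hence "(\<lambda>h. h \<bullet> D) = frechet_derivative f (at x)"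
    by (rule frechet_derivative_at)
  hence "pdx f i x = D $ i" for i
    unfolding pdx_def by (metis cart_eq_inner_axis inner_commute)
  thus ?thesis by (simp add: cgrad_def vec_eq_iff)
qed

lemma differentiable_imp_GDERIV:
  fixes f :: "real^'n \<Rightarrow> real"
  assumes "f differentiable (at x)"
  shows "GDERIV f x :> cgrad f x"
proof -
  obtain f' where f': "(f has_derivative f') (at x)"
    using assms by (auto simp: differentiable_def)
  hence eq: "f' = frechet_derivative f (at x)" by (rule frechet_derivative_at)
  have lin: "linear f'" using f' has_derivative_linear by blast
  have "f' h = h \<bullet> cgrad f x" for h
  proof -
    have "f' h = f' (\<Sum>i\<in>UNIV. h $ i *\<^sub>R axis i 1)"
      by (metis (no_types) basis_expansion scalar_mult_eq_scaleR)
    also have "\<dots> = (\<Sum>i\<in>UNIV. h $ i * f' (axis i 1))"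
      using lin by (simp add: linear_sum linear_cmul)
    also have "\<dots> = h \<bullet> cgrad f x"
      by (simp add: inner_vec_def cgrad_def pdx_def eq)
    finally show ?thesis .
  qed
  with f' show ?thesis unfolding gderiv_def by (metis (no_types, lifting) ext)
qed

lemma GDERIV_imp_differentiable: "GDERIV f x :> D \<Longrightarrow> f differentiable (at x)"
  by (auto simp: gderiv_def differentiable_def)

lemma pdx_eq_cgrad: "pdx f i x = cgrad f x $ i"
  by (simp add: cgrad_def)

lemma Ck_SucD: "Ck_on (Suc k) U f \<Longrightarrow> Ck_on k U f"
proof (induction k arbitrary: f)
  case 0 thus ?case by (auto intro: differentiable_imp_continuous_on)
next
  case (Suc k) thus ?case by (metis Ck_on.simps(2))
qed

lemma Ck_Suc_GDERIV:
  fixes f :: "real^'n \<Rightarrow> real"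
  assumes "Ck_on (Suc k) UNIV f"
  shows "GDERIV f x :> cgrad f x"
  using assms by (auto simp: differentiable_on_def intro: differentiable_imp_GDERIV)

text \<open>Reduces each closure property of \<open>Ck_on\<close> to one exhibited gradient field
  whose components are again sums and products; the inductions on the order then run through the
  \<open>GDERIV\<close> rules without evaluating \<open>frechet_derivative\<close>.\<close>

lemma Ck_SucI:
  fixes f :: "real^'n \<Rightarrow> real"
  assumes "\<And>x. GDERIV f x :> G x" "\<And>i. Ck_on k UNIV (\<lambda>x. G x $ i)"
  shows "Ck_on (Suc k) UNIV f"
proof -
  have "pdx f i = (\<lambda>x. G x $ i)" for i
    by (rule ext) (simp add: pdx_eq_cgrad GDERIV_imp_cgrad[OF assms(1)])
  thus ?thesis using assms GDERIV_imp_differentiable by (fastforce simp: differentiable_on_def)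
qed

lemma Ck_Suc_cgrad: "Ck_on (Suc k) UNIV f \<Longrightarrow> Ck_on k UNIV (\<lambda>x. cgrad f x $ i)"
  by (simp add: cgrad_def)

lemma Ck_const: "Ck_on k UNIV (\<lambda>x::real^'n. c)"
proof (induction k arbitrary: c)
  case (Suc k)
  show ?case by (rule Ck_SucI[where G="\<lambda>_. 0"]) (use Suc in \<open>auto simp: GDERIV_const\<close>)
qed auto

lemma Ck_coord: "Ck_on k UNIV (\<lambda>x::real^'n. x $ i)"
proof (cases k)
  case (Suc k)
  have "GDERIV (\<lambda>x::real^'n. x $ i) x :> axis i 1" for x
    unfolding gderiv_def by (simp add: inner_axis bounded_linear_imp_has_derivative[OF bounded_linear_vec_nth])
  hence "Ck_on (Suc k) UNIV (\<lambda>x::real^'n. x $ i)"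
    by (rule Ck_SucI) (simp add: Ck_const)
  thus ?thesis using Suc by simp
qed (auto intro!: continuous_intros)

lemma Ck_add:
  fixes f g :: "real^'n \<Rightarrow> real"
  shows "Ck_on k UNIV f \<Longrightarrow> Ck_on k UNIV g \<Longrightarrow> Ck_on k UNIV (\<lambda>x. f x + g x)"
proof (induction k arbitrary: f g)
  case 0 thus ?case by (auto intro!: continuous_intros)
next
  case (Suc k)
  show ?case
    by (rule Ck_SucI[OF GDERIV_add[OF Ck_Suc_GDERIV[OF Suc.prems(1)] Ck_Suc_GDERIV[OF Suc.prems(2)]]])
       (simp add: Suc.IH[OF Ck_Suc_cgrad[OF Suc.prems(1)] Ck_Suc_cgrad[OF Suc.prems(2)]])
qed

lemma Ck_mult:
  fixes f g :: "real^'n \<Rightarrow> real"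
  shows "Ck_on k UNIV f \<Longrightarrow> Ck_on k UNIV g \<Longrightarrow> Ck_on k UNIV (\<lambda>x. f x * g x)"
proof (induction k arbitrary: f g)
  case 0 thus ?case by (auto intro!: continuous_intros)
next
  case (Suc k)
  have "Ck_on k UNIV (\<lambda>x. f x * cgrad g x $ i + g x * cgrad f x $ i)" for i
    by (intro Ck_add Suc.IH Ck_SucD[OF Suc.prems(1)] Ck_SucD[OF Suc.prems(2)]
          Ck_Suc_cgrad[OF Suc.prems(1)] Ck_Suc_cgrad[OF Suc.prems(2)])
  thus ?case
    by (intro Ck_SucI[OF GDERIV_mult[OF Ck_Suc_GDERIV[OF Suc.prems(1)] Ck_Suc_GDERIV[OF Suc.prems(2)]]])
       simp
qed

text \<open>Smoothness is witnessed by the whole sequence of derivatives, so that an explicit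
  function is handled by one closed formula for its n-th derivative. The derivatives are two-sided,
  so \<open>S\<close> is meant to be open; it occurs as the half line and as the whole line.\<close>

definition smooth1 :: "real set \<Rightarrow> (real \<Rightarrow> real) \<Rightarrow> bool" where
  "smooth1 S f \<longleftrightarrow> (\<exists>F. F 0 = f \<and> (\<forall>n. \<forall>x\<in>S. (F n has_real_derivative F (Suc n) x) (at x)))"

lemma smooth1_deriv:
  assumes "smooth1 S f"
  obtains f' where "smooth1 S f'" "\<And>x. x \<in> S \<Longrightarrow> (f has_real_derivative f' x) (at x)"
proof -
  obtain F where "F 0 = f" "\<forall>n. \<forall>x\<in>S. (F n has_real_derivative F (Suc n) x) (at x)"
    using assms by (auto simp: smooth1_def)
  moreover from this have "smooth1 S (F 1)"
    unfolding smooth1_def by (intro exI[of _ "\<lambda>n. F (Suc n)"]) auto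
  ultimately show ?thesis using that[of "F 1"] by auto
qed

text \<open>The chain rule produces the outer derivative at the same inner function; it is again
  \<open>smooth1\<close>, so the induction on the order has to leave \<open>F\<close> free.\<close>

lemma Ck_compose:
  fixes f :: "real^'n \<Rightarrow> real"
  assumes "\<And>x. f x \<in> S"
  shows "Ck_on k UNIV f \<Longrightarrow> smooth1 S F \<Longrightarrow> Ck_on k UNIV (\<lambda>x. F (f x))"
proof (induction k arbitrary: F)
  case 0
  obtain F' where F': "\<And>x. x \<in> S \<Longrightarrow> (F has_real_derivative F' x) (at x)"
    using smooth1_deriv[OF 0(2)] by metis
  have "isCont F (f x)" for x using F' assms DERIV_isCont by blast
  with 0 show ?case
    by (auto simp: continuous_on_eq_continuous_at intro: isCont_o2)
next
  case (Suc k)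
  obtain F' where sF': "smooth1 S F'"
    and F': "\<And>x. x \<in> S \<Longrightarrow> (F has_real_derivative F' x) (at x)"
    using smooth1_deriv[OF Suc.prems(2)] by metis
  have "GDERIV (\<lambda>x. F (f x)) x :> F' (f x) *\<^sub>R cgrad f x" for x
    using GDERIV_DERIV_compose[OF Ck_Suc_GDERIV[OF Suc.prems(1)] F'[OF assms]] by simp
  moreover have "Ck_on k UNIV (\<lambda>x. F' (f x) * cgrad f x $ i)" for i
    by (rule Ck_mult[OF Suc.IH[OF Ck_SucD[OF Suc.prems(1)] sF'] Ck_Suc_cgrad[OF Suc.prems(1)]])
  ultimately show ?case by (intro Ck_SucI) auto
qed

lemma Cinf_const: "Cinf_on UNIV (\<lambda>x::real^'n. c)"
  by (simp add: Cinf_on_def Ck_const)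

lemma Cinf_coord: "Cinf_on UNIV (\<lambda>x::real^'n. x $ i)"
  by (simp add: Cinf_on_def Ck_coord)

lemma Cinf_add: "Cinf_on UNIV f \<Longrightarrow> Cinf_on UNIV g \<Longrightarrow> Cinf_on UNIV (\<lambda>x::real^'n. f x + g x)"
  by (simp add: Cinf_on_def Ck_add)

lemma Cinf_mult: "Cinf_on UNIV f \<Longrightarrow> Cinf_on UNIV g \<Longrightarrow> Cinf_on UNIV (\<lambda>x::real^'n. f x * g x)"
  by (simp add: Cinf_on_def Ck_mult)

lemma Cinf_compose:
  "smooth1 S F \<Longrightarrow> Cinf_on UNIV f \<Longrightarrow> (\<And>x::real^'n. f x \<in> S) \<Longrightarrow> Cinf_on UNIV (\<lambda>x. F (f x))"
  unfolding Cinf_on_def using Ck_compose by blast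

lemma Cinf_prod:
  "finite I \<Longrightarrow> (\<And>i. i \<in> I \<Longrightarrow> Cinf_on UNIV (f i)) \<Longrightarrow> Cinf_on UNIV (\<lambda>x::real^'n. \<Prod>i\<in>I. f i x)"
  by (induction I rule: finite_induct) (auto simp: Cinf_const Cinf_mult)

lemma Cinf_GDERIV: "Cinf_on UNIV f \<Longrightarrow> GDERIV f x :> cgrad f (x::real^'n)"
  by (metis Cinf_on_def Ck_Suc_GDERIV)

lemma Cinf_continuous: "Cinf_on UNIV f \<Longrightarrow> continuous_on UNIV (f::real^'n \<Rightarrow> real)"
  by (metis Cinf_on_def Ck_on.simps(1))

lemma Cinf_continuous_cgrad: "Cinf_on UNIV f \<Longrightarrow> continuous_on UNIV (cgrad f :: real^'n \<Rightarrow> _)"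
proof -
  assume "Cinf_on UNIV f"
  hence "Ck_on (Suc 0) UNIV f" by (metis Cinf_on_def)
  hence "\<And>i. continuous_on UNIV (\<lambda>x. cgrad f x $ i)" by (simp add: cgrad_def)
  hence "continuous_on UNIV (\<lambda>x. \<chi> i. cgrad f x $ i)" by (intro continuous_on_vec_lambda)
  thus ?thesis by simp
qed

text \<open>The n-th derivative is a falling factorial times a power. The exponents that occur are
  1/2, for the smoothed modulus, and -1, for quotients.\<close>

lemma smooth1_powr: "smooth1 {0<..} (\<lambda>t. t powr a)"
  unfolding smooth1_def
proof (intro exI[of _ "\<lambda>n t. (\<Prod>i<n. a - real i) * t powr (a - real n)"] conjI allI ballI)
  fix n and x :: real assume "x \<in> {0<..}"
  thus "((\<lambda>t. (\<Prod>i<n. a - real i) * t powr (a - real n)) has_real_derivative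
          (\<Prod>i<Suc n. a - real i) * x powr (a - real (Suc n))) (at x)"
    by (auto intro!: derivative_eq_intros simp: algebra_simps)
qed auto

lemma poly_exp_minus_tendsto_0: "((\<lambda>s::real. poly Q s * exp (- s)) \<longlongrightarrow> 0) at_top"
proof -
  have "((\<lambda>s::real. \<Sum>i\<le>degree Q. coeff Q i * (s ^ i / exp s)) \<longlongrightarrow> (\<Sum>i\<le>degree Q. coeff Q i * 0)) at_top"
    by (intro tendsto_intros tendsto_power_div_exp_0)
  moreover have "(\<lambda>s::real. poly Q s * exp (- s)) = (\<lambda>s. \<Sum>i\<le>degree Q. coeff Q i * (s ^ i / exp s))"
    by (rule ext) (simp add: poly_altdef exp_minus sum_distrib_right divide_inverse mult.assoc)
  ultimately show ?thesis by simp
qed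

text \<open>Functions P(1/t) exp(-1/t), extended by 0, are closed under differentiation: with s =
  1/t the polynomial P becomes s^2 (P - P'). At 0 the right difference quotient is s P(s) exp(-s),
  which tends to 0 as s grows.\<close>

lemma smooth1_exp_inverse: "smooth1 UNIV (\<lambda>t. if t > 0 then exp (- (1 / t)) else 0)"
proof -
  define H where "H P t = (if t > 0 then poly P (1 / t) * exp (- (1 / t)) else 0)" for P and t :: real
  define D :: "real poly \<Rightarrow> real poly" where "D P = [:0, 0, 1:] * (P - pderiv P)" for P
  have pos: "(H P has_real_derivative H (D P) x) (at x)" if "x > 0" for P x
  proof -
    have "((\<lambda>t. poly P (1 / t) * exp (- (1 / t))) has_real_derivative H (D P) x) (at x)"
      using that by (auto intro!: derivative_eq_intros simp: H_def D_def power2_eq_square field_simps)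
    thus ?thesis
      by (rule has_field_derivative_transform_within_open[of _ _ _ "{0<..}"]) (use that in \<open>auto simp: H_def\<close>)
  qed
  have neg: "(H P has_real_derivative H (D P) x) (at x)" if "x < 0" for P x
  proof -
    have "((\<lambda>t::real. 0::real) has_real_derivative H (D P) x) (at x)"
      using that by (auto simp: H_def)
    thus ?thesis
      by (rule has_field_derivative_transform_within_open[of _ _ _ "{..<0}"]) (use that in \<open>auto simp: H_def\<close>)
  qed
  have zero: "(H P has_real_derivative H (D P) 0) (at 0)" for P
  proof -
    have "((\<lambda>h. poly (pCons 0 P) (inverse h) * exp (- inverse h)) \<longlongrightarrow> 0) (at_right 0)"
      by (rule filterlim_compose[OF poly_exp_minus_tendsto_0 filterlim_inverse_at_top_right])
    hence r: "((\<lambda>h. H P h / h) \<longlongrightarrow> 0) (at_right 0)"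
      by (rule Lim_transform_eventually)
         (auto simp: H_def field_simps eventually_at_right_less intro!: eventually_mono[OF eventually_at_right_less])
    have l: "((\<lambda>h. H P h / h) \<longlongrightarrow> 0) (at_left 0)"
      by (rule Lim_transform_eventually[OF tendsto_const])
         (auto simp: H_def eventually_at_left_field intro!: exI[of _ "-1"])
    have "((\<lambda>h. H P h / h) \<longlongrightarrow> 0) (at 0)"
      using l r by (simp add: filterlim_at_split)
    thus ?thesis by (simp add: DERIV_def H_def)
  qed
  have "(H P has_real_derivative H (D P) x) (at x)" for P x
    using pos neg zero by (cases x "0::real" rule: linorder_cases) auto
  thus ?thesis unfolding smooth1_def
    by (intro exI[of _ "\<lambda>n. H ((D ^^ n) 1)"]) (auto simp: H_def)
qed

section \<open>Test functions, the smoothed modulus and cutoffs\<close>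

lemma test_funD:
  assumes "test_fun \<Omega> \<phi>"
  shows "Cinf_on UNIV \<phi>" "x \<notin> \<Omega> \<Longrightarrow> \<phi> x = 0" "x \<notin> \<Omega> \<Longrightarrow> cgrad \<phi> x = 0"
    "GDERIV \<phi> x :> cgrad \<phi> x" "continuous_on UNIV \<phi>" "continuous_on UNIV (cgrad \<phi>)"
proof -
  show C: "Cinf_on UNIV \<phi>" using assms by (simp add: test_fun_def)
  show "GDERIV \<phi> x :> cgrad \<phi> x" "continuous_on UNIV \<phi>" "continuous_on UNIV (cgrad \<phi>)"
    using C by (auto intro: Cinf_GDERIV Cinf_continuous Cinf_continuous_cgrad)
  assume x: "x \<notin> \<Omega>"
  hence x': "x \<notin> closure {x. \<phi> x \<noteq> 0}" using assms by (auto simp: test_fun_def)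
  thus "\<phi> x = 0" using closure_subset[of "{x. \<phi> x \<noteq> 0}"] by auto
  have "GDERIV \<phi> x :> 0"
    unfolding gderiv_def
    by (rule has_derivative_transform_within_open[of "\<lambda>_. 0" _ _ UNIV "- closure {x. \<phi> x \<noteq> 0}"])
       (use x' closure_subset[of "{x. \<phi> x \<noteq> 0}"] in auto)
  thus "cgrad \<phi> x = 0" by (rule GDERIV_imp_cgrad)
qed

lemma test_fun_supp:
  assumes "test_fun \<Omega> \<phi>" "Cinf_on UNIV \<psi>" "\<And>x. \<psi> x \<noteq> 0 \<Longrightarrow> \<phi> x \<noteq> 0"
  shows "test_fun \<Omega> \<psi>"
proof -
  have "closure {x. \<psi> x \<noteq> 0} \<subseteq> closure {x. \<phi> x \<noteq> 0}"
    by (intro closure_mono) (use assms(3) in auto)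
  moreover have "bounded {x. \<psi> x \<noteq> 0}"
    by (rule bounded_subset[of "{x. \<phi> x \<noteq> 0}"]) (use assms in \<open>auto simp: test_fun_def\<close>)
  ultimately show ?thesis using assms(1,2) by (auto simp: test_fun_def)
qed

lemma test_fun_add:
  assumes "test_fun \<Omega> \<phi>" "test_fun \<Omega> \<psi>"
  shows "test_fun \<Omega> (\<lambda>x. \<phi> x + \<psi> x)"
proof -
  have "closure {x. \<phi> x + \<psi> x \<noteq> 0} \<subseteq> closure ({x. \<phi> x \<noteq> 0} \<union> {x. \<psi> x \<noteq> 0})"
    by (intro closure_mono) auto
  also have "\<dots> = closure {x. \<phi> x \<noteq> 0} \<union> closure {x. \<psi> x \<noteq> 0}" by simp
  finally have s: "closure {x. \<phi> x + \<psi> x \<noteq> 0} \<subseteq> \<dots>" .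
  have "bounded {x. \<phi> x + \<psi> x \<noteq> 0}"
    by (rule bounded_subset[of "{x. \<phi> x \<noteq> 0} \<union> {x. \<psi> x \<noteq> 0}"])
       (use assms in \<open>auto simp: test_fun_def\<close>)
  moreover have "Cinf_on UNIV (\<lambda>x. \<phi> x + \<psi> x)"
    using assms by (auto simp: test_fun_def intro: Cinf_add)
  ultimately show ?thesis using assms s by (auto simp: test_fun_def)
qed

lemma test_fun_mult:
  "test_fun \<Omega> \<phi> \<Longrightarrow> Cinf_on UNIV f \<Longrightarrow> test_fun \<Omega> (\<lambda>x. f x * \<phi> x)"
  by (rule test_fun_supp) (auto simp: Cinf_mult test_funD)

lemma test_fun_cmult: "test_fun \<Omega> \<phi> \<Longrightarrow> test_fun \<Omega> (\<lambda>x. c * \<phi> x)"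
  by (simp add: test_fun_mult Cinf_const)

lemma cgrad_add:
  "test_fun \<Omega> \<phi> \<Longrightarrow> test_fun \<Omega> \<psi> \<Longrightarrow> cgrad (\<lambda>x. \<phi> x + \<psi> x) x = cgrad \<phi> x + cgrad \<psi> x"
  by (intro GDERIV_imp_cgrad GDERIV_add test_funD(4))

lemma cgrad_cmult:
  assumes "test_fun \<Omega> \<phi>" shows "cgrad (\<lambda>x. c * \<phi> x) x = c *\<^sub>R cgrad \<phi> x"
  using GDERIV_mult[OF GDERIV_const[of c] test_funD(4)[OF assms]] by (auto intro: GDERIV_imp_cgrad)

text \<open>A smooth substitute for the modulus. Subtracting \<open>\<delta>\<close> makes it vanish
  wherever \<open>\<phi>\<close> does, so the support stays inside; the factor of the gradient has
  modulus at most 1, so the Dirichlet energy does not increase.\<close>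

lemma test_fun_smooth_abs:
  assumes "test_fun \<Omega> \<phi>" "\<delta> > 0"
  defines "w \<equiv> \<lambda>x. sqrt ((\<phi> x)\<^sup>2 + \<delta>\<^sup>2) - \<delta>"
  shows "test_fun \<Omega> w" "cgrad w x = (\<phi> x / sqrt ((\<phi> x)\<^sup>2 + \<delta>\<^sup>2)) *\<^sub>R cgrad \<phi> x"
proof -
  have "Cinf_on UNIV (\<lambda>x. (\<phi> x * \<phi> x + \<delta>\<^sup>2) powr (1/2) + (- \<delta>))"
    by (intro Cinf_add Cinf_const Cinf_compose[OF smooth1_powr] Cinf_mult test_funD(1)[OF assms(1)])
       (use assms(2) in \<open>auto simp: add_nonneg_pos\<close>)
  moreover have "w = (\<lambda>x. (\<phi> x * \<phi> x + \<delta>\<^sup>2) powr (1/2) + (- \<delta>))"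
    by (auto simp: w_def powr_half_sqrt power2_eq_square)
  ultimately show "test_fun \<Omega> w"
    by (intro test_fun_supp[OF assms(1)]) (use assms(2) in \<open>auto simp: w_def\<close>)
  have p: "(\<phi> x)\<^sup>2 + \<delta>\<^sup>2 > 0" using assms(2) by (simp add: add_nonneg_pos)
  have "((\<lambda>t. sqrt (t\<^sup>2 + \<delta>\<^sup>2) - \<delta>) has_real_derivative \<phi> x / sqrt ((\<phi> x)\<^sup>2 + \<delta>\<^sup>2)) (at (\<phi> x))"
    using p by (auto intro!: derivative_eq_intros simp: field_simps)
  from GDERIV_DERIV_compose[OF test_funD(4)[OF assms(1)] this]
  show "cgrad w x = (\<phi> x / sqrt ((\<phi> x)\<^sup>2 + \<delta>\<^sup>2)) *\<^sub>R cgrad \<phi> x"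
    unfolding w_def by (rule GDERIV_imp_cgrad)
qed

text \<open>The set of positivity is the whole open box. This is used for the pointwise limit of the
  cutoffs below, and later for a positive lower bound on smaller closed boxes.\<close>

lemma box_bump:
  fixes a b :: "real^'n"
  obtains \<beta> where "Cinf_on UNIV \<beta>" "\<And>x. \<beta> x \<ge> 0" "\<And>x. \<beta> x > 0 \<longleftrightarrow> x \<in> box a b"
proof -
  define h :: "real \<Rightarrow> real" where "h = (\<lambda>t. if t > 0 then exp (- (1 / t)) else 0)"
  define \<beta> where "\<beta> = (\<lambda>x::real^'n. \<Prod>i\<in>UNIV. h (x $ i + (- a $ i)) * h (b $ i + (-1) * x $ i))"
  have h0: "h t \<ge> 0" "h t > 0 \<longleftrightarrow> t > 0" for t by (auto simp: h_def)
  have "Cinf_on UNIV \<beta>" unfolding \<beta>_def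
    by (intro Cinf_prod Cinf_mult Cinf_compose[OF smooth1_exp_inverse[folded h_def]] Cinf_add Cinf_const Cinf_coord) auto
  moreover have nn: "\<beta> x \<ge> 0" for x unfolding \<beta>_def by (intro prod_nonneg) (auto simp: h0)
  moreover have "\<beta> x > 0 \<longleftrightarrow> x \<in> box a b" for x
  proof -
    have "\<beta> x > 0 \<longleftrightarrow> \<beta> x \<noteq> 0" using nn[of x] by auto
    also have "\<dots> \<longleftrightarrow> (\<forall>i. h (x $ i + (- a $ i)) > 0 \<and> h (b $ i + (-1) * x $ i) > 0)"
      unfolding \<beta>_def using h0(1) by (auto simp: less_le)
    also have "\<dots> \<longleftrightarrow> x \<in> box a b" by (auto simp: h0 mem_box_cart)
    finally show ?thesis .
  qed
  ultimately show ?thesis using that by blast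
qed

lemma test_fun_box:
  fixes a b :: "real^'n"
  assumes "Cinf_on UNIV \<beta>" "\<And>x. \<beta> x \<noteq> 0 \<Longrightarrow> x \<in> box a b" "cbox a b \<subseteq> \<Omega>"
  shows "test_fun \<Omega> \<beta>"
proof -
  have "closure {x. \<beta> x \<noteq> 0} \<subseteq> cbox a b"
    by (intro closure_minimal) (use assms(2) box_subset_cbox in \<open>auto\<close>)
  moreover have "bounded {x. \<beta> x \<noteq> 0}"
    by (rule bounded_subset[of "box a b"]) (use assms in auto)
  ultimately show ?thesis using assms by (auto simp: test_fun_def)
qed

text \<open>For a bump \<beta> the quotient k \<beta> / (1 + k \<beta>) tends to 1 where \<beta> is
  positive and is 0 elsewhere. It is written with the power -1 so that \<open>smooth1_powr\<close>
  gives its smoothness.\<close>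

lemma box_cutoffs:
  fixes a b :: "real^'n"
  assumes "cbox a b \<subseteq> \<Omega>"
  obtains \<eta> where "\<And>k. test_fun \<Omega> (\<eta> k)" "\<And>k x. \<eta> k x \<in> {0..1}"
    "\<And>x. (\<lambda>k. \<eta> k x) \<longlonglongrightarrow> indicator (box a b) x"
proof -
  obtain \<beta> where \<beta>: "Cinf_on UNIV \<beta>" "\<And>x. \<beta> x \<ge> 0" "\<And>x. \<beta> x > 0 \<longleftrightarrow> x \<in> box a b"
    using box_bump by blast
  define \<eta> where "\<eta> = (\<lambda>k x. (1 + real k * \<beta> x) powr (-1) * (real k * \<beta> x))"
  have pos: "1 + real k * \<beta> x > 0" for k x using \<beta>(2)[of x] by (simp add: add_pos_nonneg)
  have "Cinf_on UNIV (\<eta> k)" for k unfolding \<eta>_def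
    by (intro Cinf_mult Cinf_add Cinf_const \<beta> Cinf_compose[OF smooth1_powr]) (use pos in auto)
  moreover have "\<eta> k x \<noteq> 0 \<Longrightarrow> x \<in> box a b" for k x
    using \<beta>(2)[of x] by (auto simp: \<eta>_def \<beta>(3)[symmetric])
  ultimately have "test_fun \<Omega> (\<eta> k)" for k by (rule test_fun_box[OF _ _ assms])
  moreover have \<eta>: "\<eta> k x = real k * \<beta> x / (1 + real k * \<beta> x)" for k x
    unfolding \<eta>_def using pos[of k x] by (simp add: powr_minus divide_inverse)
  moreover have "\<eta> k x \<in> {0..1}" for k x using pos[of k x] \<beta>(2)[of x] by (simp add: \<eta>)
  moreover have "(\<lambda>k. \<eta> k x) \<longlonglongrightarrow> indicator (box a b) x" for x
  proof (cases "x \<in> box a b")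
    case True
    hence "\<beta> x > 0" using \<beta>(3) by simp
    hence "(\<lambda>k. real k * \<beta> x / (1 + real k * \<beta> x)) \<longlonglongrightarrow> 1" by real_asymp
    thus ?thesis using True by (simp add: \<eta>)
  next
    case False
    hence "\<beta> x = 0" using \<beta>(2,3) less_le by metis
    thus ?thesis using False by (simp add: \<eta>)
  qed
  ultimately show ?thesis using that by blast
qed

section \<open>A nonlocal Poincare inequality\<close>

lemma nn_integral_lborel_affine:
  fixes t :: "'a::euclidean_space"
  assumes [measurable]: "f \<in> borel_measurable borel" and c: "c \<noteq> 0"
  shows "(\<integral>\<^sup>+x. f x \<partial>lborel) = ennreal (\<bar>c\<bar> ^ DIM('a)) * (\<integral>\<^sup>+x. f (t + c *\<^sub>R x) \<partial>lborel)"
  by (subst lborel_affine[OF c, of t])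
     (simp add: nn_integral_density nn_integral_distr nn_integral_cmult)

text \<open>Cauchy-Schwarz along the segment, using only monotonicity of the integral: if c is the
  increment and F' the derivative along the segment, integrate 2 c F' - c^2 \<le> F'^2; the left
  side integrates to c^2. The result is stated for nonnegative integrals so that integrations can be
  exchanged freely afterwards.\<close>

lemma segment_energy:
  fixes g :: "real^'n \<Rightarrow> real"
  assumes g: "\<And>x. GDERIV g x :> G x" and G: "continuous_on UNIV G"
  shows "ennreal ((g y - g x)\<^sup>2) \<le>
    ennreal ((norm (y - x))\<^sup>2) * (\<integral>\<^sup>+t. indicator {0..1} t * ennreal ((norm (G (x + t *\<^sub>R (y - x))))\<^sup>2) \<partial>lborel)"
proof -
  define c where "c = g y - g x"
  define k where "k = (norm (y - x))\<^sup>2"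
  define F' where "F' t = (y - x) \<bullet> G (x + t *\<^sub>R (y - x))" for t
  have G': "continuous_on S (\<lambda>t. G (x + t *\<^sub>R (y - x)))" for S
    by (intro continuous_on_compose2[OF G] continuous_intros) auto
  have contF': "continuous_on S F'" for S unfolding F'_def
    by (intro continuous_intros G')
  have der: "((\<lambda>t. g (x + t *\<^sub>R (y - x))) has_real_derivative F' t) (at t)" for t
  proof -
    have "((\<lambda>t. g (x + t *\<^sub>R (y - x))) has_derivative (\<lambda>h. (h *\<^sub>R (y - x)) \<bullet> G (x + t *\<^sub>R (y - x)))) (at t)"
      by (rule has_derivative_compose[OF _ g[unfolded gderiv_def]]) (auto intro!: derivative_eq_intros)
    thus ?thesis by (simp add: has_field_derivative_def F'_def mult_commute_abs)
  qed
  have "((\<lambda>t. 2 * c * g (x + t *\<^sub>R (y - x)) - c\<^sup>2 * t) has_real_derivative 2 * c * F' t - c\<^sup>2) (at t)" for t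
    by (auto intro!: derivative_eq_intros der)
  moreover have cont: "isCont (\<lambda>t. 2 * c * F' t - c\<^sup>2) t" for t
    using contF'[of UNIV] by (auto intro!: continuous_intros simp: continuous_on_eq_continuous_at)
  ultimately have "(\<integral>t. (2 * c * F' t - c\<^sup>2) * indicator {0..1} t \<partial>lborel)
      = (2 * c * g (x + 1 *\<^sub>R (y - x)) - c\<^sup>2 * 1) - (2 * c * g (x + 0 *\<^sub>R (y - x)) - c\<^sup>2 * 0)"
    by (intro integral_FTC_Icc_real) auto
  also have "\<dots> = c\<^sup>2" by (simp add: c_def power2_eq_square algebra_simps)
  finally have eq: "c\<^sup>2 = (\<integral>t. (2 * c * F' t - c\<^sup>2) * indicator {0..1} t \<partial>lborel)" by simp
  have i2: "integrable lborel (\<lambda>t. (k * (norm (G (x + t *\<^sub>R (y - x))))\<^sup>2) * indicator {0..1} t)"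
    by (rule borel_integrable_atLeastAtMost)
       (use G'[of UNIV] in \<open>auto intro!: continuous_intros simp: continuous_on_eq_continuous_at\<close>)
  have i1: "integrable lborel (\<lambda>t. (2 * c * F' t - c\<^sup>2) * indicator {0..1} t)"
    by (rule borel_integrable_atLeastAtMost) (use cont in auto)
  have le: "2 * c * F' t - c\<^sup>2 \<le> k * (norm (G (x + t *\<^sub>R (y - x))))\<^sup>2" for t
  proof -
    have "2 * c * F' t - c\<^sup>2 \<le> (F' t)\<^sup>2"
      using zero_le_power2[of "c - F' t"] by (simp add: power2_eq_square algebra_simps)
    also have "\<dots> \<le> k * (norm (G (x + t *\<^sub>R (y - x))))\<^sup>2"
      using power_mono[OF Cauchy_Schwarz_ineq2[of "y - x" "G (x + t *\<^sub>R (y - x))"], of 2]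
      by (simp add: F'_def k_def power_mult_distrib)
    finally show ?thesis .
  qed
  have "c\<^sup>2 \<le> (\<integral>t. (k * (norm (G (x + t *\<^sub>R (y - x))))\<^sup>2) * indicator {0..1} t \<partial>lborel)"
    by (subst eq, intro integral_mono i1 i2) (auto simp: indicator_def le)
  hence "ennreal (c\<^sup>2) \<le> ennreal (\<integral>t. (k * (norm (G (x + t *\<^sub>R (y - x))))\<^sup>2) * indicator {0..1} t \<partial>lborel)"
    by (rule ennreal_leI)
  also have "\<dots> = (\<integral>\<^sup>+t. ennreal ((k * (norm (G (x + t *\<^sub>R (y - x))))\<^sup>2) * indicator {0..1} t) \<partial>lborel)"
    by (rule nn_integral_eq_integral[symmetric, OF i2]) (auto simp: k_def)
  also have "\<dots> = (\<integral>\<^sup>+t. ennreal k * (indicator {0..1} t * ennreal ((norm (G (x + t *\<^sub>R (y - x))))\<^sup>2)) \<partial>lborel)"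
    by (intro nn_integral_cong) (auto simp: indicator_def ennreal_mult k_def)
  also have "\<dots> = ennreal k * (\<integral>\<^sup>+t. indicator {0..1} t * ennreal ((norm (G (x + t *\<^sub>R (y - x))))\<^sup>2) \<partial>lborel)"
  proof (rule nn_integral_cmult)
    have "(\<lambda>t. G (x + t *\<^sub>R (y - x))) \<in> borel_measurable borel"
      using G'[of UNIV] by (rule borel_measurable_continuous_onI)
    thus "(\<lambda>t. indicator {0..1} t * ennreal ((norm (G (x + t *\<^sub>R (y - x))))\<^sup>2)) \<in> borel_measurable lborel"
      by measurable
  qed
  finally show ?thesis by (simp add: c_def k_def)
qed

text \<open>The segment from \<open>x\<close> to \<open>y\<close> is split at its midpoint, so that one end always stays at
  least half the weight away and the affine substitution costs at most \<open>2\<^sup>N\<close>. Taking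
  \<open>S = B \<times> B\<close> gives the usual Poincare inequality; taking for \<open>S\<close> the relation
  of lying in the same cell of a grid handles all cells at once.\<close>
lemma nonlocal_poincare:
  fixes g :: "real^'n \<Rightarrow> real" and S :: "((real^'n) \<times> (real^'n)) set"
  assumes g: "\<And>x. GDERIV g x :> G x" and G: "continuous_on UNIV G"
    and S[measurable]: "S \<in> sets (borel \<Otimes>\<^sub>M borel)"
    and sym: "\<And>x y. (x, y) \<in> S \<Longrightarrow> (y, x) \<in> S"
    and conv: "\<And>x y t. (x, y) \<in> S \<Longrightarrow> 0 \<le> t \<Longrightarrow> t < 1 \<Longrightarrow> ((1 - t) *\<^sub>R x + t *\<^sub>R y, y) \<in> S"
    and diam: "\<And>x y. (x, y) \<in> S \<Longrightarrow> norm (y - x) \<le> d"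
  shows "(\<integral>\<^sup>+x. \<integral>\<^sup>+y. indicator S (x, y) * ennreal ((g y - g x)\<^sup>2) \<partial>lborel \<partial>lborel) \<le>
    ennreal (2 ^ CARD('n) * d\<^sup>2) * (\<integral>\<^sup>+x. ennreal ((norm (G x))\<^sup>2) * emeasure lborel {y. (x, y) \<in> S} \<partial>lborel)"
proof -
  have [measurable]: "G \<in> borel_measurable borel"
    using G by (rule borel_measurable_continuous_onI)
  have "continuous_on UNIV g"
    using g by (auto simp: gderiv_def continuous_on_eq_continuous_at intro: has_derivative_continuous)
  hence [measurable]: "g \<in> borel_measurable borel" by (rule borel_measurable_continuous_onI)
  define J where "J t = (\<integral>\<^sup>+x. \<integral>\<^sup>+y. indicator S (x, y) * ennreal ((norm (G (x + t *\<^sub>R (y - x))))\<^sup>2) \<partial>lborel \<partial>lborel)"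
    for t :: real
  define W where "W = (\<integral>\<^sup>+x. ennreal ((norm (G x))\<^sup>2) * emeasure lborel {y. (x, y) \<in> S} \<partial>lborel)"
  have W: "(\<integral>\<^sup>+x. \<integral>\<^sup>+y. indicator S (x, y) * ennreal ((norm (G x))\<^sup>2) \<partial>lborel \<partial>lborel) = W"
    unfolding W_def
  proof (intro nn_integral_cong)
    fix x :: "real^'n"
    have "(\<integral>\<^sup>+y. indicator S (x, y) * ennreal ((norm (G x))\<^sup>2) \<partial>lborel)
        = (\<integral>\<^sup>+y. ennreal ((norm (G x))\<^sup>2) * indicator {y. (x, y) \<in> S} y \<partial>lborel)"
      by (intro nn_integral_cong) (auto simp: indicator_def)
    also have "\<dots> = ennreal ((norm (G x))\<^sup>2) * emeasure lborel {y. (x, y) \<in> S}"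
      by (rule nn_integral_cmult_indicator) measurable
    finally show "(\<integral>\<^sup>+y. indicator S (x, y) * ennreal ((norm (G x))\<^sup>2) \<partial>lborel)
        = ennreal ((norm (G x))\<^sup>2) * emeasure lborel {y. (x, y) \<in> S}" .
  qed
  have Jlow: "J t \<le> ennreal (2 ^ CARD('n)) * W" if t: "0 \<le> t" "t \<le> 1/2" for t
  proof -
    define u where "u x y = indicator S (x, y) * ennreal ((norm (G x))\<^sup>2)" for x y
    have [measurable]: "(\<lambda>(x, y). u x y) \<in> borel_measurable (borel \<Otimes>\<^sub>M borel)"
      unfolding u_def by measurable
    have "J t = (\<integral>\<^sup>+y. \<integral>\<^sup>+x. indicator S (x, y) * ennreal ((norm (G (x + t *\<^sub>R (y - x))))\<^sup>2) \<partial>lborel \<partial>lborel)"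
      unfolding J_def by (rule lborel_pair.Fubini'[symmetric]) measurable
    \<comment> \<open>By \<open>conv\<close> the intermediate point is still related to
      \<open>y\<close>, so the indicator may be evaluated there. For fixed \<open>y\<close> this
      point is an affine image of \<open>x\<close> with ratio 1 - t.\<close>
    also have "\<dots> \<le> (\<integral>\<^sup>+y. \<integral>\<^sup>+x. u (t *\<^sub>R y + (1 - t) *\<^sub>R x) y \<partial>lborel \<partial>lborel)"
    proof (intro nn_integral_mono)
      fix x y :: "real^'n"
      have *: "x + t *\<^sub>R (y - x) = t *\<^sub>R y + (1 - t) *\<^sub>R x" by (simp add: algebra_simps)
      show "indicator S (x, y) * ennreal ((norm (G (x + t *\<^sub>R (y - x))))\<^sup>2) \<le> u (t *\<^sub>R y + (1 - t) *\<^sub>R x) y"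
        unfolding * u_def using conv[of x y t] t by (auto simp: indicator_def add.commute)
    qed
    also have "\<dots> \<le> (\<integral>\<^sup>+y. ennreal (2 ^ CARD('n)) * (\<integral>\<^sup>+x. u x y \<partial>lborel) \<partial>lborel)"
    proof (intro nn_integral_mono)
      fix y :: "real^'n"
      have "ennreal (2 ^ CARD('n)) * (\<integral>\<^sup>+x. u x y \<partial>lborel)
         = ennreal (2 ^ CARD('n)) * (ennreal (\<bar>1 - t\<bar> ^ DIM(real^'n)) * (\<integral>\<^sup>+x. u (t *\<^sub>R y + (1 - t) *\<^sub>R x) y \<partial>lborel))"
        by (subst nn_integral_lborel_affine[of _ "1 - t" "t *\<^sub>R y"]) (use t in auto)
      also have "\<dots> = ennreal ((2 * (1 - t)) ^ CARD('n)) * (\<integral>\<^sup>+x. u (t *\<^sub>R y + (1 - t) *\<^sub>R x) y \<partial>lborel)"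
        using t by (simp only: power_mult_distrib) (simp add: mult.assoc[symmetric] ennreal_mult[symmetric])
      \<comment> \<open>Here t \<le> 1/2 enters: 2 (1 - t) is at least 1.\<close>
      also have "\<dots> \<ge> 1 * (\<integral>\<^sup>+x. u (t *\<^sub>R y + (1 - t) *\<^sub>R x) y \<partial>lborel)"
        using t by (intro mult_right_mono) (auto simp flip: ennreal_1 intro!: ennreal_leI one_le_power)
      finally show "(\<integral>\<^sup>+x. u (t *\<^sub>R y + (1 - t) *\<^sub>R x) y \<partial>lborel) \<le> ennreal (2 ^ CARD('n)) * (\<integral>\<^sup>+x. u x y \<partial>lborel)"
        by simp
    qed
    also have "\<dots> = ennreal (2 ^ CARD('n)) * (\<integral>\<^sup>+y. \<integral>\<^sup>+x. u x y \<partial>lborel \<partial>lborel)"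
      by (rule nn_integral_cmult) measurable
    also have "(\<integral>\<^sup>+y. \<integral>\<^sup>+x. u x y \<partial>lborel \<partial>lborel) = (\<integral>\<^sup>+x. \<integral>\<^sup>+y. u x y \<partial>lborel \<partial>lborel)"
      by (rule lborel_pair.Fubini') measurable
    also have "\<dots> = W" unfolding u_def by (rule W)
    finally show ?thesis .
  qed
  \<comment> \<open>Exchanging the two points of a pair turns \<open>t\<close> into
    \<open>1 - t\<close>, so the half of the segment near \<open>y\<close> costs no more than the
    half near \<open>x\<close>.\<close>
  have Jsym: "J t = J (1 - t)" for t
  proof -
    have "J t = (\<integral>\<^sup>+y. \<integral>\<^sup>+x. indicator S (x, y) * ennreal ((norm (G (x + t *\<^sub>R (y - x))))\<^sup>2) \<partial>lborel \<partial>lborel)"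
      unfolding J_def by (rule lborel_pair.Fubini'[symmetric]) measurable
    also have "\<dots> = J (1 - t)" unfolding J_def
    proof (intro nn_integral_cong)
      fix x y :: "real^'n"
      have "y + t *\<^sub>R (x - y) = x + (1 - t) *\<^sub>R (y - x)" by (simp add: algebra_simps)
      thus "indicator S (y, x) * ennreal ((norm (G (y + t *\<^sub>R (x - y))))\<^sup>2)
        = indicator S (x, y) * ennreal ((norm (G (x + (1 - t) *\<^sub>R (y - x))))\<^sup>2)"
        using sym by (auto simp: indicator_def)
    qed
    finally show ?thesis .
  qed
  have J: "J t \<le> ennreal (2 ^ CARD('n)) * W" if "t \<in> {0..1}" for t
    using Jlow[of t] Jlow[of "1 - t"] Jsym[of t] that by (cases "t \<le> 1/2") auto
  have "(\<integral>\<^sup>+x. \<integral>\<^sup>+y. indicator S (x, y) * ennreal ((g y - g x)\<^sup>2) \<partial>lborel \<partial>lborel)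
     \<le> (\<integral>\<^sup>+x. \<integral>\<^sup>+y. \<integral>\<^sup>+t. ennreal (d\<^sup>2) * (indicator {0..1} t *
          (indicator S (x, y) * ennreal ((norm (G (x + t *\<^sub>R (y - x))))\<^sup>2))) \<partial>lborel \<partial>lborel \<partial>lborel)"
  proof (intro nn_integral_mono)
    fix x y :: "real^'n"
    define Q where "Q = (\<integral>\<^sup>+t. indicator {0..1} t * ennreal ((norm (G (x + t *\<^sub>R (y - x))))\<^sup>2) \<partial>lborel)"
    show "indicator S (x, y) * ennreal ((g y - g x)\<^sup>2) \<le> (\<integral>\<^sup>+t. ennreal (d\<^sup>2) * (indicator {0..1} t *
          (indicator S (x, y) * ennreal ((norm (G (x + t *\<^sub>R (y - x))))\<^sup>2))) \<partial>lborel)"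
    proof (cases "(x, y) \<in> S")
      case True
      have "ennreal ((g y - g x)\<^sup>2) \<le> ennreal ((norm (y - x))\<^sup>2) * Q"
        unfolding Q_def by (rule segment_energy[OF g G])
      also have "\<dots> \<le> ennreal (d\<^sup>2) * Q"
        using diam[OF True] by (intro mult_right_mono ennreal_leI power_mono) auto
      also have "\<dots> = (\<integral>\<^sup>+t. ennreal (d\<^sup>2) * (indicator {0..1} t * ennreal ((norm (G (x + t *\<^sub>R (y - x))))\<^sup>2)) \<partial>lborel)"
        unfolding Q_def by (rule nn_integral_cmult[symmetric]) measurable
      finally show ?thesis using True by simp
    qed simp
  qed
  also have "\<dots> = (\<integral>\<^sup>+x. \<integral>\<^sup>+t. \<integral>\<^sup>+y. ennreal (d\<^sup>2) * (indicator {0..1} t *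
          (indicator S (x, y) * ennreal ((norm (G (x + t *\<^sub>R (y - x))))\<^sup>2))) \<partial>lborel \<partial>lborel \<partial>lborel)"
    by (intro nn_integral_cong lborel_pair.Fubini'[symmetric]) measurable
  also have "\<dots> = (\<integral>\<^sup>+t. \<integral>\<^sup>+x. \<integral>\<^sup>+y. ennreal (d\<^sup>2) * (indicator {0..1} t *
          (indicator S (x, y) * ennreal ((norm (G (x + t *\<^sub>R (y - x))))\<^sup>2))) \<partial>lborel \<partial>lborel \<partial>lborel)"
    by (intro lborel_pair.Fubini'[symmetric]) measurable
  also have "\<dots> = (\<integral>\<^sup>+t. ennreal (d\<^sup>2) * (indicator {0..1} t * J t) \<partial>lborel)"
    unfolding J_def by (intro nn_integral_cong) (simp add: nn_integral_cmult)
  also have "\<dots> \<le> (\<integral>\<^sup>+t. (ennreal (d\<^sup>2) * (ennreal (2 ^ CARD('n)) * W)) * indicator {0..1::real} t \<partial>lborel)"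
    by (intro nn_integral_mono) (auto simp: indicator_def intro!: mult_left_mono J)
  also have "\<dots> = ennreal (d\<^sup>2) * (ennreal (2 ^ CARD('n)) * W) * emeasure lborel {0..1::real}"
    by (rule nn_integral_cmult_indicator) simp
  also have "\<dots> = ennreal (2 ^ CARD('n) * d\<^sup>2) * W"
    by (simp add: ennreal_mult mult_ac)
  finally show ?thesis by (simp add: W_def)
qed

section \<open>Averages over dyadic cells\<close>

text \<open>Only a continuous gradient and vanishing outside \<Omega> are recorded, so the class is
  stable under composition with any continuously differentiable function that vanishes at 0, as the
  truncation argument demands. The gradient is a parameter, which keeps the chain rule
  explicit.\<close>

definition C1z :: "(real^'n) set \<Rightarrow> (real^'n \<Rightarrow> real) \<Rightarrow> (real^'n \<Rightarrow> real^'n) \<Rightarrow> bool" where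
  "C1z \<Omega> g G \<longleftrightarrow> (\<forall>x. GDERIV g x :> G x) \<and> continuous_on UNIV G \<and> (\<forall>x. x \<notin> \<Omega> \<longrightarrow> g x = 0 \<and> G x = 0)"

lemma test_fun_C1z: "test_fun \<Omega> \<phi> \<Longrightarrow> C1z \<Omega> \<phi> (cgrad \<phi>)"
  by (auto simp: C1z_def test_funD)

lemma integrable_continuous_vanish:
  fixes f :: "'a::euclidean_space \<Rightarrow> 'b::{banach, second_countable_topology}"
  assumes "continuous_on UNIV f" "\<And>x. x \<notin> \<Omega> \<Longrightarrow> f x = 0" "bounded \<Omega>"
  shows "integrable lborel f"
proof -
  obtain a b where ab: "\<Omega> \<subseteq> cbox a b" using bounded_subset_cbox_symmetric[OF assms(3)] by blast
  have "integrable lborel (\<lambda>x. indicator (cbox a b) x *\<^sub>R f x)"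
    by (intro borel_integrable_compact compact_cbox continuous_on_subset[OF assms(1)]) auto
  moreover have "(\<lambda>x. indicator (cbox a b) x *\<^sub>R f x) = f"
    using assms(2) ab by (auto simp: indicator_def fun_eq_iff)
  ultimately show ?thesis by simp
qed

lemma bounded_continuous_vanish:
  fixes f :: "'a::euclidean_space \<Rightarrow> 'b::real_normed_vector"
  assumes "continuous_on UNIV f" "\<And>x. x \<notin> \<Omega> \<Longrightarrow> f x = 0" "bounded \<Omega>"
  obtains M where "M > 0" "\<And>x. norm (f x) \<le> M"
proof -
  have "compact (closure \<Omega>)" using assms(3) by simp
  hence "bounded (f ` closure \<Omega>)"
    by (intro compact_imp_bounded compact_continuous_image continuous_on_subset[OF assms(1)]) auto
  then obtain M where M: "M > 0" "\<And>x. x \<in> closure \<Omega> \<Longrightarrow> norm (f x) \<le> M"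
    by (auto simp: bounded_pos)
  have "norm (f x) \<le> M" for x
  proof (cases "x \<in> closure \<Omega>")
    case False
    hence "f x = 0" using assms(2) closure_subset[of \<Omega>] by blast
    thus ?thesis using M by simp
  qed (use M in auto)
  with M(1) that show ?thesis by blast
qed

lemma C1zD:
  assumes "C1z \<Omega> g G"
  shows "GDERIV g x :> G x" "continuous_on UNIV G" "continuous_on UNIV g"
    "x \<notin> \<Omega> \<Longrightarrow> g x = 0" "x \<notin> \<Omega> \<Longrightarrow> G x = 0"
    "g \<in> borel_measurable borel" "G \<in> borel_measurable borel"
proof -
  show c: "continuous_on UNIV G" "continuous_on UNIV g"
    using assms by (auto simp: C1z_def gderiv_def continuous_on_eq_continuous_at intro: has_derivative_continuous)
  thus "g \<in> borel_measurable borel" "G \<in> borel_measurable borel"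
    by (auto intro: borel_measurable_continuous_onI)
qed (use assms in \<open>auto simp: C1z_def\<close>)

lemma C1z_integrable:
  assumes "C1z \<Omega> g G" "bounded \<Omega>"
  shows "integrable lborel g" "integrable lborel (\<lambda>x. (g x)\<^sup>2)" "integrable lborel (\<lambda>x. (norm (G x))\<^sup>2)"
proof -
  note c = C1zD(2)[OF assms(1)] C1zD(3)[OF assms(1)]
  show "integrable lborel g" "integrable lborel (\<lambda>x. (g x)\<^sup>2)" "integrable lborel (\<lambda>x. (norm (G x))\<^sup>2)"
    using C1zD(4,5)[OF assms(1)]
    by (auto intro!: integrable_continuous_vanish[OF _ _ assms(2)] continuous_intros c)
qed

lemma C1z_diff: "C1z \<Omega> g G \<Longrightarrow> C1z \<Omega> h H \<Longrightarrow> C1z \<Omega> (\<lambda>x. g x - h x) (\<lambda>x. G x - H x)"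
  by (auto simp: C1z_def intro: GDERIV_diff continuous_on_diff)

lemma C1z_compose:
  assumes "C1z \<Omega> g G" "\<And>t. (T has_real_derivative T' t) (at t)" "continuous_on UNIV T'" "T 0 = 0"
  shows "C1z \<Omega> (\<lambda>x. T (g x)) (\<lambda>x. T' (g x) *\<^sub>R G x)"
proof -
  have "continuous_on UNIV (\<lambda>x. T' (g x) *\<^sub>R G x)"
    by (intro continuous_intros continuous_on_compose2[OF assms(3)] C1zD[OF assms(1)]) auto
  thus ?thesis
    using GDERIV_DERIV_compose[OF C1zD(1)[OF assms(1)] assms(2)] C1zD(4,5)[OF assms(1)] assms(4)
    by (auto simp: C1z_def)
qed

lemma C1z_scale:
  assumes "C1z \<Omega> g G" shows "C1z \<Omega> (\<lambda>x. c * g x) (\<lambda>x. c *\<^sub>R G x)"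
  by (rule C1z_compose[OF assms, of "\<lambda>t. c * t" "\<lambda>_. c"]) (auto intro!: derivative_eq_intros)

text \<open>If all sections of the relation have volume at most \<open>V\<close>, the weight becomes
  a constant and the right side a multiple of the Dirichlet energy. Both a large ball and the grid
  are of this kind.\<close>

lemma nonlocal_poincare_uniform:
  fixes g :: "real^'n \<Rightarrow> real" and S :: "((real^'n) \<times> (real^'n)) set"
  assumes gG: "C1z \<Omega> g G" "bounded \<Omega>"
    and S[measurable]: "S \<in> sets (borel \<Otimes>\<^sub>M borel)"
    and sym: "\<And>x y. (x, y) \<in> S \<Longrightarrow> (y, x) \<in> S"
    and conv: "\<And>x y t. (x, y) \<in> S \<Longrightarrow> 0 \<le> t \<Longrightarrow> t < 1 \<Longrightarrow> ((1 - t) *\<^sub>R x + t *\<^sub>R y, y) \<in> S"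
    and diam: "\<And>x y. (x, y) \<in> S \<Longrightarrow> norm (y - x) \<le> d"
    and V: "V \<ge> 0" "\<And>x. emeasure lborel {y. (x, y) \<in> S} \<le> ennreal V"
  shows "(\<integral>\<^sup>+x. \<integral>\<^sup>+y. indicator S (x, y) * ennreal ((g y - g x)\<^sup>2) \<partial>lborel \<partial>lborel) \<le>
    ennreal (2 ^ CARD('n) * d\<^sup>2 * V * (\<integral>x. (norm (G x))\<^sup>2 \<partial>lborel))"
proof -
  have [measurable]: "G \<in> borel_measurable borel" by (rule C1zD(7)[OF gG(1)])
  have "(\<integral>\<^sup>+x. \<integral>\<^sup>+y. indicator S (x, y) * ennreal ((g y - g x)\<^sup>2) \<partial>lborel \<partial>lborel) \<le>
    ennreal (2 ^ CARD('n) * d\<^sup>2) * (\<integral>\<^sup>+x. ennreal ((norm (G x))\<^sup>2) * emeasure lborel {y. (x, y) \<in> S} \<partial>lborel)"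
    by (rule nonlocal_poincare[OF C1zD(1)[OF gG(1)] C1zD(2)[OF gG(1)] S sym conv diam])
  also have "\<dots> \<le> ennreal (2 ^ CARD('n) * d\<^sup>2) * (\<integral>\<^sup>+x. ennreal ((norm (G x))\<^sup>2) * ennreal V \<partial>lborel)"
    by (intro mult_left_mono nn_integral_mono V) auto
  also have "(\<integral>\<^sup>+x. ennreal ((norm (G x))\<^sup>2) * ennreal V \<partial>lborel) = ennreal (\<integral>x. (norm (G x))\<^sup>2 \<partial>lborel) * ennreal V"
    by (simp add: nn_integral_multc nn_integral_eq_integral[OF C1z_integrable(3)[OF gG]])
  also have "ennreal (2 ^ CARD('n) * d\<^sup>2) * \<dots> = ennreal (2 ^ CARD('n) * d\<^sup>2 * V * (\<integral>x. (norm (G x))\<^sup>2 \<partial>lborel))"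
    using V by (simp add: ennreal_mult[symmetric] mult_ac)
  finally show ?thesis .
qed

text \<open>A unit ball outside \<Omega> supplies points \<open>y\<close> with
  \<open>g y = 0\<close>, for which (g y - g x)^2 is the square of g x. Integrating over pairs in a
  large ball that contains both \<Omega> and the unit ball compares the square integral with the
  nonlocal double integral.\<close>

lemma poincare:
  fixes \<Omega> :: "(real^'n) set"
  assumes "bounded \<Omega>"
  obtains C where "C > 0" "\<And>g G. C1z \<Omega> g G \<Longrightarrow> (\<integral>x. (g x)\<^sup>2 \<partial>lborel) \<le> C * (\<integral>x. (norm (G x))\<^sup>2 \<partial>lborel)"
proof -
  obtain R where R: "R > 0" "\<Omega> \<subseteq> ball 0 R"
    using bounded_subset_ballD[OF assms, of 0] by blast
  fix i :: 'n
  \<comment> \<open>The unit ball around \<open>c\<close> lies outside the ball of radius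
    \<open>R\<close> and inside the one of radius \<open>R + 2\<close>; the coordinate direction is
    arbitrary.\<close>
  define c :: "real^'n" where "c = (R + 1) *\<^sub>R axis i 1"
  have nc: "norm c = R + 1" using R by (simp add: c_def)
  define B :: "(real^'n) set" where "B = ball 0 (R + 2)"
  have cB: "ball c 1 \<subseteq> B"
  proof
    fix y assume "y \<in> ball c 1"
    hence "norm (y - c) < 1" by (simp add: dist_norm norm_minus_commute)
    thus "y \<in> B" using norm_triangle_ineq[of "y - c" c] nc by (simp add: B_def)
  qed
  have c0: "y \<notin> \<Omega>" if "y \<in> ball c 1" for y
  proof -
    have "norm (c - y) < 1" using that by (simp add: dist_norm)
    hence "norm y > R" using norm_triangle_ineq[of "c - y" y] nc by simp
    thus ?thesis using R by auto
  qed
  define V where "V = measure lborel B"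
  define v where "v = measure lborel (ball c 1)"
  have v: "v > 0" "V \<ge> 0" by (simp_all add: v_def V_def content_ball_pos)
  have eB: "emeasure lborel B = ennreal V" "emeasure lborel (ball c 1) = ennreal v"
    using emeasure_bounded_finite[of B] emeasure_bounded_finite[of "ball c 1"]
    by (auto simp: V_def v_def B_def intro!: emeasure_eq_ennreal_measure)
  have [measurable]: "B \<in> sets borel" "B \<in> sets lborel" by (auto simp: B_def)
  define K where "K = 2 ^ CARD('n) * (2 * (R + 2))\<^sup>2 * V"
  have K: "K \<ge> 0" using v by (simp add: K_def)
  have main: "(\<integral>x. (g x)\<^sup>2 \<partial>lborel) \<le> (K / v) * (\<integral>x. (norm (G x))\<^sup>2 \<partial>lborel)" if gG: "C1z \<Omega> g G" for g G
  proof -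
    have [measurable]: "g \<in> borel_measurable borel" by (rule C1zD(6)[OF gG])
    note i = C1z_integrable[OF gG assms]
    have "ennreal ((\<integral>x. (g x)\<^sup>2 \<partial>lborel) * v) = (\<integral>\<^sup>+x. ennreal ((g x)\<^sup>2) * emeasure lborel (ball c 1) \<partial>lborel)"
      using v by (simp add: nn_integral_multc nn_integral_eq_integral[OF i(2)] eB ennreal_mult)
    also have "\<dots> = (\<integral>\<^sup>+x. \<integral>\<^sup>+y. ennreal ((g x)\<^sup>2) * indicator (ball c 1) y \<partial>lborel \<partial>lborel)"
      by (simp add: nn_integral_cmult_indicator)
    also have "\<dots> \<le> (\<integral>\<^sup>+x. \<integral>\<^sup>+y. indicator (B \<times> B) (x, y) * ennreal ((g y - g x)\<^sup>2) \<partial>lborel \<partial>lborel)"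
    proof (intro nn_integral_mono)
      fix x y :: "real^'n"
      show "ennreal ((g x)\<^sup>2) * indicator (ball c 1) y \<le> indicator (B \<times> B) (x, y) * ennreal ((g y - g x)\<^sup>2)"
      proof (cases "y \<in> ball c 1 \<and> x \<in> \<Omega>")
        case True
        hence "g y = 0" using c0 C1zD(4)[OF gG] by blast
        moreover have "x \<in> B" using True R by (auto simp: B_def)
        ultimately show ?thesis using True cB by auto
      next
        case False
        thus ?thesis using C1zD(4)[OF gG, of x] by (auto simp: indicator_def)
      qed
    qed
    also have "\<dots> \<le> ennreal (2 ^ CARD('n) * (2 * (R + 2))\<^sup>2 * V * (\<integral>x. (norm (G x))\<^sup>2 \<partial>lborel))"
    proof (rule nonlocal_poincare_uniform[OF gG assms])
      show "B \<times> B \<in> sets (borel \<Otimes>\<^sub>M borel)" by measurable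
      show "norm (y - x) \<le> 2 * (R + 2)" if "(x, y) \<in> B \<times> B" for x y
        using that norm_triangle_ineq4[of y x] by (auto simp: B_def)
      show "((1 - t) *\<^sub>R x + t *\<^sub>R y, y) \<in> B \<times> B" if "(x, y) \<in> B \<times> B" "0 \<le> t" "t < 1" for x y t
        using that convexD[OF convex_ball, of x 0 "R + 2" y "1 - t" t] by (auto simp: B_def)
      show "emeasure lborel {y. (x, y) \<in> B \<times> B} \<le> ennreal V" for x
        using eB by (cases "x \<in> B") auto
    qed (use v in auto)
    finally have "(\<integral>x. (g x)\<^sup>2 \<partial>lborel) * v \<le> K * (\<integral>x. (norm (G x))\<^sup>2 \<partial>lborel)"
      using K by (simp add: K_def ennreal_le_iff integral_nonneg_AE)
    thus ?thesis using v by (simp add: field_simps)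
  qed
  have "(\<integral>x. (g x)\<^sup>2 \<partial>lborel) \<le> (K / v + 1) * (\<integral>x. (norm (G x))\<^sup>2 \<partial>lborel)" if gG: "C1z \<Omega> g G" for g G
  proof -
    have "0 \<le> (\<integral>x. (norm (G x))\<^sup>2 \<partial>lborel)" by (simp add: integral_nonneg_AE)
    with main[OF gG] show ?thesis unfolding distrib_right mult_1 by linarith
  qed
  thus ?thesis using that[of "K / v + 1"] K v by (auto simp: add_nonneg_pos)
qed

text \<open>Half-open cubes of side 2^-m, encoded by integer parts: cells are the classes of an
  equivalence relation, so they cover the space without overlap.\<close>

definition cell :: "nat \<Rightarrow> real^'n \<Rightarrow> (real^'n) set" where
  "cell m x = {y. \<forall>i. \<lfloor>2 ^ m * y $ i\<rfloor> = \<lfloor>2 ^ m * x $ i\<rfloor>}"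

definition cell_rel :: "nat \<Rightarrow> ((real^'n) \<times> (real^'n)) set" where
  "cell_rel m = {(x, y). y \<in> cell m x}"

lemma cell_rel_sets[measurable]: "cell_rel m \<in> sets (borel \<Otimes>\<^sub>M borel)"
proof -
  have "cell_rel m = {z \<in> space (borel \<Otimes>\<^sub>M borel). \<forall>i. \<lfloor>2 ^ m * snd z $ i\<rfloor> = \<lfloor>2 ^ m * fst z $ i\<rfloor>}"
    by (auto simp: cell_rel_def cell_def space_pair_measure)
  also have "\<dots> \<in> sets (borel \<Otimes>\<^sub>M borel)"
  proof -
    have [measurable]: "(\<lambda>x::real^'n. x $ i) \<in> borel_measurable borel" for i
      by (intro borel_measurable_continuous_onI continuous_intros)
    show ?thesis by measurable
  qed
  finally show ?thesis .
qed

lemma cell_eq: "y \<in> cell m x \<Longrightarrow> cell m y = cell m x"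
  by (auto simp: cell_def)

text \<open>The grids are nested because the integer part of z is that of 2 z, halved and rounded
  down.\<close>

lemma cell_Suc: "cell (Suc m) x \<subseteq> cell m x"
proof
  fix y assume y: "y \<in> cell (Suc m) x"
  have e: "\<lfloor>2 ^ m * z\<rfloor> = \<lfloor>2 ^ Suc m * z\<rfloor> div 2" for z :: real
  proof -
    have "2 ^ m * z = (2 ^ Suc m * z) / real_of_int 2" by simp
    thus ?thesis using floor_divide_real_eq_div[of 2 "2 ^ Suc m * z"] by simp
  qed
  show "y \<in> cell m x" using y unfolding cell_def mem_Collect_eq e[of "_ $ _"] by simp
qed

lemma cell_sets[measurable]: "cell m x \<in> sets borel"
proof -
  have "cell m x = {y. (x, y) \<in> cell_rel m}" by (auto simp: cell_rel_def)
  also have "\<dots> \<in> sets borel" by measurable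
  finally show ?thesis .
qed

text \<open>The cell lies between an open and a closed cube with the same corners, whose volumes
  agree.\<close>

lemma emeasure_cell: "emeasure lborel (cell m x) = ennreal ((1 / 2 ^ m) ^ CARD('n))"
  for x :: "real^'n"
proof -
  define a :: "real^'n" where "a = (\<chi> i. of_int \<lfloor>2 ^ m * x $ i\<rfloor> / 2 ^ m)"
  define b :: "real^'n" where "b = (\<chi> i. (of_int \<lfloor>2 ^ m * x $ i\<rfloor> + 1) / 2 ^ m)"
  have mem: "y \<in> cell m x \<longleftrightarrow> (\<forall>i. a $ i \<le> y $ i \<and> y $ i < b $ i)" for y
    unfolding cell_def mem_Collect_eq floor_eq_iff
    by (auto simp: a_def b_def field_simps)
  have d: "b $ i - a $ i = 1 / 2 ^ m" for i by (simp add: a_def b_def field_simps)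
  have ab: "a $ i \<le> b $ i" for i using d[of i] by (smt (verit) divide_pos_pos zero_less_power)
  have "a \<in> cbox a b" using ab by (simp add: mem_box_cart)
  hence ne: "cbox a b \<noteq> {}" by blast
  have e: "emeasure lborel (cbox a b) = ennreal ((1 / 2 ^ m) ^ CARD('n))"
    using content_cbox_cart[OF ne] emeasure_eq_ennreal_measure[of lborel "cbox a b"]
      emeasure_lborel_cbox_finite[of a b] by (simp add: d less_top)
  have "emeasure lborel (box a b) \<le> emeasure lborel (cell m x)"
    by (intro emeasure_mono) (auto simp: mem mem_box_cart less_imp_le)
  moreover have "emeasure lborel (cell m x) \<le> emeasure lborel (cbox a b)"
    by (intro emeasure_mono) (auto simp: mem mem_box_cart less_imp_le)
  moreover have "emeasure lborel (box a b) = emeasure lborel (cbox a b)"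
    by (simp add: emeasure_lborel_box_eq emeasure_lborel_cbox_eq)
  ultimately show ?thesis using e by simp
qed

lemma cell_conv: "y \<in> cell m x \<Longrightarrow> 0 \<le> t \<Longrightarrow> t < 1 \<Longrightarrow> (1 - t) *\<^sub>R x + t *\<^sub>R y \<in> cell m x"
  unfolding cell_def mem_Collect_eq
proof
  fix i assume a: "\<forall>i. \<lfloor>2 ^ m * y $ i\<rfloor> = \<lfloor>2 ^ m * x $ i\<rfloor>" "0 \<le> t" "t < 1"
  define k where "k = \<lfloor>2 ^ m * x $ i\<rfloor>"
  define X where "X = 2 ^ m * x $ i"
  define Y where "Y = 2 ^ m * y $ i"
  have X: "of_int k \<le> X" "X < of_int k + 1" "of_int k \<le> Y" "Y < of_int k + 1"
    using a(1) floor_correct[of X] floor_correct[of Y] by (auto simp: X_def Y_def k_def)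
  have "2 ^ m * ((1 - t) *\<^sub>R x + t *\<^sub>R y) $ i = (1 - t) * X + t * Y"
    by (simp add: X_def Y_def algebra_simps)
  moreover have "of_int k \<le> (1 - t) * X + t * Y"
    using convex_bound_le[of "-X" "-of_int k" "-Y" "1 - t" t] X a by simp
  moreover have "(1 - t) * X + t * Y < of_int k + 1"
    using convex_bound_lt[of X "of_int k + 1" Y "1 - t" t] X a by simp
  ultimately show "\<lfloor>2 ^ m * ((1 - t) *\<^sub>R x + t *\<^sub>R y) $ i\<rfloor> = \<lfloor>2 ^ m * x $ i\<rfloor>"
    unfolding k_def[symmetric] by (simp add: floor_eq_iff)
qed

lemma cell_diam: "y \<in> cell m x \<Longrightarrow> norm (y - x) \<le> real CARD('n) / 2 ^ m" for x :: "real^'n"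
proof -
  assume y: "y \<in> cell m x"
  have "\<bar>(y - x) $ i\<bar> \<le> 1 / 2 ^ m" for i
  proof -
    have "\<lfloor>2 ^ m * y $ i\<rfloor> = \<lfloor>2 ^ m * x $ i\<rfloor>" using y by (auto simp: cell_def)
    hence "\<bar>2 ^ m * y $ i - 2 ^ m * x $ i\<bar> \<le> 1" by linarith
    hence "2 ^ m * \<bar>y $ i - x $ i\<bar> \<le> 1" by (simp flip: right_diff_distrib add: abs_mult)
    thus ?thesis by (simp add: field_simps)
  qed
  hence "(\<Sum>i\<in>UNIV. \<bar>(y - x) $ i\<bar>) \<le> (\<Sum>i\<in>(UNIV::'n set). 1 / 2 ^ m)" by (intro sum_mono) auto
  thus ?thesis using norm_le_l1_cart[of "y - x"] by simp
qed

definition cell_avg :: "nat \<Rightarrow> (real^'n \<Rightarrow> real) \<Rightarrow> real^'n \<Rightarrow> real" where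
  "cell_avg m g x = (2 ^ m) ^ CARD('n) * (\<integral>y. indicator (cell m x) y * g y \<partial>lborel)"

text \<open>Jensen's inequality for squares, by the device used for segments: with b the average of
  \<open>h\<close>, integrate 2 b h - b^2 \<le> h^2 over \<open>A\<close>.\<close>

lemma average_square_le:
  assumes A: "A \<in> sets M" "emeasure M A = ennreal (1 / a)" "a > 0"
    and h: "integrable M (\<lambda>y. indicator A y * h y)" "integrable M (\<lambda>y. indicator A y * (h y)\<^sup>2)"
  shows "(a * (\<integral>y. indicator A y * h y \<partial>M))\<^sup>2 \<le> a * (\<integral>y. indicator A y * (h y)\<^sup>2 \<partial>M)"
proof -
  define I where "I = (\<integral>y. indicator A y * h y \<partial>M)"
  have mA: "measure M A = 1 / a" using A by (simp add: measure_def)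
  have iA: "integrable M (indicator A :: _ \<Rightarrow> real)" using A by (simp add: less_top)
  have i: "integrable M (\<lambda>y. 2 * (a * I) * (indicator A y * h y) - (a * I)\<^sup>2 * indicator A y)"
    using h iA by auto
  have "(\<integral>y. 2 * (a * I) * (indicator A y * h y) - (a * I)\<^sup>2 * indicator A y \<partial>M)
     \<le> (\<integral>y. indicator A y * (h y)\<^sup>2 \<partial>M)"
  proof (rule integral_mono[OF i h(2)])
    fix y
    show "2 * (a * I) * (indicator A y * h y) - (a * I)\<^sup>2 * indicator A y \<le> indicator A y * (h y)\<^sup>2"
      using zero_le_power2[of "a * I - h y"] by (auto simp: indicator_def power2_eq_square algebra_simps)
  qed
  also have "(\<integral>y. 2 * (a * I) * (indicator A y * h y) - (a * I)\<^sup>2 * indicator A y \<partial>M) = 2 * (a * I) * I - (a * I)\<^sup>2 * (1 / a)"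
    using h iA A by (simp add: I_def mA)
  also have "\<dots> = a * I\<^sup>2" using A by (simp add: power2_eq_square field_simps)
  finally have "a * (a * I\<^sup>2) \<le> a * (\<integral>y. indicator A y * (h y)\<^sup>2 \<partial>M)" using A by simp
  thus ?thesis by (simp add: I_def power2_eq_square mult_ac)
qed

lemma integrable_indicator_continuous:
  fixes h :: "real^'n \<Rightarrow> real"
  assumes "h \<in> borel_measurable borel" "\<And>x. \<bar>h x\<bar> \<le> M"
  shows "integrable lborel (\<lambda>y. indicator (cell m x) y * h y)"
proof (rule Bochner_Integration.integrable_bound)
  show "integrable lborel (\<lambda>y. M * indicator (cell m x) y)"
    by (simp add: emeasure_cell less_top)
  show "AE y in lborel. norm (indicator (cell m x) y * h y) \<le> norm (M * indicator (cell m x) y)"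
    using assms(2) by (auto simp: indicator_def intro!: AE_I2 order_trans[OF assms(2)])
  show "(\<lambda>y. indicator (cell m x) y * h y) \<in> borel_measurable lborel"
    using assms(1) by measurable
qed

lemma cell_avg_const_on: "y \<in> cell m x \<Longrightarrow> cell_avg m g y = cell_avg m g x"
  by (simp add: cell_avg_def cell_eq)

text \<open>On one cell Jensen bounds the squared error by the average of (g y - g x)^2. The density
  of this average is the inverse volume of a cell, which cancels the volume in the nonlocal
  inequality; what remains is the squared diameter, of order 4^-m.\<close>

lemma cell_avg_error:
  fixes g :: "real^'n \<Rightarrow> real"
  assumes gG: "C1z \<Omega> g G" "bounded \<Omega>"
  shows "(\<integral>\<^sup>+x. ennreal ((g x - cell_avg m g x)\<^sup>2) \<partial>lborel)
    \<le> ennreal (2 ^ CARD('n) * (real CARD('n) / 2 ^ m)\<^sup>2 * (\<integral>x. (norm (G x))\<^sup>2 \<partial>lborel))"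
proof -
  define a where "a = ((2::real) ^ m) ^ CARD('n)"
  have a: "a > 0" "1 / a = (1 / 2 ^ m) ^ CARD('n)" by (auto simp: a_def power_divide)
  have gm[measurable]: "g \<in> borel_measurable borel" by (rule C1zD(6)[OF gG(1)])
  obtain M where M: "\<And>x. \<bar>g x\<bar> \<le> M"
    using bounded_continuous_vanish[OF C1zD(3)[OF gG(1)] C1zD(4)[OF gG(1)] gG(2)] by (metis real_norm_def)
  have pt: "ennreal ((g x - cell_avg m g x)\<^sup>2) \<le> ennreal a * (\<integral>\<^sup>+y. indicator (cell_rel m) (x, y) * ennreal ((g y - g x)\<^sup>2) \<partial>lborel)" for x
  proof -
    define h where "h y = g y - g x" for y
    have hm[measurable]: "h \<in> borel_measurable borel" unfolding h_def by measurable
    have hb: "\<bar>h y\<bar> \<le> 2 * M" for y using M[of x] M[of y] by (auto simp: h_def)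
    have i1: "integrable lborel (\<lambda>y. indicator (cell m x) y * h y)"
      by (rule integrable_indicator_continuous[OF hm hb])
    have i2: "integrable lborel (\<lambda>y. indicator (cell m x) y * (h y)\<^sup>2)"
    proof (rule integrable_indicator_continuous)
      show "\<bar>(h y)\<^sup>2\<bar> \<le> (2 * M)\<^sup>2" for y using power_mono[OF hb[of y], of 2] by simp
    qed measurable
    have iA: "integrable lborel (\<lambda>y. indicator (cell m x) y * g x)"
      by (rule integrable_indicator_continuous) auto
    have ig: "integrable lborel (\<lambda>y. indicator (cell m x) y * g y)"
      by (rule integrable_indicator_continuous[OF gm M])
    have "(\<integral>y. indicator (cell m x) y * h y \<partial>lborel) = (\<integral>y. indicator (cell m x) y * g y \<partial>lborel) - (\<integral>y. indicator (cell m x) y * g x \<partial>lborel)"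
      by (subst Bochner_Integration.integral_diff[symmetric, OF ig iA]) (simp add: h_def algebra_simps)
    also have "(\<integral>y. indicator (cell m x) y * g x \<partial>lborel) = g x / a"
      by (simp add: measure_def emeasure_cell a(2)[symmetric] a_def)
    finally have "a * (\<integral>y. indicator (cell m x) y * h y \<partial>lborel) = cell_avg m g x - g x"
      using a by (simp add: cell_avg_def a_def right_diff_distrib)
    hence "(g x - cell_avg m g x)\<^sup>2 = (a * (\<integral>y. indicator (cell m x) y * h y \<partial>lborel))\<^sup>2"
      by (simp add: power2_commute)
    also have "\<dots> \<le> a * (\<integral>y. indicator (cell m x) y * (h y)\<^sup>2 \<partial>lborel)"
      by (rule average_square_le[OF _ _ _ i1 i2]) (use a in \<open>auto simp: emeasure_cell\<close>)
    finally have "ennreal ((g x - cell_avg m g x)\<^sup>2) \<le> ennreal a * ennreal (\<integral>y. indicator (cell m x) y * (h y)\<^sup>2 \<partial>lborel)"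
      using a by (subst ennreal_mult[symmetric]) (auto intro!: ennreal_leI)
    also have "ennreal (\<integral>y. indicator (cell m x) y * (h y)\<^sup>2 \<partial>lborel) = (\<integral>\<^sup>+y. ennreal (indicator (cell m x) y * (h y)\<^sup>2) \<partial>lborel)"
      by (rule nn_integral_eq_integral[symmetric, OF i2]) auto
    also have "\<dots> = (\<integral>\<^sup>+y. indicator (cell_rel m) (x, y) * ennreal ((g y - g x)\<^sup>2) \<partial>lborel)"
      by (intro nn_integral_cong) (auto simp: cell_rel_def h_def indicator_def)
    finally show ?thesis .
  qed
  have "(\<integral>\<^sup>+x. ennreal ((g x - cell_avg m g x)\<^sup>2) \<partial>lborel)
    \<le> (\<integral>\<^sup>+x. ennreal a * (\<integral>\<^sup>+y. indicator (cell_rel m) (x, y) * ennreal ((g y - g x)\<^sup>2) \<partial>lborel) \<partial>lborel)"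
    by (intro nn_integral_mono pt)
  also have "\<dots> = ennreal a * (\<integral>\<^sup>+x. \<integral>\<^sup>+y. indicator (cell_rel m) (x, y) * ennreal ((g y - g x)\<^sup>2) \<partial>lborel \<partial>lborel)"
    by (rule nn_integral_cmult) measurable
  also have "\<dots> \<le> ennreal a * ennreal (2 ^ CARD('n) * (real CARD('n) / 2 ^ m)\<^sup>2 * (1 / a) * (\<integral>x. (norm (G x))\<^sup>2 \<partial>lborel))"
  proof (intro mult_left_mono nonlocal_poincare_uniform[OF gG])
    show "((1 - t) *\<^sub>R x + t *\<^sub>R y, y) \<in> cell_rel m" if "(x, y) \<in> cell_rel m" "0 \<le> t" "t < 1" for x y t
    proof -
      have "y \<in> cell m x" using that by (simp add: cell_rel_def)
      moreover from cell_conv[OF this that(2,3)] have "cell m ((1 - t) *\<^sub>R x + t *\<^sub>R y) = cell m x"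
        by (rule cell_eq)
      ultimately show ?thesis by (simp add: cell_rel_def)
    qed
    show "emeasure lborel {y. (x, y) \<in> cell_rel m} \<le> ennreal (1 / a)" for x :: "real^'n"
      by (simp add: cell_rel_def emeasure_cell a)
    show "norm (y - x) \<le> real CARD('n) / 2 ^ m" if "(x, y) \<in> cell_rel m" for x y :: "real^'n"
      using that by (auto simp: cell_rel_def intro: cell_diam)
    show "(y, x) \<in> cell_rel m" if "(x, y) \<in> cell_rel m" for x y
      using that by (auto simp: cell_rel_def cell_def)
  qed (use a in auto)
  also have "\<dots> = ennreal (2 ^ CARD('n) * (real CARD('n) / 2 ^ m)\<^sup>2 * (\<integral>x. (norm (G x))\<^sup>2 \<partial>lborel))"
    using a(1) by (subst ennreal_mult[symmetric]) (auto simp: integral_nonneg_AE)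
  finally show ?thesis .
qed

text \<open>Cells of level 0 have volume 1, so Jensen's inequality carries no factor.\<close>

lemma cell_avg_0_le:
  assumes gG: "C1z \<Omega> g G" "bounded \<Omega>"
  shows "(cell_avg 0 g x)\<^sup>2 \<le> (\<integral>x. (g x)\<^sup>2 \<partial>lborel)"
proof -
  have [measurable]: "g \<in> borel_measurable borel" by (rule C1zD(6)[OF gG(1)])
  have i: "integrable lborel (\<lambda>y. indicator (cell 0 x) y * g y)"
    using integrable_mult_indicator[OF _ C1z_integrable(1)[OF gG], of "cell 0 x"] by simp
  have i2: "integrable lborel (\<lambda>y. indicator (cell 0 x) y * (g y)\<^sup>2)"
    using integrable_mult_indicator[OF _ C1z_integrable(2)[OF gG], of "cell 0 x"] by simp
  have "(1 * (\<integral>y. indicator (cell 0 x) y * g y \<partial>lborel))\<^sup>2 \<le> 1 * (\<integral>y. indicator (cell 0 x) y * (g y)\<^sup>2 \<partial>lborel)"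
    by (rule average_square_le[OF _ _ _ i i2]) (auto simp: emeasure_cell)
  also have "\<dots> \<le> (\<integral>x. (g x)\<^sup>2 \<partial>lborel)"
    unfolding mult_1 by (intro integral_mono i2 C1z_integrable(2)[OF gG]) (auto simp: indicator_def)
  finally show ?thesis by (simp add: cell_avg_def)
qed

text \<open>Jensen on the fine cell, applied to \<open>g\<close> minus its coarse average. That
  average is constant on the fine cell, so the integral is part of the total error at level
  \<open>m\<close>; the inverse volume of the fine cell is the price.\<close>

lemma cell_avg_step_le:
  fixes g :: "real^'n \<Rightarrow> real"
  assumes gG: "C1z \<Omega> g G" "bounded \<Omega>"
  shows "(cell_avg (Suc m) g x - cell_avg m g x)\<^sup>2
    \<le> (2 ^ Suc m) ^ CARD('n) * (2 ^ CARD('n) * (real CARD('n) / 2 ^ m)\<^sup>2 * (\<integral>x. (norm (G x))\<^sup>2 \<partial>lborel))"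
proof -
  define a where "a = ((2::real) ^ Suc m) ^ CARD('n)"
  have a: "a > 0" "1 / a = (1 / 2 ^ Suc m) ^ CARD('n)" by (auto simp: a_def power_divide)
  have gm[measurable]: "g \<in> borel_measurable borel" by (rule C1zD(6)[OF gG(1)])
  obtain M where M: "\<And>x. \<bar>g x\<bar> \<le> M"
    using bounded_continuous_vanish[OF C1zD(3)[OF gG(1)] C1zD(4)[OF gG(1)] gG(2)] by (metis real_norm_def)
  define c where "c = cell_avg m g x"
  define h where "h y = g y - c" for y
  have hm[measurable]: "h \<in> borel_measurable borel" unfolding h_def by measurable
  have hb: "\<bar>h y\<bar> \<le> M + \<bar>c\<bar>" for y using M[of y] by (auto simp: h_def)
  have i1: "integrable lborel (\<lambda>y. indicator (cell (Suc m) x) y * h y)"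
    by (rule integrable_indicator_continuous[OF hm hb])
  have i2: "integrable lborel (\<lambda>y. indicator (cell (Suc m) x) y * (h y)\<^sup>2)"
  proof (rule integrable_indicator_continuous)
    show "\<bar>(h y)\<^sup>2\<bar> \<le> (M + \<bar>c\<bar>)\<^sup>2" for y using power_mono[OF hb[of y], of 2] by simp
  qed measurable
  have iA: "integrable lborel (\<lambda>y. indicator (cell (Suc m) x) y * c)"
    by (rule integrable_indicator_continuous) auto
  have ig: "integrable lborel (\<lambda>y. indicator (cell (Suc m) x) y * g y)"
    by (rule integrable_indicator_continuous[OF gm M])
  have "(\<integral>y. indicator (cell (Suc m) x) y * h y \<partial>lborel)
      = (\<integral>y. indicator (cell (Suc m) x) y * g y \<partial>lborel) - (\<integral>y. indicator (cell (Suc m) x) y * c \<partial>lborel)"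
    by (subst Bochner_Integration.integral_diff[symmetric, OF ig iA]) (simp add: h_def algebra_simps)
  also have "(\<integral>y. indicator (cell (Suc m) x) y * c \<partial>lborel) = c / a"
  proof -
    have "measure lborel (cell (Suc m) x) = 1 / a"
      using a by (simp add: measure_def emeasure_cell)
    thus ?thesis by simp
  qed
  finally have "a * (\<integral>y. indicator (cell (Suc m) x) y * h y \<partial>lborel) = cell_avg (Suc m) g x - c"
    using a(1) by (simp add: cell_avg_def a_def right_diff_distrib)
  hence "(cell_avg (Suc m) g x - c)\<^sup>2 = (a * (\<integral>y. indicator (cell (Suc m) x) y * h y \<partial>lborel))\<^sup>2"
    by simp
  also have "\<dots> \<le> a * (\<integral>y. indicator (cell (Suc m) x) y * (h y)\<^sup>2 \<partial>lborel)"
    by (rule average_square_le[OF _ _ _ i1 i2]) (use a in \<open>auto simp: emeasure_cell\<close>)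
  finally have le: "(cell_avg (Suc m) g x - c)\<^sup>2 \<le> a * (\<integral>y. indicator (cell (Suc m) x) y * (h y)\<^sup>2 \<partial>lborel)" .
  have "ennreal (\<integral>y. indicator (cell (Suc m) x) y * (h y)\<^sup>2 \<partial>lborel) = (\<integral>\<^sup>+y. ennreal (indicator (cell (Suc m) x) y * (h y)\<^sup>2) \<partial>lborel)"
    by (rule nn_integral_eq_integral[symmetric, OF i2]) auto
  also have "\<dots> \<le> (\<integral>\<^sup>+y. ennreal ((g y - cell_avg m g y)\<^sup>2) \<partial>lborel)"
  proof (intro nn_integral_mono ennreal_leI)
    fix y show "indicator (cell (Suc m) x) y * (h y)\<^sup>2 \<le> (g y - cell_avg m g y)\<^sup>2"
    proof (cases "y \<in> cell (Suc m) x")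
      case True
      hence "y \<in> cell m x" using cell_Suc by blast
      hence "cell_avg m g y = c" unfolding c_def by (rule cell_avg_const_on)
      thus ?thesis by (simp add: h_def indicator_def)
    qed simp
  qed
  also note cell_avg_error[OF gG, of m]
  finally have "(\<integral>y. indicator (cell (Suc m) x) y * (h y)\<^sup>2 \<partial>lborel)
      \<le> 2 ^ CARD('n) * (real CARD('n) / 2 ^ m)\<^sup>2 * (\<integral>x. (norm (G x))\<^sup>2 \<partial>lborel)"
    by (simp add: ennreal_le_iff integral_nonneg_AE)
  from order_trans[OF le mult_left_mono[OF this]] a(1) show ?thesis
    by (simp add: a_def c_def)
qed

text \<open>The increment from level m to m + 1 is of order 2^(m (N - 2) / 2), the Sobolev scaling,
  hence at most of order \<open>(2 powr \<alpha>) ^ m\<close>. As \<alpha> is positive, these bounds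
  form a growing geometric series, in dimensions 1 and 2 as well, and their sum is controlled by the
  last term.\<close>

lemma cell_avg_bound:
  fixes \<Omega> :: "(real^'n) set"
  assumes "bounded \<Omega>" and \<alpha>: "\<alpha> > 0" "real CARD('n) - 2 \<le> 2 * \<alpha>"
  obtains K where "K > 0" "\<And>g G m x. C1z \<Omega> g G \<Longrightarrow>
    \<bar>cell_avg m g x\<bar> \<le> K * (2 powr \<alpha>) ^ m * sqrt (\<integral>x. (norm (G x))\<^sup>2 \<partial>lborel)"
proof -
  obtain C where C: "C > 0" "\<And>g G. C1z \<Omega> g G \<Longrightarrow> (\<integral>x. (g x)\<^sup>2 \<partial>lborel) \<le> C * (\<integral>x. (norm (G x))\<^sup>2 \<partial>lborel)"
    using poincare[OF assms(1)] by blast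
  define N where "N = CARD('n)"
  define c where "c = 2 ^ N * real N"
  define \<beta> where "\<beta> = 2 powr \<alpha>"
  have \<beta>: "\<beta> > 1" using \<alpha> by (simp add: \<beta>_def)
  have c: "c \<ge> 0" by (simp add: c_def)
  \<comment> \<open>Chosen so that an increment \<open>c * \<beta> ^ m\<close> is at most
    \<open>K * \<beta> ^ Suc m - K * \<beta> ^ m\<close>; \<open>sqrt C\<close> covers level
    0.\<close>
  define K where "K = sqrt C + c / (\<beta> - 1)"
  have K: "K > 0" using C c \<beta> by (simp add: K_def add_pos_nonneg)
  have "K * (\<beta> - 1) = sqrt C * (\<beta> - 1) + c" using \<beta> by (simp add: K_def distrib_right)
  hence cK: "c \<le> K * (\<beta> - 1)" using \<beta> C by simp
  have "\<bar>cell_avg m g x\<bar> \<le> K * \<beta> ^ m * sqrt (\<integral>x. (norm (G x))\<^sup>2 \<partial>lborel)"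
    if gG: "C1z \<Omega> g G" for g G m x
  proof -
    define D where "D = (\<integral>x. (norm (G x))\<^sup>2 \<partial>lborel)"
    have D: "D \<ge> 0" by (simp add: D_def integral_nonneg_AE)
    show ?thesis unfolding D_def[symmetric]
    proof (induction m)
      case 0
      have "(cell_avg 0 g x)\<^sup>2 \<le> C * D"
        using cell_avg_0_le[OF gG assms(1), of x] C(2)[OF gG] by (simp add: D_def)
      hence "\<bar>cell_avg 0 g x\<bar> \<le> sqrt C * sqrt D"
        by (metis real_sqrt_abs real_sqrt_le_mono real_sqrt_mult)
      also have "\<dots> \<le> K * sqrt D"
        using c \<beta> D by (intro mult_right_mono) (auto simp: K_def)
      finally show ?case by simp
    next
      case (Suc m)
      have "(2 ^ m) ^ N / (2 ^ m)\<^sup>2 = (2::real) powr (real m * (real N - 2))"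
      proof -
        have "((2::real) ^ m) ^ N = 2 powr (real m * real N)" by (simp add: powr_realpow[symmetric] powr_powr)
        moreover have "((2::real) ^ m)\<^sup>2 = 2 powr (real m * 2)"
          by (simp add: powr_realpow[symmetric] powr_powr flip: powr_numeral)
        ultimately show ?thesis by (simp add: powr_diff[symmetric] right_diff_distrib)
      qed
      also have "\<dots> \<le> 2 powr (real m * (2 * \<alpha>))"
        using \<alpha> by (intro powr_mono mult_left_mono) (auto simp: N_def)
      also have "\<dots> = (\<beta> ^ m)\<^sup>2"
      proof -
        have "\<beta> ^ m = \<beta> powr real m" using \<beta> by (simp add: powr_realpow)
        also have "\<dots> = 2 powr (real m * \<alpha>)" by (simp add: \<beta>_def powr_powr mult.commute)
        finally have "(\<beta> ^ m)\<^sup>2 = 2 powr (real m * \<alpha>) * 2 powr (real m * \<alpha>)" by (simp add: power2_eq_square)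
        thus ?thesis by (simp add: powr_add[symmetric] mult_ac)
      qed
      finally have pw: "(2 ^ m) ^ N / (2 ^ m)\<^sup>2 \<le> (\<beta> ^ m)\<^sup>2" .
      have "(cell_avg (Suc m) g x - cell_avg m g x)\<^sup>2 \<le> (2 ^ Suc m) ^ N * (2 ^ N * (real N / 2 ^ m)\<^sup>2 * D)"
        using cell_avg_step_le[OF gG assms(1), of m x] by (simp add: N_def D_def)
      also have "\<dots> = c\<^sup>2 * D * ((2 ^ m) ^ N / (2 ^ m)\<^sup>2)"
        by (simp add: c_def power_mult_distrib power2_eq_square field_simps)
      also have "\<dots> \<le> c\<^sup>2 * D * (\<beta> ^ m)\<^sup>2"
        using D by (intro mult_left_mono pw) auto
      finally have "(cell_avg (Suc m) g x - cell_avg m g x)\<^sup>2 \<le> (c * \<beta> ^ m * sqrt D)\<^sup>2"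
        using D by (simp add: power_mult_distrib mult_ac)
      hence "\<bar>cell_avg (Suc m) g x - cell_avg m g x\<bar> \<le> c * \<beta> ^ m * sqrt D"
        using c \<beta> D by (subst (asm) abs_le_square_iff[symmetric]) auto
      hence "\<bar>cell_avg (Suc m) g x\<bar> \<le> K * \<beta> ^ m * sqrt D + c * \<beta> ^ m * sqrt D"
        using Suc by linarith
      also have "\<dots> \<le> K * \<beta> ^ m * sqrt D + (K * (\<beta> - 1)) * \<beta> ^ m * sqrt D"
        using cK \<beta> D by (intro add_left_mono mult_right_mono) auto
      also have "\<dots> = K * \<beta> ^ Suc m * sqrt D" by (simp add: algebra_simps)
      finally show ?case .
    qed
  qed
  thus ?thesis using that K by (auto simp: \<beta>_def)
qed

lemma level_set_sets: "C1z \<Omega> g G \<Longrightarrow> {x. 1 \<le> \<bar>g x\<bar>} \<in> sets lborel"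
  by (drule C1zD(6)) measurable

lemma level_set_emeasure:
  assumes gG: "C1z \<Omega> g G" "bounded \<Omega>"
  shows "emeasure lborel {x. 1 \<le> \<bar>g x\<bar>} = ennreal (measure lborel {x. 1 \<le> \<bar>g x\<bar>})"
proof -
  have "bounded {x. 1 \<le> \<bar>g x\<bar>}"
    by (rule bounded_subset[OF gG(2)]) (use C1zD(4)[OF gG(1)] in force)
  from emeasure_bounded_finite[OF this] show ?thesis
    by (intro emeasure_eq_ennreal_measure) auto
qed

text \<open>Comparing \<open>g\<close> with its averages over the cells of the coarsest grid on which these averages
  are still at most \<open>1/2\<close>.\<close>
lemma weak_type_sobolev:
  fixes \<Omega> :: "(real^'n) set"
  assumes "bounded \<Omega>" and \<alpha>: "\<alpha> > 0" "real CARD('n) - 2 \<le> 2 * \<alpha>"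
  obtains C where "C > 0" "\<And>g G. C1z \<Omega> g G \<Longrightarrow>
    measure lborel {x. 1 \<le> \<bar>g x\<bar>} \<le> C * (\<integral>x. (norm (G x))\<^sup>2 \<partial>lborel) powr (1 + 1 / \<alpha>)"
proof -
  obtain P where P: "P > 0" "\<And>g G. C1z \<Omega> g G \<Longrightarrow> (\<integral>x. (g x)\<^sup>2 \<partial>lborel) \<le> P * (\<integral>x. (norm (G x))\<^sup>2 \<partial>lborel)"
    using poincare[OF assms(1)] by blast
  obtain K where K: "K > 0" "\<And>g G m x. C1z \<Omega> g G \<Longrightarrow>
      \<bar>cell_avg m g x\<bar> \<le> K * (2 powr \<alpha>) ^ m * sqrt (\<integral>x. (norm (G x))\<^sup>2 \<partial>lborel)"
    using cell_avg_bound[OF assms] by blast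
  define N where "N = real CARD('n)"
  define \<beta> where "\<beta> = 2 powr \<alpha>"
  have \<beta>: "\<beta> > 1" using \<alpha> by (simp add: \<beta>_def)
  \<comment> \<open>\<open>k\<close> is fixed by (2 K r)^(2 / \<alpha>) = k D^(1 / \<alpha>), where
    r = sqrt D. In \<open>L\<close> the factor 4 is Chebyshev's inequality at height 1/2.\<close>
  define k where "k = (2 * K) powr (2 / \<alpha>)"
  have k: "k > 0" using K by (simp add: k_def)
  define L where "L = 4 * (2 ^ CARD('n) * N\<^sup>2)"
  have L: "L \<ge> 0" by (simp add: L_def)
  define C where "C = (P + 4 * L) * k"
  have "measure lborel {x. 1 \<le> \<bar>g x\<bar>} \<le> C * (\<integral>x. (norm (G x))\<^sup>2 \<partial>lborel) powr (1 + 1 / \<alpha>)"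
    if gG: "C1z \<Omega> g G" for g G
  proof -
    define D where "D = (\<integral>x. (norm (G x))\<^sup>2 \<partial>lborel)"
    have D: "D \<ge> 0" by (simp add: D_def integral_nonneg_AE)
    define A where "A = {x. 1 \<le> \<bar>g x\<bar>}"
    have sA[measurable]: "A \<in> sets lborel" unfolding A_def by (rule level_set_sets[OF gG])
    have eA: "emeasure lborel A = ennreal (measure lborel A)"
      unfolding A_def by (rule level_set_emeasure[OF gG assms(1)])
    have "ennreal (measure lborel A) = (\<integral>\<^sup>+x. indicator A x \<partial>lborel)"
      by (simp only: nn_integral_indicator[OF sA] eA)
    also have "\<dots> \<le> (\<integral>\<^sup>+x. ennreal ((g x)\<^sup>2) \<partial>lborel)"
    proof (rule nn_integral_mono)
      fix x show "indicator A x \<le> ennreal ((g x)\<^sup>2)"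
        using one_le_power[of "\<bar>g x\<bar>" 2] by (auto simp: indicator_def A_def simp flip: ennreal_1)
    qed
    also have "\<dots> = ennreal (\<integral>x. (g x)\<^sup>2 \<partial>lborel)"
      by (rule nn_integral_eq_integral[OF C1z_integrable(2)[OF gG assms(1)]]) auto
    finally have "measure lborel A \<le> (\<integral>x. (g x)\<^sup>2 \<partial>lborel)"
      by (simp add: ennreal_le_iff integral_nonneg_AE)
    also have "\<dots> \<le> P * D" using P(2)[OF gG] by (simp add: D_def)
    finally have m1: "measure lborel A \<le> P * D" .
    define r where "r = sqrt D"
    have kr: "(2 * K * r) powr (2 / \<alpha>) = k * D powr (1 / \<alpha>)"
      using K D by (simp add: k_def r_def powr_mult powr_half_sqrt[symmetric] powr_powr)
    have CD: "C * D powr (1 + 1 / \<alpha>) = P * D * (k * D powr (1 / \<alpha>)) + 4 * L * D * (k * D powr (1 / \<alpha>))"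
      using D by (simp add: C_def powr_add algebra_simps)
    show ?thesis unfolding D_def[symmetric] A_def[symmetric]
    proof (cases "2 * K * r > 1")
      \<comment> \<open>The bound for the averages exceeds 1/2 already on the coarsest grid. Then
        \<open>D\<close> is bounded below, the extra power of \<open>D\<close> costs only a
        constant, and Chebyshev with Poincare suffices.\<close>
      case True
      hence "1 \<le> k * D powr (1 / \<alpha>)" unfolding kr[symmetric] using \<alpha> by (intro ge_one_powr_ge_zero) auto
      hence "P * D * 1 \<le> P * D * (k * D powr (1 / \<alpha>))" using P D by (intro mult_left_mono) auto
      moreover have "0 \<le> 4 * L * D * (k * D powr (1 / \<alpha>))" using L D k by simp
      ultimately show "measure lborel A \<le> C * D powr (1 + 1 / \<alpha>)" using m1 CD by linarith
    next
      case False
      show "measure lborel A \<le> C * D powr (1 + 1 / \<alpha>)"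
      proof (cases "D = 0")
        case True thus ?thesis using m1 by simp
      next
        case False
        hence r: "r > 0" using D by (simp add: r_def)
        obtain n where n: "1 / (2 * K * r) < \<beta> ^ n" using real_arch_pow[OF \<beta>] by blast
        \<comment> \<open>The first level at which the bound for the averages exceeds 1/2. One level
          below, at \<open>m\<close>, the averages are at most 1/2, so |g| \<ge> 1 forces an error
          of at least 1/2; the excess at \<open>l\<close> bounds 2^-m by a power of
          \<open>D\<close>.\<close>
        define l where "l = (LEAST n. 1 / (2 * K * r) < \<beta> ^ n)"
        have l: "1 / (2 * K * r) < \<beta> ^ l" unfolding l_def by (rule LeastI[where P="\<lambda>n. 1 / (2 * K * r) < \<beta> ^ n", OF n])
        have "l \<noteq> 0" using l \<open>\<not> 2 * K * r > 1\<close> K r by (intro notI) (simp add: field_simps)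
        then obtain m where m: "l = Suc m" by (cases l) auto
        have "\<not> 1 / (2 * K * r) < \<beta> ^ m" using not_less_Least[of m "\<lambda>n. 1 / (2 * K * r) < \<beta> ^ n"] m unfolding l_def by simp
        hence half: "K * \<beta> ^ m * r \<le> 1 / 2" using K r by (simp add: field_simps)
        have "ennreal (measure lborel A * (1 / 4)) = (\<integral>\<^sup>+x. indicator A x * ennreal (1 / 4) \<partial>lborel)"
          using sA by (simp add: nn_integral_multc eA ennreal_mult'[symmetric])
        also have "\<dots> \<le> (\<integral>\<^sup>+x. ennreal ((g x - cell_avg m g x)\<^sup>2) \<partial>lborel)"
        proof (rule nn_integral_mono)
          fix x show "indicator A x * ennreal (1 / 4) \<le> ennreal ((g x - cell_avg m g x)\<^sup>2)"
          proof (cases "x \<in> A")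
            case True
            have "\<bar>cell_avg m g x\<bar> \<le> 1 / 2"
              using K(2)[OF gG, of m x] half by (simp add: \<beta>_def r_def D_def)
            moreover have "1 \<le> \<bar>g x\<bar>" using True by (simp add: A_def)
            ultimately have "\<bar>g x - cell_avg m g x\<bar> \<ge> 1 / 2" by linarith
            hence "(1 / 2)\<^sup>2 \<le> (g x - cell_avg m g x)\<^sup>2" by (metis abs_le_square_iff abs_of_nonneg zero_le_divide_1_iff zero_le_numeral)
            thus ?thesis using True by (auto intro!: ennreal_leI simp: power2_eq_square)
          qed simp
        qed
        also note cell_avg_error[OF gG assms(1), of m]
        finally have "measure lborel A * (1 / 4) \<le> 2 ^ CARD('n) * (N / 2 ^ m)\<^sup>2 * D"
          using D by (simp add: ennreal_le_iff D_def N_def)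
        hence mA: "measure lborel A \<le> L * D * (1 / 2 ^ m)\<^sup>2"
          by (simp add: L_def power_divide field_simps)
        have "1 / 2 ^ m \<le> 2 * (2 * K * r) powr (1 / \<alpha>)"
        proof -
          have "\<beta> ^ l = 2 powr (\<alpha> * real l)" using \<beta> by (simp add: powr_realpow[symmetric] \<beta>_def powr_powr)
          hence "(1 / (2 * K * r)) powr (1 / \<alpha>) \<le> (2 powr (\<alpha> * real l)) powr (1 / \<alpha>)"
            using l \<alpha> K r by (intro powr_mono2) auto
          also have "\<dots> = 2 * 2 ^ m" using \<alpha> by (simp add: powr_powr m powr_realpow powr_add)
          finally have "1 / (2 * K * r) powr (1 / \<alpha>) \<le> 2 * 2 ^ m" using K r by (simp add: powr_divide)
          thus ?thesis using K r by (simp add: field_simps)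
        qed
        hence "(1 / 2 ^ m)\<^sup>2 \<le> (2 * (2 * K * r) powr (1 / \<alpha>))\<^sup>2" by (intro power_mono) auto
        also have "\<dots> = 4 * (k * D powr (1 / \<alpha>))"
          unfolding kr[symmetric] using K r by (simp add: power_mult_distrib power2_eq_square powr_add[symmetric])
        finally have "measure lborel A \<le> L * D * (4 * (k * D powr (1 / \<alpha>)))"
          using mA L D by (meson mult_left_mono mult_nonneg_nonneg order_trans)
        moreover have "0 \<le> P * D * (k * D powr (1 / \<alpha>))" using P D k by simp
        ultimately show ?thesis using CD by linarith
      qed
    qed
  qed
  moreover have "C > 0" unfolding C_def using P L k by (intro mult_pos_pos add_pos_nonneg) auto
  ultimately show ?thesis using that by blast
qed

section \<open>The Sobolev inequality\<close>

text \<open>The smooth truncation \<open>T t = 2 t\<^sup>2 / (1 + t\<^sup>2)\<close>: the squares of \<open>T'\<close> at the scales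
  \<open>2\<^sup>-\<^sup>j t\<close> are summable because they are dominated by a telescoping sum.\<close>
lemma truncation_square_sum:
  fixes t :: real
  shows "(\<Sum>j<J. (4 * (t / 2 ^ j) / (1 + (t / 2 ^ j)\<^sup>2)\<^sup>2)\<^sup>2) \<le> 22"
proof -
  define \<phi> where "\<phi> z = z\<^sup>2 / (1 + z\<^sup>2)" for z :: real
  have \<phi>: "0 \<le> \<phi> z" "\<phi> z \<le> 1" for z
  proof -
    have "1 + z\<^sup>2 > 0" by (simp add: add_pos_nonneg)
    thus "0 \<le> \<phi> z" "\<phi> z \<le> 1" by (auto simp: \<phi>_def)
  qed
  \<comment> \<open>The right side telescopes under halving of \<open>z\<close>. With w = z^2 both
    sides are rational in \<open>w\<close>, and the comparison comes down to (1 + w) (4 + w) \<le> 4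
    (1 + w)^4. The 22 of the claim is 64/3 rounded up.\<close>
  have step: "(4 * z / (1 + z\<^sup>2)\<^sup>2)\<^sup>2 \<le> 64 / 3 * (\<phi> z - \<phi> (z / 2))" for z
  proof -
    define w where "w = z\<^sup>2"
    have w: "w \<ge> 0" by (simp add: w_def)
    have "\<phi> z - \<phi> (z / 2) = w / (1 + w) - w / (4 + w)"
      by (simp add: \<phi>_def w_def power_divide divide_simps add_nonneg_eq_0_iff)
    also have "\<dots> = 3 * w / ((1 + w) * (4 + w))" using w by (simp add: divide_simps) (simp add: algebra_simps)
    finally have e: "64 / 3 * (\<phi> z - \<phi> (z / 2)) = 64 * w / ((1 + w) * (4 + w))" by simp
    have "(4 * z / (1 + z\<^sup>2)\<^sup>2)\<^sup>2 = 16 * w / (1 + w) ^ 4"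
      by (simp add: w_def power_divide power_mult_distrib)
    also have "\<dots> = 64 * w / (4 * (1 + w) ^ 4)" by simp
    also have "\<dots> \<le> 64 * w / ((1 + w) * (4 + w))"
    proof (intro divide_left_mono)
      have "(1 + w) * (4 + w) \<le> (1 + w) * (4 * (1 + w))" using w by (intro mult_left_mono) auto
      also have "\<dots> = 4 * (1 + w) ^ 2" by (simp add: power2_eq_square)
      also have "\<dots> \<le> 4 * (1 + w) ^ 4" using w by (intro mult_left_mono power_increasing) auto
      finally show "(1 + w) * (4 + w) \<le> 4 * (1 + w) ^ 4" .
    qed (use w in \<open>auto intro!: mult_pos_pos\<close>)
    finally show ?thesis using e by simp
  qed
  have "(\<Sum>j<J. (4 * (t / 2 ^ j) / (1 + (t / 2 ^ j)\<^sup>2)\<^sup>2)\<^sup>2) \<le> (\<Sum>j<J. 64 / 3 * (\<phi> (t / 2 ^ j) - \<phi> (t / 2 ^ Suc j)))"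
    by (intro sum_mono order_trans[OF step]) (simp add: field_simps)
  also have "\<dots> = 64 / 3 * (\<phi> t - \<phi> (t / 2 ^ J))"
    unfolding sum_distrib_left[symmetric] sum_lessThan_telescope'[of "\<lambda>j. \<phi> (t / 2 ^ j)"] by simp
  also have "\<dots> \<le> 22" using \<phi>[of t] \<phi>[of "t / 2 ^ J"] by simp
  finally show ?thesis .
qed

text \<open>A value with |t| \<ge> 1 lies in one layer 2^j \<le> |t| < 2^(j + 1), and smaller values
  are covered by the square because q > 2. A bounded function meets finitely many layers, so a
  finite sum is enough.\<close>

lemma dyadic_layer_bound:
  fixes t :: real
  assumes "\<bar>t\<bar> < 2 ^ J" "q > 2"
  shows "\<bar>t\<bar> powr q \<le> t\<^sup>2 + (\<Sum>j<J. 2 powr (q * (real j + 1)) * indicator {t. 1 \<le> \<bar>t / 2 ^ j\<bar>} t)"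
proof (cases "\<bar>t\<bar> < 1")
  case True
  have "\<bar>t\<bar> powr q \<le> \<bar>t\<bar> powr 2" using True assms by (intro powr_mono') auto
  also have "\<dots> = t\<^sup>2" by simp
  also have "\<dots> \<le> t\<^sup>2 + (\<Sum>j<J. 2 powr (q * (real j + 1)) * indicator {t. 1 \<le> \<bar>t / 2 ^ j\<bar>} t)"
    by (simp add: sum_nonneg)
  finally show ?thesis .
next
  case False
  define l where "l = (LEAST n. \<bar>t\<bar> < 2 ^ n)"
  have l: "\<bar>t\<bar> < 2 ^ l" unfolding l_def by (rule LeastI[where P="\<lambda>n. \<bar>t\<bar> < 2 ^ n", OF assms(1)])
  have lJ: "l \<le> J" unfolding l_def by (rule Least_le[where P="\<lambda>n. \<bar>t\<bar> < 2 ^ n", OF assms(1)])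
  have "l \<noteq> 0" using l False by (intro notI) auto
  then obtain j where j: "l = Suc j" by (cases l) auto
  have "\<not> \<bar>t\<bar> < 2 ^ j" using not_less_Least[of j "\<lambda>n. \<bar>t\<bar> < 2 ^ n"] j unfolding l_def by simp
  hence "1 \<le> \<bar>t / 2 ^ j\<bar>" by (simp add: field_simps)
  have "\<bar>t\<bar> powr q \<le> (2 ^ l) powr q" using l assms by (intro powr_mono2) auto
  also have "(2::real) ^ l = 2 powr (real j + 1)" by (simp add: j powr_add powr_realpow)
  also have "(2 powr (real j + 1)) powr q = 2 powr (q * (real j + 1))" by (simp add: powr_powr mult.commute)
  also have "\<dots> = 2 powr (q * (real j + 1)) * indicator {t. 1 \<le> \<bar>t / 2 ^ j\<bar>} t"
    using \<open>1 \<le> \<bar>t / 2 ^ j\<bar>\<close> by simp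
  also have "\<dots> \<le> (\<Sum>j<J. 2 powr (q * (real j + 1)) * indicator {t. 1 \<le> \<bar>t / 2 ^ j\<bar>} t)"
    by (rule member_le_sum) (use j lJ in auto)
  also have "\<dots> \<le> t\<^sup>2 + \<dots>" by simp
  finally show ?thesis .
qed

text \<open>Maz'ya's truncation argument: the weak-type estimate for the dyadic truncations of \<open>g\<close>
  adds up to the strong one.\<close>
lemma sobolev_normalized:
  fixes \<Omega> :: "(real^'n) set"
  assumes "bounded \<Omega>" and q: "2 < q" and crit: "below_crit CARD('n) q"
  obtains C where "C > 0" "\<And>g G. C1z \<Omega> g G \<Longrightarrow> (\<integral>x. (norm (G x))\<^sup>2 \<partial>lborel) = 1 \<Longrightarrow>
    (\<integral>x. \<bar>g x\<bar> powr q \<partial>lborel) \<le> C"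
proof -
  \<comment> \<open>This exponent turns the weak-type power 1 + 1/\<alpha> into q/2, and for N \<ge>
    3 the condition N - 2 \<le> 2 \<alpha> is q \<le> 2 N / (N - 2).\<close>
  define \<alpha> where "\<alpha> = 2 / (q - 2)"
  have \<alpha>: "\<alpha> > 0" "1 + 1 / \<alpha> = q / 2" using q by (auto simp: \<alpha>_def field_simps)
  have "real CARD('n) - 2 \<le> 2 * \<alpha>"
  proof (cases "CARD('n) \<ge> 3")
    case True
    hence "real CARD('n) - 2 > 0" by simp
    moreover have "q \<le> 2 * real CARD('n) / (real CARD('n) - 2)" using crit True by (simp add: below_crit_def)
    ultimately have "q * (real CARD('n) - 2) \<le> 2 * real CARD('n)" by (simp add: field_simps)
    thus ?thesis using q by (simp add: \<alpha>_def field_simps)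
  next
    case False
    hence "real CARD('n) \<le> 2" by simp
    thus ?thesis using \<alpha>(1) by linarith
  qed
  then obtain W where W: "W > 0" "\<And>g G. C1z \<Omega> g G \<Longrightarrow>
    measure lborel {x. 1 \<le> \<bar>g x\<bar>} \<le> W * (\<integral>x. (norm (G x))\<^sup>2 \<partial>lborel) powr (q / 2)"
    using weak_type_sobolev[OF assms(1) \<alpha>(1)] unfolding \<alpha>(2) by blast
  obtain P where P: "P > 0" "\<And>g G. C1z \<Omega> g G \<Longrightarrow> (\<integral>x. (g x)\<^sup>2 \<partial>lborel) \<le> P * (\<integral>x. (norm (G x))\<^sup>2 \<partial>lborel)"
    using poincare[OF assms(1)] by blast
  define C where "C = P + 2 powr q * W * (22 powr (q / 2 - 1) * 22)"
  have "(\<integral>x. \<bar>g x\<bar> powr q \<partial>lborel) \<le> C" if gG: "C1z \<Omega> g G" and D: "(\<integral>x. (norm (G x))\<^sup>2 \<partial>lborel) = 1" for g G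
  proof -
    have [measurable]: "g \<in> borel_measurable borel" "G \<in> borel_measurable borel"
      by (rule C1zD[OF gG])+
    obtain M where M: "\<And>x. \<bar>g x\<bar> \<le> M"
      using bounded_continuous_vanish[OF C1zD(3)[OF gG] C1zD(4)[OF gG] assms(1)] by (metis real_norm_def)
    obtain J where "M < 2 ^ J" using real_arch_pow[of 2 M] by auto
    hence J: "\<bar>g x\<bar> < 2 ^ J" for x using M[of x] by linarith
    \<comment> \<open>\<open>T\<close> reaches 1 where |t| does and saturates at 2: the level set of
      \<open>g\<close> at height 2^j is one of the truncation at scale \<open>j\<close>, whose
      gradient is concentrated on values of \<open>g\<close> of size about 2^j.\<close>
    define T where "T t = 2 * t\<^sup>2 / (1 + t\<^sup>2)" for t :: real
    define T' where "T' t = 4 * t / (1 + t\<^sup>2)\<^sup>2" for t :: real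
    have pos: "1 + t\<^sup>2 \<noteq> 0" for t :: real by (metis add_nonneg_eq_0_iff zero_le_one zero_le_power2 zero_neq_one)
    have T: "(T has_real_derivative T' t) (at t)" for t
      unfolding T_def T'_def using pos[of t]
      by (auto intro!: derivative_eq_intros simp: divide_simps) (simp add: power2_eq_square algebra_simps)
    have contT': "continuous_on UNIV T'" unfolding T'_def using pos by (intro continuous_intros) auto
    define u where "u j x = T ((1 / 2 ^ j) * g x)" for j :: nat and x
    define U where "U j x = T' ((1 / 2 ^ j) * g x) *\<^sub>R ((1 / 2 ^ j) *\<^sub>R G x)" for j :: nat and x
    have uU: "C1z \<Omega> (u j) (U j)" for j unfolding u_def U_def
      by (rule C1z_compose[OF C1z_scale[OF gG] T contT']) (simp add: T_def)
    define E where "E j x = (T' (g x / 2 ^ j))\<^sup>2 * (norm (G x))\<^sup>2" for j :: nat and x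
    define a where "a j = (\<integral>x. E j x \<partial>lborel)" for j
    have a0: "a j \<ge> 0" for j unfolding a_def by (intro integral_nonneg_AE) (auto simp: E_def)
    have nU: "(norm (U j x))\<^sup>2 = E j x / (2 ^ j)\<^sup>2" for j x
      by (simp add: U_def E_def power_mult_distrib power_divide)
    have iE: "integrable lborel (E j)" for j
    proof -
      have "integrable lborel (\<lambda>x. (2 ^ j)\<^sup>2 * (norm (U j x))\<^sup>2)"
        using C1z_integrable(3)[OF uU assms(1)] by (rule integrable_mult_right)
      thus ?thesis by (simp add: nU)
    qed
    have DU: "(\<integral>x. (norm (U j x))\<^sup>2 \<partial>lborel) = a j / (2 ^ j)\<^sup>2" for j
      unfolding nU a_def by simp
    have asum: "(\<Sum>j<J. a j) \<le> 22"
    proof -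
      have "(\<Sum>j<J. a j) = (\<integral>x. (\<Sum>j<J. E j x) \<partial>lborel)"
        unfolding a_def by (rule Bochner_Integration.integral_sum[symmetric]) (rule iE)
      also have "\<dots> \<le> (\<integral>x. 22 * (norm (G x))\<^sup>2 \<partial>lborel)"
      proof (rule integral_mono)
        fix x
        have "(\<Sum>j<J. E j x) = (\<Sum>j<J. (T' (g x / 2 ^ j))\<^sup>2) * (norm (G x))\<^sup>2"
          by (simp add: E_def sum_distrib_right)
        also have "\<dots> \<le> 22 * (norm (G x))\<^sup>2"
          unfolding T'_def by (intro mult_right_mono truncation_square_sum) auto
        finally show "(\<Sum>j<J. E j x) \<le> 22 * (norm (G x))\<^sup>2" .
      qed (auto intro!: iE C1z_integrable(3)[OF gG assms(1)])
      finally show ?thesis by (simp add: D)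
    qed
    have ale: "a j \<le> 22" if "j < J" for j
      using asum member_le_sum[of j "{..<J}" a] that a0 by auto
    define A where "A j = {x. 1 \<le> \<bar>g x / 2 ^ j\<bar>}" for j :: nat
    have gj: "C1z \<Omega> (\<lambda>x. (1 / 2 ^ j) * g x) (\<lambda>x. (1 / 2 ^ j) *\<^sub>R G x)" for j :: nat by (rule C1z_scale[OF gG])
    have Aj: "A j = {x. 1 \<le> \<bar>(1 / 2 ^ j) * g x\<bar>}" for j by (simp add: A_def)
    have sA[measurable]: "A j \<in> sets lborel" for j unfolding Aj by (rule level_set_sets[OF gj])
    have eA: "emeasure lborel (A j) = ennreal (measure lborel (A j))" for j
      unfolding Aj by (rule level_set_emeasure[OF gj assms(1)])
    \<comment> \<open>The weight 2^(q j) cancels against the scaling of the gradient of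
      \<open>u j\<close>, so no power of 2^j survives. Since q/2 \<ge> 1 and a j \<le> 22, the power
      of \<open>a j\<close> is traded for a multiple of \<open>a j\<close>, and these have a bounded
      sum.\<close>
    have mA: "2 powr (q * (real j + 1)) * measure lborel (A j) \<le> 2 powr q * W * (22 powr (q / 2 - 1) * a j)" if "j < J" for j
    proof -
      have "A j \<subseteq> {x. 1 \<le> \<bar>u j x\<bar>}"
      proof
        fix x assume "x \<in> A j"
        hence "1 \<le> ((1 / 2 ^ j) * g x)\<^sup>2" unfolding Aj by (metis (mono_tags) mem_Collect_eq one_le_power power2_abs)
        thus "x \<in> {x. 1 \<le> \<bar>u j x\<bar>}" by (simp add: u_def T_def)
      qed
      hence "measure lborel (A j) \<le> measure lborel {x. 1 \<le> \<bar>u j x\<bar>}"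
        using level_set_sets[OF uU[of j]] level_set_emeasure[OF uU[of j] assms(1)]
          sA[of j] by (intro measure_mono_fmeasurable) (auto simp: fmeasurable_def)
      also have "\<dots> \<le> W * (a j / (2 ^ j)\<^sup>2) powr (q / 2)" using W(2)[OF uU[of j]] by (simp add: DU)
      also have "(a j / (2 ^ j)\<^sup>2) powr (q / 2) = a j powr (q / 2) / 2 powr (q * real j)"
      proof -
        have "((2::real) ^ j)\<^sup>2 = 2 powr (2 * real j)" by (simp add: powr_realpow[symmetric] powr_powr power_mult[symmetric] mult.commute)
        thus ?thesis using a0[of j] by (simp add: powr_divide powr_powr mult.commute)
      qed
      finally have "2 powr (q * (real j + 1)) * measure lborel (A j) \<le> 2 powr (q * (real j + 1)) * (W * (a j powr (q / 2) / 2 powr (q * real j)))"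
        by (intro mult_left_mono) auto
      also have "\<dots> = 2 powr q * W * a j powr (q / 2)"
        by (simp add: distrib_left powr_add)
      also have "a j powr (q / 2) \<le> 22 powr (q / 2 - 1) * a j"
      proof (cases "a j = 0")
        case False
        have "a j powr (q / 2) = a j powr (q / 2 - 1) * a j"
          using a0[of j] False by (simp add: powr_diff)
        also have "\<dots> \<le> 22 powr (q / 2 - 1) * a j"
          using ale[OF that] a0[of j] q by (intro mult_right_mono powr_mono2) auto
        finally show ?thesis .
      qed simp
      finally show ?thesis using W(1) by (simp add: mult_left_mono)
    qed
    have icont: "integrable lborel (\<lambda>x. \<bar>g x\<bar> powr q)"
      by (rule integrable_continuous_vanish[OF _ _ assms(1)])
         (use C1zD(4)[OF gG] q in \<open>auto intro!: continuous_intros continuous_on_powr' C1zD(3)[OF gG]\<close>)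
    have iA: "integrable lborel (\<lambda>x. indicator (A j) x :: real)" for j
      by (rule integrable_real_indicator[OF sA]) (simp add: eA)
    have "(\<integral>x. \<bar>g x\<bar> powr q \<partial>lborel) \<le> (\<integral>x. (g x)\<^sup>2 + (\<Sum>j<J. 2 powr (q * (real j + 1)) * indicator (A j) x) \<partial>lborel)"
    proof (rule integral_mono[OF icont])
      fix x
      have "indicator (A j) x = (indicator {t. 1 \<le> \<bar>t / 2 ^ j\<bar>} (g x) :: real)" for j
        by (simp add: A_def indicator_def)
      thus "\<bar>g x\<bar> powr q \<le> (g x)\<^sup>2 + (\<Sum>j<J. 2 powr (q * (real j + 1)) * indicator (A j) x)"
        using dyadic_layer_bound[OF J[of x] q] by simp
    qed (intro Bochner_Integration.integrable_add Bochner_Integration.integrable_sum integrable_mult_right iA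
          C1z_integrable(2)[OF gG assms(1)])
    also have "\<dots> = (\<integral>x. (g x)\<^sup>2 \<partial>lborel) + (\<Sum>j<J. 2 powr (q * (real j + 1)) * measure lborel (A j))"
    proof -
      have i3: "integrable lborel (\<lambda>x. 2 powr (q * (real j + 1)) * indicator (A j) x :: real)" for j
        by (intro integrable_mult_right iA)
      have "(\<integral>x. (\<Sum>j<J. 2 powr (q * (real j + 1)) * indicator (A j) x) \<partial>lborel)
          = (\<Sum>j<J. (\<integral>x. 2 powr (q * (real j + 1)) * indicator (A j) x \<partial>lborel))"
        by (rule Bochner_Integration.integral_sum) (rule i3)
      also have "\<dots> = (\<Sum>j<J. 2 powr (q * (real j + 1)) * measure lborel (A j))"
        by simp
      finally show ?thesis
        by (subst Bochner_Integration.integral_add[OF C1z_integrable(2)[OF gG assms(1)]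
              Bochner_Integration.integrable_sum[OF i3]]) simp
    qed
    also have "\<dots> \<le> P + (\<Sum>j<J. 2 powr q * W * (22 powr (q / 2 - 1) * a j))"
      using P(2)[OF gG] D by (intro add_mono sum_mono mA) auto
    also have "\<dots> = P + 2 powr q * W * (22 powr (q / 2 - 1) * (\<Sum>j<J. a j))"
      by (simp only: sum_distrib_left)
    also have "\<dots> \<le> C" unfolding C_def using asum W by (intro add_left_mono mult_left_mono) auto
    finally show ?thesis .
  qed
  moreover have "C > 0" unfolding C_def using P W by (intro add_pos_nonneg) auto
  ultimately show ?thesis using that by blast
qed

text \<open>Both sides are homogeneous of degree \<open>q\<close>, which reduces the claim to
  normalized functions. If the Dirichlet energy is 0, Poincare gives g = 0 almost
  everywhere.\<close>

lemma sobolev_inequality: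
  fixes \<Omega> :: "(real^'n) set"
  assumes "bounded \<Omega>" and q: "2 < q" and crit: "below_crit CARD('n) q"
  obtains C where "C > 0" "\<And>g G. C1z \<Omega> g G \<Longrightarrow>
    (\<integral>x. \<bar>g x\<bar> powr q \<partial>lborel) \<le> C * (\<integral>x. (norm (G x))\<^sup>2 \<partial>lborel) powr (q / 2)"
proof -
  obtain C where C: "C > 0" "\<And>g G. C1z \<Omega> g G \<Longrightarrow> (\<integral>x. (norm (G x))\<^sup>2 \<partial>lborel) = 1 \<Longrightarrow>
    (\<integral>x. \<bar>g x\<bar> powr q \<partial>lborel) \<le> C"
    using sobolev_normalized[OF assms] by blast
  obtain P where P: "P > 0" "\<And>g G. C1z \<Omega> g G \<Longrightarrow> (\<integral>x. (g x)\<^sup>2 \<partial>lborel) \<le> P * (\<integral>x. (norm (G x))\<^sup>2 \<partial>lborel)"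
    using poincare[OF assms(1)] by blast
  have "(\<integral>x. \<bar>g x\<bar> powr q \<partial>lborel) \<le> C * (\<integral>x. (norm (G x))\<^sup>2 \<partial>lborel) powr (q / 2)" if gG: "C1z \<Omega> g G" for g G
  proof -
    define D where "D = (\<integral>x. (norm (G x))\<^sup>2 \<partial>lborel)"
    have D: "D \<ge> 0" by (simp add: D_def integral_nonneg_AE)
    show ?thesis
    proof (cases "D = 0")
      case True
      have "(\<integral>x. (g x)\<^sup>2 \<partial>lborel) = 0"
        using P(2)[OF gG] True by (simp add: D_def) (metis integral_nonneg_AE AE_I2 antisym zero_le_power2)
      hence "AE x in lborel. (g x)\<^sup>2 = 0"
        by (subst (asm) integral_nonneg_eq_0_iff_AE[OF C1z_integrable(2)[OF gG assms(1)]]) auto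
      hence "(\<integral>x. \<bar>g x\<bar> powr q \<partial>lborel) = (\<integral>x. 0 \<partial>(lborel :: (real^'n) measure))"
        using C1zD(6)[OF gG] by (intro integral_cong_AE) auto
      thus ?thesis using C D by (simp add: D_def[symmetric])
    next
      case False
      define r where "r = sqrt D"
      have r: "r > 0" using False D by (simp add: r_def)
      have "(\<integral>x. (norm ((1 / r) *\<^sub>R G x))\<^sup>2 \<partial>lborel) = 1"
        using r D by (simp add: power_mult_distrib power_divide D_def[symmetric] r_def)
      from C(2)[OF C1z_scale[OF gG] this]
      have "(\<integral>x. \<bar>(1 / r) * g x\<bar> powr q \<partial>lborel) \<le> C" .
      also have "(\<lambda>x. \<bar>(1 / r) * g x\<bar> powr q) = (\<lambda>x. (1 / r) powr q * \<bar>g x\<bar> powr q)"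
        using r by (auto simp: abs_mult powr_mult powr_divide)
      finally have "(\<integral>x. \<bar>g x\<bar> powr q \<partial>lborel) \<le> C * r powr q"
        using r by (simp add: powr_divide field_simps)
      also have "r powr q = D powr (q / 2)" using D by (simp add: r_def powr_half_sqrt[symmetric] powr_powr)
      finally show ?thesis by (simp add: D_def)
    qed
  qed
  with C(1) that show ?thesis by blast
qed

section \<open>Compactness in the mean square\<close>

lemma cell_avg_measurable:
  assumes [measurable]: "g \<in> borel_measurable borel"
  shows "cell_avg m g \<in> borel_measurable borel"
proof -
  have "(\<lambda>x. \<integral>y. indicator (cell_rel m) (x, y) * g y \<partial>lborel) \<in> borel_measurable borel"
    by measurable
  moreover have "(\<lambda>x. \<integral>y. indicator (cell_rel m) (x, y) * g y \<partial>lborel) = (\<lambda>x. \<integral>y. indicator (cell m x) y * g y \<partial>lborel)"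
    by (simp add: cell_rel_def indicator_def)
  ultimately have [measurable]: "(\<lambda>x. \<integral>y. indicator (cell m x) y * g y \<partial>lborel) \<in> borel_measurable borel"
    by simp
  show ?thesis unfolding cell_avg_def[abs_def] by measurable
qed

lemma cell_avg_diff:
  assumes gG: "C1z \<Omega> g G" and hH: "C1z \<Omega> h H" and "bounded \<Omega>"
  shows "cell_avg m (\<lambda>x. g x - h x) x = cell_avg m g x - cell_avg m h x"
proof -
  have "integrable lborel (\<lambda>y. indicator (cell m x) y * g y)"
    using integrable_mult_indicator[OF _ C1z_integrable(1)[OF gG assms(3)], of "cell m x"] by simp
  moreover have "integrable lborel (\<lambda>y. indicator (cell m x) y * h y)"
    using integrable_mult_indicator[OF _ C1z_integrable(1)[OF hH assms(3)], of "cell m x"] by simp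
  ultimately show ?thesis
    by (simp add: cell_avg_def right_diff_distrib)
qed

lemma norm_diff_square_le:
  fixes a b :: "'a::real_inner"
  shows "(norm (a - b))\<^sup>2 \<le> 2 * (norm a)\<^sup>2 + 2 * (norm b)\<^sup>2"
proof -
  have "(norm (a - b))\<^sup>2 + (norm (a + b))\<^sup>2 = 2 * (norm a)\<^sup>2 + 2 * (norm b)\<^sup>2"
    by (simp add: power2_norm_eq_inner inner_add inner_diff inner_commute)
  thus ?thesis using zero_le_power2[of "norm (a + b)"] by linarith
qed

text \<open>At a fixed level all averages of the sequence are bounded, and there are countably many
  cells over all levels, so a diagonal subsequence makes every average converge. Dominated
  convergence makes the averaged functions converge in mean square on \<Omega>, and averaging at
  level m changes a function by an amount of order 2^-m, uniformly along the sequence.\<close>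

lemma rellich:
  fixes \<Omega> :: "(real^'n) set"
  assumes bd: "bounded \<Omega>" and \<Omega>[measurable]: "\<Omega> \<in> sets borel"
    and gG: "\<And>n. C1z \<Omega> (g n) (G n)" and B: "\<And>n. (\<integral>x. (norm (G n x))\<^sup>2 \<partial>lborel) \<le> B"
  obtains r where "strict_mono (r :: nat \<Rightarrow> nat)"
    "\<And>e. e > 0 \<Longrightarrow> \<exists>n0. \<forall>k\<ge>n0. \<forall>l\<ge>n0. (\<integral>x. (g (r k) x - g (r l) x)\<^sup>2 \<partial>lborel) < e"
proof -
  have B0: "B \<ge> 0" using order_trans[OF _ B[of 0], of 0] by (simp add: integral_nonneg_AE)
  \<comment> \<open>Only finiteness of the bound at each level matters here, so a generous exponent
    is taken.\<close>
  define \<alpha> where "\<alpha> = real CARD('n)"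
  have \<alpha>: "\<alpha> > 0" "real CARD('n) - 2 \<le> 2 * \<alpha>" by (auto simp: \<alpha>_def)
  obtain K where K: "K > 0" "\<And>g G m x. C1z \<Omega> g G \<Longrightarrow>
      \<bar>cell_avg m g x\<bar> \<le> K * (2 powr \<alpha>) ^ m * sqrt (\<integral>x. (norm (G x))\<^sup>2 \<partial>lborel)"
    using cell_avg_bound[OF bd \<alpha>] by blast
  define b where "b m = K * (2 powr \<alpha>) ^ m * sqrt B" for m
  have b0: "b m \<ge> 0" for m using K B0 by (simp add: b_def)
  have avg: "\<bar>cell_avg m (g n) x\<bar> \<le> b m" for m n x
  proof -
    have "K * (2 powr \<alpha>) ^ m * sqrt (\<integral>x. (norm (G n x))\<^sup>2 \<partial>lborel) \<le> b m"
      unfolding b_def using K(1) by (intro mult_left_mono real_sqrt_le_mono B) auto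
    thus ?thesis using K(2)[OF gG, of m n x] by linarith
  qed
  define idx where "idx m x = (\<chi> i. \<lfloor>2 ^ m * x $ i\<rfloor>)" for m :: nat and x :: "real^'n"
  \<comment> \<open>The diagonal lemma wants one bound for all indices, so averages are divided by
    their bound at the given level; adding 1 excludes division by 0. Cells are labelled by integer
    vectors to obtain a countable index set.\<close>
  define f :: "nat \<Rightarrow> nat \<times> (int^'n) \<Rightarrow> real" where
    "f n z = (\<integral>y. indicator {y. idx (fst z) y = snd z} y * g n y \<partial>lborel) * (2 ^ fst z) ^ CARD('n) / (b (fst z) + 1)" for n z
  have idx_cell: "{y. idx m y = idx m x} = cell m x" for m x
    by (auto simp: idx_def cell_def vec_eq_iff)
  have f_avg: "f n (m, idx m x) = cell_avg m (g n) x / (b m + 1)" for n m x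
    by (simp add: f_def idx_cell cell_avg_def mult.commute)
  define S where "S = (\<Union>m. (\<lambda>x. (m, idx m x)) ` UNIV)"
  have "countable S" by (rule countable_subset[of _ UNIV]) auto
  moreover have "norm (f n z) \<le> 1" if "z \<in> S" for n z
  proof -
    obtain m x where z: "z = (m, idx m x)" using \<open>z \<in> S\<close> by (auto simp: S_def)
    have "\<bar>cell_avg m (g n) x\<bar> \<le> b m + 1" using avg[of m n x] by simp
    thus ?thesis using b0[of m] by (simp add: z f_avg abs_divide)
  qed
  ultimately obtain r where r: "strict_mono r" "\<And>z. z \<in> S \<Longrightarrow> \<exists>l. (\<lambda>n. f (r n) z) \<longlonglongrightarrow> l"
    using function_convergent_subsequence[of S f 1] by blast
  have "\<exists>l. (\<lambda>n. cell_avg m (g (r n)) x) \<longlonglongrightarrow> l" for m x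
  proof -
    obtain l where "(\<lambda>n. f (r n) (m, idx m x)) \<longlonglongrightarrow> l" using r(2)[of "(m, idx m x)"] by (auto simp: S_def)
    hence "(\<lambda>n. (b m + 1) * f (r n) (m, idx m x)) \<longlonglongrightarrow> (b m + 1) * l" by (intro tendsto_intros)
    moreover have "b m + 1 \<noteq> 0" using b0[of m] by simp
    ultimately show ?thesis by (auto simp: f_avg)
  qed
  then obtain a where a: "\<And>m x. (\<lambda>n. cell_avg m (g (r n)) x) \<longlonglongrightarrow> a m x" by metis
  have ab: "\<bar>a m x\<bar> \<le> b m" for m x
    by (rule LIMSEQ_le_const2[OF tendsto_rabs[OF a]]) (use avg in auto)
  note gm = C1zD(6)[OF gG]
  have am[measurable]: "a m \<in> borel_measurable borel" for m
    by (rule borel_measurable_LIMSEQ_real[OF a cell_avg_measurable[OF gm]])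
  have e\<Omega>: "emeasure lborel \<Omega> < \<infinity>" by (rule emeasure_bounded_finite[OF bd])
  \<comment> \<open>Averages need not vanish outside \<Omega>, hence the indicator; the functions
    themselves vanish there, so nothing is lost when their differences are estimated.\<close>
  have lim: "(\<lambda>n. \<integral>x. indicator \<Omega> x * (cell_avg m (g (r n)) x - a m x)\<^sup>2 \<partial>lborel) \<longlonglongrightarrow> 0" for m
  proof -
    have "(\<lambda>n. \<integral>x. indicator \<Omega> x * (cell_avg m (g (r n)) x - a m x)\<^sup>2 \<partial>lborel)
      \<longlonglongrightarrow> (\<integral>x. indicator \<Omega> x * (a m x - a m x)\<^sup>2 \<partial>(lborel :: (real^'n) measure))"
    proof (rule integral_dominated_convergence[where w="\<lambda>x. indicator \<Omega> x * (2 * b m)\<^sup>2"])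
      show "integrable lborel (\<lambda>x. indicator \<Omega> x * (2 * b m)\<^sup>2)"
        using e\<Omega> by (intro integrable_mult_left integrable_real_indicator) auto
      show "AE x in lborel. (\<lambda>n. indicator \<Omega> x * (cell_avg m (g (r n)) x - a m x)\<^sup>2) \<longlonglongrightarrow> indicator \<Omega> x * (a m x - a m x)\<^sup>2"
        by (intro AE_I2 tendsto_intros a)
      show "AE x in lborel. norm (indicator \<Omega> x * (cell_avg m (g (r n)) x - a m x)\<^sup>2) \<le> indicator \<Omega> x * (2 * b m)\<^sup>2" for n
      proof (intro AE_I2)
        fix x
        have "\<bar>cell_avg m (g (r n)) x - a m x\<bar> \<le> 2 * b m" using avg[of m "r n" x] ab[of m x] by linarith
        hence "(cell_avg m (g (r n)) x - a m x)\<^sup>2 \<le> (2 * b m)\<^sup>2" by (metis abs_ge_zero power2_abs power_mono)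
        thus "norm (indicator \<Omega> x * (cell_avg m (g (r n)) x - a m x)\<^sup>2) \<le> indicator \<Omega> x * (2 * b m)\<^sup>2"
          by (auto simp: indicator_def)
      qed
      have [measurable]: "cell_avg m (g (r n)) \<in> borel_measurable borel" for n by (rule cell_avg_measurable[OF gm])
      show "(\<lambda>x. indicator \<Omega> x * (a m x - a m x)\<^sup>2) \<in> borel_measurable lborel"
        "(\<lambda>x. indicator \<Omega> x * (cell_avg m (g (r n)) x - a m x)\<^sup>2) \<in> borel_measurable lborel" for n
        by measurable
    qed
    thus ?thesis by simp
  qed
  have main: "\<exists>n0. \<forall>k\<ge>n0. \<forall>l\<ge>n0. (\<integral>x. (g (r k) x - g (r l) x)\<^sup>2 \<partial>lborel) < e" if e: "e > 0" for e
  proof -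
    \<comment> \<open>The factor 2 comes from splitting off the averaging error, and 4 B bounds the
      energy of a difference of two members.\<close>
    define c where "c = 2 * (2 ^ CARD('n) * (real CARD('n))\<^sup>2 * (4 * B))"
    have c0: "c \<ge> 0" using B0 by (simp add: c_def)
    obtain m :: nat where m: "2 * c / e < 2 ^ m" using real_arch_pow[of 2 "2 * c / e"] by auto
    have "c / (2 ^ m)\<^sup>2 < e / 2"
    proof -
      have "2 * c < e * 2 ^ m" using m e by (simp add: field_simps)
      also have "\<dots> \<le> e * (2 ^ m)\<^sup>2" using e by (intro mult_left_mono) (auto simp: power2_eq_square)
      finally show ?thesis by (simp add: field_simps)
    qed
    note cm = this
    from LIMSEQ_D[OF lim[of m], of "e / 16"] e obtain n0 where
      n0: "\<And>n. n \<ge> n0 \<Longrightarrow> (\<integral>x. indicator \<Omega> x * (cell_avg m (g (r n)) x - a m x)\<^sup>2 \<partial>lborel) < e / 16"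
      by (auto simp: abs_less_iff)
    show ?thesis
    proof (intro exI[of _ n0] allI impI)
      fix k l assume kl: "n0 \<le> k" "n0 \<le> l"
      define h where "h x = g (r k) x - g (r l) x" for x
      define H where "H x = G (r k) x - G (r l) x" for x
      have hH: "C1z \<Omega> h H" unfolding h_def H_def by (rule C1z_diff[OF gG gG])
      define A where "A n x = indicator \<Omega> x * (cell_avg m (g (r n)) x - a m x)\<^sup>2" for n x
      have [measurable]: "cell_avg m (g (r n)) \<in> borel_measurable borel" for n by (rule cell_avg_measurable[OF gm])
      have [measurable]: "h \<in> borel_measurable borel" by (rule C1zD(6)[OF hH])
      have [measurable]: "cell_avg m h \<in> borel_measurable borel" by (rule cell_avg_measurable) measurable
      have Am[measurable]: "A n \<in> borel_measurable borel" for n unfolding A_def by measurable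
      have iA: "integrable lborel (A n)" for n
      proof (rule Bochner_Integration.integrable_bound)
        show "integrable lborel (\<lambda>x. indicator \<Omega> x * (2 * b m)\<^sup>2)"
          using e\<Omega> by (intro integrable_mult_left integrable_real_indicator) auto
        show "AE x in lborel. norm (A n x) \<le> norm (indicator \<Omega> x * (2 * b m)\<^sup>2)"
        proof (intro AE_I2)
          fix x
          have "\<bar>cell_avg m (g (r n)) x - a m x\<bar> \<le> 2 * b m" using avg[of m "r n" x] ab[of m x] by linarith
          hence "(cell_avg m (g (r n)) x - a m x)\<^sup>2 \<le> (2 * b m)\<^sup>2" by (metis abs_ge_zero power2_abs power_mono)
          thus "norm (A n x) \<le> norm (indicator \<Omega> x * (2 * b m)\<^sup>2)" by (auto simp: A_def indicator_def)
        qed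
      qed measurable
      have A0: "A n x \<ge> 0" for n x by (simp add: A_def)
      have "(\<integral>x. (norm (H x))\<^sup>2 \<partial>lborel) \<le> (\<integral>x. 2 * (norm (G (r k) x))\<^sup>2 + 2 * (norm (G (r l) x))\<^sup>2 \<partial>lborel)"
        unfolding H_def
        by (intro integral_mono norm_diff_square_le C1z_integrable(3)[OF hH[unfolded H_def] bd]
              Bochner_Integration.integrable_add integrable_mult_right C1z_integrable(3)[OF gG bd])
      also have "\<dots> \<le> 4 * B"
        using B[of "r k"] B[of "r l"] C1z_integrable(3)[OF gG bd] by simp
      finally have DH: "(\<integral>x. (norm (H x))\<^sup>2 \<partial>lborel) \<le> 4 * B" .
      have pt: "(h x)\<^sup>2 \<le> 2 * (h x - cell_avg m h x)\<^sup>2 + 4 * (A k x + A l x)" for x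
      proof (cases "x \<in> \<Omega>")
        case True
        define p where "p = cell_avg m (g (r k)) x - a m x"
        define s where "s = cell_avg m (g (r l)) x - a m x"
        have e: "cell_avg m h x = p - s"
          unfolding h_def p_def s_def by (subst cell_avg_diff[OF gG gG bd]) simp
        have two: "y\<^sup>2 \<le> 2 * (y - z)\<^sup>2 + 2 * z\<^sup>2" "(y - z)\<^sup>2 \<le> 2 * y\<^sup>2 + 2 * z\<^sup>2" for y z :: real
          using zero_le_power2[of "y - 2 * z"] zero_le_power2[of "y + z"]
          by (simp_all add: power2_eq_square algebra_simps)
        have "(h x)\<^sup>2 \<le> 2 * (h x - (p - s))\<^sup>2 + 4 * (p\<^sup>2 + s\<^sup>2)"
          using two(1)[of "h x" "p - s"] two(2)[of p s] by argo
        thus ?thesis using True by (simp add: e A_def p_def s_def)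
      next
        case False
        thus ?thesis using C1zD(4)[OF hH] A0[of k x] A0[of l x] by simp
      qed
      have "ennreal (\<integral>x. (h x)\<^sup>2 \<partial>lborel) = (\<integral>\<^sup>+x. ennreal ((h x)\<^sup>2) \<partial>lborel)"
        by (rule nn_integral_eq_integral[symmetric, OF C1z_integrable(2)[OF hH bd]]) auto
      also have "\<dots> \<le> (\<integral>\<^sup>+x. 2 * ennreal ((h x - cell_avg m h x)\<^sup>2) + ennreal (4 * (A k x + A l x)) \<partial>lborel)"
      proof (rule nn_integral_mono)
        fix x
        have "ennreal ((h x)\<^sup>2) \<le> ennreal (2 * (h x - cell_avg m h x)\<^sup>2 + 4 * (A k x + A l x))"
          by (rule ennreal_leI[OF pt])
        also have "\<dots> = ennreal (2 * (h x - cell_avg m h x)\<^sup>2) + ennreal (4 * (A k x + A l x))"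
          using A0 by (intro ennreal_plus) auto
        finally show "ennreal ((h x)\<^sup>2) \<le> 2 * ennreal ((h x - cell_avg m h x)\<^sup>2) + ennreal (4 * (A k x + A l x))"
          by (simp add: ennreal_mult)
      qed
      also have "\<dots> = 2 * (\<integral>\<^sup>+x. ennreal ((h x - cell_avg m h x)\<^sup>2) \<partial>lborel) + (\<integral>\<^sup>+x. ennreal (4 * (A k x + A l x)) \<partial>lborel)"
        by (subst nn_integral_add) (auto simp: nn_integral_cmult)
      also have "(\<integral>\<^sup>+x. ennreal (4 * (A k x + A l x)) \<partial>lborel) = ennreal (\<integral>x. 4 * (A k x + A l x) \<partial>lborel)"
        using A0 iA by (intro nn_integral_eq_integral) auto
      also have "(\<integral>x. 4 * (A k x + A l x) \<partial>lborel) = 4 * ((\<integral>x. A k x \<partial>lborel) + (\<integral>x. A l x \<partial>lborel))"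
        using iA by simp
      also have "2 * (\<integral>\<^sup>+x. ennreal ((h x - cell_avg m h x)\<^sup>2) \<partial>lborel)
         \<le> 2 * ennreal (2 ^ CARD('n) * (real CARD('n) / 2 ^ m)\<^sup>2 * (\<integral>x. (norm (H x))\<^sup>2 \<partial>lborel))"
        by (intro mult_left_mono cell_avg_error[OF hH bd]) auto
      also have "\<dots> \<le> 2 * ennreal (2 ^ CARD('n) * (real CARD('n) / 2 ^ m)\<^sup>2 * (4 * B))"
        using DH by (intro mult_left_mono ennreal_leI) auto
      also have "\<dots> = ennreal (c / (2 ^ m)\<^sup>2)"
        using B0 by (simp add: c_def power_divide ennreal_mult[symmetric] flip: ennreal_numeral)
      finally have "ennreal (\<integral>x. (h x)\<^sup>2 \<partial>lborel) \<le> ennreal (c / (2 ^ m)\<^sup>2) + ennreal (4 * ((\<integral>x. A k x \<partial>lborel) + (\<integral>x. A l x \<partial>lborel)))"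
        by (simp add: add_right_mono)
      also have "\<dots> = ennreal (c / (2 ^ m)\<^sup>2 + 4 * ((\<integral>x. A k x \<partial>lborel) + (\<integral>x. A l x \<partial>lborel)))"
        using c0 A0 by (intro ennreal_plus[symmetric]) (auto intro!: add_nonneg_nonneg integral_nonneg_AE)
      finally have "(\<integral>x. (h x)\<^sup>2 \<partial>lborel) \<le> c / (2 ^ m)\<^sup>2 + 4 * ((\<integral>x. A k x \<partial>lborel) + (\<integral>x. A l x \<partial>lborel))"
        using c0 A0 by (subst (asm) ennreal_le_iff) (auto intro!: add_nonneg_nonneg integral_nonneg_AE)
      also have "\<dots> < e" using n0[OF kl(1)] n0[OF kl(2)] cm by (simp add: A_def)
      finally show "(\<integral>x. (g (r k) x - g (r l) x)\<^sup>2 \<partial>lborel) < e" by (simp add: h_def)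
    qed
  qed
  show ?thesis by (rule that[OF r(1) main])
qed

section \<open>Square integrable functions\<close>

text \<open>One notion serves scalar functions and gradient fields. Functions are not identified
  almost everywhere, so \<open>nrm\<close> below is a seminorm and changes on null sets are made
  explicitly.\<close>

definition sq :: "'a measure \<Rightarrow> ('a \<Rightarrow> 'b::euclidean_space) \<Rightarrow> bool" where
  "sq M f \<longleftrightarrow> f \<in> borel_measurable M \<and> integrable M (\<lambda>x. (norm (f x))\<^sup>2)"

definition nrm :: "'a measure \<Rightarrow> ('a \<Rightarrow> 'b::euclidean_space) \<Rightarrow> real" where
  "nrm M f = sqrt (\<integral>x. (norm (f x))\<^sup>2 \<partial>M)"

lemma sqD: "sq M f \<Longrightarrow> f \<in> borel_measurable M" "sq M f \<Longrightarrow> integrable M (\<lambda>x. (norm (f x))\<^sup>2)"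
  by (auto simp: sq_def)

lemma sq_real: "sq M (f :: _ \<Rightarrow> real) \<longleftrightarrow> f \<in> borel_measurable M \<and> integrable M (\<lambda>x. (f x)\<^sup>2)"
  by (simp add: sq_def)

lemma nrm_nonneg: "0 \<le> nrm M f"
  by (simp add: nrm_def integral_nonneg_AE)

lemma nrm_square: "(nrm M f)\<^sup>2 = (\<integral>x. (norm (f x))\<^sup>2 \<partial>M)"
  by (simp add: nrm_def integral_nonneg_AE)

lemma sq_scaleR: "sq M f \<Longrightarrow> sq M (\<lambda>x. c *\<^sub>R f x)"
  by (auto simp: sq_def power_mult_distrib)

lemma nrm_scaleR: "nrm M (\<lambda>x. c *\<^sub>R f x) = \<bar>c\<bar> * nrm M f"
  by (simp add: nrm_def power_mult_distrib real_sqrt_mult)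

lemma sq_inner:
  assumes "sq M f" "sq M g"
  shows "integrable M (\<lambda>x. f x \<bullet> g x)"
proof (rule Bochner_Integration.integrable_bound)
  show "integrable M (\<lambda>x. (norm (f x))\<^sup>2 + (norm (g x))\<^sup>2)" using assms by (auto simp: sq_def)
  show "(\<lambda>x. f x \<bullet> g x) \<in> borel_measurable M" using assms by (auto simp: sq_def)
  show "AE x in M. norm (f x \<bullet> g x) \<le> norm ((norm (f x))\<^sup>2 + (norm (g x))\<^sup>2)"
  proof (intro AE_I2)
    fix x
    have "\<bar>f x \<bullet> g x\<bar> \<le> norm (f x) * norm (g x)" by (rule Cauchy_Schwarz_ineq2)
    also have "\<dots> \<le> (norm (f x))\<^sup>2 + (norm (g x))\<^sup>2"
      using sum_squares_bound[of "norm (f x)" "norm (g x)"]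
        mult_nonneg_nonneg[OF norm_ge_zero[of "f x"] norm_ge_zero[of "g x"]] by linarith
    finally show "norm (f x \<bullet> g x) \<le> norm ((norm (f x))\<^sup>2 + (norm (g x))\<^sup>2)" by simp
  qed
qed

lemma sq_add:
  assumes "sq M f" "sq M g"
  shows "sq M (\<lambda>x. f x + g x)"
proof -
  have "integrable M (\<lambda>x. (norm (f x))\<^sup>2 + 2 * (f x \<bullet> g x) + (norm (g x))\<^sup>2)"
    using assms sq_inner[OF assms] by (auto simp: sq_def)
  moreover have "(\<lambda>x. (norm (f x))\<^sup>2 + 2 * (f x \<bullet> g x) + (norm (g x))\<^sup>2) = (\<lambda>x. (norm (f x + g x))\<^sup>2)"
    by (rule ext) (simp add: power2_norm_eq_inner inner_add inner_commute)
  ultimately show ?thesis using assms by (auto simp: sq_def)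
qed

lemma sq_uminus: "sq M f \<Longrightarrow> sq M (\<lambda>x. - f x)"
  by (auto simp: sq_def)

lemma sq_diff: "sq M f \<Longrightarrow> sq M g \<Longrightarrow> sq M (\<lambda>x. f x - g x)"
  using sq_add[OF _ sq_uminus] by force

lemma nrm_add_square:
  assumes "sq M f" "sq M g"
  shows "(nrm M (\<lambda>x. f x + g x))\<^sup>2 = (nrm M f)\<^sup>2 + 2 * (\<integral>x. f x \<bullet> g x \<partial>M) + (nrm M g)\<^sup>2"
proof -
  have "(\<integral>x. (norm (f x + g x))\<^sup>2 \<partial>M) = (\<integral>x. (norm (f x))\<^sup>2 + 2 * (f x \<bullet> g x) + (norm (g x))\<^sup>2 \<partial>M)"
    by (simp add: power2_norm_eq_inner inner_add inner_commute algebra_simps)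
  also have "\<dots> = (nrm M f)\<^sup>2 + 2 * (\<integral>x. f x \<bullet> g x \<partial>M) + (nrm M g)\<^sup>2"
    using assms sq_inner[OF assms] by (simp add: sq_def nrm_square)
  finally show ?thesis by (simp add: nrm_square)
qed

text \<open>The discriminant of the quadratic polynomial t -> |f + t g|^2, which is nonnegative. For
  a seminorm the leading coefficient may vanish with \<open>g\<close> nonzero; then the polynomial
  is affine, and a nonzero slope would make it negative somewhere.\<close>

lemma nrm_cauchy_schwarz:
  assumes "sq M f" "sq M g"
  shows "\<bar>\<integral>x. f x \<bullet> g x \<partial>M\<bar> \<le> nrm M f * nrm M g"
proof -
  define I where "I = (\<integral>x. f x \<bullet> g x \<partial>M)"
  have q: "0 \<le> (nrm M f)\<^sup>2 + 2 * (t * I) + t\<^sup>2 * (nrm M g)\<^sup>2" for t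
    using nrm_add_square[OF assms(1) sq_scaleR[OF assms(2), of t]] zero_le_power2[of "nrm M (\<lambda>x. f x + t *\<^sub>R g x)"]
    by (simp add: nrm_scaleR power_mult_distrib I_def)
  have "I\<^sup>2 \<le> (nrm M f)\<^sup>2 * (nrm M g)\<^sup>2"
  proof (cases "nrm M g = 0")
    case True
    have "I = 0"
    proof (rule ccontr)
      assume "I \<noteq> 0"
      hence "- ((nrm M f)\<^sup>2 + 1) / (2 * I) * I = - ((nrm M f)\<^sup>2 + 1) / 2" by simp
      with q[of "- ((nrm M f)\<^sup>2 + 1) / (2 * I)"] True show False by (simp add: field_simps)
    qed
    thus ?thesis by simp
  next
    case False
    define G where "G = (nrm M g)\<^sup>2"
    have G: "G > 0" using False by (simp add: G_def)
    have "0 \<le> (nrm M f)\<^sup>2 + 2 * (- I / G * I) + (- I / G)\<^sup>2 * G" using q[of "- I / G"] by (simp add: G_def)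
    also have "\<dots> = (nrm M f)\<^sup>2 - I\<^sup>2 / G" using G by (simp add: power2_eq_square field_simps)
    finally show ?thesis using G by (simp add: field_simps G_def)
  qed
  hence "\<bar>I\<bar> \<le> \<bar>nrm M f * nrm M g\<bar>" by (subst abs_le_square_iff) (simp add: power_mult_distrib)
  thus ?thesis by (simp add: I_def abs_mult nrm_nonneg)
qed

lemma nrm_triangle:
  assumes "sq M f" "sq M g"
  shows "nrm M (\<lambda>x. f x + g x) \<le> nrm M f + nrm M g"
proof (rule power2_le_imp_le)
  have "(\<integral>x. f x \<bullet> g x \<partial>M) \<le> nrm M f * nrm M g"
    using nrm_cauchy_schwarz[OF assms] by simp
  thus "(nrm M (\<lambda>x. f x + g x))\<^sup>2 \<le> (nrm M f + nrm M g)\<^sup>2"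
    unfolding nrm_add_square[OF assms] by (simp add: power2_sum)
qed (simp add: nrm_nonneg)

lemma nrm_uminus: "nrm M (\<lambda>x. - f x) = nrm M f"
  by (simp add: nrm_def)

lemma nrm_minus_commute: "nrm M (\<lambda>x. f x - g x) = nrm M (\<lambda>x. g x - f x)"
  by (simp add: nrm_def norm_minus_commute)

lemma nrm_diff_triangle:
  assumes "sq M f" "sq M g" "sq M h"
  shows "nrm M (\<lambda>x. f x - h x) \<le> nrm M (\<lambda>x. f x - g x) + nrm M (\<lambda>x. g x - h x)"
  using nrm_triangle[OF sq_diff[OF assms(1,2)] sq_diff[OF assms(2,3)]] by simp

lemma nrm_diff_le:
  assumes "sq M f" "sq M g"
  shows "\<bar>nrm M f - nrm M g\<bar> \<le> nrm M (\<lambda>x. f x - g x)"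
  using nrm_triangle[OF sq_diff[OF assms] assms(2)] nrm_triangle[OF sq_diff[OF assms(2,1)] assms(1)]
    nrm_minus_commute[of M f g] by simp

lemma nrm_tendsto:
  assumes "\<And>n. sq M (f n)" "sq M g" "((\<lambda>n. nrm M (\<lambda>x. f n x - g x)) \<longlongrightarrow> 0) F"
  shows "((\<lambda>n. nrm M (f n)) \<longlongrightarrow> nrm M g) F"
proof (rule LIM_zero_cancel)
  show "((\<lambda>n. nrm M (f n) - nrm M g) \<longlongrightarrow> 0) F"
    by (rule Lim_null_comparison[OF _ assms(3)]) (simp add: nrm_diff_le[OF assms(1,2)])
qed

lemma nrm_cong_AE:
  assumes "f \<in> borel_measurable M" "g \<in> borel_measurable M" "AE x in M. f x = g x"
  shows "nrm M f = nrm M g"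
  unfolding nrm_def by (intro arg_cong[where f=sqrt] integral_cong_AE) (use assms in auto)

lemma sq_cong_AE:
  assumes "sq M f" "g \<in> borel_measurable M" "AE x in M. f x = g x"
  shows "sq M g"
proof -
  have "integrable M (\<lambda>x. (norm (g x))\<^sup>2)"
    by (rule iffD1[OF integrable_cong_AE[where f="\<lambda>x. (norm (f x))\<^sup>2"]]) (use assms in \<open>auto simp: sq_def\<close>)
  thus ?thesis using assms by (simp add: sq_def)
qed

lemma inner_tendsto:
  assumes "\<And>n. sq M (f n)" "sq M g" "(\<lambda>n. nrm M (\<lambda>x. f n x - g x)) \<longlonglongrightarrow> 0"
    and "\<And>n. sq M (h n)" "sq M k" "(\<lambda>n. nrm M (\<lambda>x. h n x - k x)) \<longlonglongrightarrow> 0"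
  shows "(\<lambda>n. \<integral>x. f n x \<bullet> h n x \<partial>M) \<longlonglongrightarrow> (\<integral>x. g x \<bullet> k x \<partial>M)"
proof (rule LIM_zero_cancel)
  have e: "(\<integral>x. f n x \<bullet> h n x \<partial>M) - (\<integral>x. g x \<bullet> k x \<partial>M)
     = (\<integral>x. (f n x - g x) \<bullet> h n x \<partial>M) + (\<integral>x. g x \<bullet> (h n x - k x) \<partial>M)" for n
  proof -
    have "(\<integral>x. (f n x - g x) \<bullet> h n x \<partial>M) + (\<integral>x. g x \<bullet> (h n x - k x) \<partial>M)
      = (\<integral>x. (f n x - g x) \<bullet> h n x + g x \<bullet> (h n x - k x) \<partial>M)"
      by (intro Bochner_Integration.integral_add[symmetric] sq_inner sq_diff assms)
    also have "\<dots> = (\<integral>x. f n x \<bullet> h n x - g x \<bullet> k x \<partial>M)"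
      by (simp add: inner_diff algebra_simps)
    also have "\<dots> = (\<integral>x. f n x \<bullet> h n x \<partial>M) - (\<integral>x. g x \<bullet> k x \<partial>M)"
      by (intro Bochner_Integration.integral_diff sq_inner assms)
    finally show ?thesis by simp
  qed
  show "(\<lambda>n. (\<integral>x. f n x \<bullet> h n x \<partial>M) - (\<integral>x. g x \<bullet> k x \<partial>M)) \<longlonglongrightarrow> 0"
  proof (rule Lim_null_comparison)
    show "\<forall>\<^sub>F n in sequentially. norm ((\<integral>x. f n x \<bullet> h n x \<partial>M) - (\<integral>x. g x \<bullet> k x \<partial>M))
      \<le> nrm M (\<lambda>x. f n x - g x) * nrm M (h n) + nrm M g * nrm M (\<lambda>x. h n x - k x)"
      unfolding e real_norm_def
      by (intro always_eventually allI order_trans[OF abs_triangle_ineq] add_mono nrm_cauchy_schwarz sq_diff assms)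
    have "(\<lambda>n. nrm M (\<lambda>x. f n x - g x) * nrm M (h n) + nrm M g * nrm M (\<lambda>x. h n x - k x))
      \<longlonglongrightarrow> 0 * nrm M k + nrm M g * 0"
      by (intro tendsto_intros assms nrm_tendsto[OF assms(4,5,6)])
    thus "(\<lambda>n. nrm M (\<lambda>x. f n x - g x) * nrm M (h n) + nrm M g * nrm M (\<lambda>x. h n x - k x)) \<longlonglongrightarrow> 0"
      by simp
  qed
qed

lemma nrm_tendsto_AE_subseq:
  assumes "\<And>n. sq M (f n)" "sq M g" "(\<lambda>n. nrm M (\<lambda>x. f n x - g x)) \<longlonglongrightarrow> 0"
  obtains r where "strict_mono (r :: nat \<Rightarrow> nat)" "AE x in M. (\<lambda>n. f (r n) x) \<longlonglongrightarrow> g x"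
proof -
  have "(\<lambda>n. (nrm M (\<lambda>x. f n x - g x))\<^sup>2) \<longlonglongrightarrow> 0\<^sup>2" by (intro tendsto_intros assms)
  hence "(\<lambda>n. \<integral>x. norm ((norm (f n x - g x))\<^sup>2) \<partial>M) \<longlonglongrightarrow> 0" by (simp add: nrm_square)
  from tendsto_L1_AE_subseq[OF sqD(2)[OF sq_diff[OF assms(1,2)]] this]
  obtain r where r: "strict_mono r" "AE x in M. (\<lambda>n. (norm (f (r n) x - g x))\<^sup>2) \<longlonglongrightarrow> 0" by blast
  from r(2) have "AE x in M. (\<lambda>n. f (r n) x) \<longlonglongrightarrow> g x"
  proof (eventually_elim)
    case (elim x)
    hence "(\<lambda>n. sqrt ((norm (f (r n) x - g x))\<^sup>2)) \<longlonglongrightarrow> sqrt 0" by (rule tendsto_real_sqrt)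
    hence "(\<lambda>n. f (r n) x - g x) \<longlonglongrightarrow> 0" by (simp add: tendsto_norm_zero_iff)
    thus ?case by (rule LIM_zero_cancel)
  qed
  with r(1) that show ?thesis by blast
qed

lemma const_sq: "finite_measure M \<Longrightarrow> sq M (\<lambda>x. c)"
  by (simp add: sq_def finite_measure.emeasure_finite less_top[symmetric] finite_measure.integrable_const)

lemma sq_norm: "sq M f \<Longrightarrow> sq M (\<lambda>x. norm (f x))"
  by (auto simp: sq_def)

lemma sq_integrable:
  assumes "finite_measure M" "sq M (f :: _ \<Rightarrow> real)" shows "integrable M f"
  using sq_inner[OF assms(2) const_sq[OF assms(1), of 1]] by simp

text \<open>Riesz-Fischer. Along a subsequence whose steps are below 2^-j the increments are
  summable almost everywhere, because the finite measure turns mean square bounds into bounds of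
  plain integrals; Fatou then carries the Cauchy estimate to the pointwise limit.\<close>

lemma nrm_complete:
  fixes f :: "nat \<Rightarrow> 'a \<Rightarrow> 'b::euclidean_space"
  assumes fin: "finite_measure M" and sq: "\<And>n. sq M (f n)"
    and Cauchy: "\<And>e. e > 0 \<Longrightarrow> \<exists>n0. \<forall>k\<ge>n0. \<forall>l\<ge>n0. nrm M (\<lambda>x. f k x - f l x) < e"
  obtains g where "sq M g" "(\<lambda>n. nrm M (\<lambda>x. f n x - g x)) \<longlonglongrightarrow> 0"
proof -
  interpret finite_measure M by (rule fin)
  have [measurable]: "f n \<in> borel_measurable M" for n using sq by (auto simp: sq_def)
  obtain n0 where n0: "\<And>j k l. k \<ge> n0 j \<Longrightarrow> l \<ge> n0 j \<Longrightarrow> nrm M (\<lambda>x. f k x - f l x) < (1 / 2) ^ j"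
    using Cauchy[of "(1 / 2) ^ j" for j] by (metis zero_less_divide_1_iff zero_less_numeral zero_less_power)
  define r where "r = rec_nat (n0 0) (\<lambda>j m. max (Suc m) (n0 (Suc j)))"
  have rS: "r (Suc j) = max (Suc (r j)) (n0 (Suc j))" for j by (simp add: r_def)
  have r: "strict_mono r" by (rule strict_monoI_Suc) (simp add: rS)
  have rn: "r j \<ge> n0 j" for j by (cases j) (auto simp: r_def)
  define d where "d j x = norm (f (r (Suc j)) x - f (r j) x)" for j x
  have [measurable]: "d j \<in> borel_measurable M" for j unfolding d_def by measurable
  have sd: "sq M (d j)" for j unfolding d_def by (intro sq_norm sq_diff sq)
  have nd: "nrm M (d j) \<le> (1 / 2) ^ j" for j
  proof -
    have "r (Suc j) \<ge> n0 j" using rn[of j] rS[of j] by simp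
    from n0[OF this rn] show ?thesis by (simp add: nrm_def d_def)
  qed
  have id: "integrable M (d j)" for j by (rule sq_integrable[OF fin sd])
  define c where "c = nrm M (\<lambda>x. 1::real)"
  have Id: "(\<integral>x. d j x \<partial>M) \<le> c * (1 / 2) ^ j" for j
  proof -
    have "(\<integral>x. d j x \<partial>M) \<le> nrm M (d j) * c"
      using nrm_cauchy_schwarz[OF sd const_sq[OF fin, of 1], of j] by (simp add: c_def)
    also have "\<dots> \<le> (1 / 2) ^ j * c" by (intro mult_right_mono nd) (simp add: c_def nrm_nonneg)
    finally show ?thesis by (simp add: mult.commute)
  qed
  have "(\<integral>\<^sup>+x. (\<Sum>j. ennreal (d j x)) \<partial>M) = (\<Sum>j. \<integral>\<^sup>+x. ennreal (d j x) \<partial>M)"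
    by (rule nn_integral_suminf) measurable
  also have "\<dots> = (\<Sum>j. ennreal (\<integral>x. d j x \<partial>M))"
    by (intro suminf_cong nn_integral_eq_integral id) (auto simp: d_def)
  also have "\<dots> \<le> (\<Sum>j. ennreal (c * (1 / 2) ^ j))"
    by (intro suminf_le ennreal_leI Id) auto
  also have "\<dots> < \<infinity>"
  proof -
    have "(\<Sum>j. ennreal (c * (1 / 2) ^ j)) = ennreal (\<Sum>j. c * (1 / 2) ^ j)"
      by (intro suminf_ennreal2 summable_mult summable_geometric) (auto simp: c_def nrm_nonneg)
    thus ?thesis by simp
  qed
  finally have "AE x in M. (\<Sum>j. ennreal (d j x)) \<noteq> \<infinity>"
    by (intro nn_integral_noteq_infinite) auto
  hence conv: "AE x in M. convergent (\<lambda>n. f (r n) x)"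
  proof eventually_elim
    case (elim x)
    have "summable (\<lambda>j. d j x)"
      by (rule summable_suminf_not_top) (use elim in \<open>auto simp: d_def\<close>)
    hence "summable (\<lambda>j. f (r (Suc j)) x - f (r j) x)"
      unfolding d_def by (rule summable_norm_cancel)
    hence "convergent (\<lambda>n. \<Sum>j<n. f (r (Suc j)) x - f (r j) x)"
      by (simp add: summable_iff_convergent)
    hence "convergent (\<lambda>n. f (r n) x - f (r 0) x)" by (simp add: sum_lessThan_telescope[of "\<lambda>j. f (r j) x"])
    from convergent_add[OF this convergent_const[of "f (r 0) x"]] show ?case by simp
  qed
  define g where "g x = lim (\<lambda>n. f (r n) x)" for x
  have [measurable]: "g \<in> borel_measurable M" unfolding g_def by measurable
  from conv have lim: "AE x in M. (\<lambda>n. f (r n) x) \<longlonglongrightarrow> g x"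
    by eventually_elim (simp add: g_def convergent_LIMSEQ_iff)
  have fatou: "(\<integral>\<^sup>+x. ennreal ((norm (f k x - g x))\<^sup>2) \<partial>M) \<le> ennreal (e\<^sup>2)"
    if e: "e > 0" and k: "\<And>l. l \<ge> n1 \<Longrightarrow> nrm M (\<lambda>x. f k x - f l x) < e" for k e n1
  proof -
    have "(\<integral>\<^sup>+x. ennreal ((norm (f k x - g x))\<^sup>2) \<partial>M)
        = (\<integral>\<^sup>+x. liminf (\<lambda>n. ennreal ((norm (f k x - f (r n) x))\<^sup>2)) \<partial>M)"
    proof (rule nn_integral_cong_AE)
      from lim show "AE x in M. ennreal ((norm (f k x - g x))\<^sup>2) = liminf (\<lambda>n. ennreal ((norm (f k x - f (r n) x))\<^sup>2))"
      proof eventually_elim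
        case (elim x)
        have "(\<lambda>n. ennreal ((norm (f k x - f (r n) x))\<^sup>2)) \<longlonglongrightarrow> ennreal ((norm (f k x - g x))\<^sup>2)"
          by (intro tendsto_ennrealI tendsto_intros elim)
        from lim_imp_Liminf[OF _ this] show ?case by simp
      qed
    qed
    also have "\<dots> \<le> liminf (\<lambda>n. \<integral>\<^sup>+x. ennreal ((norm (f k x - f (r n) x))\<^sup>2) \<partial>M)"
      by (rule nn_integral_liminf) measurable
    also have "\<dots> \<le> limsup (\<lambda>n. \<integral>\<^sup>+x. ennreal ((norm (f k x - f (r n) x))\<^sup>2) \<partial>M)"
      by (rule Liminf_le_Limsup) simp
    also have "\<dots> \<le> ennreal (e\<^sup>2)"
    proof (rule Limsup_bounded)
      show "\<forall>\<^sub>F n in sequentially. (\<integral>\<^sup>+x. ennreal ((norm (f k x - f (r n) x))\<^sup>2) \<partial>M) \<le> ennreal (e\<^sup>2)"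
        using eventually_ge_at_top[of n1]
      proof eventually_elim
        case (elim n)
        have "r n \<ge> n1" using elim seq_suble[OF r, of n] by simp
        hence "(nrm M (\<lambda>x. f k x - f (r n) x))\<^sup>2 \<le> e\<^sup>2" using k[of "r n"] by (intro power_mono) (auto simp: nrm_nonneg)
        moreover have "(\<integral>\<^sup>+x. ennreal ((norm (f k x - f (r n) x))\<^sup>2) \<partial>M) = ennreal ((nrm M (\<lambda>x. f k x - f (r n) x))\<^sup>2)"
          unfolding nrm_square by (intro nn_integral_eq_integral sqD(2) sq_diff sq) auto
        ultimately show ?case by (simp add: ennreal_leI)
      qed
    qed
    finally show ?thesis .
  qed
  have sqd: "sq M (\<lambda>x. f k x - g x)" "nrm M (\<lambda>x. f k x - g x) \<le> e"
    if e: "e > 0" and k: "\<And>l. l \<ge> n1 \<Longrightarrow> nrm M (\<lambda>x. f k x - f l x) < e" for k e n1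
  proof -
    have fk: "(\<integral>\<^sup>+x. ennreal ((norm (f k x - g x))\<^sup>2) \<partial>M) \<le> ennreal (e\<^sup>2)"
      by (rule fatou[OF e]) (rule k)
    have "integrable M (\<lambda>x. (norm (f k x - g x))\<^sup>2)"
    proof (rule integrableI_bounded)
      show "(\<integral>\<^sup>+x. ennreal (norm ((norm (f k x - g x))\<^sup>2)) \<partial>M) < \<infinity>"
        using le_less_trans[OF fk ennreal_less_top] by simp
    qed measurable
    thus s: "sq M (\<lambda>x. f k x - g x)" by (simp add: sq_def)
    have "ennreal ((nrm M (\<lambda>x. f k x - g x))\<^sup>2) \<le> ennreal (e\<^sup>2)"
      unfolding nrm_square using fk nn_integral_eq_integral[OF sqD(2)[OF s]] by simp
    hence "(nrm M (\<lambda>x. f k x - g x))\<^sup>2 \<le> e\<^sup>2" by (subst (asm) ennreal_le_iff) auto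
    thus "nrm M (\<lambda>x. f k x - g x) \<le> e" by (rule power2_le_imp_le) (use e in simp)
  qed
  have "sq M (\<lambda>x. f (n0 0) x - (f (n0 0) x - g x))"
    by (intro sq_diff[OF sq] sqd(1)[of "(1/2)^0" "n0 0" "n0 0"] n0) auto
  hence "sq M g" by simp
  moreover have "(\<lambda>n. nrm M (\<lambda>x. f n x - g x)) \<longlonglongrightarrow> 0"
  proof (rule LIMSEQ_I)
    fix e :: real assume e: "e > 0"
    obtain n1 where n1: "\<forall>k\<ge>n1. \<forall>l\<ge>n1. nrm M (\<lambda>x. f k x - f l x) < e / 2" using Cauchy[of "e / 2"] e by auto
    show "\<exists>n1. \<forall>n\<ge>n1. norm (nrm M (\<lambda>x. f n x - g x) - 0) < e"
    proof (intro exI[of _ n1] allI impI)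
      fix n assume "n \<ge> n1"
      hence "nrm M (\<lambda>x. f n x - g x) \<le> e / 2" using n1 e by (intro sqd(2)[of _ n1]) auto
      thus "norm (nrm M (\<lambda>x. f n x - g x) - 0) < e" using e by (simp add: nrm_nonneg)
    qed
  qed
  ultimately show ?thesis by (rule that)
qed

section \<open>The energy space\<close>

lemma GDERIV_lipschitz:
  fixes g :: "real^'n \<Rightarrow> real"
  assumes g: "\<And>x. GDERIV g x :> G x" and L: "\<And>x. norm (G x) \<le> L"
  shows "\<bar>g y - g x\<bar> \<le> L * norm (y - x)"
proof -
  have "norm (g y - g x) \<le> L * norm (y - x)"
  proof (rule differentiable_bound[OF convex_UNIV])
    show "(g has_derivative (\<lambda>h. h \<bullet> G x)) (at x within UNIV)" for x
      using g by (simp add: gderiv_def)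
    show "onorm (\<lambda>h. h \<bullet> G x) \<le> L" for x
    proof (rule onorm_le)
      fix h
      have "norm (h \<bullet> G x) \<le> norm h * norm (G x)" using Cauchy_Schwarz_ineq2 by simp
      also have "\<dots> \<le> norm h * L" by (intro mult_left_mono L) auto
      finally show "norm (h \<bullet> G x) \<le> L * norm h" by (simp add: mult.commute)
    qed
  qed auto
  thus ?thesis by simp
qed

text \<open>By translation invariance all difference quotients have vanishing integral.\<close>
lemma integral_partial_derivative_zero:
  fixes \<Omega> :: "(real^'n) set"
  assumes gG: "C1z \<Omega> g G" and bd: "bounded \<Omega>"
  shows "(\<integral>x. G x $ i \<partial>lborel) = 0"
proof -
  have [measurable]: "g \<in> borel_measurable borel" "G \<in> borel_measurable borel" by (rule C1zD[OF gG])+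
  obtain L where L: "L > 0" "\<And>x. norm (G x) \<le> L"
    using bounded_continuous_vanish[OF C1zD(2)[OF gG] C1zD(5)[OF gG] bd] by blast
  obtain R where R: "R > 0" "\<Omega> \<subseteq> ball 0 R" using bounded_subset_ballD[OF bd, of 0] by blast
  define t where "t n = 1 / real (Suc n)" for n
  have t: "0 < t n" "t n \<le> 1" for n by (auto simp: t_def)
  define e :: "real^'n" where "e = axis i 1"
  have ne: "norm e = 1" by (simp add: e_def)
  define q where "q n x = (g (t n *\<^sub>R e + x) - g x) / t n" for n x
  have q0: "(\<integral>x. q n x \<partial>lborel) = 0" for n
  proof -
    have ig: "integrable lborel g" by (rule C1z_integrable(1)[OF gG bd])
    have "integrable (distr lborel borel ((+) (t n *\<^sub>R e))) g" using ig by (simp add: lborel_distr_plus)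
    hence i2: "integrable lborel (\<lambda>x. g (t n *\<^sub>R e + x))" by (subst (asm) integrable_distr_eq) auto
    have "(\<integral>x. g x \<partial>lborel) = (\<integral>x. g x \<partial>(distr lborel borel ((+) (t n *\<^sub>R e))))" by (simp add: lborel_distr_plus)
    also have "\<dots> = (\<integral>x. g (t n *\<^sub>R e + x) \<partial>lborel)" by (subst integral_distr) auto
    finally show ?thesis using ig i2 by (simp add: q_def)
  qed
  have "(\<lambda>n. \<integral>x. q n x \<partial>lborel) \<longlonglongrightarrow> (\<integral>x. G x $ i \<partial>lborel)"
  \<comment> \<open>Translations are by at most 1, so all difference quotients live in the ball of
    radius R + 1, where the Lipschitz constant dominates them.\<close>
  proof (rule integral_dominated_convergence[where w="\<lambda>x. indicator (cball 0 (R + 1)) x * L"])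
    show "(\<lambda>x. G x $ i) \<in> borel_measurable lborel"
      using borel_measurable_continuous_onI[OF continuous_on_component[OF C1zD(2)[OF gG]], of i] by simp
    show "q n \<in> borel_measurable lborel" for n unfolding q_def by measurable
    show "integrable lborel (\<lambda>x::real^'n. indicator (cball 0 (R + 1)) x * L)"
      by (intro integrable_mult_left integrable_real_indicator) (use emeasure_bounded_finite[OF bounded_cball] in auto)
    show "AE x in lborel. norm (q n x) \<le> indicator (cball 0 (R + 1)) x * L" for n
    proof (intro AE_I2)
      fix x
      show "norm (q n x) \<le> indicator (cball 0 (R + 1)) x * L"
      proof (cases "x \<in> cball 0 (R + 1)")
        case True
        have "\<bar>g (t n *\<^sub>R e + x) - g x\<bar> \<le> L * norm (t n *\<^sub>R e + x - x)"
          by (rule GDERIV_lipschitz[OF C1zD(1)[OF gG] L(2)])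
        thus ?thesis using True t[of n] ne by (simp add: q_def abs_divide field_simps)
      next
        case False
        have "norm x \<le> norm (t n *\<^sub>R e + x) + norm (t n *\<^sub>R e)"
          using norm_triangle_ineq4[of "t n *\<^sub>R e + x" "t n *\<^sub>R e"] by simp
        hence "norm (t n *\<^sub>R e + x) > R" using False t[of n] ne by simp
        hence "t n *\<^sub>R e + x \<notin> \<Omega>" "x \<notin> \<Omega>" using R False by auto
        thus ?thesis using C1zD(4)[OF gG] False by (simp add: q_def)
      qed
    qed
    show "AE x in lborel. (\<lambda>n. q n x) \<longlonglongrightarrow> G x $ i"
    proof (intro AE_I2)
      fix x
      have "((\<lambda>s. g (s *\<^sub>R e + x)) has_derivative (\<lambda>h. (h *\<^sub>R e) \<bullet> G x)) (at 0)"
        by (rule has_derivative_compose[of "\<lambda>s. s *\<^sub>R e + x" "\<lambda>h. h *\<^sub>R e" 0 UNIV g "\<lambda>h. h \<bullet> G x"])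
           (use C1zD(1)[OF gG, of x] in \<open>auto intro!: derivative_eq_intros simp: gderiv_def\<close>)
      hence "((\<lambda>s. g (s *\<^sub>R e + x)) has_real_derivative G x $ i) (at 0)"
        by (simp add: has_field_derivative_def e_def inner_axis' mult_commute_abs)
      hence "((\<lambda>h. (g (h *\<^sub>R e + x) - g x) / h) \<longlongrightarrow> G x $ i) (at 0)"
        by (simp add: DERIV_def)
      moreover have "t \<longlonglongrightarrow> 0"
        unfolding t_def[abs_def] using LIMSEQ_inverse_real_of_nat by (simp add: inverse_eq_divide)
      hence "filterlim t (at 0) sequentially"
        using t(1) by (auto simp: filterlim_at less_imp_neq[symmetric] intro!: always_eventually)
      ultimately show "(\<lambda>n. q n x) \<longlonglongrightarrow> G x $ i"
        unfolding q_def by (rule filterlim_compose)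
    qed
  qed
  moreover have "(\<lambda>n. \<integral>x. q n x \<partial>lborel) \<longlonglongrightarrow> 0" by (simp add: q0)
  ultimately show ?thesis by (rule LIMSEQ_unique)
qed

section \<open>The space H^1_0 and its inequalities\<close>

locale bounded_domain =
  fixes \<Omega> :: "(real^'n) set"
  assumes open_dom: "open \<Omega>" and connected_dom: "connected \<Omega>"
    and bounded_dom: "bounded \<Omega>" and nonempty_dom: "\<Omega> \<noteq> {}"
begin

abbreviation M :: "(real^'n) measure" where "M \<equiv> lebesgue_on \<Omega>"

lemma dom_sets: "\<Omega> \<in> sets borel" "\<Omega> \<in> sets lebesgue" "\<Omega> \<inter> space lebesgue \<in> sets lebesgue"
  using open_dom by auto

lemma finite_M: "finite_measure M"
proof (rule finite_measureI)
  have "emeasure lborel \<Omega> \<noteq> \<infinity>" using emeasure_bounded_finite[OF bounded_dom] by simp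
  thus "emeasure M (space M) \<noteq> \<infinity>"
    using dom_sets by (simp add: emeasure_restrict_space space_restrict_space)
qed

lemma set_integrable_M: "set_integrable lebesgue \<Omega> f \<longleftrightarrow> integrable M f"
  for f :: "_ \<Rightarrow> 'b::{banach, second_countable_topology}"
  unfolding set_integrable_def by (rule integrable_restrict_space[symmetric, OF dom_sets(3)])

lemma set_integral_M: "(LINT x:\<Omega>|lebesgue. f x) = integral\<^sup>L M f"
  for f :: "_ \<Rightarrow> 'b::{banach, second_countable_topology}"
  unfolding set_lebesgue_integral_def by (rule integral_restrict_space[symmetric, OF dom_sets(3)])

lemma set_borel_measurable_M: "set_borel_measurable lebesgue \<Omega> f \<longleftrightarrow> f \<in> borel_measurable M"
  for f :: "_ \<Rightarrow> 'b::real_normed_vector"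
  unfolding set_borel_measurable_def by (rule borel_measurable_restrict_space_iff[symmetric, OF dom_sets(3)])

lemma borel_measurable_M: "f \<in> borel_measurable borel \<Longrightarrow> f \<in> borel_measurable M"
  by (intro measurable_restrict_space1 measurable_completion) simp

text \<open>Bridge from the Borel integrals over the whole space, in which the inequalities are
  proved, to the Lebesgue integrals over \<Omega> of the definitions.\<close>

lemma
  fixes f :: "_ \<Rightarrow> 'b::{banach, second_countable_topology}"
  assumes [measurable]: "f \<in> borel_measurable borel" and "\<And>x. x \<notin> \<Omega> \<Longrightarrow> f x = 0"
  shows integral_M_lborel: "integral\<^sup>L M f = integral\<^sup>L lborel f"
    and integrable_M_lborel: "integrable M f \<longleftrightarrow> integrable lborel f"
proof -
  have e: "(\<lambda>x. indicator \<Omega> x *\<^sub>R f x) = f" using assms(2) by (auto simp: indicator_def fun_eq_iff)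
  show "integral\<^sup>L M f = integral\<^sup>L lborel f"
    unfolding integral_restrict_space[OF dom_sets(3)] e by (rule integral_completion) simp
  show "integrable M f \<longleftrightarrow> integrable lborel f"
    unfolding integrable_restrict_space[OF dom_sets(3)] e by (rule integrable_completion) simp
qed

lemma
  assumes gG: "C1z \<Omega> g G"
  shows C1z_sq: "sq M g" "sq M G"
    and C1z_nrm: "(nrm M g)\<^sup>2 = (\<integral>x. (g x)\<^sup>2 \<partial>lborel)" "(nrm M G)\<^sup>2 = (\<integral>x. (norm (G x))\<^sup>2 \<partial>lborel)"
proof -
  have [measurable]: "g \<in> borel_measurable borel" "G \<in> borel_measurable borel" by (rule C1zD[OF gG])+
  note i = C1z_integrable[OF gG bounded_dom]
  show "sq M g" "sq M G"
    using i C1zD(4,5)[OF gG] by (auto simp: sq_def borel_measurable_M integrable_M_lborel)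
  show "(nrm M g)\<^sup>2 = (\<integral>x. (g x)\<^sup>2 \<partial>lborel)" "(nrm M G)\<^sup>2 = (\<integral>x. (norm (G x))\<^sup>2 \<partial>lborel)"
    using C1zD(4,5)[OF gG] by (simp_all add: nrm_square integral_M_lborel)
qed

lemmas test_sq = C1z_sq[OF test_fun_C1z]

text \<open>The closure of the graph of the gradient on test functions: \<open>v\<close> belongs to \<open>H\<^sup>1\<^sub>0\<close> and has
  weak gradient \<open>h\<close>.\<close>
definition HP :: "(real^'n \<Rightarrow> real) \<Rightarrow> (real^'n \<Rightarrow> real^'n) \<Rightarrow> bool" where
  "HP v h \<longleftrightarrow> sq M v \<and> sq M h \<and> (\<forall>e>0. \<exists>\<phi>. test_fun \<Omega> \<phi> \<and>
     nrm M (\<lambda>x. \<phi> x - v x) < e \<and> nrm M (\<lambda>x. cgrad \<phi> x - h x) < e)"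

lemma HP_sq: "HP v h \<Longrightarrow> sq M v" "HP v h \<Longrightarrow> sq M h"
  by (simp_all add: HP_def)

lemma HP_test: "test_fun \<Omega> \<phi> \<Longrightarrow> HP \<phi> (cgrad \<phi>)"
  unfolding HP_def by (intro conjI allI impI test_sq exI[of _ \<phi>]) (simp_all add: nrm_def)

lemma HP_approx:
  assumes "HP v h"
  obtains \<phi> where "\<And>k. test_fun \<Omega> (\<phi> k)" "(\<lambda>k. nrm M (\<lambda>x. \<phi> k x - v x)) \<longlonglongrightarrow> 0"
    "(\<lambda>k. nrm M (\<lambda>x. cgrad (\<phi> k) x - h x)) \<longlonglongrightarrow> 0"
proof -
  have "\<forall>k. \<exists>\<phi>. test_fun \<Omega> \<phi> \<and> nrm M (\<lambda>x. \<phi> x - v x) < 1 / real (Suc k) \<and> nrm M (\<lambda>x. cgrad \<phi> x - h x) < 1 / real (Suc k)"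
    using assms by (simp add: HP_def)
  from choice[OF this]
  obtain \<phi> where \<phi>: "\<And>k. test_fun \<Omega> (\<phi> k)" "\<And>k. nrm M (\<lambda>x. \<phi> k x - v x) < 1 / real (Suc k)"
    "\<And>k. nrm M (\<lambda>x. cgrad (\<phi> k) x - h x) < 1 / real (Suc k)" by auto
  have *: "(\<lambda>k. a k) \<longlonglongrightarrow> 0" if "\<And>k. 0 \<le> a k" "\<And>k. a k < 1 / real (Suc k)" for a :: "nat \<Rightarrow> real"
    by (rule tendsto_sandwich[OF _ _ tendsto_const LIMSEQ_inverse_real_of_nat[unfolded inverse_eq_divide]])
       (use that in \<open>auto intro!: always_eventually less_imp_le\<close>)
  show ?thesis by (rule that[OF \<phi>(1) *[OF nrm_nonneg \<phi>(2)] *[OF nrm_nonneg \<phi>(3)]])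
qed

lemma HP_closed:
  assumes "\<And>k. HP (\<phi> k) (\<Phi> k)" "sq M v" "sq M h"
    "(\<lambda>k. nrm M (\<lambda>x. \<phi> k x - v x)) \<longlonglongrightarrow> 0" "(\<lambda>k. nrm M (\<lambda>x. \<Phi> k x - h x)) \<longlonglongrightarrow> 0"
  shows "HP v h"
  unfolding HP_def
proof (intro conjI assms(2,3) allI impI)
  fix e :: real assume e: "e > 0"
  have "\<forall>\<^sub>F k in sequentially. nrm M (\<lambda>x. \<phi> k x - v x) < e / 2 \<and> nrm M (\<lambda>x. \<Phi> k x - h x) < e / 2"
    using order_tendstoD(2)[OF assms(4), of "e / 2"] order_tendstoD(2)[OF assms(5), of "e / 2"] e
    by (auto intro: eventually_conj)
  then obtain k where k: "nrm M (\<lambda>x. \<phi> k x - v x) < e / 2" "nrm M (\<lambda>x. \<Phi> k x - h x) < e / 2"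
    by (auto dest: eventually_happens)
  obtain \<psi> where \<psi>: "test_fun \<Omega> \<psi>" "nrm M (\<lambda>x. \<psi> x - \<phi> k x) < e / 2" "nrm M (\<lambda>x. cgrad \<psi> x - \<Phi> k x) < e / 2"
    using assms(1)[of k] e unfolding HP_def by (meson half_gt_zero)
  show "\<exists>\<phi>. test_fun \<Omega> \<phi> \<and> nrm M (\<lambda>x. \<phi> x - v x) < e \<and> nrm M (\<lambda>x. cgrad \<phi> x - h x) < e"
    using nrm_diff_triangle[OF test_sq(1)[OF \<psi>(1)] HP_sq(1)[OF assms(1)[of k]] assms(2)]
      nrm_diff_triangle[OF test_sq(2)[OF \<psi>(1)] HP_sq(2)[OF assms(1)[of k]] assms(3)] k \<psi>
    by (intro exI[of _ \<psi>]) auto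
qed

lemma HP_add:
  assumes "HP v h" "HP w k"
  shows "HP (\<lambda>x. v x + w x) (\<lambda>x. h x + k x)"
proof -
  obtain \<phi> where \<phi>: "\<And>k. test_fun \<Omega> (\<phi> k)" "(\<lambda>k. nrm M (\<lambda>x. \<phi> k x - v x)) \<longlonglongrightarrow> 0"
    "(\<lambda>k. nrm M (\<lambda>x. cgrad (\<phi> k) x - h x)) \<longlonglongrightarrow> 0" using HP_approx[OF assms(1)] by blast
  obtain \<psi> where \<psi>: "\<And>k. test_fun \<Omega> (\<psi> k)" "(\<lambda>k. nrm M (\<lambda>x. \<psi> k x - w x)) \<longlonglongrightarrow> 0"
    "(\<lambda>n. nrm M (\<lambda>x. cgrad (\<psi> n) x - k x)) \<longlonglongrightarrow> 0" using HP_approx[OF assms(2)] by blast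
  have *: "(\<lambda>n. nrm M (\<lambda>x. (a n x + b n x) - (c x + d x))) \<longlonglongrightarrow> 0"
    if "\<And>n. sq M (a n)" "\<And>n. sq M (b n)" "sq M c" "sq M d"
      "(\<lambda>n. nrm M (\<lambda>x. a n x - c x)) \<longlonglongrightarrow> 0" "(\<lambda>n. nrm M (\<lambda>x. b n x - d x)) \<longlonglongrightarrow> 0"
    for a b :: "nat \<Rightarrow> real^'n \<Rightarrow> 'b::euclidean_space" and c d
  proof (rule Lim_null_comparison)
    show "\<forall>\<^sub>F n in sequentially. norm (nrm M (\<lambda>x. (a n x + b n x) - (c x + d x)))
      \<le> nrm M (\<lambda>x. a n x - c x) + nrm M (\<lambda>x. b n x - d x)"
    proof (intro always_eventually allI)
      fix n
      have "nrm M (\<lambda>x. (a n x - c x) + (b n x - d x)) \<le> nrm M (\<lambda>x. a n x - c x) + nrm M (\<lambda>x. b n x - d x)"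
        by (intro nrm_triangle sq_diff that)
      moreover have "(\<lambda>x. (a n x - c x) + (b n x - d x)) = (\<lambda>x. (a n x + b n x) - (c x + d x))" by (simp add: algebra_simps)
      ultimately show "norm (nrm M (\<lambda>x. (a n x + b n x) - (c x + d x))) \<le> nrm M (\<lambda>x. a n x - c x) + nrm M (\<lambda>x. b n x - d x)"
        by (simp add: nrm_nonneg)
    qed
    show "(\<lambda>n. nrm M (\<lambda>x. a n x - c x) + nrm M (\<lambda>x. b n x - d x)) \<longlonglongrightarrow> 0"
      using tendsto_add[OF that(5,6)] by simp
  qed
  show ?thesis
  proof (rule HP_closed)
    show "HP (\<lambda>x. \<phi> n x + \<psi> n x) (\<lambda>x. cgrad (\<phi> n) x + cgrad (\<psi> n) x)" for n
      using HP_test[OF test_fun_add[OF \<phi>(1) \<psi>(1)]] by (simp add: cgrad_add[OF \<phi>(1) \<psi>(1), abs_def])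
    show "(\<lambda>n. nrm M (\<lambda>x. (\<phi> n x + \<psi> n x) - (v x + w x))) \<longlonglongrightarrow> 0"
      by (intro * \<phi> \<psi> test_sq HP_sq[OF assms(1)] HP_sq[OF assms(2)])
    show "(\<lambda>n. nrm M (\<lambda>x. (cgrad (\<phi> n) x + cgrad (\<psi> n) x) - (h x + k x))) \<longlonglongrightarrow> 0"
      by (intro * \<phi> \<psi> test_sq HP_sq[OF assms(1)] HP_sq[OF assms(2)])
  qed (intro sq_add HP_sq[OF assms(1)] HP_sq[OF assms(2)])+
qed

lemma HP_scale:
  assumes "HP v h"
  shows "HP (\<lambda>x. c * v x) (\<lambda>x. c *\<^sub>R h x)"
proof -
  obtain \<phi> where \<phi>: "\<And>k. test_fun \<Omega> (\<phi> k)" "(\<lambda>k. nrm M (\<lambda>x. \<phi> k x - v x)) \<longlonglongrightarrow> 0"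
    "(\<lambda>k. nrm M (\<lambda>x. cgrad (\<phi> k) x - h x)) \<longlonglongrightarrow> 0" using HP_approx[OF assms(1)] by blast
  show ?thesis
  proof (rule HP_closed)
    have "cgrad (\<lambda>x. c * \<phi> n x) = (\<lambda>x. c *\<^sub>R cgrad (\<phi> n) x)" for n
      by (rule ext) (rule cgrad_cmult[OF \<phi>(1)])
    thus "HP (\<lambda>x. c * \<phi> n x) (\<lambda>x. c *\<^sub>R cgrad (\<phi> n) x)" for n
      using HP_test[OF test_fun_cmult[OF \<phi>(1)], of c n] by simp
    show "sq M (\<lambda>x. c * v x)" "sq M (\<lambda>x. c *\<^sub>R h x)"
      using sq_scaleR[OF HP_sq(1)[OF assms], of c] sq_scaleR[OF HP_sq(2)[OF assms], of c] by auto
    have "nrm M (\<lambda>x. c * \<phi> n x - c * v x) = \<bar>c\<bar> * nrm M (\<lambda>x. \<phi> n x - v x)" for n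
      using nrm_scaleR[of M c "\<lambda>x. \<phi> n x - v x"] by (simp add: right_diff_distrib)
    thus "(\<lambda>n. nrm M (\<lambda>x. c * \<phi> n x - c * v x)) \<longlonglongrightarrow> 0" using tendsto_mult_right_zero[OF \<phi>(2)] by simp
    have "nrm M (\<lambda>x. c *\<^sub>R cgrad (\<phi> n) x - c *\<^sub>R h x) = \<bar>c\<bar> * nrm M (\<lambda>x. cgrad (\<phi> n) x - h x)" for n
      using nrm_scaleR[of M c "\<lambda>x. cgrad (\<phi> n) x - h x"] by (simp add: scaleR_right_diff_distrib)
    thus "(\<lambda>n. nrm M (\<lambda>x. c *\<^sub>R cgrad (\<phi> n) x - c *\<^sub>R h x)) \<longlonglongrightarrow> 0" using tendsto_mult_right_zero[OF \<phi>(3)] by simp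
  qed
qed

lemma HP_diff:
  assumes "HP v h" "HP w k"
  shows "HP (\<lambda>x. v x - w x) (\<lambda>x. h x - k x)"
  using HP_add[OF assms(1) HP_scale[OF assms(2), of "-1"]] by simp

lemma HP_cong_AE:
  assumes "HP v h" "w \<in> borel_measurable M" "k \<in> borel_measurable M"
    "AE x in M. v x = w x" "AE x in M. h x = k x"
  shows "HP w k"
proof (rule HP_closed[where \<phi>="\<lambda>_. v" and \<Phi>="\<lambda>_. h"])
  show s: "sq M w" "sq M k"
    using sq_cong_AE[OF HP_sq(1)[OF assms(1)] assms(2,4)] sq_cong_AE[OF HP_sq(2)[OF assms(1)] assms(3,5)] .
  have "nrm M (\<lambda>x. v x - w x) = nrm M (\<lambda>x. 0::real)"
    using HP_sq(1)[OF assms(1)] assms by (intro nrm_cong_AE) (auto simp: sq_def)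
  thus "(\<lambda>_. nrm M (\<lambda>x. v x - w x)) \<longlonglongrightarrow> 0" by (simp add: nrm_def)
  have "nrm M (\<lambda>x. h x - k x) = nrm M (\<lambda>x. 0::real^'n)"
    using HP_sq(2)[OF assms(1)] assms by (intro nrm_cong_AE) (auto simp: sq_def)
  thus "(\<lambda>_. nrm M (\<lambda>x. h x - k x)) \<longlonglongrightarrow> 0" by (simp add: nrm_def)
qed (rule assms(1))

lemma HP_poincare:
  obtains C where "C > 0" "\<And>v h. HP v h \<Longrightarrow> nrm M v \<le> C * nrm M h"
proof -
  obtain P where P: "P > 0" "\<And>g G. C1z \<Omega> g G \<Longrightarrow> (\<integral>x. (g x)\<^sup>2 \<partial>lborel) \<le> P * (\<integral>x. (norm (G x))\<^sup>2 \<partial>lborel)"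
    using poincare[OF bounded_dom] by blast
  have t: "nrm M \<phi> \<le> sqrt P * nrm M (cgrad \<phi>)" if "test_fun \<Omega> \<phi>" for \<phi>
  proof (rule power2_le_imp_le)
    note c = test_fun_C1z[OF that]
    show "(nrm M \<phi>)\<^sup>2 \<le> (sqrt P * nrm M (cgrad \<phi>))\<^sup>2"
      using P(2)[OF c] P(1) by (simp add: C1z_nrm[OF c] power_mult_distrib)
  qed (use P in \<open>simp add: nrm_nonneg\<close>)
  have "nrm M v \<le> sqrt P * nrm M h" if vh: "HP v h" for v h
  proof -
    obtain \<phi> where \<phi>: "\<And>k. test_fun \<Omega> (\<phi> k)" "(\<lambda>k. nrm M (\<lambda>x. \<phi> k x - v x)) \<longlonglongrightarrow> 0"
      "(\<lambda>k. nrm M (\<lambda>x. cgrad (\<phi> k) x - h x)) \<longlonglongrightarrow> 0" using HP_approx[OF vh] by blast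
    show ?thesis
    proof (rule LIMSEQ_le)
      show "(\<lambda>k. nrm M (\<phi> k)) \<longlonglongrightarrow> nrm M v" by (rule nrm_tendsto[OF test_sq(1)[OF \<phi>(1)] HP_sq(1)[OF vh] \<phi>(2)])
      show "(\<lambda>k. sqrt P * nrm M (cgrad (\<phi> k))) \<longlonglongrightarrow> sqrt P * nrm M h"
        by (intro tendsto_intros nrm_tendsto[OF test_sq(2)[OF \<phi>(1)] HP_sq(2)[OF vh] \<phi>(3)])
    qed (use t \<phi>(1) in auto)
  qed
  thus ?thesis using that[of "sqrt P"] P by simp
qed

text \<open>Mean square convergence of the approximating test functions gives a subsequence
  converging almost everywhere; Fatou along it yields both integrability and the inequality.\<close>

lemma HP_sobolev:
  assumes q: "2 < q" "below_crit CARD('n) q"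
  obtains C where "C > 0" "\<And>v h. HP v h \<Longrightarrow> integrable M (\<lambda>x. \<bar>v x\<bar> powr q)"
    "\<And>v h. HP v h \<Longrightarrow> (\<integral>x. \<bar>v x\<bar> powr q \<partial>M) \<le> C * nrm M h powr q"
proof -
  obtain C where C: "C > 0" "\<And>g G. C1z \<Omega> g G \<Longrightarrow>
      (\<integral>x. \<bar>g x\<bar> powr q \<partial>lborel) \<le> C * (\<integral>x. (norm (G x))\<^sup>2 \<partial>lborel) powr (q / 2)"
    using sobolev_inequality[OF bounded_dom q] by blast
  have t: "integrable M (\<lambda>x. \<bar>\<phi> x\<bar> powr q)" "(\<integral>x. \<bar>\<phi> x\<bar> powr q \<partial>M) \<le> C * nrm M (cgrad \<phi>) powr q"
    if "test_fun \<Omega> \<phi>" for \<phi>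
  proof -
    note c = test_fun_C1z[OF that]
    have [measurable]: "\<phi> \<in> borel_measurable borel" by (rule C1zD(6)[OF c])
    have z: "x \<notin> \<Omega> \<Longrightarrow> \<bar>\<phi> x\<bar> powr q = 0" for x using C1zD(4)[OF c] by simp
    have i: "integrable lborel (\<lambda>x. \<bar>\<phi> x\<bar> powr q)"
      by (rule integrable_continuous_vanish[OF _ z bounded_dom])
         (use q in \<open>auto intro!: continuous_intros continuous_on_powr' C1zD(3)[OF c]\<close>)
    show "integrable M (\<lambda>x. \<bar>\<phi> x\<bar> powr q)" using i by (subst integrable_M_lborel) (auto simp: z)
    have "(\<integral>x. \<bar>\<phi> x\<bar> powr q \<partial>M) = (\<integral>x. \<bar>\<phi> x\<bar> powr q \<partial>lborel)" by (rule integral_M_lborel) (auto simp: z)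
    also have "\<dots> \<le> C * ((nrm M (cgrad \<phi>))\<^sup>2) powr (q / 2)" using C(2)[OF c] by (simp add: C1z_nrm(2)[OF c])
    also have "((nrm M (cgrad \<phi>))\<^sup>2) powr (q / 2) = nrm M (cgrad \<phi>) powr q"
      using nrm_nonneg[of M "cgrad \<phi>"] by (simp add: powr_powr flip: powr_numeral)
    finally show "(\<integral>x. \<bar>\<phi> x\<bar> powr q \<partial>M) \<le> C * nrm M (cgrad \<phi>) powr q" .
  qed
  have main: "(\<integral>\<^sup>+x. ennreal (\<bar>v x\<bar> powr q) \<partial>M) \<le> ennreal (C * nrm M h powr q)" if vh: "HP v h" for v h
  proof -
    have [measurable]: "v \<in> borel_measurable M" using HP_sq(1)[OF vh] by (simp add: sq_def)
    obtain \<phi> where \<phi>: "\<And>k. test_fun \<Omega> (\<phi> k)" "(\<lambda>k. nrm M (\<lambda>x. \<phi> k x - v x)) \<longlonglongrightarrow> 0"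
      "(\<lambda>k. nrm M (\<lambda>x. cgrad (\<phi> k) x - h x)) \<longlonglongrightarrow> 0" using HP_approx[OF vh] by blast
    have [measurable]: "\<phi> k \<in> borel_measurable M" for k using test_sq(1)[OF \<phi>(1)] by (simp add: sq_def)
    obtain r where r: "strict_mono (r :: nat \<Rightarrow> nat)" "AE x in M. (\<lambda>n. \<phi> (r n) x) \<longlonglongrightarrow> v x"
      using nrm_tendsto_AE_subseq[OF test_sq(1)[OF \<phi>(1)] HP_sq(1)[OF vh] \<phi>(2)] by blast
    have "(\<integral>\<^sup>+x. ennreal (\<bar>v x\<bar> powr q) \<partial>M) = (\<integral>\<^sup>+x. liminf (\<lambda>n. ennreal (\<bar>\<phi> (r n) x\<bar> powr q)) \<partial>M)"
    proof (rule nn_integral_cong_AE)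
      from r(2) show "AE x in M. ennreal (\<bar>v x\<bar> powr q) = liminf (\<lambda>n. ennreal (\<bar>\<phi> (r n) x\<bar> powr q))"
      proof eventually_elim
        case (elim x)
        have "(\<lambda>n. ennreal (\<bar>\<phi> (r n) x\<bar> powr q)) \<longlonglongrightarrow> ennreal (\<bar>v x\<bar> powr q)"
          by (intro tendsto_ennrealI tendsto_powr' tendsto_rabs elim tendsto_const) (use q in auto)
        from lim_imp_Liminf[OF _ this] show ?case by simp
      qed
    qed
    also have "\<dots> \<le> liminf (\<lambda>n. \<integral>\<^sup>+x. ennreal (\<bar>\<phi> (r n) x\<bar> powr q) \<partial>M)" by (rule nn_integral_liminf) measurable
    also have "\<dots> \<le> liminf (\<lambda>n. ennreal (C * nrm M (cgrad (\<phi> (r n))) powr q))"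
    proof (intro Liminf_mono always_eventually allI)
      fix n
      show "(\<integral>\<^sup>+x. ennreal (\<bar>\<phi> (r n) x\<bar> powr q) \<partial>M) \<le> ennreal (C * nrm M (cgrad (\<phi> (r n))) powr q)"
        using t[OF \<phi>(1)[of "r n"]] by (subst nn_integral_eq_integral) (auto intro: ennreal_leI)
    qed
    also have "\<dots> = ennreal (C * nrm M h powr q)"
    proof (rule lim_imp_Liminf)
      have "(\<lambda>k. nrm M (cgrad (\<phi> k))) \<longlonglongrightarrow> nrm M h"
        by (rule nrm_tendsto[OF test_sq(2)[OF \<phi>(1)] HP_sq(2)[OF vh] \<phi>(3)])
      from LIMSEQ_subseq_LIMSEQ[OF this r(1)]
      show "(\<lambda>n. ennreal (C * nrm M (cgrad (\<phi> (r n))) powr q)) \<longlonglongrightarrow> ennreal (C * nrm M h powr q)"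
        by (intro tendsto_ennrealI tendsto_intros tendsto_powr') (use q in \<open>auto simp: o_def nrm_nonneg intro!: always_eventually\<close>)
    qed simp
    finally show ?thesis .
  qed
  have i: "integrable M (\<lambda>x. \<bar>v x\<bar> powr q)" if vh: "HP v h" for v h
  proof (rule integrableI_bounded)
    have [measurable]: "v \<in> borel_measurable M" using HP_sq(1)[OF vh] by (simp add: sq_def)
    show "(\<lambda>x. \<bar>v x\<bar> powr q) \<in> borel_measurable M" by measurable
    show "(\<integral>\<^sup>+x. ennreal (norm (\<bar>v x\<bar> powr q)) \<partial>M) < \<infinity>"
      using le_less_trans[OF main[OF vh] ennreal_less_top] by simp
  qed
  moreover have "(\<integral>x. \<bar>v x\<bar> powr q \<partial>M) \<le> C * nrm M h powr q" if vh: "HP v h" for v h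
    using main[OF vh] nn_integral_eq_integral[OF i[OF vh]] C(1) by (simp add: ennreal_le_iff)
  ultimately show ?thesis using that C(1) by blast
qed

end

lemma sq_component:
  fixes g :: "'a \<Rightarrow> real^'n"
  assumes "sq M g" shows "sq M (\<lambda>x. g x $ i)"
proof -
  have c: "(\<lambda>x::real^'n. x $ i) \<in> borel_measurable borel"
    by (intro borel_measurable_continuous_onI continuous_intros)
  have [measurable]: "g \<in> borel_measurable M" using assms by (simp add: sq_def)
  have m: "(\<lambda>x. g x $ i) \<in> borel_measurable M" using measurable_compose[OF _ c] by measurable
  have "integrable M (\<lambda>x. (norm (g x $ i))\<^sup>2)"
  proof (rule Bochner_Integration.integrable_bound[OF sqD(2)[OF assms]])
    show "(\<lambda>x. (norm (g x $ i))\<^sup>2) \<in> borel_measurable M" using m by measurable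
    show "AE x in M. norm ((norm (g x $ i))\<^sup>2) \<le> norm ((norm (g x))\<^sup>2)"
      by (intro AE_I2) (simp, metis abs_ge_zero component_le_norm_cart power2_abs power_mono)
  qed
  thus ?thesis using m by (simp add: sq_def)
qed

lemma sq_mult_integrable:
  fixes f g :: "'a \<Rightarrow> real"
  shows "sq M f \<Longrightarrow> sq M g \<Longrightarrow> integrable M (\<lambda>x. f x * g x)"
  using sq_inner[of M f g] by (simp add: mult.commute)

section \<open>Weak gradients: existence and uniqueness\<close>

context bounded_domain
begin

text \<open>The product of two test functions is a test function, and its partial derivatives have
  integral 0.\<close>

lemma test_integration_by_parts:
  assumes \<phi>: "test_fun \<Omega> \<phi>" and \<psi>: "test_fun \<Omega> \<psi>"
  shows "(\<integral>x. \<phi> x * pdx \<psi> i x \<partial>M) = - (\<integral>x. cgrad \<phi> x $ i * \<psi> x \<partial>M)"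
proof -
  have p: "test_fun \<Omega> (\<lambda>x. \<phi> x * \<psi> x)" by (rule test_fun_mult[OF \<psi> test_funD(1)[OF \<phi>]])
  have g: "cgrad (\<lambda>x. \<phi> x * \<psi> x) x = \<phi> x *\<^sub>R cgrad \<psi> x + \<psi> x *\<^sub>R cgrad \<phi> x" for x
    by (intro GDERIV_imp_cgrad GDERIV_mult test_funD(4)[OF \<phi>] test_funD(4)[OF \<psi>])
  note c = test_fun_C1z[OF p]
  have [measurable]: "(\<lambda>x. cgrad (\<lambda>x. \<phi> x * \<psi> x) x $ i) \<in> borel_measurable borel"
    by (intro borel_measurable_continuous_onI continuous_on_component C1zD(2)[OF c])
  have "(\<integral>x. cgrad (\<lambda>x. \<phi> x * \<psi> x) x $ i \<partial>M) = (\<integral>x. cgrad (\<lambda>x. \<phi> x * \<psi> x) x $ i \<partial>lborel)"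
    by (rule integral_M_lborel) (auto simp: C1zD(5)[OF c])
  also have "\<dots> = 0" by (rule integral_partial_derivative_zero[OF c bounded_dom])
  finally have "0 = (\<integral>x. \<phi> x * pdx \<psi> i x + cgrad \<phi> x $ i * \<psi> x \<partial>M)"
    by (simp add: g pdx_eq_cgrad mult.commute)
  also have "\<dots> = (\<integral>x. \<phi> x * pdx \<psi> i x \<partial>M) + (\<integral>x. cgrad \<phi> x $ i * \<psi> x \<partial>M)"
    unfolding pdx_eq_cgrad
    by (intro Bochner_Integration.integral_add sq_mult_integrable sq_component test_sq \<phi> \<psi>)
  finally show ?thesis by simp
qed

lemma HP_weak_gradient:
  assumes vh: "HP v h" shows "weak_gradient \<Omega> v h"
  unfolding weak_gradient_def set_integrable_M set_integral_M
proof (intro allI impI conjI)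
  fix \<psi> i assume \<psi>: "test_fun \<Omega> \<psi>"
  have s: "sq M (\<lambda>x. pdx \<psi> i x)" unfolding pdx_eq_cgrad by (intro sq_component test_sq \<psi>)
  show "integrable M (\<lambda>x. v x * pdx \<psi> i x)" by (intro sq_mult_integrable HP_sq[OF vh] s)
  show "integrable M (\<lambda>x. h x $ i * \<psi> x)" by (intro sq_mult_integrable sq_component HP_sq[OF vh] test_sq \<psi>)
  obtain \<phi> where \<phi>: "\<And>k. test_fun \<Omega> (\<phi> k)" "(\<lambda>k. nrm M (\<lambda>x. \<phi> k x - v x)) \<longlonglongrightarrow> 0"
    "(\<lambda>k. nrm M (\<lambda>x. cgrad (\<phi> k) x - h x)) \<longlonglongrightarrow> 0" using HP_approx[OF vh] by blast
  \<comment> \<open>A component of a gradient is an inner product with a unit vector; this form lets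
    \<open>inner_tendsto\<close> handle the vector side.\<close>
  define a :: "real^'n" where "a = axis i 1"
  have e: "z \<bullet> (c *\<^sub>R a) = z $ i * c" for z :: "real^'n" and c
    by (simp add: a_def inner_axis)
  have sa: "sq M (\<lambda>x. \<psi> x *\<^sub>R a)"
  proof -
    have [measurable]: "\<psi> \<in> borel_measurable M" using test_sq(1)[OF \<psi>] by (simp add: sq_def)
    show ?thesis using test_sq(1)[OF \<psi>] by (simp add: sq_def power_mult_distrib)
  qed
  have "(\<lambda>k. \<integral>x. \<phi> k x \<bullet> pdx \<psi> i x \<partial>M) \<longlonglongrightarrow> (\<integral>x. v x \<bullet> pdx \<psi> i x \<partial>M)"
    by (rule inner_tendsto[OF test_sq(1)[OF \<phi>(1)] HP_sq(1)[OF vh] \<phi>(2) s s]) (simp add: nrm_def)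
  moreover have "(\<lambda>k. \<integral>x. cgrad (\<phi> k) x \<bullet> (\<psi> x *\<^sub>R a) \<partial>M) \<longlonglongrightarrow> (\<integral>x. h x \<bullet> (\<psi> x *\<^sub>R a) \<partial>M)"
    by (rule inner_tendsto[OF test_sq(2)[OF \<phi>(1)] HP_sq(2)[OF vh] \<phi>(3) sa sa]) (simp add: nrm_def)
  ultimately have "(\<lambda>k. \<integral>x. \<phi> k x * pdx \<psi> i x \<partial>M) \<longlonglongrightarrow> (\<integral>x. v x * pdx \<psi> i x \<partial>M)"
    "(\<lambda>k. - (\<integral>x. cgrad (\<phi> k) x $ i * \<psi> x \<partial>M)) \<longlonglongrightarrow> - (\<integral>x. h x $ i * \<psi> x \<partial>M)"
    by (auto simp only: e inner_real_def intro: tendsto_minus)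
  thus "(\<integral>x. v x * pdx \<psi> i x \<partial>M) = - (\<integral>x. h x $ i * \<psi> x \<partial>M)"
    unfolding test_integration_by_parts[OF \<phi>(1) \<psi>] by (rule LIMSEQ_unique)
qed

lemma L2_on_iff: "L2_on \<Omega> u \<longleftrightarrow> sq M u"
  by (simp add: L2_on_def sq_real set_borel_measurable_M set_integrable_M)

lemma L2v_on_iff: "L2v_on \<Omega> g \<longleftrightarrow> sq M g"
  by (simp add: L2v_on_def sq_def set_borel_measurable_M set_integrable_M)

lemma HP_H1_grad: "HP v h \<Longrightarrow> H1_grad \<Omega> v h"
  by (simp add: H1_grad_def L2_on_iff L2v_on_iff HP_sq HP_weak_gradient)

lemma H1_dist2_eq:
  assumes "sq M u" "sq M g" "sq M v" "sq M h"
  shows "H1_dist2 \<Omega> u g v h = (nrm M (\<lambda>x. u x - v x))\<^sup>2 + (nrm M (\<lambda>x. g x - h x))\<^sup>2"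
proof -
  have "H1_dist2 \<Omega> u g v h = (\<integral>x. (norm (u x - v x))\<^sup>2 + (norm (g x - h x))\<^sup>2 \<partial>M)"
    by (simp add: H1_dist2_def set_integral_M)
  also have "\<dots> = (nrm M (\<lambda>x. u x - v x))\<^sup>2 + (nrm M (\<lambda>x. g x - h x))\<^sup>2"
    unfolding nrm_square by (intro Bochner_Integration.integral_add sqD(2) sq_diff assms)
  finally show ?thesis .
qed

lemma HP_imp_H10:
  assumes vh: "HP v h" shows "H10 \<Omega> v"
proof -
  obtain \<phi> where \<phi>: "\<And>k. test_fun \<Omega> (\<phi> k)" "(\<lambda>k. nrm M (\<lambda>x. \<phi> k x - v x)) \<longlonglongrightarrow> 0"
    "(\<lambda>k. nrm M (\<lambda>x. cgrad (\<phi> k) x - h x)) \<longlonglongrightarrow> 0" using HP_approx[OF vh] by blast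
  have "(\<lambda>k. (nrm M (\<lambda>x. \<phi> k x - v x))\<^sup>2 + (nrm M (\<lambda>x. cgrad (\<phi> k) x - h x))\<^sup>2) \<longlonglongrightarrow> 0\<^sup>2 + 0\<^sup>2"
    by (intro tendsto_intros \<phi>)
  hence "(\<lambda>k. H1_dist2 \<Omega> (\<phi> k) (cgrad (\<phi> k)) v h) \<longlonglongrightarrow> 0"
    by (simp add: H1_dist2_eq test_sq[OF \<phi>(1)] HP_sq[OF vh])
  thus ?thesis using HP_H1_grad[OF vh] \<phi>(1) unfolding H10_def by blast
qed

text \<open>The squared distance in \<open>H10\<close> dominates each of the two squared seminorms,
  so its approximating sequence serves for the closure as well.\<close>

lemma H10_imp_HP:
  assumes "H10 \<Omega> v" obtains g where "HP v g"
proof -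
  obtain g \<phi> where g: "H1_grad \<Omega> v g" and \<phi>: "\<And>k. test_fun \<Omega> (\<phi> k)"
    "(\<lambda>k. H1_dist2 \<Omega> (\<phi> k) (cgrad (\<phi> k)) v g) \<longlonglongrightarrow> 0"
    using assms unfolding H10_def by blast
  have s: "sq M v" "sq M g" using g by (simp_all add: H1_grad_def L2_on_iff L2v_on_iff)
  have l: "(\<lambda>k. (nrm M (\<lambda>x. \<phi> k x - v x))\<^sup>2 + (nrm M (\<lambda>x. cgrad (\<phi> k) x - g x))\<^sup>2) \<longlonglongrightarrow> 0"
    using \<phi>(2) by (simp add: H1_dist2_eq test_sq[OF \<phi>(1)] s)
  have *: "a \<longlonglongrightarrow> 0" if "\<And>k. 0 \<le> a k" "\<And>k. (a k)\<^sup>2 \<le> (nrm M (\<lambda>x. \<phi> k x - v x))\<^sup>2 + (nrm M (\<lambda>x. cgrad (\<phi> k) x - g x))\<^sup>2"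
    for a :: "nat \<Rightarrow> real"
  proof -
    have "(\<lambda>k. (a k)\<^sup>2) \<longlonglongrightarrow> 0"
      by (rule tendsto_sandwich[OF _ _ tendsto_const l]) (use that in auto)
    hence "(\<lambda>k. sqrt ((a k)\<^sup>2)) \<longlonglongrightarrow> sqrt 0" by (rule tendsto_real_sqrt)
    thus ?thesis using that(1) by simp
  qed
  have "(\<lambda>k. nrm M (\<lambda>x. \<phi> k x - v x)) \<longlonglongrightarrow> 0" "(\<lambda>k. nrm M (\<lambda>x. cgrad (\<phi> k) x - g x)) \<longlonglongrightarrow> 0"
    by (rule *; simp add: nrm_nonneg)+
  hence "HP v g" by (rule HP_closed[OF HP_test[OF \<phi>(1)] s])
  thus ?thesis by (rule that)
qed

lemma du_bois_reymond_box:
  assumes w: "sq M w" and 0: "\<And>\<phi>. test_fun \<Omega> \<phi> \<Longrightarrow> (\<integral>x. w x * \<phi> x \<partial>M) = 0"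
    and ab: "cbox a b \<subseteq> \<Omega>"
  shows "(\<integral>x. w x * indicator (box a b) x \<partial>M) = 0"
proof -
  obtain \<eta> where \<eta>: "\<And>k. test_fun \<Omega> (\<eta> k)" "\<And>k x. \<eta> k x \<in> {0..1}"
    "\<And>x. (\<lambda>k. \<eta> k x) \<longlonglongrightarrow> indicator (box a b) x"
    using box_cutoffs[OF ab] by blast
  have [measurable]: "w \<in> borel_measurable M" using w by (simp add: sq_def)
  have [measurable]: "\<eta> k \<in> borel_measurable M" for k using test_sq(1)[OF \<eta>(1)] by (simp add: sq_def)
  have [measurable]: "(indicator (box a b) :: _ \<Rightarrow> real) \<in> borel_measurable M" by (rule borel_measurable_M) simp
  have "(\<lambda>k. \<integral>x. w x * \<eta> k x \<partial>M) \<longlonglongrightarrow> (\<integral>x. w x * indicator (box a b) x \<partial>M)"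
  proof (rule integral_dominated_convergence[where w="\<lambda>x. norm (w x)"])
    show "integrable M (\<lambda>x. norm (w x))" by (rule integrable_norm[OF sq_integrable[OF finite_M w]])
    show "AE x in M. norm (w x * \<eta> k x) \<le> norm (w x)" for k
      using \<eta>(2)[of k] by (intro AE_I2) (auto simp: abs_mult mult_left_le)
    show "AE x in M. (\<lambda>k. w x * \<eta> k x) \<longlonglongrightarrow> w x * indicator (box a b) x"
      by (intro AE_I2 tendsto_intros \<eta>)
  qed measurable
  moreover have "(\<integral>x. w x * \<eta> k x \<partial>M) = 0" for k by (rule 0[OF \<eta>(1)])
  ultimately show ?thesis by (simp add: LIMSEQ_const_iff)
qed

text \<open>Cutoffs give integral 0 over open boxes. Boxes are stable under intersection and
  generate the Borel sets, so inside a fixed box all Borel sets have integral 0 and the integrand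
  vanishes there. Countably many boxes exhaust \<Omega>.\<close>

lemma du_bois_reymond:
  assumes w: "sq M w" and 0: "\<And>\<phi>. test_fun \<Omega> \<phi> \<Longrightarrow> (\<integral>x. w x * \<phi> x \<partial>M) = 0"
  shows "AE x in M. w x = 0"
proof -
  define f where "f x = indicator \<Omega> x *\<^sub>R w x" for x
  have fi: "integrable lebesgue f"
    using sq_integrable[OF finite_M w] unfolding f_def by (simp add: integrable_restrict_space[OF dom_sets(3)])
  have fm[measurable]: "f \<in> borel_measurable lebesgue" using fi by auto
  \<comment> \<open>Boxes generate only the Borel sets, while \<open>w\<close> is Lebesgue
    measurable; its extension by 0 is therefore replaced by a Borel representative.\<close>
  obtain g where gm[measurable]: "g \<in> borel_measurable lborel" and fg: "AE x in lborel. f x = g x"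
    using completion_ex_borel_measurable_real[OF fm] by blast
  have fg': "AE x in lebesgue. f x = g x" by (rule AE_completion[OF fg])
  have gm': "g \<in> borel_measurable lebesgue" by (rule measurable_completion[OF gm])
  have "integrable lebesgue g" by (rule iffD1[OF integrable_cong_AE[OF fm gm' fg'] fi])
  hence gi: "integrable lborel g" by (simp add: integrable_completion)
  have loc: "AE x in lborel. x \<in> box a b \<longrightarrow> g x = 0" if ab: "cbox a b \<subseteq> \<Omega>" for a b
  proof -
    define g0 where "g0 x = indicator (box a b) x *\<^sub>R g x" for x
    have g0i: "integrable lborel g0" unfolding g0_def by (rule integrable_mult_indicator[OF _ gi]) simp
    have sub: "(\<integral>x. indicator (box c d) x * g x \<partial>lborel) = 0" if cd: "box c d \<subseteq> box a b" for c d
    proof (cases "box c d = {}")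
      case False
      have "cbox c d = closure (box c d)" using False by simp
      also have "\<dots> \<subseteq> cbox a b" by (rule closure_minimal) (use cd box_subset_cbox in \<open>auto\<close>)
      finally have cd': "cbox c d \<subseteq> \<Omega>" using ab by simp
      have "(\<integral>x. indicator (box c d) x * g x \<partial>lborel) = (\<integral>x. indicator (box c d) x * g x \<partial>lebesgue)"
        by (rule integral_completion[symmetric]) measurable
      also have "\<dots> = (\<integral>x. indicator (box c d) x * f x \<partial>lebesgue)"
      proof (rule integral_cong_AE)
        show "(\<lambda>x. indicator (box c d) x * g x) \<in> borel_measurable lebesgue"
          by (intro borel_measurable_times borel_measurable_indicator gm') auto
        show "AE x in lebesgue. indicator (box c d) x * g x = indicator (box c d) x * f x" using fg' by eventually_elim simp
      qed (intro borel_measurable_times borel_measurable_indicator fm, auto)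
      also have "\<dots> = (\<integral>x. indicator \<Omega> x *\<^sub>R (w x * indicator (box c d) x) \<partial>lebesgue)"
        by (intro Bochner_Integration.integral_cong) (auto simp: f_def)
      also have "\<dots> = (\<integral>x. w x * indicator (box c d) x \<partial>M)" by (rule integral_restrict_space[symmetric, OF dom_sets(3)])
      also have "\<dots> = 0" by (rule du_bois_reymond_box[OF w 0 cd'])
      finally show ?thesis .
    qed simp
    \<comment> \<open>Dynkin induction: a box meets the fixed box in a box, and complements are
      handled because the total integral is 0.\<close>
    have J: "(LINT x:A|lborel. g0 x) = 0" if "A \<in> sets borel" for A
    proof -
      have si: "set_integrable lborel A g0" if "A \<in> sets borel" for A
        unfolding set_integrable_def by (rule integrable_mult_indicator[OF _ g0i]) (use that in simp)
      have "A \<in> sigma_sets UNIV (range (\<lambda>(a, b). box a b))"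
        using that unfolding borel_eq_box by simp
      thus ?thesis
      proof (induction rule: sigma_sets_induct_disjoint[rotated 2, consumes 1])
        case 5
        show ?case by (auto simp: Int_stable_def box_Int_box)
      next
        case 6 show ?case by simp
      next
        case (1 A)
        then obtain c d where A: "A = box c d" by auto
        obtain c' d' where e: "box c d \<inter> box a b = box c' d'" by (rule that[OF box_Int_box])
        have "(LINT x:A|lborel. g0 x) = (\<integral>x. indicator (box c' d') x * g x \<partial>lborel)"
          unfolding set_lebesgue_integral_def g0_def A e[symmetric]
          by (intro Bochner_Integration.integral_cong) (auto simp: indicator_def)
        also have "\<dots> = 0" by (rule sub) (use e in auto)
        finally show ?case .
      next
        case 2 show ?case by (simp add: set_lebesgue_integral_def)
      next
        case (3 A)
        have A: "A \<in> sets borel" using 3 by (simp add: borel_eq_box)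
        have "(LINT x:UNIV|lborel. g0 x) = (\<integral>x. indicator (box a b) x * g x \<partial>lborel)"
          by (simp add: set_lebesgue_integral_def g0_def)
        also have "\<dots> = 0" by (rule sub) simp
        finally have u: "(LINT x:UNIV|lborel. g0 x) = 0" .
        have "(LINT x:UNIV|lborel. g0 x) = (LINT x:A|lborel. g0 x) + (LINT x:UNIV - A|lborel. g0 x)"
          using set_integral_Un[of A "UNIV - A" lborel g0] si A by (simp add: Un_Diff_cancel)
        with u 3 show ?case by simp
      next
        case (4 A)
        have A: "\<And>i. A i \<in> sets borel" using 4 by (auto simp: borel_eq_box)
        have "(LINT x:(\<Union>i. A i)|lborel. g0 x) = (\<Sum>i. (LINT x:(A i)|lborel. g0 x))"
          by (rule lebesgue_integral_countable_add) (use A 4 si in \<open>auto simp: disjoint_family_on_def\<close>)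
        thus ?case using 4 by simp
      qed
    qed
    have "AE x in lborel. g0 x = 0"
      by (rule density_unique_real[OF g0i]) (use J in \<open>auto simp: set_lebesgue_integral_def\<close>)
    thus ?thesis by eventually_elim (auto simp: g0_def)
  qed
  obtain \<D> where \<D>: "countable \<D>" "\<And>X. X \<in> \<D> \<Longrightarrow> X \<subseteq> \<Omega>"
    "\<And>X. X \<in> \<D> \<Longrightarrow> \<exists>a b. X = cbox a b" "\<Union>\<D> = \<Omega>"
    by (rule open_countable_Union_open_cbox[OF open_dom]) (rule that, auto)
  have "AE x in lebesgue. \<forall>X\<in>\<D>. x \<in> X \<longrightarrow> f x = 0"
  proof (rule AE_ball_countable[THEN iffD2, OF \<D>(1)], rule ballI)
    fix X assume X: "X \<in> \<D>"
    then obtain a b where ab: "X = cbox a b" "X \<subseteq> \<Omega>" using \<D>(2,3) by blast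
    \<comment> \<open>The covering is by closed boxes, the local statement concerns open ones; the
      boundary between them is negligible.\<close>
    have "cbox a b - box a b \<in> null_sets lebesgue"
      using negligible_frontier_interval negligible_iff_null_sets by blast
    hence "AE x in lebesgue. x \<notin> cbox a b - box a b" by (rule AE_not_in)
    moreover have "AE x in lebesgue. x \<in> box a b \<longrightarrow> g x = 0"
      by (rule AE_completion[OF loc]) (use ab in simp)
    ultimately show "AE x in lebesgue. x \<in> X \<longrightarrow> f x = 0" using fg'
      by eventually_elim (auto simp: ab(1))
  qed
  hence "AE x in lebesgue. x \<in> \<Omega> \<longrightarrow> w x = 0"
  proof eventually_elim
    case (elim x)
    show ?case
    proof
      assume x: "x \<in> \<Omega>"
      then obtain X where "X \<in> \<D>" "x \<in> X" using \<D>(4) by auto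
      hence "f x = 0" using elim by blast
      thus "w x = 0" using x by (simp add: f_def)
    qed
  qed
  thus ?thesis by (subst AE_restrict_space_iff[OF dom_sets(3)])
qed

lemma weak_gradient_unique:
  assumes "H1_grad \<Omega> v g" "H1_grad \<Omega> v h"
  shows "AE x in M. g x = h x"
proof -
  have s: "sq M g" "sq M h" using assms by (simp_all add: H1_grad_def L2v_on_iff)
  have "AE x in M. g x $ i - h x $ i = 0" for i
  proof (rule du_bois_reymond)
    show "sq M (\<lambda>x. g x $ i - h x $ i)" by (intro sq_diff sq_component s)
    fix \<phi> assume \<phi>: "test_fun \<Omega> \<phi>"
    have i: "integrable M (\<lambda>x. g x $ i * \<phi> x)" "integrable M (\<lambda>x. h x $ i * \<phi> x)"
      by (intro sq_mult_integrable sq_component s test_sq \<phi>)+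
    have ibp: "(\<integral>x. v x * pdx \<phi> i x \<partial>M) = - (\<integral>x. k x $ i * \<phi> x \<partial>M)" if "H1_grad \<Omega> v k" for k
      using that \<phi> unfolding H1_grad_def weak_gradient_def set_integral_M by blast
    have "(\<integral>x. g x $ i * \<phi> x \<partial>M) = (\<integral>x. h x $ i * \<phi> x \<partial>M)"
      using ibp[OF assms(1)] ibp[OF assms(2)] by simp
    thus "(\<integral>x. (g x $ i - h x $ i) * \<phi> x \<partial>M) = 0" using i by (simp add: left_diff_distrib)
  qed
  hence "AE x in M. \<forall>i. g x $ i - h x $ i = 0" by (simp add: AE_all_countable)
  thus ?thesis by eventually_elim (simp add: vec_eq_iff)
qed

text \<open>Uniqueness identifies the gradient picked by \<open>SOME\<close> in \<open>wgrad\<close>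
  with the one carried along. Together with the two lemmas that follow, this translates the
  definitions of the statement into \<open>HP\<close>.\<close>

lemma HP_wgrad_AE:
  assumes "HP v h" shows "AE x in M. wgrad \<Omega> v x = h x"
proof -
  have "H1_grad \<Omega> v (wgrad \<Omega> v)" unfolding wgrad_def by (rule someI[of "H1_grad \<Omega> v", OF HP_H1_grad[OF assms]])
  thus ?thesis by (rule weak_gradient_unique[OF _ HP_H1_grad[OF assms]])
qed

lemma HP_wgrad:
  assumes "HP v h" shows "HP v (wgrad \<Omega> v)"
proof (rule HP_cong_AE[OF assms])
  have "H1_grad \<Omega> v (wgrad \<Omega> v)" unfolding wgrad_def by (rule someI[of "H1_grad \<Omega> v", OF HP_H1_grad[OF assms]])
  thus "wgrad \<Omega> v \<in> borel_measurable M" by (simp add: H1_grad_def L2v_on_iff sq_def)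
  show "AE x in M. h x = wgrad \<Omega> v x" using HP_wgrad_AE[OF assms] by eventually_elim simp
qed (use HP_sq(1)[OF assms] in \<open>auto simp: sq_def\<close>)

lemma H10_iff: "H10 \<Omega> v \<longleftrightarrow> HP v (wgrad \<Omega> v)"
  using H10_imp_HP HP_wgrad HP_imp_H10 by metis

end

section \<open>The power nonlinearity\<close>

text \<open>Mean value theorem for nonnegative arguments; the derivative at the intermediate point
  is bounded by its value at the larger end, hence by the symmetric sum.\<close>

lemma powr_diff_le:
  fixes a b r :: real
  assumes "r > 1"
  shows "\<bar>\<bar>a\<bar> powr r - \<bar>b\<bar> powr r\<bar> \<le> r * ((\<bar>a\<bar> powr (r - 1) + \<bar>b\<bar> powr (r - 1)) * \<bar>a - b\<bar>)"
proof -
  have *: "A powr r - B powr r \<le> r * ((A powr (r - 1) + B powr (r - 1)) * (A - B))" if AB: "0 \<le> B" "B < A" for A B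
  proof -
    have "\<exists>l z. B < z \<and> z < A \<and> ((\<lambda>t. t powr r) has_real_derivative l) (at z) \<and> A powr r - B powr r = (A - B) * l"
    proof (rule MVT[OF AB(2)])
      show "continuous_on {B..A} (\<lambda>t. t powr r)"
        using AB assms by (intro continuous_on_powr' continuous_intros) auto
      show "(\<lambda>t. t powr r) differentiable (at x)" if "B < x" "x < A" for x
        using that AB has_real_derivative_powr[of x r] real_differentiable_def by auto
    qed
    then obtain l z where z: "B < z" "z < A" "((\<lambda>t. t powr r) has_real_derivative l) (at z)"
      "A powr r - B powr r = (A - B) * l" by blast
    have "l = r * z powr (r - 1)" using z(3) has_real_derivative_powr[of z r] z AB DERIV_unique by fastforce
    also have "\<dots> \<le> r * (A powr (r - 1) + B powr (r - 1))"
    proof (rule mult_left_mono)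
      have "z powr (r - 1) \<le> A powr (r - 1)" using z AB assms by (intro powr_mono2) auto
      thus "z powr (r - 1) \<le> A powr (r - 1) + B powr (r - 1)" using powr_ge_zero[of B "r - 1"] by linarith
    qed (use assms in simp)
    finally have "(A - B) * l \<le> (A - B) * (r * (A powr (r - 1) + B powr (r - 1)))" using AB by (intro mult_left_mono) auto
    thus ?thesis using z(4) by (simp add: mult_ac)
  qed
  have **: "\<bar>A powr r - B powr r\<bar> \<le> r * ((A powr (r - 1) + B powr (r - 1)) * \<bar>A - B\<bar>)" if "0 \<le> A" "0 \<le> B" for A B
  proof (cases A B rule: linorder_cases)
    case less
    with *[of A B] powr_mono2[of r A B] that assms show ?thesis by (simp add: add.commute)
  next
    case greater
    with *[of B A] powr_mono2[of r B A] that assms show ?thesis by simp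
  qed (use assms in simp)
  have "\<bar>\<bar>a\<bar> powr r - \<bar>b\<bar> powr r\<bar> \<le> r * ((\<bar>a\<bar> powr (r - 1) + \<bar>b\<bar> powr (r - 1)) * \<bar>\<bar>a\<bar> - \<bar>b\<bar>\<bar>)"
    by (rule **) auto
  also have "\<dots> \<le> r * ((\<bar>a\<bar> powr (r - 1) + \<bar>b\<bar> powr (r - 1)) * \<bar>a - b\<bar>)"
    using assms by (intro mult_left_mono) auto
  finally show ?thesis .
qed

text \<open>The defect at the midpoint is a difference of two mean slopes, one for each half
  interval, hence a second derivative times a quantity of at most (a - b)^2. Both signs are bounded
  because \<open>\<mu>\<close> may have either sign.\<close>

lemma powr_midpoint_gap:
  fixes a b r :: real
  assumes r: "r > 2" and "0 \<le> a" "0 \<le> b"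
  shows "\<bar>a powr r / 2 + b powr r / 2 - ((a + b) / 2) powr r\<bar>
    \<le> r * (r - 1) * ((a powr (r - 2) + b powr (r - 2)) * (a - b)\<^sup>2)"
proof -
  have *: "\<bar>a powr r / 2 + b powr r / 2 - ((a + b) / 2) powr r\<bar>
    \<le> r * (r - 1) * ((a powr (r - 2) + b powr (r - 2)) * (a - b)\<^sup>2)" if ab: "0 \<le> b" "b < a" for a b
  proof -
    define m where "m = (a + b) / 2"
    have m: "b < m" "m < a" using ab by (auto simp: m_def)
    have mvt: "\<exists>z. x < z \<and> z < y \<and> y powr s - x powr s = (y - x) * (s * z powr (s - 1))"
      if xy: "0 \<le> x" "x < y" and s: "s > 0" for x y s :: real
    proof -
      have "\<exists>l z. x < z \<and> z < y \<and> ((\<lambda>t. t powr s) has_real_derivative l) (at z) \<and> y powr s - x powr s = (y - x) * l"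
      proof (rule MVT[OF xy(2)])
        show "continuous_on {x..y} (\<lambda>t. t powr s)"
          using xy s by (intro continuous_on_powr' continuous_intros) auto
        show "(\<lambda>t. t powr s) differentiable (at z)" if "x < z" "z < y" for z
          using that xy has_real_derivative_powr[of z s] real_differentiable_def by auto
      qed
      then obtain l z where z: "x < z" "z < y" "((\<lambda>t. t powr s) has_real_derivative l) (at z)"
        "y powr s - x powr s = (y - x) * l" by blast
      have "l = s * z powr (s - 1)" using z(3) has_real_derivative_powr[of z s] z xy DERIV_unique by fastforce
      thus ?thesis using z by blast
    qed
    obtain \<xi> where \<xi>: "m < \<xi>" "\<xi> < a" "a powr r - m powr r = (a - m) * (r * \<xi> powr (r - 1))"
      using mvt[of m a r] m ab r by auto
    obtain \<eta> where \<eta>: "b < \<eta>" "\<eta> < m" "m powr r - b powr r = (m - b) * (r * \<eta> powr (r - 1))"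
      using mvt[of b m r] m ab r by auto
    obtain \<zeta> where \<zeta>: "\<eta> < \<zeta>" "\<zeta> < \<xi>" "\<xi> powr (r - 1) - \<eta> powr (r - 1) = (\<xi> - \<eta>) * ((r - 1) * \<zeta> powr (r - 2))"
      using mvt[of \<eta> \<xi> "r - 1"] \<xi> \<eta> ab r by auto
    have h: "a - m = (a - b) / 2" "m - b = (a - b) / 2" by (auto simp: m_def field_simps)
    have "a powr r / 2 + b powr r / 2 - m powr r = ((a powr r - m powr r) - (m powr r - b powr r)) / 2"
      by (simp add: field_simps)
    also have "\<dots> = ((a - b) / 2 * r * (\<xi> powr (r - 1) - \<eta> powr (r - 1))) / 2"
      unfolding \<xi>(3) \<eta>(3) h by (simp add: field_simps)
    also have "\<dots> = r * (r - 1) * (\<zeta> powr (r - 2) * ((a - b) / 4 * (\<xi> - \<eta>)))"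
      unfolding \<zeta>(3) by simp
    finally have e: "a powr r / 2 + b powr r / 2 - m powr r = r * (r - 1) * (\<zeta> powr (r - 2) * ((a - b) / 4 * (\<xi> - \<eta>)))" .
    have n: "0 \<le> (a - b) / 4 * (\<xi> - \<eta>)" using \<xi> \<eta> ab by (intro mult_nonneg_nonneg) auto
    have "(a - b) / 4 * (\<xi> - \<eta>) \<le> (a - b) * (a - b)" using \<xi> \<eta> ab by (intro mult_mono) auto
    moreover have "\<zeta> powr (r - 2) \<le> a powr (r - 2)" using \<zeta> \<xi> \<eta> ab r by (intro powr_mono2) auto
    hence "\<zeta> powr (r - 2) \<le> a powr (r - 2) + b powr (r - 2)" using powr_ge_zero[of b "r - 2"] by linarith
    ultimately have le: "\<zeta> powr (r - 2) * ((a - b) / 4 * (\<xi> - \<eta>)) \<le> (a powr (r - 2) + b powr (r - 2)) * (a - b)\<^sup>2"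
      unfolding power2_eq_square by (intro mult_mono[OF _ _ _ n]) (auto simp: add_nonneg_nonneg)
    have "0 \<le> r * (r - 1) * (\<zeta> powr (r - 2) * ((a - b) / 4 * (\<xi> - \<eta>)))" 
      by (intro mult_nonneg_nonneg[OF _ mult_nonneg_nonneg[OF powr_ge_zero n]]) (use r in auto)
    moreover have "r * (r - 1) * (\<zeta> powr (r - 2) * ((a - b) / 4 * (\<xi> - \<eta>)))
        \<le> r * (r - 1) * ((a powr (r - 2) + b powr (r - 2)) * (a - b)\<^sup>2)"
      by (rule mult_left_mono[OF le]) (use r in simp)
    ultimately show ?thesis unfolding m_def[symmetric] e by linarith
  qed
  show ?thesis
  proof (cases a b rule: linorder_cases)
    case less
    with *[of a b] assms show ?thesis by (simp add: add_ac power2_commute)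
  next
    case greater
    with *[of b a] assms show ?thesis by simp
  qed (use assms in simp)
qed

text \<open>Young's inequality for the normalized functions \<open>f / X\<close> and \<open>g / Z\<close> replaces Hoelder's.\<close>
lemma
  fixes f g :: "'a \<Rightarrow> real"
  assumes [measurable]: "f \<in> borel_measurable M" "g \<in> borel_measurable M"
    and i: "integrable M (\<lambda>x. \<bar>f x\<bar> powr r)" "integrable M (\<lambda>x. \<bar>g x\<bar> powr r)"
    and \<theta>: "0 < \<theta>" "\<theta> < r"
  shows powr_product_integrable: "integrable M (\<lambda>x. \<bar>f x\<bar> powr (r - \<theta>) * \<bar>g x\<bar> powr \<theta>)"
    and powr_product_integral_le: "0 \<le> X \<Longrightarrow> 0 \<le> Z \<Longrightarrow> (\<integral>x. \<bar>f x\<bar> powr r \<partial>M) \<le> K * X powr r \<Longrightarrow>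
      (\<integral>x. \<bar>g x\<bar> powr r \<partial>M) \<le> K * Z powr r \<Longrightarrow> 0 \<le> K \<Longrightarrow>
      (\<integral>x. \<bar>f x\<bar> powr (r - \<theta>) * \<bar>g x\<bar> powr \<theta> \<partial>M) \<le> 2 * K * (X powr (r - \<theta>) * Z powr \<theta>)"
proof -
  \<comment> \<open>A crude form of Young's inequality suffices: the product is at most the r-th
    power of the larger factor.\<close>
  have young: "A powr (r - \<theta>) * B powr \<theta> \<le> A powr r + B powr r" if "0 \<le> A" "0 \<le> B" for A B :: real
  proof (cases "A \<le> B")
    case True
    hence "A powr (r - \<theta>) * B powr \<theta> \<le> B powr (r - \<theta>) * B powr \<theta>"
      using that \<theta> by (intro mult_right_mono powr_mono2) auto
    also have "\<dots> = B powr r" by (simp add: powr_add[symmetric])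
    finally show ?thesis by (simp add: add_increasing)
  next
    case False
    hence "A powr (r - \<theta>) * B powr \<theta> \<le> A powr (r - \<theta>) * A powr \<theta>"
      using that \<theta> by (intro mult_left_mono powr_mono2) auto
    also have "\<dots> = A powr r" by (simp add: powr_add[symmetric])
    finally show ?thesis by (simp add: add_increasing2)
  qed
  show int: "integrable M (\<lambda>x. \<bar>f x\<bar> powr (r - \<theta>) * \<bar>g x\<bar> powr \<theta>)"
    by (rule Bochner_Integration.integrable_bound[OF Bochner_Integration.integrable_add[OF i]])
       (auto intro!: AE_I2 young)
  assume XZ: "0 \<le> X" "0 \<le> Z" and F: "(\<integral>x. \<bar>f x\<bar> powr r \<partial>M) \<le> K * X powr r"
    and G: "(\<integral>x. \<bar>g x\<bar> powr r \<partial>M) \<le> K * Z powr r" and K: "0 \<le> K"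
  \<comment> \<open>\<open>X\<close> and \<open>Z\<close> may be 0, so the division is by slightly
    larger numbers, which decrease to them at the end.\<close>
  have pos: "(\<integral>x. \<bar>f x\<bar> powr (r - \<theta>) * \<bar>g x\<bar> powr \<theta> \<partial>M) \<le> 2 * K * (U powr (r - \<theta>) * V powr \<theta>)"
    if UV: "X < U" "Z < V" for U V
  proof -
    define c where "c = U powr (r - \<theta>) * V powr \<theta>"
    have c: "c > 0" using UV XZ by (simp add: c_def)
    have "(\<integral>x. \<bar>f x\<bar> powr (r - \<theta>) * \<bar>g x\<bar> powr \<theta> \<partial>M)
        \<le> (\<integral>x. c * (\<bar>f x\<bar> powr r / U powr r + \<bar>g x\<bar> powr r / V powr r) \<partial>M)"
    proof (rule integral_mono[OF int])
      show "integrable M (\<lambda>x. c * (\<bar>f x\<bar> powr r / U powr r + \<bar>g x\<bar> powr r / V powr r))"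
        using i by (intro integrable_mult_right Bochner_Integration.integrable_add integrable_divide) auto
      fix x
      have "(\<bar>f x\<bar> / U) powr (r - \<theta>) * (\<bar>g x\<bar> / V) powr \<theta> \<le> (\<bar>f x\<bar> / U) powr r + (\<bar>g x\<bar> / V) powr r"
        using UV XZ by (intro young) auto
      hence "\<bar>f x\<bar> powr (r - \<theta>) * \<bar>g x\<bar> powr \<theta> / c \<le> \<bar>f x\<bar> powr r / U powr r + \<bar>g x\<bar> powr r / V powr r"
        using UV XZ by (simp add: powr_divide c_def)
      thus "\<bar>f x\<bar> powr (r - \<theta>) * \<bar>g x\<bar> powr \<theta> \<le> c * (\<bar>f x\<bar> powr r / U powr r + \<bar>g x\<bar> powr r / V powr r)"
        using c by (simp add: field_simps)
    qed
    also have "\<dots> = c * ((\<integral>x. \<bar>f x\<bar> powr r \<partial>M) / U powr r + (\<integral>x. \<bar>g x\<bar> powr r \<partial>M) / V powr r)"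
      using i by simp
    also have "\<dots> \<le> c * (K + K)"
    proof (intro mult_left_mono add_mono)
      have "(\<integral>x. \<bar>f x\<bar> powr r \<partial>M) \<le> K * U powr r"
        using F K UV XZ \<theta> by (meson mult_left_mono order_trans powr_mono2 less_imp_le less_trans)
      thus "(\<integral>x. \<bar>f x\<bar> powr r \<partial>M) / U powr r \<le> K" using UV XZ by (simp add: field_simps)
      have "(\<integral>x. \<bar>g x\<bar> powr r \<partial>M) \<le> K * V powr r"
        using G K UV XZ \<theta> by (meson mult_left_mono order_trans powr_mono2 less_imp_le less_trans)
      thus "(\<integral>x. \<bar>g x\<bar> powr r \<partial>M) / V powr r \<le> K" using UV XZ by (simp add: field_simps)
    qed (use c in simp)
    finally show ?thesis by (simp add: c_def mult_ac)
  qed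
  show "(\<integral>x. \<bar>f x\<bar> powr (r - \<theta>) * \<bar>g x\<bar> powr \<theta> \<partial>M) \<le> 2 * K * (X powr (r - \<theta>) * Z powr \<theta>)"
  proof (rule tendsto_lowerbound)
    have l: "(\<lambda>n. Y + 1 / real (Suc n)) \<longlonglongrightarrow> Y" for Y :: real
      using tendsto_add[OF tendsto_const[of Y] LIMSEQ_inverse_real_of_nat] by (simp add: inverse_eq_divide)
    show "(\<lambda>n. 2 * K * ((X + 1 / real (Suc n)) powr (r - \<theta>) * (Z + 1 / real (Suc n)) powr \<theta>))
      \<longlonglongrightarrow> 2 * K * (X powr (r - \<theta>) * Z powr \<theta>)"
      by (intro tendsto_mult tendsto_const tendsto_powr' l) (use \<theta> XZ in \<open>auto intro!: always_eventually\<close>)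
    show "\<forall>\<^sub>F n in sequentially. (\<integral>x. \<bar>f x\<bar> powr (r - \<theta>) * \<bar>g x\<bar> powr \<theta> \<partial>M)
      \<le> 2 * K * ((X + 1 / real (Suc n)) powr (r - \<theta>) * (Z + 1 / real (Suc n)) powr \<theta>)"
      by (intro always_eventually allI pos) auto
  qed simp
qed

section \<open>Power integrals on the energy space\<close>

context bounded_domain
begin

lemma HP_measurable: "HP v h \<Longrightarrow> v \<in> borel_measurable M" "HP v h \<Longrightarrow> h \<in> borel_measurable M"
  using HP_sq by (auto simp: sq_def)

text \<open>The product estimate is used with \<theta> = 1 for differences and \<theta> = 2 for
  midpoint defects. The Sobolev inequality measures every factor by its gradient, so the bounds
  involve gradients alone, and the midpoint bound carries the factor \<open>X powr (r - 2)\<close>,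
  small on small balls at the critical exponent too.\<close>

lemma power_functional_bounds:
  assumes r: "2 < r" "below_crit CARD('n) r"
  obtains C where "C > 0" "\<And>v h. HP v h \<Longrightarrow> integrable M (\<lambda>x. \<bar>v x\<bar> powr r)"
    "\<And>v h. HP v h \<Longrightarrow> (\<integral>x. \<bar>v x\<bar> powr r \<partial>M) \<le> C * nrm M h powr r"
    "\<And>v h w k X. HP v h \<Longrightarrow> HP w k \<Longrightarrow> nrm M h \<le> X \<Longrightarrow> nrm M k \<le> X \<Longrightarrow>
      \<bar>(\<integral>x. \<bar>v x\<bar> powr r \<partial>M) - (\<integral>x. \<bar>w x\<bar> powr r \<partial>M)\<bar> \<le> C * X powr (r - 1) * nrm M (\<lambda>x. h x - k x)"
    "\<And>v h w k X. HP v h \<Longrightarrow> HP w k \<Longrightarrow> nrm M h \<le> X \<Longrightarrow> nrm M k \<le> X \<Longrightarrow>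
      AE x in M. 0 \<le> v x \<Longrightarrow> AE x in M. 0 \<le> w x \<Longrightarrow>
      \<bar>(\<integral>x. \<bar>v x\<bar> powr r \<partial>M) / 2 + (\<integral>x. \<bar>w x\<bar> powr r \<partial>M) / 2 - (\<integral>x. \<bar>(v x + w x) / 2\<bar> powr r \<partial>M)\<bar>
        \<le> C * X powr (r - 2) * (nrm M (\<lambda>x. h x - k x))\<^sup>2"
proof -
  obtain K where K: "K > 0" "\<And>v h. HP v h \<Longrightarrow> integrable M (\<lambda>x. \<bar>v x\<bar> powr r)"
    "\<And>v h. HP v h \<Longrightarrow> (\<integral>x. \<bar>v x\<bar> powr r \<partial>M) \<le> K * nrm M h powr r"
    using HP_sobolev[OF r] by blast
  have KX: "(\<integral>x. \<bar>v x\<bar> powr r \<partial>M) \<le> K * X powr r" if "HP v h" "nrm M h \<le> X" for v h X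
  proof -
    have "K * nrm M h powr r \<le> K * X powr r"
      using K(1) that(2) r by (intro mult_left_mono powr_mono2) (auto simp: nrm_nonneg)
    thus ?thesis using K(3)[OF that(1)] by linarith
  qed
  have prod: "integrable M (\<lambda>x. \<bar>v x\<bar> powr (r - \<theta>) * \<bar>w x\<bar> powr \<theta>)"
    "(\<integral>x. \<bar>v x\<bar> powr (r - \<theta>) * \<bar>w x\<bar> powr \<theta> \<partial>M) \<le> 2 * K * (X powr (r - \<theta>) * nrm M k powr \<theta>)"
    if "HP v h" "HP w k" "nrm M h \<le> X" "0 < \<theta>" "\<theta> < r" for v h w k X \<theta>
  proof -
    have X: "0 \<le> X" using that(3) nrm_nonneg[of M h] by linarith
    show "integrable M (\<lambda>x. \<bar>v x\<bar> powr (r - \<theta>) * \<bar>w x\<bar> powr \<theta>)"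
      by (rule powr_product_integrable[OF HP_measurable(1)[OF that(1)] HP_measurable(1)[OF that(2)]
            K(2)[OF that(1)] K(2)[OF that(2)] that(4,5)])
    show "(\<integral>x. \<bar>v x\<bar> powr (r - \<theta>) * \<bar>w x\<bar> powr \<theta> \<partial>M) \<le> 2 * K * (X powr (r - \<theta>) * nrm M k powr \<theta>)"
      by (rule powr_product_integral_le[OF HP_measurable(1)[OF that(1)] HP_measurable(1)[OF that(2)]
            K(2)[OF that(1)] K(2)[OF that(2)] that(4,5) X nrm_nonneg KX[OF that(1,3)] K(3)[OF that(2)] less_imp_le[OF K(1)]])
  qed
  define C where "C = K + 4 * K * r + 4 * K * (r * (r - 1))"
  have C: "C > 0" "K \<le> C" "4 * K * r \<le> C" "4 * K * (r * (r - 1)) \<le> C"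
    using K(1) r by (auto simp: C_def intro!: add_pos_nonneg)
  have b1: "(\<integral>x. \<bar>v x\<bar> powr r \<partial>M) \<le> C * nrm M h powr r" if "HP v h" for v h
  proof -
    have "K * nrm M h powr r \<le> C * nrm M h powr r" using C by (intro mult_right_mono) auto
    thus ?thesis using K(3)[OF that] by linarith
  qed
  have b2: "\<bar>(\<integral>x. \<bar>v x\<bar> powr r \<partial>M) - (\<integral>x. \<bar>w x\<bar> powr r \<partial>M)\<bar> \<le> C * X powr (r - 1) * nrm M (\<lambda>x. h x - k x)"
    if vh: "HP v h" "HP w k" "nrm M h \<le> X" "nrm M k \<le> X" for v h w k X
  proof -
    note d = HP_diff[OF vh(1,2)]
    have r1: "0 < (1::real)" "1 < r" using r by auto
    note i1 = prod(1)[OF vh(1) d vh(3) r1] and i2 = prod(1)[OF vh(2) d vh(4) r1]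
    have "\<bar>(\<integral>x. \<bar>v x\<bar> powr r \<partial>M) - (\<integral>x. \<bar>w x\<bar> powr r \<partial>M)\<bar> = \<bar>\<integral>x. \<bar>v x\<bar> powr r - \<bar>w x\<bar> powr r \<partial>M\<bar>"
      using K(2)[OF vh(1)] K(2)[OF vh(2)] by simp
    also have "\<dots> \<le> (\<integral>x. \<bar>\<bar>v x\<bar> powr r - \<bar>w x\<bar> powr r\<bar> \<partial>M)" by (rule integral_abs_bound)
    also have "\<dots> \<le> (\<integral>x. r * (\<bar>v x\<bar> powr (r - 1) * \<bar>v x - w x\<bar> powr 1 + \<bar>w x\<bar> powr (r - 1) * \<bar>v x - w x\<bar> powr 1) \<partial>M)"
    proof (rule integral_mono)
      show "integrable M (\<lambda>x. \<bar>\<bar>v x\<bar> powr r - \<bar>w x\<bar> powr r\<bar>)"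
        using K(2)[OF vh(1)] K(2)[OF vh(2)] by (intro integrable_abs Bochner_Integration.integrable_diff)
      show "integrable M (\<lambda>x. r * (\<bar>v x\<bar> powr (r - 1) * \<bar>v x - w x\<bar> powr 1 + \<bar>w x\<bar> powr (r - 1) * \<bar>v x - w x\<bar> powr 1))"
        by (intro integrable_mult_right Bochner_Integration.integrable_add i1 i2)
      show "\<bar>\<bar>v x\<bar> powr r - \<bar>w x\<bar> powr r\<bar> \<le> r * (\<bar>v x\<bar> powr (r - 1) * \<bar>v x - w x\<bar> powr 1 + \<bar>w x\<bar> powr (r - 1) * \<bar>v x - w x\<bar> powr 1)" for x
        using powr_diff_le[of r "v x" "w x"] r by (simp add: distrib_right)
    qed
    also have "\<dots> = r * ((\<integral>x. \<bar>v x\<bar> powr (r - 1) * \<bar>v x - w x\<bar> powr 1 \<partial>M) + (\<integral>x. \<bar>w x\<bar> powr (r - 1) * \<bar>v x - w x\<bar> powr 1 \<partial>M))"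
      using i1 i2 by simp
    also have "\<dots> \<le> r * (2 * K * (X powr (r - 1) * nrm M (\<lambda>x. h x - k x) powr 1) + 2 * K * (X powr (r - 1) * nrm M (\<lambda>x. h x - k x) powr 1))"
      using r by (intro mult_left_mono add_mono prod(2)[OF vh(1) d vh(3) r1] prod(2)[OF vh(2) d vh(4) r1]) auto
    also have "\<dots> = 4 * K * r * (X powr (r - 1) * nrm M (\<lambda>x. h x - k x))"
      by (simp add: nrm_nonneg)
    also have "\<dots> \<le> C * (X powr (r - 1) * nrm M (\<lambda>x. h x - k x))"
      by (intro mult_right_mono C) (simp add: nrm_nonneg)
    finally show ?thesis by (simp add: mult.assoc)
  qed
  have b3: "\<bar>(\<integral>x. \<bar>v x\<bar> powr r \<partial>M) / 2 + (\<integral>x. \<bar>w x\<bar> powr r \<partial>M) / 2 - (\<integral>x. \<bar>(v x + w x) / 2\<bar> powr r \<partial>M)\<bar>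
        \<le> C * X powr (r - 2) * (nrm M (\<lambda>x. h x - k x))\<^sup>2"
    if vh: "HP v h" "HP w k" "nrm M h \<le> X" "nrm M k \<le> X" "AE x in M. 0 \<le> v x" "AE x in M. 0 \<le> w x" for v h w k X
  proof -
    note d = HP_diff[OF vh(1,2)]
    have r1: "0 < (2::real)" "2 < r" using r by auto
    note i1 = prod(1)[OF vh(1) d vh(3) r1] and i2 = prod(1)[OF vh(2) d vh(4) r1]
    have [measurable]: "v \<in> borel_measurable M" "w \<in> borel_measurable M" by (rule HP_measurable[OF vh(1)] HP_measurable[OF vh(2)])+
    have im: "integrable M (\<lambda>x. \<bar>(v x + w x) / 2\<bar> powr r)"
      using K(2)[OF HP_scale[OF HP_add[OF vh(1,2)], of "1/2"]] by simp
    note i = K(2)[OF vh(1)] K(2)[OF vh(2)] im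
    have "\<bar>(\<integral>x. \<bar>v x\<bar> powr r \<partial>M) / 2 + (\<integral>x. \<bar>w x\<bar> powr r \<partial>M) / 2 - (\<integral>x. \<bar>(v x + w x) / 2\<bar> powr r \<partial>M)\<bar>
       = \<bar>\<integral>x. \<bar>v x\<bar> powr r / 2 + \<bar>w x\<bar> powr r / 2 - \<bar>(v x + w x) / 2\<bar> powr r \<partial>M\<bar>"
      using i by simp
    also have "\<dots> \<le> (\<integral>x. \<bar>\<bar>v x\<bar> powr r / 2 + \<bar>w x\<bar> powr r / 2 - \<bar>(v x + w x) / 2\<bar> powr r\<bar> \<partial>M)" by (rule integral_abs_bound)
    also have "\<dots> \<le> (\<integral>x. r * (r - 1) * (\<bar>v x\<bar> powr (r - 2) * \<bar>v x - w x\<bar> powr 2 + \<bar>w x\<bar> powr (r - 2) * \<bar>v x - w x\<bar> powr 2) \<partial>M)"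
    proof (rule integral_mono_AE)
      show "integrable M (\<lambda>x. \<bar>\<bar>v x\<bar> powr r / 2 + \<bar>w x\<bar> powr r / 2 - \<bar>(v x + w x) / 2\<bar> powr r\<bar>)"
        using i by (intro integrable_abs Bochner_Integration.integrable_diff Bochner_Integration.integrable_add integrable_divide) auto
      show "integrable M (\<lambda>x. r * (r - 1) * (\<bar>v x\<bar> powr (r - 2) * \<bar>v x - w x\<bar> powr 2 + \<bar>w x\<bar> powr (r - 2) * \<bar>v x - w x\<bar> powr 2))"
        by (intro integrable_mult_right Bochner_Integration.integrable_add i1 i2)
      show "AE x in M. \<bar>\<bar>v x\<bar> powr r / 2 + \<bar>w x\<bar> powr r / 2 - \<bar>(v x + w x) / 2\<bar> powr r\<bar>
        \<le> r * (r - 1) * (\<bar>v x\<bar> powr (r - 2) * \<bar>v x - w x\<bar> powr 2 + \<bar>w x\<bar> powr (r - 2) * \<bar>v x - w x\<bar> powr 2)"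
        using vh(5,6)
      proof eventually_elim
        case (elim x)
        thus ?case using powr_midpoint_gap[of r "v x" "w x"] r by (simp add: distrib_right)
      qed
    qed
    also have "\<dots> = r * (r - 1) * ((\<integral>x. \<bar>v x\<bar> powr (r - 2) * \<bar>v x - w x\<bar> powr 2 \<partial>M) + (\<integral>x. \<bar>w x\<bar> powr (r - 2) * \<bar>v x - w x\<bar> powr 2 \<partial>M))"
      using i1 i2 by simp
    also have "\<dots> \<le> r * (r - 1) * (2 * K * (X powr (r - 2) * nrm M (\<lambda>x. h x - k x) powr 2) + 2 * K * (X powr (r - 2) * nrm M (\<lambda>x. h x - k x) powr 2))"
      using r by (intro mult_left_mono add_mono prod(2)[OF vh(1) d vh(3) r1] prod(2)[OF vh(2) d vh(4) r1]) auto
    also have "\<dots> = 4 * K * (r * (r - 1)) * (X powr (r - 2) * (nrm M (\<lambda>x. h x - k x))\<^sup>2)"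
      by (simp add: nrm_nonneg)
    also have "\<dots> \<le> C * (X powr (r - 2) * (nrm M (\<lambda>x. h x - k x))\<^sup>2)"
      by (intro mult_right_mono C) simp
    finally show ?thesis by (simp add: mult.assoc)
  qed
  show ?thesis by (rule that[OF C(1) K(2) b1 b2 b3])
qed

end

lemma nrm_mono:
  assumes "sq M g" "f \<in> borel_measurable M" "\<And>x. norm (f x) \<le> norm (g x)"
  shows "nrm M f \<le> nrm M g"
proof -
  have le: "(norm (f x))\<^sup>2 \<le> (norm (g x))\<^sup>2" for x by (intro power_mono assms) auto
  have "integrable M (\<lambda>x. (norm (f x))\<^sup>2)"
    by (rule Bochner_Integration.integrable_bound[OF sqD(2)[OF assms(1)]]) (use assms(2) le in auto)
  thus ?thesis unfolding nrm_def
    by (intro real_sqrt_le_mono integral_mono sqD(2)[OF assms(1)] le)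
qed

lemma smooth_abs_bounds:
  fixes t \<delta> :: real
  assumes "\<delta> > 0"
  shows "0 \<le> sqrt (t\<^sup>2 + \<delta>\<^sup>2) - \<delta>" "sqrt (t\<^sup>2 + \<delta>\<^sup>2) - \<delta> \<le> \<bar>t\<bar>" "\<bar>t / sqrt (t\<^sup>2 + \<delta>\<^sup>2)\<bar> \<le> 1"
proof -
  have "sqrt (\<delta>\<^sup>2) \<le> sqrt (t\<^sup>2 + \<delta>\<^sup>2)" by (intro real_sqrt_le_mono) simp
  thus "0 \<le> sqrt (t\<^sup>2 + \<delta>\<^sup>2) - \<delta>" using assms by simp
  show "sqrt (t\<^sup>2 + \<delta>\<^sup>2) - \<delta> \<le> \<bar>t\<bar>"
    using sqrt_add_le_add_sqrt[of "t\<^sup>2" "\<delta>\<^sup>2"] assms by simp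
  have "sqrt (t\<^sup>2) \<le> sqrt (t\<^sup>2 + \<delta>\<^sup>2)" by (intro real_sqrt_le_mono) simp
  moreover have "0 < sqrt (t\<^sup>2 + \<delta>\<^sup>2)" using assms by (simp add: add_nonneg_pos)
  ultimately show "\<bar>t / sqrt (t\<^sup>2 + \<delta>\<^sup>2)\<bar> \<le> 1" by (simp add: abs_divide)
qed

context bounded_domain
begin

text \<open>Supplies the comparison function whose Dirichlet energy fixes the size of the ball. A
  bump is positive on a nonempty open box, so its norm is not 0.\<close>

lemma unit_test_fun:
  obtains \<phi> where "test_fun \<Omega> \<phi>" "\<And>x. 0 \<le> \<phi> x" "nrm M \<phi> = 1"
proof -
  obtain z where z: "z \<in> \<Omega>" using nonempty_dom by blast
  obtain a b where ab: "z \<in> box a b" "cbox a b \<subseteq> \<Omega>"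
    by (rule open_contains_cbox[OF open_dom z]) (rule that)
  obtain \<beta> where \<beta>: "Cinf_on UNIV \<beta>" "\<And>x. \<beta> x \<ge> 0" "\<And>x. \<beta> x > 0 \<longleftrightarrow> x \<in> box a b"
    using box_bump by blast
  have t: "test_fun \<Omega> \<beta>"
    by (rule test_fun_box[OF \<beta>(1) _ ab(2)]) (use \<beta> in \<open>auto simp: less_le\<close>)
  note c = test_fun_C1z[OF t]
  have "nrm M \<beta> \<noteq> 0"
  proof
    assume "nrm M \<beta> = 0"
    hence "(\<integral>x. (\<beta> x)\<^sup>2 \<partial>lborel) = 0" using C1z_nrm(1)[OF c] by simp
    hence "AE x in lborel. (\<beta> x)\<^sup>2 = 0"
      by (subst (asm) integral_nonneg_eq_0_iff_AE[OF C1z_integrable(2)[OF c bounded_dom]]) auto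
    hence "AE x in lebesgue. (\<beta> x)\<^sup>2 = 0" by (rule AE_completion)
    hence "AE x in lebesgue. x \<notin> box a b"
    proof eventually_elim
      case (elim x) thus ?case using \<beta>(3)[of x] by auto
    qed
    hence "box a b \<in> null_sets lebesgue" by (subst AE_iff_null_sets) auto
    hence "negligible (box a b)" by (simp add: negligible_iff_null_sets)
    thus False using open_not_negligible[OF open_box, of a b] ab(1) by blast
  qed
  hence n: "nrm M \<beta> > 0" using nrm_nonneg[of M \<beta>] by linarith
  show ?thesis
  proof (rule that[of "\<lambda>x. (1 / nrm M \<beta>) * \<beta> x"])
    show "test_fun \<Omega> (\<lambda>x. (1 / nrm M \<beta>) * \<beta> x)" by (rule test_fun_cmult[OF t])
    show "0 \<le> (1 / nrm M \<beta>) * \<beta> x" for x using n \<beta>(2) by simp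
    show "nrm M (\<lambda>x. (1 / nrm M \<beta>) * \<beta> x) = 1"
      using nrm_scaleR[of M "1 / nrm M \<beta>" \<beta>] n by simp
  qed
qed

lemma HP_power_integrable:
  assumes "2 < r" "below_crit CARD('n) r" "HP v h"
  shows "integrable M (\<lambda>x. \<bar>v x\<bar> powr r)"
  by (rule HP_sobolev[OF assms(1,2)]) (use assms(3) in blast)

text \<open>The gradients converge strongly, so the Lipschitz estimate gives the limit without
  compactness, the critical exponent included.\<close>

lemma power_functional_tendsto:
  assumes r: "2 < r" "below_crit CARD('n) r"
    and "\<And>n. HP (v n) (h n)" "HP w k" "(\<lambda>n. nrm M (\<lambda>x. h n x - k x)) \<longlonglongrightarrow> 0"
  shows "(\<lambda>n. \<integral>x. \<bar>v n x\<bar> powr r \<partial>M) \<longlonglongrightarrow> (\<integral>x. \<bar>w x\<bar> powr r \<partial>M)"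
proof (rule LIM_zero_cancel)
  obtain C where C: "C > 0" and C2: "\<And>v h w k X. HP v h \<Longrightarrow> HP w k \<Longrightarrow> nrm M h \<le> X \<Longrightarrow> nrm M k \<le> X \<Longrightarrow>
      \<bar>(\<integral>x. \<bar>v x\<bar> powr r \<partial>M) - (\<integral>x. \<bar>w x\<bar> powr r \<partial>M)\<bar> \<le> C * X powr (r - 1) * nrm M (\<lambda>x. h x - k x)"
    by (rule power_functional_bounds[OF r]) (rule that)
  have hk: "(\<lambda>n. nrm M (h n)) \<longlonglongrightarrow> nrm M k"
    by (rule nrm_tendsto[OF HP_sq(2)[OF assms(3)] HP_sq(2)[OF assms(4)] assms(5)])
  show "(\<lambda>n. (\<integral>x. \<bar>v n x\<bar> powr r \<partial>M) - (\<integral>x. \<bar>w x\<bar> powr r \<partial>M)) \<longlonglongrightarrow> 0"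
  proof (rule Lim_null_comparison)
    show "\<forall>\<^sub>F n in sequentially. norm ((\<integral>x. \<bar>v n x\<bar> powr r \<partial>M) - (\<integral>x. \<bar>w x\<bar> powr r \<partial>M))
      \<le> C * (nrm M (h n) + nrm M k) powr (r - 1) * nrm M (\<lambda>x. h n x - k x)"
    proof (intro always_eventually allI)
      fix n
      have "nrm M (h n) \<le> nrm M (h n) + nrm M k" "nrm M k \<le> nrm M (h n) + nrm M k"
        using nrm_nonneg[of M "h n"] nrm_nonneg[of M k] by auto
      from C2[OF assms(3,4) this]
      show "norm ((\<integral>x. \<bar>v n x\<bar> powr r \<partial>M) - (\<integral>x. \<bar>w x\<bar> powr r \<partial>M))
        \<le> C * (nrm M (h n) + nrm M k) powr (r - 1) * nrm M (\<lambda>x. h n x - k x)" by simp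
    qed
    have "(\<lambda>n. C * (nrm M (h n) + nrm M k) powr (r - 1) * nrm M (\<lambda>x. h n x - k x))
      \<longlonglongrightarrow> C * (nrm M k + nrm M k) powr (r - 1) * 0"
      by (intro tendsto_mult tendsto_const tendsto_powr' tendsto_add hk assms(5))
         (use r in \<open>auto intro!: always_eventually simp: nrm_nonneg\<close>)
    thus "(\<lambda>n. C * (nrm M (h n) + nrm M k) powr (r - 1) * nrm M (\<lambda>x. h n x - k x)) \<longlonglongrightarrow> 0" by simp
  qed
qed

text \<open>The smoothed modulus lies between 0 and the modulus, which serves as majorant.\<close>

lemma smooth_abs_tendsto:
  assumes \<phi>: "test_fun \<Omega> \<phi>" and s: "s > 0" and i: "integrable M (\<lambda>x. \<bar>\<phi> x\<bar> powr s)"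
  shows "(\<lambda>n. \<integral>x. \<bar>sqrt ((\<phi> x)\<^sup>2 + (1 / real (Suc n))\<^sup>2) - 1 / real (Suc n)\<bar> powr s \<partial>M)
    \<longlonglongrightarrow> (\<integral>x. \<bar>\<phi> x\<bar> powr s \<partial>M)"
proof (rule integral_dominated_convergence[where w="\<lambda>x. \<bar>\<phi> x\<bar> powr s"])
  have [measurable]: "\<phi> \<in> borel_measurable M" using test_sq(1)[OF \<phi>] by (simp add: sq_def)
  show "(\<lambda>x. \<bar>\<phi> x\<bar> powr s) \<in> borel_measurable M"
    "(\<lambda>x. \<bar>sqrt ((\<phi> x)\<^sup>2 + (1 / real (Suc n))\<^sup>2) - 1 / real (Suc n)\<bar> powr s) \<in> borel_measurable M" for n
    by measurable
  have l: "(\<lambda>n. 1 / real (Suc n)) \<longlonglongrightarrow> 0" using LIMSEQ_inverse_real_of_nat by (simp add: inverse_eq_divide)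
  show "AE x in M. (\<lambda>n. \<bar>sqrt ((\<phi> x)\<^sup>2 + (1 / real (Suc n))\<^sup>2) - 1 / real (Suc n)\<bar> powr s) \<longlonglongrightarrow> \<bar>\<phi> x\<bar> powr s"
  proof (intro AE_I2)
    fix x
    have "(\<lambda>n. sqrt ((\<phi> x)\<^sup>2 + (1 / real (Suc n))\<^sup>2) - 1 / real (Suc n)) \<longlonglongrightarrow> sqrt ((\<phi> x)\<^sup>2 + 0\<^sup>2) - 0"
      by (intro tendsto_intros l)
    hence "(\<lambda>n. \<bar>sqrt ((\<phi> x)\<^sup>2 + (1 / real (Suc n))\<^sup>2) - 1 / real (Suc n)\<bar>) \<longlonglongrightarrow> \<bar>\<phi> x\<bar>"
      by (auto dest: tendsto_rabs)
    thus "(\<lambda>n. \<bar>sqrt ((\<phi> x)\<^sup>2 + (1 / real (Suc n))\<^sup>2) - 1 / real (Suc n)\<bar> powr s) \<longlonglongrightarrow> \<bar>\<phi> x\<bar> powr s"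
      by (intro tendsto_powr' tendsto_const) (use s in auto)
  qed
  show "AE x in M. norm (\<bar>sqrt ((\<phi> x)\<^sup>2 + (1 / real (Suc n))\<^sup>2) - 1 / real (Suc n)\<bar> powr s) \<le> \<bar>\<phi> x\<bar> powr s" for n
    using s smooth_abs_bounds(1,2)[of "1 / real (Suc n)"] by (intro AE_I2) (auto intro!: powr_mono2)
qed (rule i)

end

section \<open>The energy functional and nonnegative approximation\<close>

locale dirichlet_problem = bounded_domain \<Omega> for \<Omega> :: "(real^'n) set" +
  fixes \<mu> p q :: real
  assumes p_gt_2: "2 < p" and p_le_q: "p \<le> q" and q_crit: "below_crit CARD('n) q"
begin

lemma p_crit: "below_crit CARD('n) p"
  using q_crit p_le_q by (auto simp: below_crit_def)

lemma q_gt_2: "2 < q" using p_gt_2 p_le_q by linarith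

definition Nl :: "(real^'n \<Rightarrow> real) \<Rightarrow> real" where
  "Nl v = \<mu> / p * (\<integral>x. \<bar>v x\<bar> powr p \<partial>M) + 1 / q * (\<integral>x. \<bar>v x\<bar> powr q \<partial>M)"

text \<open>The gradient is an argument, so no choice of a weak gradient enters until the result is
  translated back.\<close>

definition En :: "(real^'n \<Rightarrow> real) \<Rightarrow> (real^'n \<Rightarrow> real^'n) \<Rightarrow> real" where
  "En v h = (nrm M h)\<^sup>2 / 2 - Nl v"

lemma energy_eq_En:
  assumes "HP v h" shows "energy \<Omega> \<mu> p q v = En v h"
proof -
  have "nrm M (wgrad \<Omega> v) = nrm M h"
    by (rule nrm_cong_AE[OF HP_measurable(2)[OF HP_wgrad[OF assms]] HP_measurable(2)[OF assms] HP_wgrad_AE[OF assms]])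
  thus ?thesis
    by (simp add: energy_def En_def Nl_def set_integral_M nrm_square[symmetric])
qed

lemma Nl_tendsto:
  assumes "\<And>n. HP (v n) (h n)" "HP w k" "(\<lambda>n. nrm M (\<lambda>x. h n x - k x)) \<longlonglongrightarrow> 0"
  shows "(\<lambda>n. Nl (v n)) \<longlonglongrightarrow> Nl w"
  unfolding Nl_def
  by (intro tendsto_intros power_functional_tendsto[OF p_gt_2 p_crit assms] power_functional_tendsto[OF q_gt_2 q_crit assms])

lemma Nl_scale:
  assumes "c \<ge> 0"
  shows "Nl (\<lambda>x. c * v x) = \<mu> / p * (c powr p * (\<integral>x. \<bar>v x\<bar> powr p \<partial>M)) + 1 / q * (c powr q * (\<integral>x. \<bar>v x\<bar> powr q \<partial>M))"
  using assms by (simp add: Nl_def abs_mult powr_mult)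

text \<open>For gradient norms at most X \<le> 1 powers with \<open>q\<close> are dominated by those
  with \<open>p\<close>, so both nonlinear terms share bounds in \<open>p\<close>. The modulus of
  \<open>\<mu>\<close> enters the constant \<open>B\<close>, so its sign is irrelevant
  afterwards.\<close>

lemma Nl_bounds:
  obtains B where "B > 0"
    "\<And>v h X. HP v h \<Longrightarrow> nrm M h \<le> X \<Longrightarrow> X \<le> 1 \<Longrightarrow> \<bar>Nl v\<bar> \<le> B * X powr p"
    "\<And>v h w k. HP v h \<Longrightarrow> HP w k \<Longrightarrow> nrm M h \<le> 1 \<Longrightarrow> nrm M k \<le> 1 \<Longrightarrow> \<bar>Nl v - Nl w\<bar> \<le> B * nrm M (\<lambda>x. h x - k x)"
    "\<And>v h w k X. HP v h \<Longrightarrow> HP w k \<Longrightarrow> nrm M h \<le> X \<Longrightarrow> nrm M k \<le> X \<Longrightarrow> X \<le> 1 \<Longrightarrow>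
      AE x in M. 0 \<le> v x \<Longrightarrow> AE x in M. 0 \<le> w x \<Longrightarrow>
      \<bar>Nl v / 2 + Nl w / 2 - Nl (\<lambda>x. (v x + w x) / 2)\<bar> \<le> B * X powr (p - 2) * (nrm M (\<lambda>x. h x - k x))\<^sup>2"
proof -
  obtain P where P: "P > 0"
    "\<And>v h. HP v h \<Longrightarrow> (\<integral>x. \<bar>v x\<bar> powr p \<partial>M) \<le> P * nrm M h powr p"
    "\<And>v h w k X. HP v h \<Longrightarrow> HP w k \<Longrightarrow> nrm M h \<le> X \<Longrightarrow> nrm M k \<le> X \<Longrightarrow>
      \<bar>(\<integral>x. \<bar>v x\<bar> powr p \<partial>M) - (\<integral>x. \<bar>w x\<bar> powr p \<partial>M)\<bar> \<le> P * X powr (p - 1) * nrm M (\<lambda>x. h x - k x)"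
    "\<And>v h w k X. HP v h \<Longrightarrow> HP w k \<Longrightarrow> nrm M h \<le> X \<Longrightarrow> nrm M k \<le> X \<Longrightarrow>
      AE x in M. 0 \<le> v x \<Longrightarrow> AE x in M. 0 \<le> w x \<Longrightarrow>
      \<bar>(\<integral>x. \<bar>v x\<bar> powr p \<partial>M) / 2 + (\<integral>x. \<bar>w x\<bar> powr p \<partial>M) / 2 - (\<integral>x. \<bar>(v x + w x) / 2\<bar> powr p \<partial>M)\<bar>
        \<le> P * X powr (p - 2) * (nrm M (\<lambda>x. h x - k x))\<^sup>2"
    by (rule power_functional_bounds[OF p_gt_2 p_crit]) (rule that)
  obtain Q where Q: "Q > 0"
    "\<And>v h. HP v h \<Longrightarrow> (\<integral>x. \<bar>v x\<bar> powr q \<partial>M) \<le> Q * nrm M h powr q"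
    "\<And>v h w k X. HP v h \<Longrightarrow> HP w k \<Longrightarrow> nrm M h \<le> X \<Longrightarrow> nrm M k \<le> X \<Longrightarrow>
      \<bar>(\<integral>x. \<bar>v x\<bar> powr q \<partial>M) - (\<integral>x. \<bar>w x\<bar> powr q \<partial>M)\<bar> \<le> Q * X powr (q - 1) * nrm M (\<lambda>x. h x - k x)"
    "\<And>v h w k X. HP v h \<Longrightarrow> HP w k \<Longrightarrow> nrm M h \<le> X \<Longrightarrow> nrm M k \<le> X \<Longrightarrow>
      AE x in M. 0 \<le> v x \<Longrightarrow> AE x in M. 0 \<le> w x \<Longrightarrow>
      \<bar>(\<integral>x. \<bar>v x\<bar> powr q \<partial>M) / 2 + (\<integral>x. \<bar>w x\<bar> powr q \<partial>M) / 2 - (\<integral>x. \<bar>(v x + w x) / 2\<bar> powr q \<partial>M)\<bar>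
        \<le> Q * X powr (q - 2) * (nrm M (\<lambda>x. h x - k x))\<^sup>2"
    by (rule power_functional_bounds[OF q_gt_2 q_crit]) (rule that)
  define B where "B = \<bar>\<mu>\<bar> / p * P + 1 / q * Q"
  have B: "B > 0" unfolding B_def using P Q p_gt_2 q_gt_2 by (intro add_nonneg_pos) auto
  \<comment> \<open>\<open>y\<close> and \<open>y'\<close> stand for the corresponding powers of
    \<open>X\<close> for \<open>p\<close> and \<open>q\<close>, and \<open>z\<close> for the
    remaining factor.\<close>
  have comb: "\<bar>\<mu> / p * a + 1 / q * b\<bar> \<le> B * (y * z)"
    if "\<bar>a\<bar> \<le> P * y * z" "\<bar>b\<bar> \<le> Q * y' * z" "y' \<le> y" "0 \<le> z" for a b y y' z
  proof -
    have "Q * y' * z \<le> Q * y * z" using that Q(1) by (intro mult_right_mono mult_left_mono) auto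
    hence b: "\<bar>b\<bar> \<le> Q * y * z" using that by linarith
    have "\<bar>\<mu> / p * a + 1 / q * b\<bar> \<le> \<bar>\<mu> / p * a\<bar> + \<bar>1 / q * b\<bar>" by (rule abs_triangle_ineq)
    also have "\<dots> = \<bar>\<mu>\<bar> / p * \<bar>a\<bar> + 1 / q * \<bar>b\<bar>" using p_gt_2 q_gt_2 by (simp add: abs_mult abs_divide)
    also have "\<dots> \<le> \<bar>\<mu>\<bar> / p * (P * y * z) + 1 / q * (Q * y * z)"
      using that(1) b p_gt_2 q_gt_2 by (intro add_mono mult_left_mono) auto
    also have "\<dots> = B * (y * z)" by (simp add: B_def algebra_simps)
    finally show ?thesis .
  qed
  have b1: "\<bar>Nl v\<bar> \<le> B * X powr p" if vh: "HP v h" "nrm M h \<le> X" "X \<le> 1" for v h X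
  proof -
    have X0: "0 \<le> X" using that(2) nrm_nonneg[of M h] by linarith
    have n: "0 \<le> (\<integral>x. \<bar>v x\<bar> powr r \<partial>M)" for r by (simp add: integral_nonneg_AE)
    have "P * nrm M h powr p \<le> P * X powr p" using that P p_gt_2 by (intro mult_left_mono powr_mono2) (auto simp: nrm_nonneg)
    hence 1: "\<bar>\<integral>x. \<bar>v x\<bar> powr p \<partial>M\<bar> \<le> P * X powr p * 1" using P(2)[OF vh(1)] n[of p] by simp
    have "Q * nrm M h powr q \<le> Q * X powr q" using that Q q_gt_2 by (intro mult_left_mono powr_mono2) (auto simp: nrm_nonneg)
    hence 2: "\<bar>\<integral>x. \<bar>v x\<bar> powr q \<partial>M\<bar> \<le> Q * X powr q * 1" using Q(2)[OF vh(1)] n[of q] by simp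
    have "X powr q \<le> X powr p" using X0 that(3) p_le_q by (intro powr_mono') auto
    from comb[OF 1 2 this] show ?thesis by (simp add: Nl_def)
  qed
  have b2: "\<bar>Nl v - Nl w\<bar> \<le> B * nrm M (\<lambda>x. h x - k x)"
    if vh: "HP v h" "HP w k" "nrm M h \<le> 1" "nrm M k \<le> 1" for v h w k
    using comb[OF P(3)[OF vh] Q(3)[OF vh]] nrm_nonneg[of M "\<lambda>x. h x - k x"]
    by (simp add: Nl_def algebra_simps)
  have b3: "\<bar>Nl v / 2 + Nl w / 2 - Nl (\<lambda>x. (v x + w x) / 2)\<bar> \<le> B * X powr (p - 2) * (nrm M (\<lambda>x. h x - k x))\<^sup>2"
    if vh: "HP v h" "HP w k" "nrm M h \<le> X" "nrm M k \<le> X" and X: "X \<le> 1"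
      and AE: "AE x in M. 0 \<le> v x" "AE x in M. 0 \<le> w x" for v h w k X
  proof -
    have X0: "0 \<le> X" using vh(3) nrm_nonneg[of M h] by linarith
    have "X powr (q - 2) \<le> X powr (p - 2)" using X0 X p_le_q by (intro powr_mono') auto
    from comb[OF P(4)[OF vh AE] Q(4)[OF vh AE] this]
    show ?thesis by (simp add: Nl_def algebra_simps add_divide_distrib)
  qed
  show ?thesis by (rule that[OF B b1 b2 b3])
qed

text \<open>Connects arbitrary competitors with nonnegative test functions. Where \<open>v\<close>
  changes sign the gradients of the smoothed moduli cannot be expected to approach \<open>h\<close>;
  what survives is a bound by numbers \<open>a k\<close> with limit \<open>nrm M h\<close>, and this
  suffices because an upper bound for the energy of the approximants is all that the comparison
  uses.\<close>

lemma nonneg_test_approx: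
  assumes vh: "HP v h"
  obtains w a where "\<And>k. test_fun \<Omega> (w k)" "\<And>k x. 0 \<le> w k x" "(\<lambda>k. nrm M (w k)) \<longlonglongrightarrow> nrm M v"
    "\<And>k. nrm M (cgrad (w k)) \<le> a k" "a \<longlonglongrightarrow> nrm M h"
    "(\<lambda>k. \<integral>x. \<bar>w k x\<bar> powr p \<partial>M) \<longlonglongrightarrow> (\<integral>x. \<bar>v x\<bar> powr p \<partial>M)"
    "(\<lambda>k. \<integral>x. \<bar>w k x\<bar> powr q \<partial>M) \<longlonglongrightarrow> (\<integral>x. \<bar>v x\<bar> powr q \<partial>M)"
proof -
  obtain \<phi> where \<phi>: "\<And>k. test_fun \<Omega> (\<phi> k)" "(\<lambda>k. nrm M (\<lambda>x. \<phi> k x - v x)) \<longlonglongrightarrow> 0"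
    "(\<lambda>k. nrm M (\<lambda>x. cgrad (\<phi> k) x - h x)) \<longlonglongrightarrow> 0" using HP_approx[OF vh] by blast
  define W where "W k n x = sqrt ((\<phi> k x)\<^sup>2 + (1 / real (Suc n))\<^sup>2) - 1 / real (Suc n)" for k n x
  have W: "test_fun \<Omega> (W k n)" "cgrad (W k n) x = (\<phi> k x / sqrt ((\<phi> k x)\<^sup>2 + (1 / real (Suc n))\<^sup>2)) *\<^sub>R cgrad (\<phi> k) x" for k n x
    unfolding W_def by (rule test_fun_smooth_abs[OF \<phi>(1)], simp)+
  have W0: "0 \<le> W k n x" for k n x unfolding W_def by (rule smooth_abs_bounds) simp
  have Wg: "nrm M (cgrad (W k n)) \<le> nrm M (cgrad (\<phi> k))" for k n
  proof (rule nrm_mono[OF test_sq(2)[OF \<phi>(1)]])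
    show "cgrad (W k n) \<in> borel_measurable M" using test_sq(2)[OF W(1)] by (simp add: sq_def)
    show "norm (cgrad (W k n) x) \<le> norm (cgrad (\<phi> k) x)" for x
    proof -
      have "norm (cgrad (W k n) x) = \<bar>\<phi> k x / sqrt ((\<phi> k x)\<^sup>2 + (1 / real (Suc n))\<^sup>2)\<bar> * norm (cgrad (\<phi> k) x)"
        by (simp add: W(2))
      also have "\<dots> \<le> 1 * norm (cgrad (\<phi> k) x)" by (intro mult_right_mono smooth_abs_bounds(3)) auto
      finally show ?thesis by simp
    qed
  qed
  have ii: "integrable M (\<lambda>x. \<bar>\<phi> k x\<bar> powr p)" "integrable M (\<lambda>x. \<bar>\<phi> k x\<bar> powr q)" for k
    by (rule HP_power_integrable[OF p_gt_2 p_crit HP_test[OF \<phi>(1)]]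
        HP_power_integrable[OF q_gt_2 q_crit HP_test[OF \<phi>(1)]])+
  have i2: "integrable M (\<lambda>x. \<bar>\<phi> k x\<bar> powr 2)" for k
    using sqD(2)[OF test_sq(1)[OF \<phi>(1)[of k]]] by simp
  \<comment> \<open>For each \<open>k\<close> the smoothing parameter 1 / (n + 1) tends to 0 before
    \<open>k\<close> grows; \<open>Pr\<close> selects an \<open>n\<close> that is good for three
    limits at once.\<close>
  define Pr where "Pr k n \<longleftrightarrow> \<bar>nrm M (W k n) - nrm M (\<phi> k)\<bar> < 1 / real (Suc k) \<and>
     \<bar>(\<integral>x. \<bar>W k n x\<bar> powr p \<partial>M) - (\<integral>x. \<bar>\<phi> k x\<bar> powr p \<partial>M)\<bar> < 1 / real (Suc k) \<and>
     \<bar>(\<integral>x. \<bar>W k n x\<bar> powr q \<partial>M) - (\<integral>x. \<bar>\<phi> k x\<bar> powr q \<partial>M)\<bar> < 1 / real (Suc k)" for k n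
  have "\<forall>k. \<exists>n. Pr k n"
  proof
    fix k
    have "(\<lambda>n. \<integral>x. \<bar>W k n x\<bar> powr 2 \<partial>M) \<longlonglongrightarrow> (\<integral>x. \<bar>\<phi> k x\<bar> powr 2 \<partial>M)"
      unfolding W_def by (rule smooth_abs_tendsto[OF \<phi>(1) _ i2]) simp
    from tendsto_real_sqrt[OF this]
    have 1: "(\<lambda>n. nrm M (W k n)) \<longlonglongrightarrow> nrm M (\<phi> k)" by (simp add: nrm_def)
    have 2: "(\<lambda>n. \<integral>x. \<bar>W k n x\<bar> powr p \<partial>M) \<longlonglongrightarrow> (\<integral>x. \<bar>\<phi> k x\<bar> powr p \<partial>M)"
      unfolding W_def by (rule smooth_abs_tendsto[OF \<phi>(1) _ ii(1)]) (use p_gt_2 in simp)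
    have 3: "(\<lambda>n. \<integral>x. \<bar>W k n x\<bar> powr q \<partial>M) \<longlonglongrightarrow> (\<integral>x. \<bar>\<phi> k x\<bar> powr q \<partial>M)"
      unfolding W_def by (rule smooth_abs_tendsto[OF \<phi>(1) _ ii(2)]) (use q_gt_2 in simp)
    have e: "0 < 1 / real (Suc k)" by simp
    have "\<forall>\<^sub>F n in sequentially. Pr k n"
      using tendstoD[OF 1 e] tendstoD[OF 2 e] tendstoD[OF 3 e]
      by (auto simp: dist_real_def Pr_def intro: eventually_conj)
    thus "\<exists>n. Pr k n" by (auto dest: eventually_happens)
  qed
  from choice[OF this] obtain n where "\<And>k. Pr k (n k)" by auto
  hence n: "\<And>k. \<bar>nrm M (W k (n k)) - nrm M (\<phi> k)\<bar> < 1 / real (Suc k)"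
     "\<And>k. \<bar>(\<integral>x. \<bar>W k (n k) x\<bar> powr p \<partial>M) - (\<integral>x. \<bar>\<phi> k x\<bar> powr p \<partial>M)\<bar> < 1 / real (Suc k)"
     "\<And>k. \<bar>(\<integral>x. \<bar>W k (n k) x\<bar> powr q \<partial>M) - (\<integral>x. \<bar>\<phi> k x\<bar> powr q \<partial>M)\<bar> < 1 / real (Suc k)"
    by (auto simp: Pr_def)
  have *: "a \<longlonglongrightarrow> L" if "\<And>k. \<bar>a k - b k\<bar> < 1 / real (Suc k)" "b \<longlonglongrightarrow> L" for a b :: "nat \<Rightarrow> real" and L
  proof -
    have "(\<lambda>k. a k - b k) \<longlonglongrightarrow> 0"
      by (rule Lim_null_comparison[OF _ LIMSEQ_inverse_real_of_nat[unfolded inverse_eq_divide]])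
         (use that(1) in \<open>auto intro!: always_eventually less_imp_le\<close>)
    from tendsto_add[OF this that(2)] show ?thesis by simp
  qed
  show ?thesis
  proof (rule that[of "\<lambda>k. W k (n k)" "\<lambda>k. nrm M (cgrad (\<phi> k))"])
    show "(\<lambda>k. nrm M (W k (n k))) \<longlonglongrightarrow> nrm M v"
      by (rule *[OF n(1) nrm_tendsto[OF test_sq(1)[OF \<phi>(1)] HP_sq(1)[OF vh] \<phi>(2)]])
    show "(\<lambda>k. nrm M (cgrad (\<phi> k))) \<longlonglongrightarrow> nrm M h"
      by (rule nrm_tendsto[OF test_sq(2)[OF \<phi>(1)] HP_sq(2)[OF vh] \<phi>(3)])
    show "(\<lambda>k. \<integral>x. \<bar>W k (n k) x\<bar> powr p \<partial>M) \<longlonglongrightarrow> (\<integral>x. \<bar>v x\<bar> powr p \<partial>M)"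
      by (rule *[OF n(2) power_functional_tendsto[OF p_gt_2 p_crit HP_test[OF \<phi>(1)] vh \<phi>(3)]])
    show "(\<lambda>k. \<integral>x. \<bar>W k (n k) x\<bar> powr q \<partial>M) \<longlonglongrightarrow> (\<integral>x. \<bar>v x\<bar> powr q \<partial>M)"
      by (rule *[OF n(3) power_functional_tendsto[OF q_gt_2 q_crit HP_test[OF \<phi>(1)] vh \<phi>(3)]])
  qed (rule W(1) W0 Wg)+
qed

end

section \<open>Existence of a minimizer\<close>

text \<open>The parallelogram law; the last term is the gain from uniform convexity.\<close>

lemma nrm_midpoint:
  assumes "sq M f" "sq M g"
  shows "(nrm M (\<lambda>x. (1 / 2) *\<^sub>R (f x + g x)))\<^sup>2
    = (nrm M f)\<^sup>2 / 2 + (nrm M g)\<^sup>2 / 2 - (nrm M (\<lambda>x. f x - g x))\<^sup>2 / 4"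
proof -
  have 1: "(nrm M (\<lambda>x. (1 / 2) *\<^sub>R (f x + g x)))\<^sup>2 = (nrm M (\<lambda>x. f x + g x))\<^sup>2 / 4"
    by (simp add: nrm_scaleR power_mult_distrib power2_eq_square)
  have 2: "(nrm M (\<lambda>x. f x - g x))\<^sup>2 = (nrm M f)\<^sup>2 - 2 * (\<integral>x. f x \<bullet> g x \<partial>M) + (nrm M g)\<^sup>2"
    using nrm_add_square[OF assms(1) sq_uminus[OF assms(2)]] by (simp add: nrm_uminus)
  show ?thesis unfolding 1 2 nrm_add_square[OF assms] by (simp add: field_simps)
qed

context dirichlet_problem
begin

text \<open>On the ball \<open>\<parallel>\<nabla>v\<parallel>\<^sup>2 \<le> T\<close> with \<open>T\<close> small the energy is uniformly convex, so a minimizing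
  sequence on the sphere is Cauchy in \<open>H\<^sup>1\<close> as soon as it is Cauchy in \<open>L\<^sup>2\<close>; the midpoints
  are brought back to the sphere by rescaling.\<close>
lemma minimizer_exists:
  obtains \<rho>0 where "\<rho>0 > 0" "\<And>\<rho>. 0 < \<rho> \<Longrightarrow> \<rho> < \<rho>0 \<Longrightarrow>
    \<exists>T u g w. HP u g \<and> (nrm M u)\<^sup>2 = \<rho> \<and> (AE x in M. 0 \<le> u x) \<and> (nrm M g)\<^sup>2 < T \<and>
      (\<forall>v h. HP v h \<longrightarrow> (nrm M v)\<^sup>2 = \<rho> \<longrightarrow> (nrm M h)\<^sup>2 < T \<longrightarrow> En u g \<le> En v h) \<and>
      (\<forall>k. test_fun \<Omega> (w k) \<and> (\<forall>x. 0 \<le> w k x)) \<and>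
      (\<lambda>k. nrm M (\<lambda>x. w k x - u x)) \<longlonglongrightarrow> 0 \<and> (\<lambda>k. nrm M (\<lambda>x. cgrad (w k) x - g x)) \<longlonglongrightarrow> 0"
proof -
  obtain B where B: "B > 0"
    "\<And>v h X. HP v h \<Longrightarrow> nrm M h \<le> X \<Longrightarrow> X \<le> 1 \<Longrightarrow> \<bar>Nl v\<bar> \<le> B * X powr p"
    "\<And>v h w k. HP v h \<Longrightarrow> HP w k \<Longrightarrow> nrm M h \<le> 1 \<Longrightarrow> nrm M k \<le> 1 \<Longrightarrow> \<bar>Nl v - Nl w\<bar> \<le> B * nrm M (\<lambda>x. h x - k x)"
    "\<And>v h w k X. HP v h \<Longrightarrow> HP w k \<Longrightarrow> nrm M h \<le> X \<Longrightarrow> nrm M k \<le> X \<Longrightarrow> X \<le> 1 \<Longrightarrow>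
      AE x in M. 0 \<le> v x \<Longrightarrow> AE x in M. 0 \<le> w x \<Longrightarrow>
      \<bar>Nl v / 2 + Nl w / 2 - Nl (\<lambda>x. (v x + w x) / 2)\<bar> \<le> B * X powr (p - 2) * (nrm M (\<lambda>x. h x - k x))\<^sup>2"
    by (rule Nl_bounds) (rule that)
  obtain \<phi>0 where \<phi>0: "test_fun \<Omega> \<phi>0" "\<And>x. 0 \<le> \<phi>0 x" "nrm M \<phi>0 = 1"
    by (rule unit_test_fun) (rule that)
  define A where "A = (nrm M (cgrad \<phi>0))\<^sup>2"
  have A: "A > 0"
  proof -
    obtain C where "C > 0" "\<And>v h. HP v h \<Longrightarrow> nrm M v \<le> C * nrm M h" by (rule HP_poincare) (rule that)
    from this(2)[OF HP_test[OF \<phi>0(1)]] have "nrm M (cgrad \<phi>0) \<noteq> 0" using \<phi>0(3) by auto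
    thus ?thesis by (simp add: A_def)
  qed
  \<comment> \<open>R \<le> R0 gives \<open>B * R powr (p - 2) \<le> 1 / 32\<close>, the bound
    behind both the smallness of \<open>Nl\<close> and the convexity; the cap 1/4 keeps the radius
    below 1, where \<open>Nl_bounds\<close> applies. \<open>\<rho>0\<close> is then the value of
    \<rho> at which T reaches R0^2.\<close>
  define R0 where "R0 = min (1 / 4) ((1 / (32 * B)) powr (1 / (p - 2)))"
  have R0: "R0 > 0" using B(1) by (simp add: R0_def)
  define \<rho>0 where "\<rho>0 = R0\<^sup>2 / (2 * A)"
  have main: "\<exists>T u g w. HP u g \<and> (nrm M u)\<^sup>2 = \<rho> \<and> (AE x in M. 0 \<le> u x) \<and> (nrm M g)\<^sup>2 < T \<and>
      (\<forall>v h. HP v h \<longrightarrow> (nrm M v)\<^sup>2 = \<rho> \<longrightarrow> (nrm M h)\<^sup>2 < T \<longrightarrow> En u g \<le> En v h) \<and>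
      (\<forall>k. test_fun \<Omega> (w k) \<and> (\<forall>x. 0 \<le> w k x)) \<and>
      (\<lambda>k. nrm M (\<lambda>x. w k x - u x)) \<longlonglongrightarrow> 0 \<and> (\<lambda>k. nrm M (\<lambda>x. cgrad (w k) x - g x)) \<longlonglongrightarrow> 0"
    if \<rho>: "0 < \<rho>" "\<rho> < \<rho>0" for \<rho>
  proof -
    define T where "T = 2 * A * \<rho>"
    have T: "T > 0" using A \<rho> by (simp add: T_def)
    define R where "R = sqrt T"
    have R: "R > 0" "R\<^sup>2 = T" using T by (auto simp: R_def)
    have "T < R0\<^sup>2" using \<rho> A by (simp add: T_def \<rho>0_def field_simps)
    hence RR0: "R \<le> R0" unfolding R_def using R0 real_le_lsqrt[of R0 T] T by simp
    have R1: "R \<le> 1" using RR0 by (simp add: R0_def)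
    have BR: "B * R powr (p - 2) \<le> 1 / 32"
    proof -
      have "R powr (p - 2) \<le> ((1 / (32 * B)) powr (1 / (p - 2))) powr (p - 2)"
        using RR0 R p_gt_2 by (intro powr_mono2) (auto simp: R0_def)
      also have "\<dots> = 1 / (32 * B)" using B(1) p_gt_2 by (simp add: powr_powr)
      finally show ?thesis using B(1) by (simp add: field_simps)
    qed
    have le_R: "nrm M h \<le> R" if "(nrm M h)\<^sup>2 \<le> T" for h :: "real^'n \<Rightarrow> real^'n"
      unfolding R_def using real_le_rsqrt[OF that] .
    have nl: "\<bar>Nl v\<bar> \<le> T / 32" if "HP v h" "(nrm M h)\<^sup>2 \<le> T" for v h
    proof -
      have "\<bar>Nl v\<bar> \<le> B * R powr p" by (rule B(2)[OF that(1) le_R[OF that(2)] R1])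
      also have "R powr p = R powr (p - 2) * R\<^sup>2"
        using R(1) powr_add[of R "p - 2" 2] by simp
      also have "B * (R powr (p - 2) * R\<^sup>2) = (B * R powr (p - 2)) * T" by (simp add: R(2))
      also have "\<dots> \<le> (1 / 32) * T" using BR T by (intro mult_right_mono) auto
      finally show ?thesis by simp
    qed
    define S where "S = {\<phi>. test_fun \<Omega> \<phi> \<and> (\<forall>x. 0 \<le> \<phi> x) \<and> (nrm M \<phi>)\<^sup>2 = \<rho> \<and> (nrm M (cgrad \<phi>))\<^sup>2 \<le> T}"
    define J where "J \<phi> = En \<phi> (cgrad \<phi>)" for \<phi>
    have J: "J \<phi> = (nrm M (cgrad \<phi>))\<^sup>2 / 2 - Nl \<phi>" for \<phi> by (simp add: J_def En_def)
    have cg: "cgrad (\<lambda>x. c * \<phi> x) = (\<lambda>x. c *\<^sub>R cgrad \<phi> x)" if "test_fun \<Omega> \<phi>" for c \<phi>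
      by (rule ext) (rule cgrad_cmult[OF that])
    have ncg: "nrm M (cgrad (\<lambda>x. c * \<phi> x)) = \<bar>c\<bar> * nrm M (cgrad \<phi>)" if "test_fun \<Omega> \<phi>" for c \<phi>
      unfolding cg[OF that] by (rule nrm_scaleR)
    have nc: "nrm M (\<lambda>x. c * \<phi> x) = \<bar>c\<bar> * nrm M \<phi>" for c and \<phi> :: "real^'n \<Rightarrow> real"
      using nrm_scaleR[of M c \<phi>] by simp
    define \<phi>1 where "\<phi>1 = (\<lambda>x. sqrt \<rho> * \<phi>0 x)"
    have \<phi>1T: "(nrm M (cgrad \<phi>1))\<^sup>2 = T / 2"
      using \<rho> by (simp add: \<phi>1_def ncg[OF \<phi>0(1)] power_mult_distrib T_def A_def)
    have \<phi>1: "\<phi>1 \<in> S"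
      using \<phi>1T \<phi>0 \<rho> T test_fun_cmult[OF \<phi>0(1)] by (simp add: S_def \<phi>1_def nc power_mult_distrib)
    \<comment> \<open>T/4 from the gradient plus at most T/32 from the power terms.\<close>
    have J1: "J \<phi>1 \<le> 9 * T / 32"
    proof -
      have "HP \<phi>1 (cgrad \<phi>1)" using \<phi>1 by (auto simp: S_def intro: HP_test)
      from nl[OF this] have "\<bar>Nl \<phi>1\<bar> \<le> T / 32" using \<phi>1T T by simp
      thus ?thesis by (simp add: J \<phi>1T)
    qed
    have SD: "test_fun \<Omega> \<phi>" "0 \<le> \<phi> x" "(nrm M \<phi>)\<^sup>2 = \<rho>" "(nrm M (cgrad \<phi>))\<^sup>2 \<le> T" "HP \<phi> (cgrad \<phi>)" "\<bar>Nl \<phi>\<bar> \<le> T / 32"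
      if "\<phi> \<in> S" for \<phi> x
      using that nl[OF HP_test] by (auto simp: S_def intro: HP_test)
    define m where "m = Inf (J ` S)"
    have bdd: "bdd_below (J ` S)"
    proof (rule bdd_belowI2)
      fix \<phi> assume "\<phi> \<in> S"
      show "- (T / 32) \<le> J \<phi>" using SD(6)[OF \<open>\<phi> \<in> S\<close>] zero_le_power2[of "nrm M (cgrad \<phi>)"] unfolding J by linarith
    qed
    have mle: "m \<le> J \<phi>" if "\<phi> \<in> S" for \<phi>
      unfolding m_def by (rule cINF_lower[OF bdd that])
    have "\<exists>\<phi>. \<phi> \<in> S \<and> J \<phi> < m + T / (32 * real (Suc k))" for k
    proof -
      have "Inf (J ` S) < m + T / (32 * real (Suc k))" using T by (simp add: m_def)
      thus ?thesis using cInf_lessD[of "J ` S"] \<phi>1 by blast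
    qed
    hence "\<forall>k. \<exists>\<phi>. \<phi> \<in> S \<and> J \<phi> < m + T / (32 * real (Suc k))" by blast
    from choice[OF this] obtain \<phi> where \<phi>: "\<And>k. \<phi> k \<in> S" "\<And>k. J (\<phi> k) < m + T / (32 * real (Suc k))" by auto
    \<comment> \<open>Near-minimality adds at most T/32 to 9 T/32, and the power terms another T/32:
      half the gradient mass is at most 11 T/32, well below T/2.\<close>
    have D: "(nrm M (cgrad (\<phi> k)))\<^sup>2 \<le> 11 * T / 16" for k
    proof -
      have "T / (32 * real (Suc k)) \<le> T / 32" using T by (simp add: field_simps)
      hence "J (\<phi> k) \<le> 10 * T / 32" using \<phi>(2)[of k] mle[OF \<phi>1] J1 by linarith
      thus ?thesis using SD(6)[OF \<phi>(1)[of k]] unfolding J by linarith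
    qed
    note tf = SD(1)[OF \<phi>(1)]
    obtain r where r: "strict_mono (r :: nat \<Rightarrow> nat)"
      "\<And>e. e > 0 \<Longrightarrow> \<exists>n0. \<forall>k\<ge>n0. \<forall>l\<ge>n0. (\<integral>x. (\<phi> (r k) x - \<phi> (r l) x)\<^sup>2 \<partial>lborel) < e"
    proof (rule rellich[OF bounded_dom dom_sets(1) test_fun_C1z[OF tf]])
      show "(\<integral>x. (norm (cgrad (\<phi> n) x))\<^sup>2 \<partial>lborel) \<le> T" for n
        using SD(4)[OF \<phi>(1)[of n]] by (simp add: C1z_nrm(2)[OF test_fun_C1z[OF tf]])
    qed (rule that)
    define \<psi> where "\<psi> k = \<phi> (r k)" for k
    have \<psi>S: "\<psi> k \<in> S" for k by (simp add: \<psi>_def \<phi>)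
    note S\<psi> = SD[OF \<psi>S]
    have \<psi>D: "(nrm M (cgrad (\<psi> k)))\<^sup>2 \<le> 11 * T / 16" for k unfolding \<psi>_def by (rule D)
    have \<psi>J: "J (\<psi> k) \<le> m + T / (32 * real (Suc k))" for k
    proof -
      have "T / (32 * real (Suc (r k))) \<le> T / (32 * real (Suc k))"
        using seq_suble[OF r(1), of k] T by (intro divide_left_mono mult_left_mono) auto
      thus ?thesis using \<phi>(2)[of "r k"] by (simp add: \<psi>_def)
    qed
    have L2: "\<exists>n0. \<forall>k\<ge>n0. \<forall>l\<ge>n0. (nrm M (\<lambda>x. \<psi> k x - \<psi> l x))\<^sup>2 < e" if "e > 0" for e
      using r(2)[OF that] by (simp add: \<psi>_def C1z_nrm(1)[OF C1z_diff[OF test_fun_C1z[OF tf] test_fun_C1z[OF tf]]])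
    \<comment> \<open>The price of bringing a midpoint back to the sphere: c^2 - 1 is at most d2 /
      (3 \<rho>), and the energy rises by at most T/2 + B times c^2 - 1.\<close>
    define L where "L = (T / 2 + B) / (3 * \<rho>)"
    have L: "L \<ge> 0" using T B \<rho> by (simp add: L_def)
    \<comment> \<open>The parallelogram law gains Z2/8 in the energy of the midpoint, the midpoint
      bound for \<open>Nl\<close> loses at most Z2/32, and 1/8 - 1/32 = 3/32. Since the rescaled
      midpoint cannot go below \<open>m\<close>, the gain is at most the slack of the two members
      plus the price of rescaling.\<close>
    have conv: "3 * (nrm M (\<lambda>x. cgrad (\<psi> k) x - cgrad (\<psi> l) x))\<^sup>2 / 32
        \<le> T / (64 * real (Suc k)) + T / (64 * real (Suc l)) + L * (nrm M (\<lambda>x. \<psi> k x - \<psi> l x))\<^sup>2"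
      if dk: "(nrm M (\<lambda>x. \<psi> k x - \<psi> l x))\<^sup>2 \<le> \<rho>" for k l
    proof -
      define d2 where "d2 = (nrm M (\<lambda>x. \<psi> k x - \<psi> l x))\<^sup>2"
      define Z2 where "Z2 = (nrm M (\<lambda>x. cgrad (\<psi> k) x - cgrad (\<psi> l) x))\<^sup>2"
      define c0 where "c0 x = \<psi> k x + \<psi> l x" for x
      define y where "y x = (1 / 2) * c0 x" for x
      have tc0: "test_fun \<Omega> c0" unfolding c0_def by (intro test_fun_add S\<psi>)
      have ty: "test_fun \<Omega> y" unfolding y_def by (rule test_fun_cmult[OF tc0])
      have gy: "cgrad y = (\<lambda>x. (1 / 2) *\<^sub>R (cgrad (\<psi> k) x + cgrad (\<psi> l) x))"
        unfolding y_def cg[OF tc0] by (rule ext) (simp only: c0_def[abs_def] cgrad_add[OF S\<psi>(1) S\<psi>(1)])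
      \<comment> \<open>The midpoint falls inside the sphere by a quarter of the squared distance,
        so members close in mean square need little rescaling.\<close>
      have ny: "(nrm M y)\<^sup>2 = \<rho> - d2 / 4"
        using nrm_midpoint[OF test_sq(1)[OF S\<psi>(1)] test_sq(1)[OF S\<psi>(1)], of k l] S\<psi>(3)[of k] S\<psi>(3)[of l]
        by (simp add: y_def[abs_def] c0_def d2_def)
      have Dy: "(nrm M (cgrad y))\<^sup>2 = (nrm M (cgrad (\<psi> k)))\<^sup>2 / 2 + (nrm M (cgrad (\<psi> l)))\<^sup>2 / 2 - Z2 / 4"
        unfolding gy Z2_def by (rule nrm_midpoint[OF test_sq(2)[OF S\<psi>(1)] test_sq(2)[OF S\<psi>(1)]])
      have Dy2: "(nrm M (cgrad y))\<^sup>2 \<le> 11 * T / 16"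
      proof -
        have "0 \<le> Z2" by (simp add: Z2_def)
        thus ?thesis using Dy \<psi>D[of k] \<psi>D[of l] by linarith
      qed
      define s where "s = (nrm M y)\<^sup>2"
      have d2: "0 \<le> d2" "d2 \<le> \<rho>" using dk by (auto simp: d2_def)
      have s: "3 * \<rho> / 4 \<le> s" "s \<le> \<rho>" "s > 0" using ny d2 \<rho> by (auto simp: s_def)
      define c where "c = sqrt (\<rho> / s)"
      have c2: "c\<^sup>2 = \<rho> / s" using s \<rho> by (simp add: c_def)
      have c1: "c \<ge> 1" using s by (simp add: c_def)
      have c2le: "c\<^sup>2 - 1 \<le> d2 / (3 * \<rho>)"
      proof -
        have "c\<^sup>2 - 1 = (\<rho> - s) / s" using s(3) by (simp add: c2 diff_divide_distrib)
        also have "\<rho> - s = d2 / 4" using ny by (simp add: s_def)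
        also have "(d2 / 4) / s \<le> (d2 / 4) / (3 * \<rho> / 4)" using s \<rho> d2 by (intro divide_left_mono) auto
        also have "\<dots> = d2 / (3 * \<rho>)" by simp
        finally show ?thesis .
      qed
      \<comment> \<open>The midpoint has gradient mass at most 11 T/16, so after rescaling it has at
        most 4/3 times that, which is 11 T/12 and still inside the ball. This is the use of the
        restriction d2 \<le> \<rho>.\<close>
      have c43: "c\<^sup>2 \<le> 4 / 3"
      proof -
        have "\<rho> / s \<le> \<rho> / (3 * \<rho> / 4)" using s \<rho> by (intro divide_left_mono) auto
        thus ?thesis using \<rho> by (simp add: c2)
      qed
      have cyS: "(\<lambda>x. c * y x) \<in> S"
        unfolding S_def
      proof (intro CollectI conjI allI)
        show "test_fun \<Omega> (\<lambda>x. c * y x)" by (rule test_fun_cmult[OF ty])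
        show "0 \<le> c * y x" for x using c1 S\<psi>(2) by (simp add: y_def c0_def)
        show "(nrm M (\<lambda>x. c * y x))\<^sup>2 = \<rho>" using s by (simp add: nc power_mult_distrib c2 s_def)
        have "(nrm M (cgrad (\<lambda>x. c * y x)))\<^sup>2 = c\<^sup>2 * (nrm M (cgrad y))\<^sup>2" by (simp add: ncg[OF ty] power_mult_distrib)
        also have "\<dots> \<le> (4 / 3) * (11 * T / 16)" by (intro mult_mono c43 Dy2) auto
        also have "\<dots> \<le> T" using T by simp
        finally show "(nrm M (cgrad (\<lambda>x. c * y x)))\<^sup>2 \<le> T" .
      qed
      have ny1: "nrm M (cgrad y) \<le> R" using Dy2 T by (intro le_R) simp
      have ncy1: "nrm M (cgrad (\<lambda>x. c * y x)) \<le> R" using SD(4)[OF cyS] by (rule le_R)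
      have "\<bar>Nl (\<lambda>x. c * y x) - Nl y\<bar> \<le> B * nrm M (\<lambda>x. cgrad (\<lambda>x. c * y x) x - cgrad y x)"
        by (rule B(3)[OF SD(5)[OF cyS] HP_test[OF ty]]) (use ny1 ncy1 R1 in auto)
      also have "(\<lambda>x. cgrad (\<lambda>x. c * y x) x - cgrad y x) = (\<lambda>x. (c - 1) *\<^sub>R cgrad y x)"
        by (simp add: cg[OF ty] scaleR_left_diff_distrib)
      also have "B * nrm M (\<lambda>x. (c - 1) *\<^sub>R cgrad y x) = B * ((c - 1) * nrm M (cgrad y))"
        using c1 by (simp add: nrm_scaleR)
      also have "\<dots> \<le> B * ((c\<^sup>2 - 1) * 1)"
      proof (intro mult_left_mono mult_mono)
        show "c - 1 \<le> c\<^sup>2 - 1" using c1 by (simp add: power2_eq_square)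
      qed (use ny1 R1 c1 B in \<open>auto simp: nrm_nonneg\<close>)
      finally have Nlc: "\<bar>Nl (\<lambda>x. c * y x) - Nl y\<bar> \<le> B * (c\<^sup>2 - 1)" by simp
      have "J (\<lambda>x. c * y x) = c\<^sup>2 * (nrm M (cgrad y))\<^sup>2 / 2 - Nl (\<lambda>x. c * y x)"
        by (simp add: J ncg[OF ty] power_mult_distrib)
      moreover have "(c\<^sup>2 - 1) * (nrm M (cgrad y))\<^sup>2 \<le> (c\<^sup>2 - 1) * T"
        using Dy2 T c1 by (intro mult_left_mono) (auto simp: one_le_power)
      ultimately have "J (\<lambda>x. c * y x) \<le> J y + (c\<^sup>2 - 1) * (T / 2 + B)"
        using Nlc by (simp add: J algebra_simps abs_le_iff)
      also have "(c\<^sup>2 - 1) * (T / 2 + B) \<le> d2 / (3 * \<rho>) * (T / 2 + B)"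
        using c2le T B by (intro mult_right_mono) auto
      finally have Jy: "m \<le> J y + L * d2" using mle[OF cyS] by (simp add: L_def mult.commute)
      have "\<bar>Nl (\<psi> k) / 2 + Nl (\<psi> l) / 2 - Nl (\<lambda>x. (\<psi> k x + \<psi> l x) / 2)\<bar> \<le> B * R powr (p - 2) * Z2"
        unfolding Z2_def
        by (rule B(4)[OF S\<psi>(5) S\<psi>(5) le_R[OF S\<psi>(4)] le_R[OF S\<psi>(4)] R1]) (auto simp: S\<psi>(2))
      also have "\<dots> \<le> (1 / 32) * Z2" using BR by (intro mult_right_mono) (auto simp: Z2_def)
      finally have "\<bar>Nl (\<psi> k) / 2 + Nl (\<psi> l) / 2 - Nl y\<bar> \<le> Z2 / 32"
        by (simp add: y_def[abs_def] c0_def)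
      hence "Nl (\<psi> k) / 2 + Nl (\<psi> l) / 2 - Nl y \<le> Z2 / 32" by (rule abs_le_D1)
      hence "J (\<psi> k) / 2 + J (\<psi> l) / 2 - J y \<ge> Z2 / 8 - Z2 / 32"
        unfolding J Dy by (simp add: field_simps)
      moreover have "3 * Z / 32 \<le> a / 2 + b / 2 + l"
        if "Z / 8 - Z / 32 \<le> x / 2 + y / 2 - z" "m \<le> z + l" "x \<le> m + a" "y \<le> m + b" for Z x y z a b l :: real
        using that by linarith
      ultimately have "3 * Z2 / 32 \<le> T / (32 * real (Suc k)) / 2 + T / (32 * real (Suc l)) / 2 + L * d2"
        using Jy \<psi>J by blast
      hence "3 * Z2 / 32 \<le> T / (64 * real (Suc k)) + T / (64 * real (Suc l)) + L * d2"
        by simp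
      thus ?thesis by (simp only: Z2_def d2_def)
    qed
    have L2C: "\<exists>n0. \<forall>k\<ge>n0. \<forall>l\<ge>n0. nrm M (\<lambda>x. \<psi> k x - \<psi> l x) < e" if "e > 0" for e
    proof -
      obtain n0 where n0: "\<forall>k\<ge>n0. \<forall>l\<ge>n0. (nrm M (\<lambda>x. \<psi> k x - \<psi> l x))\<^sup>2 < e\<^sup>2" using L2[of "e\<^sup>2"] \<open>e > 0\<close> by auto
      show ?thesis
        by (rule exI[of _ n0]) (use n0 \<open>e > 0\<close> in \<open>auto intro: power_less_imp_less_base[of _ 2]\<close>)
    qed
    have gradC: "\<exists>n0. \<forall>k\<ge>n0. \<forall>l\<ge>n0. nrm M (\<lambda>x. cgrad (\<psi> k) x - cgrad (\<psi> l) x) < e" if e: "e > 0" for e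
    proof -
      \<comment> \<open>The bound \<rho> makes \<open>conv\<close> applicable; the other makes L d2
        at most 3 e^2 / 128. With the two slack terms the total is 9 e^2 / 128, below 3 e^2 / 32.
        Using L + 1 avoids dividing by 0.\<close>
      define \<delta> where "\<delta> = min \<rho> (3 * e\<^sup>2 / (128 * (L + 1)))"
      have \<delta>: "\<delta> > 0" using \<rho> e L by (simp add: \<delta>_def)
      obtain n1 where n1: "\<forall>k\<ge>n1. \<forall>l\<ge>n1. (nrm M (\<lambda>x. \<psi> k x - \<psi> l x))\<^sup>2 < \<delta>" using L2[OF \<delta>] by blast
      obtain n2 :: nat where n2: "2 * T / (3 * e\<^sup>2) < real n2" using reals_Archimedean2 by blast
      have eps: "T / (64 * real (Suc k)) \<le> 3 * e\<^sup>2 / 128" if "k \<ge> n2" for k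
      proof -
        have "2 * T / (3 * e\<^sup>2) < real (Suc k)" using n2 that by simp
        hence "2 * T \<le> real (Suc k) * (3 * e\<^sup>2)" using e by (simp add: field_simps)
        thus ?thesis by (simp add: field_simps)
      qed
      show ?thesis
      proof (intro exI[of _ "max n1 n2"] allI impI)
        fix k l assume kl: "max n1 n2 \<le> k" "max n1 n2 \<le> l"
        define d2 where "d2 = (nrm M (\<lambda>x. \<psi> k x - \<psi> l x))\<^sup>2"
        have d2: "d2 < \<delta>" using n1 kl by (simp add: d2_def)
        have "L * d2 \<le> (L + 1) * \<delta>" using d2 L by (intro mult_mono) (auto simp: d2_def)
        also have "\<dots> \<le> (L + 1) * (3 * e\<^sup>2 / (128 * (L + 1)))" using L by (intro mult_left_mono) (auto simp: \<delta>_def)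
        also have "\<dots> = 3 * e\<^sup>2 / 128"
        proof -
          have "L + 1 \<noteq> 0" using L by simp
          thus ?thesis by (simp add: divide_simps)
        qed
        finally have Ld: "L * d2 \<le> 3 * e\<^sup>2 / 128" .
        have "d2 \<le> \<rho>" using d2 by (simp add: \<delta>_def)
        hence "3 * (nrm M (\<lambda>x. cgrad (\<psi> k) x - cgrad (\<psi> l) x))\<^sup>2 / 32
            \<le> T / (64 * real (Suc k)) + T / (64 * real (Suc l)) + L * d2"
          unfolding d2_def by (rule conv)
        moreover have "T / (64 * real (Suc k)) \<le> 3 * e\<^sup>2 / 128" "T / (64 * real (Suc l)) \<le> 3 * e\<^sup>2 / 128"
          by (rule eps, use kl in simp)+
        ultimately have "3 * (nrm M (\<lambda>x. cgrad (\<psi> k) x - cgrad (\<psi> l) x))\<^sup>2 / 32 \<le> 3 * (3 * e\<^sup>2 / 128)"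
          using Ld by linarith
        moreover have "e\<^sup>2 > 0" using e by simp
        ultimately have "(nrm M (\<lambda>x. cgrad (\<psi> k) x - cgrad (\<psi> l) x))\<^sup>2 < e\<^sup>2" by linarith
        thus "nrm M (\<lambda>x. cgrad (\<psi> k) x - cgrad (\<psi> l) x) < e" by (rule power_less_imp_less_base) (use e in simp)
      qed
    qed
    obtain u where u: "sq M u" "(\<lambda>n. nrm M (\<lambda>x. \<psi> n x - u x)) \<longlonglongrightarrow> 0"
      by (rule nrm_complete[OF finite_M test_sq(1)[OF S\<psi>(1)]]) (erule L2C, rule that)
    obtain g where g: "sq M g" "(\<lambda>n. nrm M (\<lambda>x. cgrad (\<psi> n) x - g x)) \<longlonglongrightarrow> 0"
      by (rule nrm_complete[OF finite_M test_sq(2)[OF S\<psi>(1)]]) (erule gradC, rule that)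
    have ug: "HP u g" by (rule HP_closed[OF S\<psi>(5) u(1) g(1) u(2) g(2)])
    have "(\<lambda>n. (nrm M (\<psi> n))\<^sup>2) \<longlonglongrightarrow> (nrm M u)\<^sup>2"
      by (intro tendsto_intros nrm_tendsto[OF test_sq(1)[OF S\<psi>(1)] u])
    hence nu: "(nrm M u)\<^sup>2 = \<rho>" by (simp add: S\<psi>(3) LIMSEQ_const_iff)
    have gl: "(\<lambda>n. (nrm M (cgrad (\<psi> n)))\<^sup>2) \<longlonglongrightarrow> (nrm M g)\<^sup>2"
      by (intro tendsto_intros nrm_tendsto[OF test_sq(2)[OF S\<psi>(1)] g])
    \<comment> \<open>The limit keeps its distance from the boundary of the ball, so the minimizer
      is interior, as the variations and the neighbourhood in the theorem require.\<close>
    have "(nrm M g)\<^sup>2 \<le> 11 * T / 16" by (rule LIMSEQ_le_const2[OF gl]) (use \<psi>D in auto)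
    hence ng: "(nrm M g)\<^sup>2 < T" using T by simp
    obtain r' where r': "strict_mono (r' :: nat \<Rightarrow> nat)" "AE x in M. (\<lambda>n. \<psi> (r' n) x) \<longlonglongrightarrow> u x"
      by (rule nrm_tendsto_AE_subseq[OF test_sq(1)[OF S\<psi>(1)] u]) (rule that)
    have u0: "AE x in M. 0 \<le> u x"
      using r'(2) by eventually_elim (rule LIMSEQ_le_const, auto simp: S\<psi>(2))
    have Eu: "En u g \<le> m"
    proof (rule LIMSEQ_le)
      show "(\<lambda>n. J (\<psi> n)) \<longlonglongrightarrow> En u g"
        unfolding J En_def by (intro tendsto_intros gl Nl_tendsto[OF S\<psi>(5) ug g(2)]) simp
      have "(\<lambda>n. m + T / 32 * (1 / real (Suc n))) \<longlonglongrightarrow> m + T / 32 * 0"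
        by (intro tendsto_intros LIMSEQ_inverse_real_of_nat[unfolded inverse_eq_divide])
      thus "(\<lambda>n. m + T / (32 * real (Suc n))) \<longlonglongrightarrow> m" by simp
    qed (use \<psi>J in auto)
    have comp: "En u g \<le> En v h" if vh: "HP v h" "(nrm M v)\<^sup>2 = \<rho>" "(nrm M h)\<^sup>2 < T" for v h
    proof -
      obtain w a where w: "\<And>k. test_fun \<Omega> (w k)" "\<And>k x. 0 \<le> w k x" "(\<lambda>k. nrm M (w k)) \<longlonglongrightarrow> nrm M v"
        "\<And>k. nrm M (cgrad (w k)) \<le> a k" "a \<longlonglongrightarrow> nrm M h"
        "(\<lambda>k. \<integral>x. \<bar>w k x\<bar> powr p \<partial>M) \<longlonglongrightarrow> (\<integral>x. \<bar>v x\<bar> powr p \<partial>M)"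
        "(\<lambda>k. \<integral>x. \<bar>w k x\<bar> powr q \<partial>M) \<longlonglongrightarrow> (\<integral>x. \<bar>v x\<bar> powr q \<partial>M)"
        by (rule nonneg_test_approx[OF vh(1)]) (rule that)
      have nv: "nrm M v = sqrt \<rho>" using vh(2) nrm_nonneg[of M v] by (metis real_sqrt_abs abs_of_nonneg)
      define c where "c k = sqrt \<rho> / nrm M (w k)" for k
      have c: "c \<longlonglongrightarrow> 1"
      proof -
        have "c \<longlonglongrightarrow> sqrt \<rho> / nrm M v" unfolding c_def by (intro tendsto_intros w) (use nv \<rho> in simp)
        thus ?thesis using nv \<rho> by simp
      qed
      have c0: "c k \<ge> 0" for k using \<rho> by (simp add: c_def nrm_nonneg)
      \<comment> \<open>An upper bound for the energy of the rescaled approximant, with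
        \<open>a k\<close> in place of its gradient norm; it converges to the energy of the
        competitor. The strict bound on the gradient norm of \<open>h\<close> puts the approximants
        into \<open>S\<close> from some index on.\<close>
      define E where "E k = (c k)\<^sup>2 * (a k)\<^sup>2 / 2 - (\<mu> / p * (c k powr p * (\<integral>x. \<bar>w k x\<bar> powr p \<partial>M))
        + 1 / q * (c k powr q * (\<integral>x. \<bar>w k x\<bar> powr q \<partial>M)))" for k
      have "E \<longlonglongrightarrow> 1\<^sup>2 * (nrm M h)\<^sup>2 / 2 - (\<mu> / p * (1 powr p * (\<integral>x. \<bar>v x\<bar> powr p \<partial>M))
        + 1 / q * (1 powr q * (\<integral>x. \<bar>v x\<bar> powr q \<partial>M)))"
        unfolding E_def by (intro tendsto_intros c w) auto
      hence El: "E \<longlonglongrightarrow> En v h" by (simp add: En_def Nl_def)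
      have "(\<lambda>k. (c k)\<^sup>2 * (a k)\<^sup>2) \<longlonglongrightarrow> 1\<^sup>2 * (nrm M h)\<^sup>2" by (intro tendsto_intros c w)
      hence ev1: "\<forall>\<^sub>F k in sequentially. (c k)\<^sup>2 * (a k)\<^sup>2 < T" using vh(3) by (intro order_tendstoD) auto
      have ev2: "\<forall>\<^sub>F k in sequentially. nrm M (w k) > 0" by (rule order_tendstoD(1)[OF w(3)]) (use nv \<rho> in simp)
      have "\<forall>\<^sub>F k in sequentially. m \<le> E k" using ev1 ev2
      proof eventually_elim
        case (elim k)
        have le: "(nrm M (cgrad (\<lambda>x. c k * w k x)))\<^sup>2 \<le> (c k)\<^sup>2 * (a k)\<^sup>2"
          unfolding ncg[OF w(1)] using w(4)[of k]
          by (simp add: power_mult_distrib nrm_nonneg) (intro mult_left_mono power_mono; simp add: nrm_nonneg)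
        have cwS: "(\<lambda>x. c k * w k x) \<in> S"
          unfolding S_def
        proof (intro CollectI conjI allI)
          show "test_fun \<Omega> (\<lambda>x. c k * w k x)" by (rule test_fun_cmult[OF w(1)])
          show "0 \<le> c k * w k x" for x using c0 w(2) by simp
          show "(nrm M (\<lambda>x. c k * w k x))\<^sup>2 = \<rho>" 
            unfolding nc using elim \<rho> by (simp add: power_mult_distrib c_def power_divide)
          show "(nrm M (cgrad (\<lambda>x. c k * w k x)))\<^sup>2 \<le> T" using le elim by linarith
        qed
        have "m \<le> J (\<lambda>x. c k * w k x)" by (rule mle[OF cwS])
        also have "\<dots> \<le> E k" unfolding J E_def Nl_scale[OF c0] using le by simp
        finally show ?case .
      qed
      from tendsto_lowerbound[OF El this] have "m \<le> En v h" by simp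
      thus ?thesis using Eu by linarith
    qed
    show ?thesis
      by (intro exI[of _ T] exI[of _ u] exI[of _ g] exI[of _ \<psi>] conjI allI impI ug nu u0 ng comp S\<psi> u(2) g(2))
  qed
  have "\<rho>0 > 0" using R0 A by (simp add: \<rho>0_def)
  thus ?thesis by (rule that) (rule main)
qed

end

section \<open>The Euler-Lagrange equation\<close>

text \<open>At a = 0 the modulus of the quotient is |h|^(r - 1) |b|^r, which tends to 0 because r >
  1; for a > 0 the modulus is inactive near t = 0.\<close>

lemma DERIV_abs_powr_line:
  fixes a b r :: real
  assumes a: "0 \<le> a" and r: "r > 1"
  shows "((\<lambda>t. \<bar>a + t * b\<bar> powr r) has_real_derivative r * \<bar>a\<bar> powr (r - 1) * b) (at 0)"
proof (cases "a = 0")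
  case False
  hence a: "a > 0" using a by simp
  have "((\<lambda>t. (a + t * b) powr r) has_real_derivative r * \<bar>a\<bar> powr (r - 1) * b) (at 0)"
    using a by (auto intro!: derivative_eq_intros)
  moreover have "\<forall>\<^sub>F t in nhds 0. (a + t * b) powr r = \<bar>a + t * b\<bar> powr r"
  proof -
    have "((\<lambda>t. a + t * b) \<longlongrightarrow> a + 0 * b) (nhds 0)" by (intro tendsto_intros filterlim_ident)
    hence "\<forall>\<^sub>F t in nhds 0. a + t * b > 0" using a by (intro order_tendstoD) auto
    thus ?thesis by eventually_elim simp
  qed
  ultimately show ?thesis by (subst (asm) DERIV_cong_ev[OF refl _ refl]) auto
next
  case True
  have "((\<lambda>h. (\<bar>h * b\<bar> powr r - 0) / h) \<longlongrightarrow> 0) (at 0)"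
  proof (rule Lim_null_comparison)
    have "((\<lambda>h::real. \<bar>h\<bar> powr (r - 1) * \<bar>b\<bar> powr r) \<longlongrightarrow> \<bar>0\<bar> powr (r - 1) * \<bar>b\<bar> powr r) (at 0)"
      by (intro tendsto_mult tendsto_const tendsto_powr' tendsto_rabs tendsto_ident_at) (use r in auto)
    thus "((\<lambda>h::real. \<bar>h\<bar> powr (r - 1) * \<bar>b\<bar> powr r) \<longlongrightarrow> 0) (at 0)" using r by simp
    show "\<forall>\<^sub>F h in at 0. norm ((\<bar>h * b\<bar> powr r - 0) / h) \<le> \<bar>h\<bar> powr (r - 1) * \<bar>b\<bar> powr r"
    proof (rule eventually_at_filter[THEN iffD2], intro always_eventually allI impI)
      fix h :: real assume h: "h \<noteq> 0"
      have "norm ((\<bar>h * b\<bar> powr r - 0) / h) = \<bar>h\<bar> powr r * \<bar>b\<bar> powr r / \<bar>h\<bar>" by (simp add: abs_mult powr_mult abs_divide)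
      also have "\<dots> = \<bar>h\<bar> powr (r - 1) * \<bar>b\<bar> powr r" using h by (simp add: powr_diff)
      finally show "norm ((\<bar>h * b\<bar> powr r - 0) / h) \<le> \<bar>h\<bar> powr (r - 1) * \<bar>b\<bar> powr r" by simp
    qed
  qed
  thus ?thesis using True r by (simp add: DERIV_def)
qed

lemma powr_le_add_powr:
  fixes t s r :: real
  assumes "0 \<le> t" "0 \<le> s" "s \<le> r"
  shows "t powr s \<le> 1 + t powr r"
proof (cases "t \<le> 1")
  case True
  have "t powr s \<le> 1" using assms True by (intro powr_le1) auto
  thus ?thesis using powr_ge_zero[of t r] by linarith
next
  case False
  hence "t powr s \<le> t powr r" using assms by (intro powr_mono) auto
  thus ?thesis by simp
qed

context bounded_domain
begin

lemma lower_power_integrable: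
  fixes v :: "real^'n \<Rightarrow> real" and r s :: real
  assumes [measurable]: "v \<in> borel_measurable M" and i: "integrable M (\<lambda>x. \<bar>v x\<bar> powr r)" and s: "0 \<le> s" "s \<le> r"
  shows "integrable M (\<lambda>x. \<bar>v x\<bar> powr s)"
proof (rule Bochner_Integration.integrable_bound)
  show "integrable M (\<lambda>x. 1 + \<bar>v x\<bar> powr r)"
    using i finite_measure.integrable_const[OF finite_M] by (intro Bochner_Integration.integrable_add)
  show "AE x in M. norm (\<bar>v x\<bar> powr s) \<le> norm (1 + \<bar>v x\<bar> powr r)"
    using powr_le_add_powr[OF _ s] by (intro AE_I2) simp
qed measurable

lemma test_bounded:
  assumes "test_fun \<Omega> \<phi>" obtains L where "L > 0" "\<And>x. \<bar>\<phi> x\<bar> \<le> L"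
  by (rule bounded_continuous_vanish[OF C1zD(3) C1zD(4) bounded_dom, OF test_fun_C1z[OF assms] test_fun_C1z[OF assms]])
     (use that in auto)

lemma bounded_mult_integrable:
  fixes f \<phi> :: "real^'n \<Rightarrow> real"
  assumes f: "integrable M f" and \<phi>: "test_fun \<Omega> \<phi>"
  shows "integrable M (\<lambda>x. f x * \<phi> x)"
proof -
  obtain L where L: "L > 0" "\<And>x. \<bar>\<phi> x\<bar> \<le> L" by (rule test_bounded[OF \<phi>]) (rule that)
  have [measurable]: "\<phi> \<in> borel_measurable M" by (rule HP_measurable[OF HP_test[OF \<phi>]])
  have [measurable]: "f \<in> borel_measurable M" using f by simp
  show ?thesis
  proof (rule Bochner_Integration.integrable_bound)
    show "integrable M (\<lambda>x. norm (f x) * L)" using f by (intro integrable_mult_left integrable_norm)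
    show "AE x in M. norm (f x * \<phi> x) \<le> norm (norm (f x) * L)"
      using L by (intro AE_I2) (simp add: abs_mult mult_left_mono)
  qed measurable
qed

text \<open>Difference quotients converge pointwise and, for |t| \<le> 1, are dominated through
  \<open>powr_diff_le\<close>: |u + t \<phi>| is at most twice the larger of |u| and the bound of
  \<phi>, so the majorant is built from |u|^r and constants, integrable over the bounded
  domain.\<close>

lemma DERIV_power_functional:
  assumes r: "2 < r" "below_crit CARD('n) r" and ug: "HP u g" and u0: "AE x in M. 0 \<le> u x" and \<phi>: "test_fun \<Omega> \<phi>"
  shows "((\<lambda>t. \<integral>x. \<bar>u x + t * \<phi> x\<bar> powr r \<partial>M) has_real_derivative r * (\<integral>x. \<bar>u x\<bar> powr (r - 1) * \<phi> x \<partial>M)) (at 0)"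
proof -
  obtain L where L: "L > 0" "\<And>x. \<bar>\<phi> x\<bar> \<le> L" by (rule test_bounded[OF \<phi>]) (rule that)
  have [measurable]: "u \<in> borel_measurable M" "\<phi> \<in> borel_measurable M"
    using HP_measurable[OF ug] HP_measurable[OF HP_test[OF \<phi>]] by auto
  have it: "integrable M (\<lambda>x. \<bar>u x + t * \<phi> x\<bar> powr r)" for t
    by (rule HP_power_integrable[OF r HP_add[OF ug HP_scale[OF HP_test[OF \<phi>]]]])
  define dq where "dq t x = (\<bar>u x + t * \<phi> x\<bar> powr r - \<bar>u x\<bar> powr r) / t" for t x
  define W where "W x = r * ((2 powr r * (\<bar>u x\<bar> powr r + L powr r) + 1 + (1 + \<bar>u x\<bar> powr r)) * L)" for x
  have iW: "integrable M W" unfolding W_def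
    using it[of 0] finite_measure.integrable_const[OF finite_M]
    by (intro integrable_mult_right integrable_mult_left Bochner_Integration.integrable_add) auto
  have bound: "\<bar>dq t x\<bar> \<le> W x" if t: "\<bar>t\<bar> \<le> 1" "t \<noteq> 0" for t x
  proof -
    have p1: "\<bar>u x + t * \<phi> x\<bar> powr (r - 1) \<le> 2 powr r * (\<bar>u x\<bar> powr r + L powr r) + 1"
    proof -
      define m where "m = max \<bar>u x\<bar> L"
      have "\<bar>t * \<phi> x\<bar> \<le> 1 * L" unfolding abs_mult using t L by (intro mult_mono) auto
      hence "\<bar>u x + t * \<phi> x\<bar> \<le> 2 * m" by (simp add: m_def)
      hence "\<bar>u x + t * \<phi> x\<bar> powr (r - 1) \<le> (2 * m) powr (r - 1)" using r by (intro powr_mono2) auto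
      also have "\<dots> \<le> 1 + (2 * m) powr r" using L r by (intro powr_le_add_powr) (auto simp: m_def)
      also have "(2 * m) powr r = 2 powr r * m powr r" using L by (simp add: m_def powr_mult)
      also have "m powr r \<le> \<bar>u x\<bar> powr r + L powr r" by (cases "\<bar>u x\<bar> \<le> L") (auto simp: m_def)
      finally show ?thesis by (simp add: mult_left_mono)
    qed
    have p2: "\<bar>u x\<bar> powr (r - 1) \<le> 1 + \<bar>u x\<bar> powr r" using r by (intro powr_le_add_powr) auto
    have "\<bar>\<bar>u x + t * \<phi> x\<bar> powr r - \<bar>u x\<bar> powr r\<bar> \<le> r * ((\<bar>u x + t * \<phi> x\<bar> powr (r - 1) + \<bar>u x\<bar> powr (r - 1)) * \<bar>(u x + t * \<phi> x) - u x\<bar>)"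
      using r by (intro powr_diff_le) auto
    also have "\<dots> = (r * ((\<bar>u x + t * \<phi> x\<bar> powr (r - 1) + \<bar>u x\<bar> powr (r - 1)) * \<bar>\<phi> x\<bar>)) * \<bar>t\<bar>" by (simp add: abs_mult)
    also have "\<dots> \<le> W x * \<bar>t\<bar>" unfolding W_def
      using p1 p2 L r by (intro mult_right_mono mult_left_mono mult_mono add_mono) (auto intro!: add_nonneg_nonneg)
    finally show ?thesis using t by (simp add: dq_def abs_divide field_simps)
  qed
  have "((\<lambda>t. \<integral>x. dq t x \<partial>M) \<longlongrightarrow> (\<integral>x. r * \<bar>u x\<bar> powr (r - 1) * \<phi> x \<partial>M)) (at 0)"
    unfolding tendsto_at_iff_sequentially
  proof (intro allI impI)
    fix X :: "nat \<Rightarrow> real" assume X: "\<forall>i. X i \<in> UNIV - {0}" "X \<longlonglongrightarrow> 0"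
    have "\<forall>\<^sub>F i in sequentially. \<bar>X i\<bar> < 1" using tendstoD[OF X(2), of 1] by (simp add: dist_real_def)
    then obtain n0 where n0: "\<And>i. i \<ge> n0 \<Longrightarrow> \<bar>X i\<bar> < 1" by (auto simp: eventually_sequentially)
    \<comment> \<open>The majorant is valid for |t| \<le> 1 only, hence the shift past
      \<open>n0\<close>.\<close>
    have "(\<lambda>i. \<integral>x. dq (X (i + n0)) x \<partial>M) \<longlonglongrightarrow> (\<integral>x. r * \<bar>u x\<bar> powr (r - 1) * \<phi> x \<partial>M)"
    proof (rule integral_dominated_convergence[where w=W])
      show "(\<lambda>x. r * \<bar>u x\<bar> powr (r - 1) * \<phi> x) \<in> borel_measurable M" by measurable
      show "dq (X (i + n0)) \<in> borel_measurable M" for i unfolding dq_def by measurable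
      show "AE x in M. norm (dq (X (i + n0)) x) \<le> W x" for i
        using bound[of "X (i + n0)"] n0[of "i + n0"] X(1) by (intro AE_I2) simp
      show "AE x in M. (\<lambda>i. dq (X (i + n0)) x) \<longlonglongrightarrow> r * \<bar>u x\<bar> powr (r - 1) * \<phi> x"
        using u0
      proof eventually_elim
        case (elim x)
        have "((\<lambda>h. dq h x) \<longlongrightarrow> r * \<bar>u x\<bar> powr (r - 1) * \<phi> x) (at 0)"
          using DERIV_abs_powr_line[OF elim, of r "\<phi> x"] r by (simp add: DERIV_def dq_def)
        hence "((\<lambda>h. dq h x) \<circ> X) \<longlonglongrightarrow> r * \<bar>u x\<bar> powr (r - 1) * \<phi> x"
          using X unfolding tendsto_at_iff_sequentially by blast
        from LIMSEQ_ignore_initial_segment[OF this, of n0] show ?case by (simp add: o_def)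
      qed
    qed (rule iW)
    hence "(\<lambda>i. \<integral>x. dq (X i) x \<partial>M) \<longlonglongrightarrow> (\<integral>x. r * \<bar>u x\<bar> powr (r - 1) * \<phi> x \<partial>M)"
      by (rule LIMSEQ_offset)
    thus "((\<lambda>t. \<integral>x. dq t x \<partial>M) \<circ> X) \<longlonglongrightarrow> (\<integral>x. r * \<bar>u x\<bar> powr (r - 1) * \<phi> x \<partial>M)" by (simp add: o_def)
  qed
  moreover have "(\<integral>x. dq t x \<partial>M) = ((\<integral>x. \<bar>u x + t * \<phi> x\<bar> powr r \<partial>M) - (\<integral>x. \<bar>u x + 0 * \<phi> x\<bar> powr r \<partial>M)) / t" for t
    using it[of t] it[of 0] by (simp add: dq_def)
  ultimately show ?thesis by (simp add: DERIV_def mult.assoc)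
qed

end

context dirichlet_problem
begin

text \<open>The curve of multiples of u + t \<phi> normalized by the root of \<rho> / l(t) stays on
  the sphere and, near t = 0, inside the ball where \<open>u\<close> is minimal. Its energy is an
  explicit function of \<open>t\<close> with a local minimum at 0; the derivative of the normalizing
  factor produces the multiplier.\<close>

lemma euler_lagrange:
  assumes ug: "HP u g" and nu: "(nrm M u)\<^sup>2 = \<rho>" "\<rho> > 0" and u0: "AE x in M. 0 \<le> u x" and ng: "(nrm M g)\<^sup>2 < T"
    and min: "\<And>v h. HP v h \<Longrightarrow> (nrm M v)\<^sup>2 = \<rho> \<Longrightarrow> (nrm M h)\<^sup>2 < T \<Longrightarrow> En u g \<le> En v h"
  obtains \<omega> where "\<And>\<phi>. test_fun \<Omega> \<phi> \<Longrightarrow> (\<integral>x. g x \<bullet> cgrad \<phi> x \<partial>M) + \<omega> * (\<integral>x. u x * \<phi> x \<partial>M)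
    = \<mu> * (\<integral>x. \<bar>u x\<bar> powr (p - 1) * \<phi> x \<partial>M) + (\<integral>x. \<bar>u x\<bar> powr (q - 1) * \<phi> x \<partial>M)"
proof -
  define Np where "Np = (\<integral>x. \<bar>u x\<bar> powr p \<partial>M)"
  define Nq where "Nq = (\<integral>x. \<bar>u x\<bar> powr q \<partial>M)"
  define G where "G = (nrm M g)\<^sup>2"
  \<comment> \<open>The value that the equation forces when it is tested with \<open>u\<close>
    itself.\<close>
  define \<omega> where "\<omega> = - (G - \<mu> * Np - Nq) / \<rho>"
  have "(\<integral>x. g x \<bullet> cgrad \<phi> x \<partial>M) + \<omega> * (\<integral>x. u x * \<phi> x \<partial>M)
    = \<mu> * (\<integral>x. \<bar>u x\<bar> powr (p - 1) * \<phi> x \<partial>M) + (\<integral>x. \<bar>u x\<bar> powr (q - 1) * \<phi> x \<partial>M)" if \<phi>: "test_fun \<Omega> \<phi>" for \<phi>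
  proof -
    define a where "a = (\<integral>x. u x * \<phi> x \<partial>M)"
    define b where "b = (\<integral>x. g x \<bullet> cgrad \<phi> x \<partial>M)"
    define Fp where "Fp t = (\<integral>x. \<bar>u x + t * \<phi> x\<bar> powr p \<partial>M)" for t
    define Fq where "Fq t = (\<integral>x. \<bar>u x + t * \<phi> x\<bar> powr q \<partial>M)" for t
    define l where "l t = \<rho> + 2 * t * a + t\<^sup>2 * (nrm M \<phi>)\<^sup>2" for t
    define d where "d t = G + 2 * t * b + t\<^sup>2 * (nrm M (cgrad \<phi>))\<^sup>2" for t
    define Ip where "Ip = (\<integral>x. \<bar>u x\<bar> powr (p - 1) * \<phi> x \<partial>M)"
    define Iq where "Iq = (\<integral>x. \<bar>u x\<bar> powr (q - 1) * \<phi> x \<partial>M)"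
    define E where "E t = (\<rho> / l t) * d t / 2 - (\<mu> / p * ((\<rho> / l t) powr (p / 2) * Fp t) + 1 / q * ((\<rho> / l t) powr (q / 2) * Fq t))" for t
    have HPt: "HP (\<lambda>x. u x + t * \<phi> x) (\<lambda>x. g x + t *\<^sub>R cgrad \<phi> x)" for t
      by (rule HP_add[OF ug HP_scale[OF HP_test[OF \<phi>]]])
    have lt: "(nrm M (\<lambda>x. u x + t * \<phi> x))\<^sup>2 = l t" for t
      using nrm_add_square[OF HP_sq(1)[OF ug] sq_scaleR[OF test_sq(1)[OF \<phi>], of t]] nrm_scaleR[of M t \<phi>]
      by (simp add: l_def nu a_def power_mult_distrib mult.left_commute mult.assoc mult.commute)
    have dt: "(nrm M (\<lambda>x. g x + t *\<^sub>R cgrad \<phi> x))\<^sup>2 = d t" for t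
      using nrm_add_square[OF HP_sq(2)[OF ug] sq_scaleR[OF test_sq(2)[OF \<phi>], of t]]
      by (simp add: d_def G_def b_def power_mult_distrib nrm_scaleR)
    have E0: "E 0 = En u g" using nu by (simp add: E_def En_def Nl_def l_def d_def Fp_def Fq_def G_def)
    have Et: "En u g \<le> E t" if pos: "l t > 0" and T: "(\<rho> / l t) * d t < T" for t
    proof -
      define c where "c = sqrt (\<rho> / l t)"
      have c: "c \<ge> 0" "c\<^sup>2 = \<rho> / l t" using pos nu(2) by (auto simp: c_def)
      have cr: "c powr r = (\<rho> / l t) powr (r / 2)" for r
        using pos nu(2) by (simp add: c_def powr_half_sqrt[symmetric] powr_powr)
      note H = HP_scale[OF HPt[of t], of c]
      have n1: "(nrm M (\<lambda>x. c * (u x + t * \<phi> x)))\<^sup>2 = \<rho>"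
        using nrm_scaleR[of M c "\<lambda>x. u x + t * \<phi> x"] pos by (simp add: power_mult_distrib c(2) lt)
      have n2: "(nrm M (\<lambda>x. c *\<^sub>R (g x + t *\<^sub>R cgrad \<phi> x)))\<^sup>2 = (\<rho> / l t) * d t"
        by (simp only: nrm_scaleR power_mult_distrib c(2) dt power2_abs)
      have "En u g \<le> En (\<lambda>x. c * (u x + t * \<phi> x)) (\<lambda>x. c *\<^sub>R (g x + t *\<^sub>R cgrad \<phi> x))"
        by (rule min[OF H n1]) (simp only: n2 T)
      also have "\<dots> = E t"
        unfolding En_def n2 Nl_scale[OF c(1)] by (simp only: cr E_def Fp_def Fq_def)
      finally show ?thesis .
    qed
    have Fp': "(Fp has_real_derivative p * Ip) (at 0)"
      unfolding Fp_def[abs_def] Ip_def by (rule DERIV_power_functional[OF p_gt_2 p_crit ug u0 \<phi>])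
    have Fq': "(Fq has_real_derivative q * Iq) (at 0)"
      unfolding Fq_def[abs_def] Iq_def by (rule DERIV_power_functional[OF q_gt_2 q_crit ug u0 \<phi>])
    have l': "(l has_real_derivative 2 * a) (at 0)"
      unfolding l_def[abs_def] by (auto intro!: derivative_eq_intros)
    have d': "(d has_real_derivative 2 * b) (at 0)"
      unfolding d_def[abs_def] by (auto intro!: derivative_eq_intros)
    have l0: "l 0 = \<rho>" and d0: "d 0 = G" and Fp0: "Fp 0 = Np" and Fq0: "Fq 0 = Nq"
      by (simp_all add: l_def d_def Fp_def Fq_def Np_def Nq_def)
    define \<kappa> where "\<kappa> t = \<rho> / l t" for t
    have \<kappa>0: "\<kappa> 0 = 1" using nu by (simp add: \<kappa>_def l0)
    have \<kappa>': "(\<kappa> has_real_derivative - 2 * a / \<rho>) (at 0)"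
      unfolding \<kappa>_def[abs_def] using nu(2)
      by (auto intro!: derivative_eq_intros l' simp: l0 power2_eq_square field_simps)
    have pw: "((\<lambda>t. \<kappa> t powr s) has_real_derivative s * (- 2 * a / \<rho>)) (at 0)" for s
      using DERIV_fun_powr[OF \<kappa>', of s] by (simp add: \<kappa>0)
    have "(E has_real_derivative ((- 2 * a / \<rho>) * G + 2 * b) / 2 - (\<mu> / p * (p / 2 * (- 2 * a / \<rho>) * Np + p * Ip)
        + 1 / q * (q / 2 * (- 2 * a / \<rho>) * Nq + q * Iq))) (at 0)"
      unfolding E_def[abs_def] \<kappa>_def[symmetric]
      using p_gt_2 q_gt_2 nu(2)
      by (auto intro!: derivative_eq_intros \<kappa>' d' pw Fp' Fq' simp: \<kappa>0 d0 Fp0 Fq0 field_simps)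
    moreover have "\<exists>\<delta>>0. \<forall>y. \<bar>0 - y\<bar> < \<delta> \<longrightarrow> E 0 \<le> E y"
    proof -
      have "isCont l 0" "isCont d 0" using l' d' DERIV_isCont by blast+
      hence "(l \<longlongrightarrow> l 0) (nhds 0)" "(d \<longlongrightarrow> d 0) (nhds 0)"
        unfolding isCont_def tendsto_at_iff_tendsto_nhds .
      hence "(l \<longlongrightarrow> \<rho>) (nhds 0)" "(d \<longlongrightarrow> G) (nhds 0)" unfolding l0 d0 .
      note ld = this
      have lim: "(l \<longlongrightarrow> \<rho>) (nhds 0)" "((\<lambda>t. (\<rho> / l t) * d t) \<longlongrightarrow> (\<rho> / \<rho>) * G) (nhds 0)"
        using nu(2) by (intro tendsto_mult tendsto_divide tendsto_const ld; simp)+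
      \<comment> \<open>Both conditions of \<open>Et\<close> are open at t = 0; for the second this
        rests on the strict inequality for the gradient norm of the minimizer.\<close>
      have "\<forall>\<^sub>F t in nhds 0. l t > 0" by (rule order_tendstoD(1)[OF lim(1) nu(2)])
      moreover have "\<forall>\<^sub>F t in nhds 0. (\<rho> / l t) * d t < T"
        by (rule order_tendstoD(2)[OF lim(2)]) (use nu(2) ng in \<open>simp add: G_def\<close>)
      ultimately have "\<forall>\<^sub>F t in nhds 0. E 0 \<le> E t"
        by eventually_elim (simp add: E0 Et)
      thus ?thesis by (auto simp: eventually_nhds_metric dist_real_def)
    qed
    ultimately have e1: "((- 2 * a / \<rho>) * G + 2 * b) / 2 - (\<mu> / p * (p / 2 * (- 2 * a / \<rho>) * Np + p * Ip)
        + 1 / q * (q / 2 * (- 2 * a / \<rho>) * Nq + q * Iq)) = 0"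
      using DERIV_local_min by blast
    have e2: "((- 2 * a / \<rho>) * G + 2 * b) / 2 - (\<mu> / p * (p / 2 * (- 2 * a / \<rho>) * Np + p * Ip)
        + 1 / q * (q / 2 * (- 2 * a / \<rho>) * Nq + q * Iq)) = b + \<omega> * a - \<mu> * Ip - Iq"
      using p_gt_2 q_gt_2 nu(2) by (simp add: \<omega>_def field_simps)
    from trans[OF e2[symmetric] e1] show ?thesis by (simp add: a_def b_def Ip_def Iq_def)
  qed
  thus ?thesis by (rule that)
qed

end

section \<open>The strong maximum principle\<close>

lemma
  fixes g :: "'a \<Rightarrow> 'b::euclidean_space" and f :: "'a \<Rightarrow> real"
  assumes f: "f \<in> borel_measurable M" "\<And>x. x \<in> space M \<Longrightarrow> \<bar>f x\<bar> \<le> K" and g: "sq M g" and K: "0 \<le> K"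
  shows sq_bounded_scaleR: "sq M (\<lambda>x. f x *\<^sub>R g x)"
    and nrm_bounded_scaleR_le: "nrm M (\<lambda>x. f x *\<^sub>R g x) \<le> K * nrm M g"
proof -
  have [measurable]: "f \<in> borel_measurable M" "g \<in> borel_measurable M" using f g by (auto simp: sq_def)
  have le: "(norm (f x *\<^sub>R g x))\<^sup>2 \<le> K\<^sup>2 * (norm (g x))\<^sup>2" if "x \<in> space M" for x
  proof -
    have "norm (f x *\<^sub>R g x) \<le> K * norm (g x)" using f(2)[OF that] by (simp add: mult_right_mono)
    thus ?thesis unfolding power_mult_distrib[symmetric] by (intro power_mono) auto
  qed
  have iK: "integrable M (\<lambda>x. K\<^sup>2 * (norm (g x))\<^sup>2)" by (intro integrable_mult_right sqD(2)[OF g])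
  have i: "integrable M (\<lambda>x. (norm (f x *\<^sub>R g x))\<^sup>2)"
  proof (rule Bochner_Integration.integrable_bound[OF iK])
    show "(\<lambda>x. (norm (f x *\<^sub>R g x))\<^sup>2) \<in> borel_measurable M" by measurable
    show "AE x in M. norm ((norm (f x *\<^sub>R g x))\<^sup>2) \<le> norm (K\<^sup>2 * (norm (g x))\<^sup>2)"
    proof (rule AE_I2)
      fix x assume "x \<in> space M"
      from le[OF this] show "norm ((norm (f x *\<^sub>R g x))\<^sup>2) \<le> norm (K\<^sup>2 * (norm (g x))\<^sup>2)"
        unfolding real_norm_def by (subst (1 2) abs_of_nonneg) auto
    qed
  qed
  show s: "sq M (\<lambda>x. f x *\<^sub>R g x)" using i unfolding sq_def by auto
  have "(nrm M (\<lambda>x. f x *\<^sub>R g x))\<^sup>2 \<le> (K * nrm M g)\<^sup>2"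
    unfolding power_mult_distrib nrm_square using integral_mono[OF i iK le] by simp
  thus "nrm M (\<lambda>x. f x *\<^sub>R g x) \<le> K * nrm M g"
    by (rule power2_le_imp_le) (simp add: K nrm_nonneg)
qed

context bounded_domain
begin

text \<open>Testing with \<open>\<eta>\<^sup>2 / (w\<^sub>k + \<epsilon>)\<close>: the bound on \<open>\<nabla> ln (w\<^sub>k + \<epsilon>)\<close> does not depend on \<open>\<epsilon>\<close>.\<close>
lemma log_energy_bound:
  assumes ug: "HP u g" and u0: "AE x in M. 0 \<le> u x"
    and w: "\<And>k. test_fun \<Omega> (w k)" "\<And>k x. 0 \<le> w k x"
    and wg: "(\<lambda>k. nrm M (\<lambda>x. cgrad (w k) x - g x)) \<longlonglongrightarrow> 0"
    and wu: "AE x in M. (\<lambda>k. w k x) \<longlonglongrightarrow> u x"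
    and c: "integrable M c" "\<And>x. 0 \<le> c x" "integrable M (\<lambda>x. c x * u x)"
    and super: "\<And>\<phi>. test_fun \<Omega> \<phi> \<Longrightarrow> (\<And>x. 0 \<le> \<phi> x) \<Longrightarrow> - (\<integral>x. c x * u x * \<phi> x \<partial>M) \<le> (\<integral>x. g x \<bullet> cgrad \<phi> x \<partial>M)"
    and \<eta>: "test_fun \<Omega> \<eta>"
  obtains C where "\<And>\<epsilon>. \<epsilon> > 0 \<Longrightarrow> \<forall>\<^sub>F k in sequentially.
    (nrm M (\<lambda>x. (\<eta> x / (w k x + \<epsilon>)) *\<^sub>R cgrad (w k) x))\<^sup>2 \<le> C"
proof -
  obtain H where H: "H > 0" "\<And>x. \<bar>\<eta> x\<bar> \<le> H" by (rule test_bounded[OF \<eta>]) (rule that)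
  have [measurable]: "c \<in> borel_measurable M" "u \<in> borel_measurable M" "\<eta> \<in> borel_measurable M" "g \<in> borel_measurable M"
    using c HP_measurable[OF ug] HP_measurable[OF HP_test[OF \<eta>]] by auto
  have [measurable]: "w k \<in> borel_measurable M" for k using HP_measurable[OF HP_test[OF w(1)]] by auto
  have \<eta>2: "(\<eta> x)\<^sup>2 \<le> H\<^sup>2" for x using power_mono[OF H(2)[of x], of 2] by simp
  have ic: "integrable M (\<lambda>x. c x * (\<eta> x)\<^sup>2)"
  proof (rule Bochner_Integration.integrable_bound)
    show "integrable M (\<lambda>x. c x * H\<^sup>2)" using c by simp
    show "AE x in M. norm (c x * (\<eta> x)\<^sup>2) \<le> norm (c x * H\<^sup>2)"
      using \<eta>2 c(2) by (intro AE_I2) (simp add: abs_mult mult_left_mono)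
  qed measurable
  define N where "N = nrm M (cgrad \<eta>)"
  define C0 where "C0 = 2 * N\<^sup>2 + (\<integral>x. c x * (\<eta> x)\<^sup>2 \<partial>M)"
  have "\<forall>\<^sub>F k in sequentially. (nrm M (\<lambda>x. (\<eta> x / (w k x + \<epsilon>)) *\<^sub>R cgrad (w k) x))\<^sup>2 \<le> 2 * C0 + 2" if \<epsilon>: "\<epsilon> > 0" for \<epsilon>
  proof -
    have wp: "w k x + \<epsilon> > 0" for k x using w(2)[of k x] \<epsilon> by linarith
    define h where "h k x = \<eta> x / (w k x + \<epsilon>)" for k x
    have [measurable]: "h k \<in> borel_measurable M" for k unfolding h_def by measurable
    define L where "L = H / \<epsilon>"
    have L: "L > 0" using H \<epsilon> by (simp add: L_def)
    have hL: "\<bar>h k x\<bar> \<le> L" for k x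
      unfolding h_def L_def abs_divide using H(1) H(2)[of x] w(2)[of k x] \<epsilon> by (intro frac_le) auto
    define \<zeta> where "\<zeta> k x = (w k x + \<epsilon>) powr (-1) * (\<eta> x * \<eta> x)" for k x
    have \<zeta>e: "\<zeta> k x = (\<eta> x)\<^sup>2 / (w k x + \<epsilon>)" for k x
      using wp[of k x] by (simp add: \<zeta>_def powr_minus power2_eq_square divide_inverse mult.commute)
    have t\<zeta>: "test_fun \<Omega> (\<zeta> k)" for k
      unfolding \<zeta>_def
      by (intro test_fun_mult[OF test_fun_mult[OF \<eta> test_funD(1)[OF \<eta>]]] Cinf_compose[OF smooth1_powr] Cinf_add Cinf_const test_funD(1)[OF w(1)])
         (use wp in auto)
    have \<zeta>0: "0 \<le> \<zeta> k x" for k x using wp[of k x] by (simp add: \<zeta>e)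
    have g\<zeta>: "cgrad (\<zeta> k) x = (2 * h k x) *\<^sub>R cgrad \<eta> x - (h k x)\<^sup>2 *\<^sub>R cgrad (w k) x" for k x
    proof -
      have d1: "GDERIV (\<lambda>x. (w k x + \<epsilon>) powr (-1)) x :> (- 1 / (w k x + \<epsilon>)\<^sup>2) *\<^sub>R cgrad (w k) x"
      proof (rule GDERIV_DERIV_compose[OF test_funD(4)[OF w(1)], where g="\<lambda>t. (t + \<epsilon>) powr (-1)"])
        have "((\<lambda>t. t + \<epsilon>) has_real_derivative 1) (at (w k x))" by (auto intro!: derivative_eq_intros)
        from DERIV_fun_powr[OF this wp[of k x], of "-1"]
        have "((\<lambda>t. (t + \<epsilon>) powr (-1)) has_real_derivative (-1) * (w k x + \<epsilon>) powr (-2)) (at (w k x))"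
          by simp
        also have "(-1) * (w k x + \<epsilon>) powr (-2) = - 1 / (w k x + \<epsilon>)\<^sup>2"
          using wp[of k x] by (simp add: powr_minus divide_inverse)
        finally show "((\<lambda>t. (t + \<epsilon>) powr (-1)) has_real_derivative - 1 / (w k x + \<epsilon>)\<^sup>2) (at (w k x))" .
      qed
      have "GDERIV (\<zeta> k) x :> (w k x + \<epsilon>) powr (-1) *\<^sub>R (\<eta> x *\<^sub>R cgrad \<eta> x + \<eta> x *\<^sub>R cgrad \<eta> x)
          + (\<eta> x * \<eta> x) *\<^sub>R ((- 1 / (w k x + \<epsilon>)\<^sup>2) *\<^sub>R cgrad (w k) x)"
        unfolding \<zeta>_def by (intro GDERIV_mult d1 test_funD(4)[OF \<eta>])
      hence "cgrad (\<zeta> k) x = (w k x + \<epsilon>) powr (-1) *\<^sub>R (\<eta> x *\<^sub>R cgrad \<eta> x + \<eta> x *\<^sub>R cgrad \<eta> x)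
          + (\<eta> x * \<eta> x) *\<^sub>R ((- 1 / (w k x + \<epsilon>)\<^sup>2) *\<^sub>R cgrad (w k) x)" by (rule GDERIV_imp_cgrad)
      also have "\<dots> = (2 * h k x) *\<^sub>R cgrad \<eta> x - (h k x)\<^sup>2 *\<^sub>R cgrad (w k) x"
        using wp[of k x]
        by (simp add: h_def powr_minus scaleR_add_right[symmetric] scaleR_2[symmetric] power_divide power2_eq_square divide_inverse mult_ac)
      finally show ?thesis .
    qed
    \<comment> \<open>\<open>a k\<close> is \<eta> times the gradient of ln (w k + \<epsilon>). The
      inequality \<open>super\<close> concerns \<open>g\<close> and not the gradient of
      \<open>w k\<close>; \<open>e k\<close> is the difference, which tends to 0 in mean
      square.\<close>
    define a where "a k x = h k x *\<^sub>R cgrad (w k) x" for k x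
    define e where "e k x = g x - cgrad (w k) x" for k x
    have se: "sq M (e k)" for k unfolding e_def by (intro sq_diff HP_sq[OF ug] test_sq w)
    have ne: "(\<lambda>k. nrm M (e k)) \<longlonglongrightarrow> 0" using wg unfolding e_def by (subst nrm_minus_commute)
    have sa: "sq M (a k)" and na: "nrm M (a k) \<le> L * nrm M (cgrad (w k))" for k
      unfolding a_def
      by (rule sq_bounded_scaleR[OF _ hL test_sq(2)[OF w(1)]] nrm_bounded_scaleR_le[OF _ hL test_sq(2)[OF w(1)]];
          use L in simp)+
    have she: "sq M (\<lambda>x. h k x *\<^sub>R e k x)" and nhe: "nrm M (\<lambda>x. h k x *\<^sub>R e k x) \<le> L * nrm M (e k)" for k
      by (rule sq_bounded_scaleR[OF _ hL se] nrm_bounded_scaleR_le[OF _ hL se]; use L in simp)+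
    note s\<eta> = test_sq(2)[OF \<eta>]
    \<comment> \<open>A bound for all terms containing \<open>e k\<close>. The factor
      \<open>L\<close> blows up as \<epsilon> tends to 0, but for fixed \<epsilon> these terms
      vanish in the limit; hence a bound independent of \<epsilon> that holds only from an index
      depending on it.\<close>
    define s where "s k = L * nrm M (e k) * (L * nrm M (cgrad (w k))) + 2 * (L * nrm M (e k) * N)" for k
    define I where "I k = (\<integral>x. c x * u x * \<zeta> k x \<partial>M)" for k
    \<comment> \<open>The gradient of \<zeta> produces the negative square -|a|^2; Young's
      inequality uses up half of it for the mixed term with the gradient of \<eta>.\<close>
    have key: "(nrm M (a k))\<^sup>2 / 2 \<le> 2 * N\<^sup>2 + I k + s k" for k
    proof -
      define i1 where "i1 = (\<integral>x. a k x \<bullet> cgrad \<eta> x \<partial>M)"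
      define i2 where "i2 = (\<integral>x. (h k x *\<^sub>R e k x) \<bullet> cgrad \<eta> x \<partial>M)"
      define i3 where "i3 = (\<integral>x. (h k x *\<^sub>R e k x) \<bullet> a k x \<partial>M)"
      have "g x \<bullet> cgrad (\<zeta> k) x = 2 * (a k x \<bullet> cgrad \<eta> x) + 2 * ((h k x *\<^sub>R e k x) \<bullet> cgrad \<eta> x)
          - (h k x *\<^sub>R e k x) \<bullet> a k x - (norm (a k x))\<^sup>2" for x
        unfolding g\<zeta> a_def e_def power2_norm_eq_inner
        by (simp add: inner_diff inner_add inner_commute power2_eq_square algebra_simps)
      hence "(\<integral>x. g x \<bullet> cgrad (\<zeta> k) x \<partial>M) = 2 * i1 + 2 * i2 - i3 - (nrm M (a k))\<^sup>2"
        using sq_inner[OF sa s\<eta>, of k] sq_inner[OF she s\<eta>, of k] sq_inner[OF she sa, of k k] sqD(2)[OF sa[of k]]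
        by (simp add: i1_def i2_def i3_def nrm_square)
      hence "(nrm M (a k))\<^sup>2 \<le> 2 * i1 + 2 * i2 - i3 + I k"
        using super[OF t\<zeta> \<zeta>0, of k] by (simp add: I_def)
      moreover have "2 * i1 \<le> (nrm M (a k))\<^sup>2 / 2 + 2 * N\<^sup>2"
      proof -
        have "i1 \<le> nrm M (a k) * N" using nrm_cauchy_schwarz[OF sa s\<eta>, of k] by (simp add: i1_def N_def)
        moreover have "2 * (nrm M (a k) * N) \<le> (nrm M (a k))\<^sup>2 / 2 + 2 * N\<^sup>2"
          using zero_le_power2[of "nrm M (a k) - 2 * N"] by (simp add: power2_eq_square algebra_simps)
        ultimately show ?thesis by linarith
      qed
      moreover have "i2 \<le> L * nrm M (e k) * N"
        using nrm_cauchy_schwarz[OF she s\<eta>, of k] mult_right_mono[OF nhe[of k], of N]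
        by (simp add: i2_def N_def nrm_nonneg)
      moreover have "- i3 \<le> L * nrm M (e k) * (L * nrm M (cgrad (w k)))"
      proof -
        have "- i3 \<le> nrm M (\<lambda>x. h k x *\<^sub>R e k x) * nrm M (a k)"
          using nrm_cauchy_schwarz[OF she sa, of k k] by (simp add: i3_def)
        also have "\<dots> \<le> L * nrm M (e k) * (L * nrm M (cgrad (w k)))"
          using L by (intro mult_mono nhe na) (auto simp: nrm_nonneg)
        finally show ?thesis .
      qed
      ultimately show ?thesis unfolding s_def by linarith
    qed
    have "(\<lambda>k. nrm M (cgrad (w k))) \<longlonglongrightarrow> nrm M g"
      by (rule nrm_tendsto[OF test_sq(2)[OF w(1)] HP_sq(2)[OF ug] wg])
    hence "s \<longlonglongrightarrow> L * 0 * (L * nrm M g) + 2 * (L * 0 * N)"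
      unfolding s_def by (intro tendsto_intros ne)
    hence s0: "s \<longlonglongrightarrow> 0" by simp
    define I0 where "I0 = (\<integral>x. c x * u x * ((\<eta> x)\<^sup>2 / (u x + \<epsilon>)) \<partial>M)"
    have bnd: "(\<eta> x)\<^sup>2 / (t + \<epsilon>) \<le> H\<^sup>2 / \<epsilon>" if "0 \<le> t" for x t
      using that \<epsilon> \<eta>2[of x] by (intro frac_le) auto
    have Il: "I \<longlonglongrightarrow> I0"
      unfolding I_def[abs_def] I0_def
    proof (rule integral_dominated_convergence[where w="\<lambda>x. norm (c x * u x) * (H\<^sup>2 / \<epsilon>)"])
      show "(\<lambda>x. c x * u x * ((\<eta> x)\<^sup>2 / (u x + \<epsilon>))) \<in> borel_measurable M" by measurable
      show "(\<lambda>x. c x * u x * \<zeta> k x) \<in> borel_measurable M" for k unfolding \<zeta>e by measurable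
      show "integrable M (\<lambda>x. norm (c x * u x) * (H\<^sup>2 / \<epsilon>))"
        by (intro integrable_mult_left integrable_norm c)
      show "AE x in M. norm (c x * u x * \<zeta> k x) \<le> norm (c x * u x) * (H\<^sup>2 / \<epsilon>)" for k
      proof (rule AE_I2)
        fix x
        have "norm (c x * u x * \<zeta> k x) = norm (c x * u x) * ((\<eta> x)\<^sup>2 / (w k x + \<epsilon>))"
          using wp[of k x] by (simp add: \<zeta>e abs_mult)
        also have "\<dots> \<le> norm (c x * u x) * (H\<^sup>2 / \<epsilon>)" by (intro mult_left_mono bnd w) auto
        finally show "norm (c x * u x * \<zeta> k x) \<le> norm (c x * u x) * (H\<^sup>2 / \<epsilon>)" .
      qed
      show "AE x in M. (\<lambda>k. c x * u x * \<zeta> k x) \<longlonglongrightarrow> c x * u x * ((\<eta> x)\<^sup>2 / (u x + \<epsilon>))"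
        using wu u0
      proof eventually_elim
        case (elim x)
        thus ?case unfolding \<zeta>e using \<epsilon> by (intro tendsto_intros) auto
      qed
    qed
    \<comment> \<open>u / (u + \<epsilon>) \<le> 1 removes \<epsilon> from the term with the
      potential.\<close>
    have "I0 \<le> (\<integral>x. c x * (\<eta> x)\<^sup>2 \<partial>M)"
      unfolding I0_def
    proof (rule integral_mono_AE[OF _ ic])
      show "AE x in M. c x * u x * ((\<eta> x)\<^sup>2 / (u x + \<epsilon>)) \<le> c x * (\<eta> x)\<^sup>2"
        using u0
      proof eventually_elim
        case (elim x)
        have "u x / (u x + \<epsilon>) \<le> 1" using elim \<epsilon> by simp
        hence "c x * (\<eta> x)\<^sup>2 * (u x / (u x + \<epsilon>)) \<le> c x * (\<eta> x)\<^sup>2 * 1" using c(2) by (intro mult_left_mono) auto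
        thus ?case by (simp add: mult_ac)
      qed
      show "integrable M (\<lambda>x. c x * u x * ((\<eta> x)\<^sup>2 / (u x + \<epsilon>)))"
      proof (rule Bochner_Integration.integrable_bound)
        show "integrable M (\<lambda>x. norm (c x * u x) * (H\<^sup>2 / \<epsilon>))"
          by (intro integrable_mult_left integrable_norm c)
        show "AE x in M. norm (c x * u x * ((\<eta> x)\<^sup>2 / (u x + \<epsilon>))) \<le> norm (norm (c x * u x) * (H\<^sup>2 / \<epsilon>))"
          using u0
        proof eventually_elim
          case (elim x)
          have "norm (c x * u x * ((\<eta> x)\<^sup>2 / (u x + \<epsilon>))) = norm (c x * u x) * ((\<eta> x)\<^sup>2 / (u x + \<epsilon>))"
            using elim \<epsilon> by (simp add: abs_mult)
          also have "\<dots> \<le> norm (c x * u x) * (H\<^sup>2 / \<epsilon>)" by (intro mult_left_mono bnd elim) auto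
          finally show ?case using \<epsilon> by simp
        qed
      qed measurable
    qed
    moreover have "(\<lambda>k. 2 * N\<^sup>2 + I k + s k) \<longlonglongrightarrow> 2 * N\<^sup>2 + I0 + 0" by (intro tendsto_intros Il s0)
    ultimately have "\<forall>\<^sub>F k in sequentially. 2 * N\<^sup>2 + I k + s k < C0 + 1"
      by (intro order_tendstoD(2)) (auto simp: C0_def)
    thus ?thesis
    proof eventually_elim
      case (elim k)
      have "(nrm M (a k))\<^sup>2 \<le> 2 * C0 + 2" using key[of k] elim by linarith
      thus ?case by (simp add: a_def[abs_def] h_def)
    qed
  qed
  thus ?thesis by (rule that)
qed

end

lemma nn_integral_nn_integral_Fatou:
  fixes f :: "nat \<Rightarrow> 'a::euclidean_space \<Rightarrow> 'a \<Rightarrow> ennreal"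
  assumes [measurable]: "\<And>k. (\<lambda>(x, y). f k x y) \<in> borel_measurable (borel \<Otimes>\<^sub>M borel)"
  shows "(\<integral>\<^sup>+x. \<integral>\<^sup>+y. liminf (\<lambda>k. f k x y) \<partial>lborel \<partial>lborel) \<le> liminf (\<lambda>k. \<integral>\<^sup>+x. \<integral>\<^sup>+y. f k x y \<partial>lborel \<partial>lborel)"
proof -
  have "(\<integral>\<^sup>+x. \<integral>\<^sup>+y. liminf (\<lambda>k. f k x y) \<partial>lborel \<partial>lborel) \<le> (\<integral>\<^sup>+x. liminf (\<lambda>k. \<integral>\<^sup>+y. f k x y \<partial>lborel) \<partial>lborel)"
    by (intro nn_integral_mono nn_integral_liminf) measurable
  also have "\<dots> \<le> liminf (\<lambda>k. \<integral>\<^sup>+x. \<integral>\<^sup>+y. f k x y \<partial>lborel \<partial>lborel)"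
    by (intro nn_integral_liminf) measurable
  finally show ?thesis .
qed

text \<open>Lindelof's theorem leaves only countably many exceptional null sets.\<close>

lemma AE_open_local:
  fixes \<Omega> :: "'a::euclidean_space set"
  assumes "\<And>x. x \<in> \<Omega> \<Longrightarrow> \<exists>U. open U \<and> x \<in> U \<and> (AE y in lborel. y \<in> U \<longrightarrow> Q y)"
  shows "AE y in lborel. y \<in> \<Omega> \<longrightarrow> Q y"
proof -
  define F where "F = {U. open U \<and> (AE y in lborel. y \<in> U \<longrightarrow> Q y)}"
  obtain F' where F': "F' \<subseteq> F" "countable F'" "\<Union>F' = \<Union>F"
    by (rule Lindelof[of F]) (auto simp: F_def)
  have "AE y in lborel. \<forall>U\<in>F'. y \<in> U \<longrightarrow> Q y"
    by (rule AE_ball_countable[THEN iffD2, OF F'(2)]) (use F'(1) in \<open>auto simp: F_def\<close>)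
  moreover have "\<Omega> \<subseteq> \<Union>F'" unfolding F'(3) using assms by (auto simp: F_def)
  ultimately show ?thesis by (auto elim!: eventually_mono)
qed

context bounded_domain
begin

text \<open>If \<open>u\<close> vanished on a set \<open>Z\<close> of positive measure and were at least \<open>s\<close> on such a set \<open>P\<close>, both inside \<open>B\<close>,
  the Poincare inequality would bound \<open>|Z| |P| (ln (1 + s / \<epsilon>))\<^sup>2\<close> uniformly in \<open>\<epsilon>\<close>.\<close>
lemma zero_or_positive_on_box:
  assumes w: "\<And>k. test_fun \<Omega> (w k)" "\<And>k x. 0 \<le> w k x"
    and u[measurable]: "u \<in> borel_measurable borel" and u0: "\<And>x. 0 \<le> u x"
    and wu: "AE x in lborel. x \<in> \<Omega> \<longrightarrow> (\<lambda>k. w k x) \<longlonglongrightarrow> u x"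
    and \<eta>: "test_fun \<Omega> \<eta>" and B: "box a b \<subseteq> \<Omega>" and \<delta>: "\<delta> > 0" "\<And>x. x \<in> box a b \<Longrightarrow> \<delta> \<le> (\<eta> x)\<^sup>2"
    and C: "\<And>\<epsilon>. \<epsilon> > 0 \<Longrightarrow> \<forall>\<^sub>F k in sequentially. (nrm M (\<lambda>x. (\<eta> x / (w k x + \<epsilon>)) *\<^sub>R cgrad (w k) x))\<^sup>2 \<le> C"
  shows "(AE x in lborel. x \<in> box a b \<longrightarrow> u x = 0) \<or> (AE x in lborel. x \<in> box a b \<longrightarrow> u x > 0)"
proof -
  define B where "B = box a b"
  have [measurable]: "B \<in> sets borel" by (simp add: B_def)
  have bB: "bounded B" by (simp add: B_def bounded_box)
  obtain d where d: "\<And>x. x \<in> B \<Longrightarrow> norm x \<le> d" using bB unfolding bounded_iff by blast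
  define V where "V = measure lborel B"
  have V: "V \<ge> 0" "emeasure lborel B = ennreal V"
    using emeasure_bounded_finite[OF bB] by (auto simp: V_def intro!: emeasure_eq_ennreal_measure)
  define C2 where "C2 = 2 ^ CARD('n) * (2 * d)\<^sup>2 * (V / \<delta> * C)"
  \<comment> \<open>ln (1 + w / \<epsilon>) has the same gradient as ln (w + \<epsilon>), and it
    tends to 0 along the sequence where \<open>u\<close> vanishes. On the box the cutoff is removed
    through \<delta> \<le> \<eta>^2.\<close>
  have poin: "\<forall>\<^sub>F k in sequentially. (\<integral>\<^sup>+x. \<integral>\<^sup>+y. indicator (B \<times> B) (x, y) *
      ennreal ((ln (1 + w k y / \<epsilon>) - ln (1 + w k x / \<epsilon>))\<^sup>2) \<partial>lborel \<partial>lborel) \<le> ennreal C2" if \<epsilon>: "\<epsilon> > 0" for \<epsilon>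
    using C[OF \<epsilon>]
  proof eventually_elim
    case (elim k)
    have wp: "w k x + \<epsilon> > 0" for x using w(2)[of k x] \<epsilon> by linarith
    define G where "G x = (1 / (w k x + \<epsilon>)) *\<^sub>R cgrad (w k) x" for x
    note cw = test_fun_C1z[OF w(1)[of k]] and c\<eta> = test_fun_C1z[OF \<eta>]
    have GD: "GDERIV (\<lambda>x. ln (1 + w k x / \<epsilon>)) x :> G x" for x
      unfolding G_def
    proof (rule GDERIV_DERIV_compose[OF test_funD(4)[OF w(1)], where g="\<lambda>t. ln (1 + t / \<epsilon>)"])
      have "1 + w k x / \<epsilon> > 0" using w(2)[of k x] \<epsilon> by (simp add: add_pos_nonneg)
      thus "((\<lambda>t. ln (1 + t / \<epsilon>)) has_real_derivative 1 / (w k x + \<epsilon>)) (at (w k x))"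
        using \<epsilon> wp[of x] by (auto intro!: derivative_eq_intros simp: field_simps)
    qed
    have cG: "continuous_on UNIV G" unfolding G_def
      using wp by (intro continuous_intros C1zD[OF cw]) (auto simp: less_imp_neq[symmetric])
    hence [measurable]: "G \<in> borel_measurable borel" by (rule borel_measurable_continuous_onI)
    have [measurable]: "\<eta> \<in> borel_measurable borel" by (rule C1zD(6)[OF c\<eta>])
    have G0: "G x = 0" if "x \<notin> \<Omega>" for x using C1zD(5)[OF cw that] by (simp add: G_def)
    define F where "F x = (norm (\<eta> x *\<^sub>R G x))\<^sup>2" for x
    have iF: "integrable lborel F"
      unfolding F_def by (rule integrable_continuous_vanish[OF _ _ bounded_dom])
        (use G0 in \<open>auto intro!: continuous_intros cG C1zD(3)[OF c\<eta>]\<close>)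
    have "(\<integral>x. F x \<partial>lborel) = (nrm M (\<lambda>x. \<eta> x *\<^sub>R G x))\<^sup>2"
      unfolding nrm_square F_def by (rule integral_M_lborel[symmetric]) (auto simp: G0)
    also have "\<dots> \<le> C" using elim by (simp add: G_def)
    finally have FC: "(\<integral>x. F x \<partial>lborel) \<le> C" .
    have "0 \<le> (\<integral>x. F x \<partial>lborel)" by (rule integral_nonneg_AE) (simp add: F_def)
    hence C0: "C \<ge> 0" using FC by linarith
    have "(\<integral>\<^sup>+x. \<integral>\<^sup>+y. indicator (B \<times> B) (x, y) * ennreal ((ln (1 + w k y / \<epsilon>) - ln (1 + w k x / \<epsilon>))\<^sup>2) \<partial>lborel \<partial>lborel)
      \<le> ennreal (2 ^ CARD('n) * (2 * d)\<^sup>2) * (\<integral>\<^sup>+x. ennreal ((norm (G x))\<^sup>2) * emeasure lborel {y. (x, y) \<in> B \<times> B} \<partial>lborel)"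
    proof (rule nonlocal_poincare[OF GD cG])
      show "B \<times> B \<in> sets (borel \<Otimes>\<^sub>M borel)" by measurable
      show "norm (y - x) \<le> 2 * d" if "(x, y) \<in> B \<times> B" for x y
        using that norm_triangle_ineq4[of y x] d[of x] d[of y] by auto
      show "((1 - t) *\<^sub>R x + t *\<^sub>R y, y) \<in> B \<times> B" if "(x, y) \<in> B \<times> B" "0 \<le> t" "t < 1" for x y t
        using that convexD[OF convex_box(2), of x a b y "1 - t" t] by (auto simp: B_def)
    qed auto
    also have "(\<integral>\<^sup>+x. ennreal ((norm (G x))\<^sup>2) * emeasure lborel {y. (x, y) \<in> B \<times> B} \<partial>lborel)
        \<le> (\<integral>\<^sup>+x. ennreal (V / \<delta>) * ennreal (F x) \<partial>lborel)"
    proof (rule nn_integral_mono)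
      fix x
      show "ennreal ((norm (G x))\<^sup>2) * emeasure lborel {y. (x, y) \<in> B \<times> B} \<le> ennreal (V / \<delta>) * ennreal (F x)"
      proof (cases "x \<in> B")
        case True
        have "\<delta> * (norm (G x))\<^sup>2 \<le> (\<eta> x)\<^sup>2 * (norm (G x))\<^sup>2" using \<delta>(2) True by (intro mult_right_mono) (auto simp: B_def)
        hence "(norm (G x))\<^sup>2 \<le> F x / \<delta>" using \<delta>(1) by (simp add: F_def power_mult_distrib field_simps)
        hence "(norm (G x))\<^sup>2 * V \<le> F x / \<delta> * V" using V by (intro mult_right_mono) auto
        hence "ennreal ((norm (G x))\<^sup>2) * ennreal V \<le> ennreal (V / \<delta> * F x)"
          using V by (subst ennreal_mult[symmetric]) (auto intro!: ennreal_leI simp: mult.commute)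
        moreover have "ennreal (V / \<delta> * F x) = ennreal (V / \<delta>) * ennreal (F x)"
          using V \<delta> by (intro ennreal_mult) (auto simp: F_def)
        ultimately show ?thesis using True V by simp
      qed simp
    qed
    also have "\<dots> = ennreal (V / \<delta>) * ennreal (\<integral>x. F x \<partial>lborel)"
    proof -
      have "(\<integral>\<^sup>+x. ennreal (F x) \<partial>lborel) = ennreal (\<integral>x. F x \<partial>lborel)"
        by (rule nn_integral_eq_integral[OF iF]) (simp add: F_def)
      thus ?thesis using iF by (subst nn_integral_cmult) auto
    qed
    also have "\<dots> \<le> ennreal (V / \<delta>) * ennreal C" using FC by (intro mult_left_mono ennreal_leI) auto
    also have "ennreal (2 ^ CARD('n) * (2 * d)\<^sup>2) * (ennreal (V / \<delta>) * ennreal C) = ennreal C2"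
      using V \<delta> C0 by (simp add: C2_def ennreal_mult[symmetric])
    finally show ?case by (simp add: mult_left_mono)
  qed
  define Z where "Z = {x \<in> B. u x = 0}"
  define P where "P s = {x \<in> B. s \<le> u x}" for s
  have [measurable]: "Z \<in> sets borel" "P s \<in> sets borel" for s unfolding Z_def P_def by measurable
  have Zf: "emeasure lborel Z = ennreal (measure lborel Z)"
    using emeasure_bounded_finite[of Z] bounded_subset[OF bB, of Z] by (intro emeasure_eq_ennreal_measure) (auto simp: Z_def)
  have Pf: "emeasure lborel (P s) = ennreal (measure lborel (P s))" for s
    using emeasure_bounded_finite[of "P s"] bounded_subset[OF bB, of "P s"] by (intro emeasure_eq_ennreal_measure) (auto simp: P_def)
  \<comment> \<open>For almost all pairs from \<open>Z\<close> and \<open>P s\<close> the limiting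
    difference of logarithms is at least ln (1 + s / \<epsilon>), and Fatou brings the limit in
    \<open>k\<close> under the double integral. The sign of \<open>C\<close> is open, hence the
    maximum with 0.\<close>
  have est: "(ln (1 + s / \<epsilon>))\<^sup>2 * (measure lborel Z * measure lborel (P s)) \<le> max 0 C2" if s: "s > 0" and \<epsilon>: "\<epsilon> > 0" for s \<epsilon>
  proof -
    define f where "f k x y = indicator (B \<times> B) (x, y) * ennreal ((ln (1 + w k y / \<epsilon>) - ln (1 + w k x / \<epsilon>))\<^sup>2)" for k x y
    have [measurable]: "w k \<in> borel_measurable borel" for k by (rule C1zD(6)[OF test_fun_C1z[OF w(1)]])
    have fm: "(\<lambda>(x, y). f k x y) \<in> borel_measurable (borel \<Otimes>\<^sub>M borel)" for k unfolding f_def by measurable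
    define c where "c = ennreal ((ln (1 + s / \<epsilon>))\<^sup>2)"
    have lim: "f_lim \<le> liminf (\<lambda>k. f k x y)"
      if x: "x \<in> \<Omega> \<longrightarrow> (\<lambda>k. w k x) \<longlonglongrightarrow> u x" and y: "y \<in> \<Omega> \<longrightarrow> (\<lambda>k. w k y) \<longlonglongrightarrow> u y"
        and f_lim: "f_lim = indicator Z x * (indicator (P s) y * c)" for x y f_lim
    proof (cases "x \<in> Z \<and> y \<in> P s")
      case True
      hence xy: "x \<in> B" "y \<in> B" "u x = 0" "s \<le> u y" by (auto simp: Z_def P_def)
      hence xy\<Omega>: "x \<in> \<Omega>" "y \<in> \<Omega>" using B by (auto simp: B_def)
      have pos: "1 + u z / \<epsilon> \<noteq> 0" for z using u0[of z] \<epsilon> by (smt (verit) divide_nonneg_pos)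
      have "(\<lambda>k. ennreal ((ln (1 + w k y / \<epsilon>) - ln (1 + w k x / \<epsilon>))\<^sup>2)) \<longlonglongrightarrow> ennreal ((ln (1 + u y / \<epsilon>) - ln (1 + u x / \<epsilon>))\<^sup>2)"
        using x y xy\<Omega> \<epsilon> by (intro tendsto_ennrealI tendsto_intros pos) auto
      hence "(\<lambda>k. f k x y) \<longlonglongrightarrow> ennreal ((ln (1 + u y / \<epsilon>))\<^sup>2)" using xy by (simp add: f_def)
      from lim_imp_Liminf[OF _ this] have "liminf (\<lambda>k. f k x y) = ennreal ((ln (1 + u y / \<epsilon>))\<^sup>2)" by simp
      moreover have "ln (1 + s / \<epsilon>) \<le> ln (1 + u y / \<epsilon>)" using xy s \<epsilon> by (simp add: divide_right_mono add_pos_pos)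
      hence "(ln (1 + s / \<epsilon>))\<^sup>2 \<le> (ln (1 + u y / \<epsilon>))\<^sup>2" using s \<epsilon> by (intro power_mono) auto
      ultimately show ?thesis using True by (simp add: f_lim c_def ennreal_leI)
    qed (auto simp: f_lim)
    have "c * (emeasure lborel Z * emeasure lborel (P s)) = (\<integral>\<^sup>+x. \<integral>\<^sup>+y. indicator Z x * (indicator (P s) y * c) \<partial>lborel \<partial>lborel)"
      by (simp add: nn_integral_cmult nn_integral_multc mult_ac)
    also have "\<dots> \<le> (\<integral>\<^sup>+x. \<integral>\<^sup>+y. liminf (\<lambda>k. f k x y) \<partial>lborel \<partial>lborel)"
    proof (rule nn_integral_mono_AE)
      show "AE x in lborel. (\<integral>\<^sup>+y. indicator Z x * (indicator (P s) y * c) \<partial>lborel) \<le> (\<integral>\<^sup>+y. liminf (\<lambda>k. f k x y) \<partial>lborel)"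
        using wu
      proof eventually_elim
        case (elim x)
        show ?case by (rule nn_integral_mono_AE) (use wu in eventually_elim, rule lim[OF elim], auto)
      qed
    qed
    also have "\<dots> \<le> liminf (\<lambda>k. \<integral>\<^sup>+x. \<integral>\<^sup>+y. f k x y \<partial>lborel \<partial>lborel)"
      by (rule nn_integral_nn_integral_Fatou[OF fm])
    also have "\<dots> \<le> limsup (\<lambda>k. \<integral>\<^sup>+x. \<integral>\<^sup>+y. f k x y \<partial>lborel \<partial>lborel)" by (rule Liminf_le_Limsup) simp
    also have "\<dots> \<le> ennreal C2" by (rule Limsup_bounded) (use poin[OF \<epsilon>] in \<open>simp add: f_def\<close>)
    also have "\<dots> \<le> ennreal (max 0 C2)" by (intro ennreal_leI) simp
    finally have "ennreal ((ln (1 + s / \<epsilon>))\<^sup>2 * (measure lborel Z * measure lborel (P s))) \<le> ennreal (max 0 C2)"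
      by (simp add: c_def Zf Pf ennreal_mult)
    thus ?thesis by (subst (asm) ennreal_le_iff) auto
  qed
  have zp: "measure lborel Z * measure lborel (P s) = 0" if s: "s > 0" for s
  proof (rule ccontr)
    define m where "m = measure lborel Z * measure lborel (P s)"
    assume "measure lborel Z * measure lborel (P s) \<noteq> 0"
    hence m: "m > 0" by (simp add: m_def less_le)
    \<comment> \<open>Solved backwards: \<epsilon> is taken with ln (1 + s / \<epsilon>) = t, and
      t^2 m exceeds the bound of \<open>est\<close> by 1.\<close>
    define t where "t = sqrt ((max 0 C2 + 1) / m)"
    have t: "t > 0" "t\<^sup>2 * m = max 0 C2 + 1" using m by (auto simp: t_def add_nonneg_pos)
    define \<epsilon> where "\<epsilon> = s / (exp t - 1)"
    have \<epsilon>: "\<epsilon> > 0" using s t by (simp add: \<epsilon>_def)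
    have "1 + s / \<epsilon> = exp t" using s t by (simp add: \<epsilon>_def)
    with est[OF s \<epsilon>] t(2) show False by (simp add: m_def)
  qed
  show ?thesis
  proof (cases "measure lborel Z = 0")
    case True
    hence "Z \<in> null_sets lborel" using Zf by (auto simp: null_sets_def)
    hence "AE x in lborel. x \<notin> Z" by (rule AE_not_in)
    hence "AE x in lborel. x \<in> box a b \<longrightarrow> u x > 0"
    proof eventually_elim
      case (elim x) thus ?case using u0[of x] by (auto simp: Z_def B_def)
    qed
    thus ?thesis ..
  next
    case False
    have "P (1 / real (Suc n)) \<in> null_sets lborel" for n
      using zp[of "1 / real (Suc n)"] False Pf[of "1 / real (Suc n)"] by (auto simp: null_sets_def)
    hence "AE x in lborel. \<forall>n. x \<notin> P (1 / real (Suc n))" by (subst AE_all_countable) (auto intro: AE_not_in)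
    hence "AE x in lborel. x \<in> box a b \<longrightarrow> u x = 0"
    proof eventually_elim
      case (elim x)
      show ?case
      proof (intro impI, rule ccontr)
        assume x: "x \<in> box a b" "u x \<noteq> 0"
        hence "u x > 0" using u0[of x] by simp
        then obtain n where "1 / real (Suc n) < u x" using nat_approx_posE by blast
        with elim x show False by (auto simp: P_def B_def intro: less_imp_le)
      qed
    qed
    thus ?thesis ..
  qed
qed

text \<open>Each point has a box on which \<open>u\<close> is zero almost everywhere or positive
  almost everywhere. The unions of the boxes of either kind are open, cover \<Omega> and cannot meet
  in \<Omega>, since two boxes of different kind with a common point would intersect in a nonempty
  open null set. Connectedness leaves one kind, and \<open>nrm M u \<noteq> 0\<close> excludes zero.
  The hypothesis \<open>super\<close> is the weak form of -\<Delta>u + c u \<ge> 0.\<close>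

lemma strong_maximum_principle:
  assumes ug: "HP u g" and u0: "AE x in M. 0 \<le> u x" and nu: "nrm M u \<noteq> 0"
    and w: "\<And>k. test_fun \<Omega> (w k)" "\<And>k x. 0 \<le> w k x"
    and wu: "(\<lambda>k. nrm M (\<lambda>x. w k x - u x)) \<longlonglongrightarrow> 0" and wg: "(\<lambda>k. nrm M (\<lambda>x. cgrad (w k) x - g x)) \<longlonglongrightarrow> 0"
    and c: "integrable M c" "\<And>x. 0 \<le> c x" "integrable M (\<lambda>x. c x * u x)"
    and super: "\<And>\<phi>. test_fun \<Omega> \<phi> \<Longrightarrow> (\<And>x. 0 \<le> \<phi> x) \<Longrightarrow> - (\<integral>x. c x * u x * \<phi> x \<partial>M) \<le> (\<integral>x. g x \<bullet> cgrad \<phi> x \<partial>M)"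
  shows "AE x in M. 0 < u x"
proof -
  obtain r where r: "strict_mono (r :: nat \<Rightarrow> nat)" "AE x in M. (\<lambda>k. w (r k) x) \<longlonglongrightarrow> u x"
    by (rule nrm_tendsto_AE_subseq[OF test_sq(1)[OF w(1)] HP_sq(1)[OF ug] wu]) (rule that)
  have wg': "(\<lambda>k. nrm M (\<lambda>x. cgrad (w (r k)) x - g x)) \<longlonglongrightarrow> 0"
    using LIMSEQ_subseq_LIMSEQ[OF wg r(1)] by (simp add: o_def)
  have "(\<lambda>x. indicator \<Omega> x *\<^sub>R u x) \<in> borel_measurable lebesgue"
    using HP_measurable(1)[OF ug] by (simp only: borel_measurable_restrict_space_iff[OF dom_sets(3)])
  from completion_ex_borel_measurable_real[OF this]
  obtain f where f[measurable]: "f \<in> borel_measurable lborel" "AE x in lborel. indicator \<Omega> x *\<^sub>R u x = f x" by blast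
  \<comment> \<open>A Borel representative, nonnegative everywhere, as the argument with double
    integrals over pairs of points requires.\<close>
  define v where "v x = max 0 (f x)" for x
  have vm: "v \<in> borel_measurable borel" using f(1) unfolding v_def by measurable
  have v0: "0 \<le> v x" for x by (simp add: v_def)
  have u0': "AE x in lborel. x \<in> \<Omega> \<longrightarrow> 0 \<le> u x"
    using u0 by (simp add: AE_restrict_space_iff[OF dom_sets(3)] AE_completion_iff)
  have r2': "AE x in lborel. x \<in> \<Omega> \<longrightarrow> (\<lambda>k. w (r k) x) \<longlonglongrightarrow> u x"
    using r(2) by (simp add: AE_restrict_space_iff[OF dom_sets(3)] AE_completion_iff)
  have uv: "AE x in lborel. x \<in> \<Omega> \<longrightarrow> u x = v x"
    using u0' f(2) by eventually_elim (auto simp: v_def)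
  have wv: "AE x in lborel. x \<in> \<Omega> \<longrightarrow> (\<lambda>k. w (r k) x) \<longlonglongrightarrow> v x"
    using uv r2' by eventually_elim auto
  have loc: "\<exists>a b. x \<in> box a b \<and> box a b \<subseteq> \<Omega> \<and>
      ((AE y in lborel. y \<in> box a b \<longrightarrow> v y = 0) \<or> (AE y in lborel. y \<in> box a b \<longrightarrow> v y > 0))" if x: "x \<in> \<Omega>" for x
  proof -
    obtain a' b' where ab': "cbox a' b' \<subseteq> \<Omega>" "x \<in> box a' b'" by (rule open_contains_cbox[OF open_dom x]) (rule that)
    \<comment> \<open>A second, smaller box: the cutoff belonging to the outer box has a positive
      minimum on its closure.\<close>
    obtain a b where ab: "cbox a b \<subseteq> box a' b'" "x \<in> box a b" by (rule open_contains_cbox[OF open_box ab'(2)]) (rule that)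
    obtain \<eta> where \<eta>: "Cinf_on UNIV \<eta>" "\<And>x. \<eta> x \<ge> 0" "\<And>x. \<eta> x > 0 \<longleftrightarrow> x \<in> box a' b'" by (rule box_bump[of a' b']) (rule that)
    have t\<eta>: "test_fun \<Omega> \<eta>" by (rule test_fun_box[OF \<eta>(1) _ ab'(1)]) (use \<eta> in \<open>auto simp: less_le\<close>)
    have "x \<in> cbox a b" using ab(2) box_subset_cbox by blast
    hence "\<exists>z\<in>cbox a b. \<forall>y\<in>cbox a b. \<eta> z \<le> \<eta> y"
      by (intro continuous_attains_inf compact_cbox continuous_on_subset[OF Cinf_continuous[OF \<eta>(1)]]) auto
    then obtain z where z: "z \<in> cbox a b" "\<And>y. y \<in> cbox a b \<Longrightarrow> \<eta> z \<le> \<eta> y" by blast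
    have \<eta>z: "\<eta> z > 0" using \<eta>(3) ab(1) z(1) by blast
    obtain C where C: "\<And>\<epsilon>. \<epsilon> > 0 \<Longrightarrow> \<forall>\<^sub>F k in sequentially. (nrm M (\<lambda>x. (\<eta> x / (w (r k) x + \<epsilon>)) *\<^sub>R cgrad (w (r k)) x))\<^sup>2 \<le> C"
    proof (rule log_energy_bound[where w="\<lambda>k. w (r k)", OF ug u0 w(1) w(2) wg' r(2) c _ t\<eta>])
      show "- (\<integral>x. c x * u x * \<phi> x \<partial>M) \<le> (\<integral>x. g x \<bullet> cgrad \<phi> x \<partial>M)"
        if "test_fun \<Omega> \<phi>" "\<And>x. 0 \<le> \<phi> x" for \<phi> by (rule super[OF that])
    qed (rule that)
    have sub: "box a b \<subseteq> \<Omega>" using ab(1) ab'(1) box_subset_cbox[of a b] box_subset_cbox[of a' b'] by blast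
    have \<delta>: "(\<eta> z)\<^sup>2 \<le> (\<eta> y)\<^sup>2" if "y \<in> box a b" for y
      using z(2)[of y] that box_subset_cbox[of a b] \<eta>z by (intro power_mono) auto
    have "(AE y in lborel. y \<in> box a b \<longrightarrow> v y = 0) \<or> (AE y in lborel. y \<in> box a b \<longrightarrow> v y > 0)"
      by (rule zero_or_positive_on_box[where w="\<lambda>k. w (r k)", OF w(1) w(2) vm v0 wv t\<eta> sub _ \<delta> C]) (use \<eta>z in auto)
    thus ?thesis using ab(2) sub by blast
  qed
  define U where "U Q = \<Union>{box a b | a b. (AE y in lborel. y \<in> box a b \<longrightarrow> Q (v y))}" for Q :: "real \<Rightarrow> bool"
  have oU: "open (U Q)" for Q unfolding U_def by (rule open_Union) auto
  have UI: "x \<in> U Q" if "x \<in> box a b" "AE y in lborel. y \<in> box a b \<longrightarrow> Q (v y)" for x a b Q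
    using that unfolding U_def by (intro UnionI[of "box a b"] CollectI exI[of _ a] exI[of _ b] conjI refl)
  have UE: "\<exists>a b. x \<in> box a b \<and> (AE y in lborel. y \<in> box a b \<longrightarrow> Q (v y))" if "x \<in> U Q" for x Q
    using that unfolding U_def by (elim UnionE CollectE exE conjE) (intro exI conjI; simp)
  have cov: "\<Omega> \<subseteq> U (\<lambda>t. t = 0) \<union> U (\<lambda>t. t > 0)"
  proof
    fix x assume "x \<in> \<Omega>"
    then obtain a b where ab: "x \<in> box a b"
      "(AE y in lborel. y \<in> box a b \<longrightarrow> v y = 0) \<or> (AE y in lborel. y \<in> box a b \<longrightarrow> v y > 0)"
      using loc[of x] by auto
    from ab(2) show "x \<in> U (\<lambda>t. t = 0) \<union> U (\<lambda>t. t > 0)"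
    proof
      assume "AE y in lborel. y \<in> box a b \<longrightarrow> v y = 0"
      from UI[of x a b "\<lambda>t. t = 0", OF ab(1) this] show ?thesis by (rule UnI1)
    next
      assume "AE y in lborel. y \<in> box a b \<longrightarrow> v y > 0"
      from UI[of x a b "\<lambda>t. t > 0", OF ab(1) this] show ?thesis by (rule UnI2)
    qed
  qed
  have dis: "U (\<lambda>t. t = 0) \<inter> U (\<lambda>t. t > 0) \<inter> \<Omega> = {}"
  proof (rule ccontr)
    assume "U (\<lambda>t. t = 0) \<inter> U (\<lambda>t. t > 0) \<inter> \<Omega> \<noteq> {}"
    then obtain x where "x \<in> U (\<lambda>t. t = 0)" "x \<in> U (\<lambda>t. t > 0)" by auto
    then obtain a b a' b' where x: "x \<in> box a b" "x \<in> box a' b'"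
      and AE: "AE y in lborel. y \<in> box a b \<longrightarrow> v y = 0" "AE y in lborel. y \<in> box a' b' \<longrightarrow> v y > 0"
      using UE[of x "\<lambda>t. t = 0"] UE[of x "\<lambda>t. t > 0"] by auto
    have "AE y in lborel. y \<notin> box a b \<inter> box a' b'" using AE by eventually_elim auto
    hence "AE y in lebesgue. y \<notin> box a b \<inter> box a' b'" by (rule AE_completion)
    hence "box a b \<inter> box a' b' \<in> null_sets lebesgue" by (subst AE_iff_null_sets) auto
    hence "negligible (box a b \<inter> box a' b')" by (simp add: negligible_iff_null_sets)
    thus False using open_not_negligible[of "box a b \<inter> box a' b'"] x by blast
  qed
  have AEU: "AE y in lborel. y \<in> \<Omega> \<longrightarrow> Q (v y)" if "\<Omega> \<subseteq> U Q" for Q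
  proof (rule AE_open_local)
    fix x assume "x \<in> \<Omega>"
    then obtain a b where "x \<in> box a b" "AE y in lborel. y \<in> box a b \<longrightarrow> Q (v y)" using UE[of x Q] \<open>\<Omega> \<subseteq> U Q\<close> by auto
    thus "\<exists>U. open U \<and> x \<in> U \<and> (AE y in lborel. y \<in> U \<longrightarrow> Q (v y))"
      by (intro exI[of _ "box a b"] conjI open_box)
  qed
  have "U (\<lambda>t. t = 0) \<inter> \<Omega> = {} \<or> U (\<lambda>t. t > 0) \<inter> \<Omega> = {}"
    by (rule connectedD[OF connected_dom oU oU dis cov])
  thus ?thesis
  proof
    assume "U (\<lambda>t. t = 0) \<inter> \<Omega> = {}"
    hence "AE y in lborel. y \<in> \<Omega> \<longrightarrow> v y > 0" using cov by (intro AEU) blast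
    hence "AE y in lborel. y \<in> \<Omega> \<longrightarrow> u y > 0" using uv by eventually_elim auto
    thus ?thesis by (simp add: AE_restrict_space_iff[OF dom_sets(3)] AE_completion_iff)
  next
    assume "U (\<lambda>t. t > 0) \<inter> \<Omega> = {}"
    hence "AE y in lborel. y \<in> \<Omega> \<longrightarrow> v y = 0" using cov by (intro AEU) blast
    hence "AE y in lborel. y \<in> \<Omega> \<longrightarrow> u y = 0" using uv by eventually_elim auto
    hence "AE y in M. u y = 0" by (simp add: AE_restrict_space_iff[OF dom_sets(3)] AE_completion_iff)
    hence "nrm M u = nrm M (\<lambda>x. 0 :: real)" using HP_measurable(1)[OF ug] by (intro nrm_cong_AE) auto
    thus ?thesis using nu by (simp add: nrm_def)
  qed
qed

end

section \<open>Conclusion\<close>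

context dirichlet_problem
begin

lemma minimizer_positive:
  assumes ug: "HP u g" and u0: "AE x in M. 0 \<le> u x" and nu: "nrm M u \<noteq> 0"
    and w: "\<And>k. test_fun \<Omega> (w k)" "\<And>k x. 0 \<le> w k x"
    and wu: "(\<lambda>k. nrm M (\<lambda>x. w k x - u x)) \<longlonglongrightarrow> 0" and wg: "(\<lambda>k. nrm M (\<lambda>x. cgrad (w k) x - g x)) \<longlonglongrightarrow> 0"
    and el: "\<And>\<phi>. test_fun \<Omega> \<phi> \<Longrightarrow> (\<integral>x. g x \<bullet> cgrad \<phi> x \<partial>M) + \<omega> * (\<integral>x. u x * \<phi> x \<partial>M)
      = \<mu> * (\<integral>x. \<bar>u x\<bar> powr (p - 1) * \<phi> x \<partial>M) + (\<integral>x. \<bar>u x\<bar> powr (q - 1) * \<phi> x \<partial>M)"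
  shows "AE x in M. 0 < u x"
proof -
  define c where "c x = \<bar>\<omega>\<bar> + \<bar>\<mu>\<bar> * \<bar>u x\<bar> powr (p - 2)" for x
  have [measurable]: "u \<in> borel_measurable M" by (rule HP_measurable[OF ug])
  have ip: "integrable M (\<lambda>x. \<bar>u x\<bar> powr s)" if "0 \<le> s" "s \<le> q" for s
    by (rule lower_power_integrable[OF _ HP_power_integrable[OF q_gt_2 q_crit ug] that]) measurable
  have iu: "integrable M u" by (rule sq_integrable[OF finite_M HP_sq(1)[OF ug]])
  have c0: "0 \<le> c x" for x by (simp add: c_def)
  have ic: "integrable M c" unfolding c_def
    using finite_measure.integrable_const[OF finite_M] ip[of "p - 2"] p_gt_2 p_le_q
    by (intro Bochner_Integration.integrable_add integrable_mult_right) auto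
  have pw: "\<bar>t\<bar> powr (p - 2) * \<bar>t\<bar> = \<bar>t\<bar> powr (p - 1)" for t :: real
    using powr_add[of "\<bar>t\<bar>" "p - 2" 1] by simp
  have icu: "integrable M (\<lambda>x. c x * u x)"
  proof (rule Bochner_Integration.integrable_bound)
    show "integrable M (\<lambda>x. \<bar>\<omega>\<bar> * norm (u x) + \<bar>\<mu>\<bar> * \<bar>u x\<bar> powr (p - 1))"
      using iu ip[of "p - 1"] p_gt_2 p_le_q by (intro Bochner_Integration.integrable_add integrable_mult_right integrable_norm) auto
    show "(\<lambda>x. c x * u x) \<in> borel_measurable M" unfolding c_def by measurable
    show "AE x in M. norm (c x * u x) \<le> norm (\<bar>\<omega>\<bar> * norm (u x) + \<bar>\<mu>\<bar> * \<bar>u x\<bar> powr (p - 1))"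
    proof (rule AE_I2)
      fix x
      have "norm (c x * u x) = \<bar>\<omega>\<bar> * \<bar>u x\<bar> + \<bar>\<mu>\<bar> * (\<bar>u x\<bar> powr (p - 2) * \<bar>u x\<bar>)"
        using c0[of x] by (simp add: abs_mult) (simp add: c_def algebra_simps)
      thus "norm (c x * u x) \<le> norm (\<bar>\<omega>\<bar> * norm (u x) + \<bar>\<mu>\<bar> * \<bar>u x\<bar> powr (p - 1))" by (simp add: pw)
    qed
  qed
  have super: "- (\<integral>x. c x * u x * \<phi> x \<partial>M) \<le> (\<integral>x. g x \<bullet> cgrad \<phi> x \<partial>M)" if \<phi>: "test_fun \<Omega> \<phi>" "\<And>x. 0 \<le> \<phi> x" for \<phi>
  proof -
    note i1 = bounded_mult_integrable[OF iu \<phi>(1)]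
    have i2: "integrable M (\<lambda>x. \<bar>u x\<bar> powr (p - 1) * \<phi> x)" "integrable M (\<lambda>x. \<bar>u x\<bar> powr (q - 1) * \<phi> x)"
      using p_gt_2 p_le_q by (intro bounded_mult_integrable[OF ip \<phi>(1)]; simp)+
    note i3 = bounded_mult_integrable[OF icu \<phi>(1)]
    have "0 \<le> (\<integral>x. (- \<omega>) * (u x * \<phi> x) + \<mu> * (\<bar>u x\<bar> powr (p - 1) * \<phi> x) + \<bar>u x\<bar> powr (q - 1) * \<phi> x + c x * u x * \<phi> x \<partial>M)"
    proof (rule integral_nonneg_AE)
      show "AE x in M. 0 \<le> (- \<omega>) * (u x * \<phi> x) + \<mu> * (\<bar>u x\<bar> powr (p - 1) * \<phi> x) + \<bar>u x\<bar> powr (q - 1) * \<phi> x + c x * u x * \<phi> x"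
        using u0
      proof eventually_elim
        case (elim x)
        have e: "\<bar>u x\<bar> powr (p - 1) = \<bar>u x\<bar> powr (p - 2) * u x" using pw[of "u x"] elim by simp
        have "(- \<omega>) * (u x * \<phi> x) + \<mu> * (\<bar>u x\<bar> powr (p - 1) * \<phi> x) + \<bar>u x\<bar> powr (q - 1) * \<phi> x + c x * u x * \<phi> x
          = (\<bar>\<omega>\<bar> - \<omega>) * (u x * \<phi> x) + (\<bar>\<mu>\<bar> + \<mu>) * (\<bar>u x\<bar> powr (p - 2) * u x * \<phi> x) + \<bar>u x\<bar> powr (q - 1) * \<phi> x"
          unfolding e c_def by (simp add: algebra_simps)
        also have "0 \<le> \<dots>"
        proof -
          have t1: "0 \<le> (\<bar>\<omega>\<bar> - \<omega>) * (u x * \<phi> x)"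
            using elim \<phi>(2)[of x] by (intro mult_nonneg_nonneg) auto
          have "0 \<le> \<bar>\<mu>\<bar> + \<mu>" by simp
          moreover have "0 \<le> \<bar>u x\<bar> powr (p - 2) * u x * \<phi> x"
            using elim \<phi>(2)[of x] by (intro mult_nonneg_nonneg) auto
          ultimately have t2: "0 \<le> (\<bar>\<mu>\<bar> + \<mu>) * (\<bar>u x\<bar> powr (p - 2) * u x * \<phi> x)"
            by (rule mult_nonneg_nonneg)
          have t3: "0 \<le> \<bar>u x\<bar> powr (q - 1) * \<phi> x" using \<phi>(2)[of x] by simp
          show ?thesis by (rule add_nonneg_nonneg[OF add_nonneg_nonneg[OF t1 t2] t3])
        qed
        finally show ?case .
      qed
    qed
    also have "\<dots> = (- \<omega>) * (\<integral>x. u x * \<phi> x \<partial>M) + \<mu> * (\<integral>x. \<bar>u x\<bar> powr (p - 1) * \<phi> x \<partial>M)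
        + (\<integral>x. \<bar>u x\<bar> powr (q - 1) * \<phi> x \<partial>M) + (\<integral>x. c x * u x * \<phi> x \<partial>M)"
      using i1 i2 i3 by simp
    finally show ?thesis using el[OF \<phi>(1)] by simp
  qed
  show ?thesis
  proof (rule strong_maximum_principle[OF ug u0 nu w wu wg ic c0 icu])
    show "- (\<integral>x. c x * u x * \<phi> x \<partial>M) \<le> (\<integral>x. g x \<bullet> cgrad \<phi> x \<partial>M)"
      if "test_fun \<Omega> \<phi>" "\<And>x. 0 \<le> \<phi> x" for \<phi> by (rule super[OF that])
  qed
qed

lemma positive_local_minimizer_exists:
  "\<exists>\<rho>0>0. \<forall>\<rho>. 0 < \<rho> \<and> \<rho> < \<rho>0 \<longrightarrow>
     (\<exists>\<omega> u. u \<in> S_rho \<Omega> \<rho> \<and> weak_solution \<Omega> \<mu> p q \<omega> u \<and>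
        (\<forall>x\<in>\<Omega>. u x > 0) \<and> local_min_on_S \<Omega> \<mu> p q \<rho> u)"
proof -
  obtain \<rho>0 where \<rho>0: "\<rho>0 > 0" "\<And>\<rho>. 0 < \<rho> \<Longrightarrow> \<rho> < \<rho>0 \<Longrightarrow>
    \<exists>T u g w. HP u g \<and> (nrm M u)\<^sup>2 = \<rho> \<and> (AE x in M. 0 \<le> u x) \<and> (nrm M g)\<^sup>2 < T \<and>
      (\<forall>v h. HP v h \<longrightarrow> (nrm M v)\<^sup>2 = \<rho> \<longrightarrow> (nrm M h)\<^sup>2 < T \<longrightarrow> En u g \<le> En v h) \<and>
      (\<forall>k. test_fun \<Omega> (w k) \<and> (\<forall>x. 0 \<le> w k x)) \<and>
      (\<lambda>k. nrm M (\<lambda>x. w k x - u x)) \<longlonglongrightarrow> 0 \<and> (\<lambda>k. nrm M (\<lambda>x. cgrad (w k) x - g x)) \<longlonglongrightarrow> 0"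
    by (rule minimizer_exists) (rule that)
  show ?thesis
  proof (rule exI[of _ \<rho>0], intro conjI allI impI)
    show "\<rho>0 > 0" by (rule \<rho>0(1))
    fix \<rho> assume "0 < \<rho> \<and> \<rho> < \<rho>0"
    hence \<rho>: "0 < \<rho>" "\<rho> < \<rho>0" by auto
    from \<rho>0(2)[OF \<rho>] obtain T v g w where ex: "HP v g \<and> (nrm M v)\<^sup>2 = \<rho> \<and> (AE x in M. 0 \<le> v x) \<and> (nrm M g)\<^sup>2 < T \<and>
      (\<forall>v' h. HP v' h \<longrightarrow> (nrm M v')\<^sup>2 = \<rho> \<longrightarrow> (nrm M h)\<^sup>2 < T \<longrightarrow> En v g \<le> En v' h) \<and>
      (\<forall>k. test_fun \<Omega> (w k) \<and> (\<forall>x. 0 \<le> w k x)) \<and>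
      (\<lambda>k. nrm M (\<lambda>x. w k x - v x)) \<longlonglongrightarrow> 0 \<and> (\<lambda>k. nrm M (\<lambda>x. cgrad (w k) x - g x)) \<longlonglongrightarrow> 0"
      by (elim exE)
    hence vg: "HP v g" and nv: "(nrm M v)\<^sup>2 = \<rho>" and v0: "AE x in M. 0 \<le> v x" and gT: "(nrm M g)\<^sup>2 < T"
      and min: "\<And>v' h. HP v' h \<Longrightarrow> (nrm M v')\<^sup>2 = \<rho> \<Longrightarrow> (nrm M h)\<^sup>2 < T \<Longrightarrow> En v g \<le> En v' h"
      and w: "\<And>k. test_fun \<Omega> (w k)" "\<And>k x. 0 \<le> w k x"
      and wv: "(\<lambda>k. nrm M (\<lambda>x. w k x - v x)) \<longlonglongrightarrow> 0" and wg: "(\<lambda>k. nrm M (\<lambda>x. cgrad (w k) x - g x)) \<longlonglongrightarrow> 0"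
      by simp_all
    obtain \<omega> where el: "\<And>\<phi>. test_fun \<Omega> \<phi> \<Longrightarrow> (\<integral>x. g x \<bullet> cgrad \<phi> x \<partial>M) + \<omega> * (\<integral>x. v x * \<phi> x \<partial>M)
      = \<mu> * (\<integral>x. \<bar>v x\<bar> powr (p - 1) * \<phi> x \<partial>M) + (\<integral>x. \<bar>v x\<bar> powr (q - 1) * \<phi> x \<partial>M)"
      by (rule euler_lagrange[OF vg nv \<rho>(1) v0 gT min]) (assumption | rule that)+
    have pos: "AE x in M. 0 < v x"
      by (rule minimizer_positive[OF vg v0 _ w wv wg el]) (use nv \<rho> in auto)
    \<comment> \<open>The minimizer is only positive almost everywhere.\<close>
    define u where "u x = (if 0 < v x then v x else 1)" for x
    have vu: "AE x in M. v x = u x" using pos by eventually_elim (simp add: u_def)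
    have [measurable]: "v \<in> borel_measurable M" "g \<in> borel_measurable M" by (rule HP_measurable[OF vg])+
    have um[measurable]: "u \<in> borel_measurable M" unfolding u_def by measurable
    have ug: "HP u g" by (rule HP_cong_AE[OF vg um _ vu]) auto
    have upos: "u x > 0" for x by (simp add: u_def)
    have nu: "(nrm M u)\<^sup>2 = \<rho>" using nrm_cong_AE[OF _ um vu] nv by simp
    have uS: "u \<in> S_rho \<Omega> \<rho>"
      using HP_imp_H10[OF ug] nu by (simp add: S_rho_def set_integral_M nrm_square)
    note gu = HP_wgrad_AE[OF ug]
    have gm[measurable]: "wgrad \<Omega> u \<in> borel_measurable M" by (rule HP_measurable[OF HP_wgrad[OF ug]])
    have weak: "weak_solution \<Omega> \<mu> p q \<omega> u"
      unfolding weak_solution_def set_integral_M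
    proof (intro conjI allI impI HP_imp_H10[OF ug])
      fix \<phi> assume \<phi>: "test_fun \<Omega> \<phi>"
      have [measurable]: "\<phi> \<in> borel_measurable M" "cgrad \<phi> \<in> borel_measurable M"
        by (rule HP_measurable[OF HP_test[OF \<phi>]])+
      have 1: "(\<integral>x. wgrad \<Omega> u x \<bullet> cgrad \<phi> x \<partial>M) = (\<integral>x. g x \<bullet> cgrad \<phi> x \<partial>M)"
        by (rule integral_cong_AE) (measurable, use gu in \<open>eventually_elim, simp\<close>)
      have 2: "(\<integral>x. u x * \<phi> x \<partial>M) = (\<integral>x. v x * \<phi> x \<partial>M)"
        by (rule integral_cong_AE) (measurable, use vu in \<open>eventually_elim, simp\<close>)
      \<comment> \<open>\<open>weak_solution\<close> has powers of \<open>u\<close>, the equation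
        for \<open>v\<close> powers of its modulus; they agree where v = u > 0.\<close>
      have 3: "(\<integral>x. u x powr s * \<phi> x \<partial>M) = (\<integral>x. \<bar>v x\<bar> powr s * \<phi> x \<partial>M)" for s
        by (rule integral_cong_AE) (measurable, use vu pos in \<open>eventually_elim, simp\<close>)
      show "(\<integral>x. wgrad \<Omega> u x \<bullet> cgrad \<phi> x \<partial>M) + \<omega> * (\<integral>x. u x * \<phi> x \<partial>M)
        = \<mu> * (\<integral>x. u x powr (p - 1) * \<phi> x \<partial>M) + (\<integral>x. u x powr (q - 1) * \<phi> x \<partial>M)"
        unfolding 1 2 3 by (rule el[OF \<phi>])
    qed
    have Nlu: "Nl u = Nl v"
    proof -
      have "(\<integral>x. \<bar>u x\<bar> powr s \<partial>M) = (\<integral>x. \<bar>v x\<bar> powr s \<partial>M)" for s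
        by (rule integral_cong_AE) (measurable, use vu in \<open>eventually_elim, simp\<close>)
      thus ?thesis by (simp add: Nl_def)
    qed
    have Eu: "energy \<Omega> \<mu> p q u = En v g" by (simp add: energy_eq_En[OF ug] En_def Nlu)
    \<comment> \<open>A squared H^1 distance below this value forces the gradient norm below sqrt T,
      so that minimality in the ball applies.\<close>
    define R where "R = (sqrt T - nrm M g)\<^sup>2"
    have "nrm M g < sqrt T" using gT by (rule real_less_rsqrt)
    hence R: "R > 0" "sqrt R = sqrt T - nrm M g" by (simp_all add: R_def)
    have lm: "local_min_on_S \<Omega> \<mu> p q \<rho> u"
      unfolding local_min_on_S_def
    proof (intro conjI uS exI[of _ R] R(1) ballI impI)
      fix z assume z: "z \<in> S_rho \<Omega> \<rho>" and d: "H1_dist2 \<Omega> z (wgrad \<Omega> z) u (wgrad \<Omega> u) < R"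
      have hz: "HP z (wgrad \<Omega> z)" and nz: "(nrm M z)\<^sup>2 = \<rho>"
        using z by (simp_all add: S_rho_def H10_iff set_integral_M nrm_square)
      note hu = HP_wgrad[OF ug]
      have "(nrm M (\<lambda>x. wgrad \<Omega> z x - wgrad \<Omega> u x))\<^sup>2 < R"
        using d unfolding H1_dist2_eq[OF HP_sq[OF hz] HP_sq[OF hu]]
        using zero_le_power2[of "nrm M (\<lambda>x. z x - u x)"] by linarith
      hence "nrm M (\<lambda>x. wgrad \<Omega> z x - wgrad \<Omega> u x) < sqrt R" by (rule real_less_rsqrt)
      moreover have "nrm M (wgrad \<Omega> z) \<le> nrm M (wgrad \<Omega> u) + nrm M (\<lambda>x. wgrad \<Omega> z x - wgrad \<Omega> u x)"
        using nrm_diff_le[OF HP_sq(2)[OF hz] HP_sq(2)[OF hu]] by linarith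
      moreover have "nrm M (wgrad \<Omega> u) = nrm M g" by (rule nrm_cong_AE[OF gm _ gu]) measurable
      ultimately have "nrm M (wgrad \<Omega> z) < sqrt T" using R(2) by linarith
      hence "(nrm M (wgrad \<Omega> z))\<^sup>2 < (sqrt T)\<^sup>2" by (intro power_strict_mono) (auto simp: nrm_nonneg)
      moreover have "T \<ge> 0" using gT zero_le_power2[of "nrm M g"] by linarith
      ultimately have "(nrm M (wgrad \<Omega> z))\<^sup>2 < T" by simp
      from min[OF hz nz this] show "energy \<Omega> \<mu> p q u \<le> energy \<Omega> \<mu> p q z"
        by (simp add: Eu energy_eq_En[OF hz])
    qed
    show "\<exists>\<omega> u. u \<in> S_rho \<Omega> \<rho> \<and> weak_solution \<Omega> \<mu> p q \<omega> u \<and> (\<forall>x\<in>\<Omega>. u x > 0) \<and> local_min_on_S \<Omega> \<mu> p q \<rho> u"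
      using uS weak upos lm by blast
  qed
qed

end

theorem theorem1p1:
  fixes \<Omega> :: "(real^'n) set" and \<mu> p q :: real
  assumes "smooth_bounded_domain \<Omega>"
    and "2 < p" and "p \<le> q" and "below_crit CARD('n) q"
  shows "\<exists>\<rho>0>0. \<forall>\<rho>. 0 < \<rho> \<and> \<rho> < \<rho>0 \<longrightarrow>
           (\<exists>\<omega> u. u \<in> S_rho \<Omega> \<rho> \<and> weak_solution \<Omega> \<mu> p q \<omega> u \<and>
                   (\<forall>x\<in>\<Omega>. u x > 0) \<and> local_min_on_S \<Omega> \<mu> p q \<rho> u)"
proof -
  interpret dirichlet_problem \<Omega> \<mu> p q
    by unfold_locales (use assms in \<open>auto simp: smooth_bounded_domain_def\<close>)
  show ?thesis by (rule positive_local_minimizer_exists)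
qed

end
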